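(* Let $(A,\mathcal U)$ be a co-commutative (right) Hopf algebroid with an admissible filtration, let $(A,\mathcal U^\circ)$ be its finite dual, and assume that $\zeta:\mathcal U^\circ\to\mathcal U^*$ is injective. Then the following assertions are equivalent: (a) the morphism $\widehat\zeta:\widehat{\mathcal U^\circ}\to\mathcal U^*$ is a filtered isomorphism; (b) the morphism $\mathrm{gr}(\widehat\zeta):\mathrm{gr}(\widehat{\mathcal U^\circ})\to\mathrm{gr}(\mathcal U^* )$ is a graded isomorphism; (c) $\widehat\zeta$ is surjective and the $\mathcal K$-adic filtration on $\mathcal U^\circ$ coincides with the one induced from $\mathcal U^*$ via $\zeta$; (d) the graded morphism $\mathrm{gr}(\widehat\zeta):\mathrm{gr}(\widehat{\mathcal U^\circ})\to\mathrm{gr}(\mathcal U^* )$ is surjective and the $\mathcal K$-adic filtration on $\mathcal U^\circ$ coincides with the one induced from $\mathcal U^*$ via $\zeta$; (e) the graded morphism $\mathrm{gr}(\zeta):\mathrm{gr}(\mathcal U^\circ)\to\mathrm{gr}(\mathcal U^* )$ is surjective and the $\mathcal K$-adic filtration on $\mathcal U^\circ$ coincides with the one induced from $\mathcal U^*$ via $\zeta$. Moreover, the following assertions are equivalent as well: (f) the morphism $\widehat\zeta:\widehat{\mathcal U^\circ}\to\mathcal U^*$ is a homeomorphism; (g) the morphism $\widehat\zeta$ is open and injective and $\mathcal U^\circ$ (that is, $\zeta(\mathcal U^\circ)$) is dense in $\mathcal U^*$; (h) the $\mathcal K$-adic topology on $\mathcal U^\circ$ is equivalent to the one induced from $\mathcal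 U^*$ via $\zeta$, and $\mathcal U^\circ$ is dense in $\mathcal U^*$. If in addition the morphism $\widehat\vartheta:\widehat{A\otimes A}\to\mathcal U^*$ induced by the algebra map $\vartheta:A\otimes A\to\mathcal U^*$, $\vartheta(a'\otimes a)(u)=\varepsilon(au)a'$, is a filtered isomorphism, then all the assertions (a)–(h) are equivalent.
   Context: $\Bbbk$ is a field; algebras are $\Bbbk$-algebras; $\otimes=\otimes_{\Bbbk}$; $\mathrm{Spec}(A)\neq\emptyset$. **Co-commutative Hopf algebroid.** A (right) co-commutative Hopf algebroid $(A,\mathcal U)$ consists of a commutative algebra $A$, a possibly noncommutative algebra $\mathcal U$, an algebra map $A\to\mathcal U$ (image not necessarily central; elements of $A$ are viewed in $\mathcal U$ through it), a right $A$-linear map $\varepsilon:\mathcal U\to A$ with $\varepsilon(uv)=\varepsilon(\varepsilon(u)v)$, and a map of $A$-rings $\Delta:\mathcal U\to\mathcal U\times_A\mathcal U$, $u\mapsto u_1\otimes_A u_2$, where $\mathcal U\times_A\mathcal U=\{\sum u_i\otimes_A v_i\in\mathcal U_A\otimes_A\mathcal U_A\mid\sum au_i\otimes_A v_i=\sum u_i\otimes_A av_i\ \forall a\in A\}$ has componentwise product and the map $A\to \mathcal U\times_A\mathcal U$, $a\mapsto a\otimes_A1=1\otimes_A a$. One requires $\Delta$ coassociative, co-commutative ($u_1\otimes_A u_2=u_2\otimes_A u_1$), counital with counit $\varepsilon$, and that $\beta:\mathcal U_A\otimes_A{}_A\mathcal U\to\mathcal U_A\otimes_A\mathcal U_A$,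 $u\otimes_A v\mapsto uv_1\otimes_A v_2$, is bijective. Write $\beta^{-1}(1\otimes_A u)=u_-\otimes_A u_+$. **Admissible filtration.** $A\subset\mathcal U$ and $\mathcal U=\bigcup_{n\ge0}F^n\mathcal U$ is an increasing filtration by $A$-subbimodules with $F^0\mathcal U=A$, $F^n\mathcal U\cdot F^m\mathcal U\subseteq F^{n+m}\mathcal U$, each $F^n\mathcal U/F^{n-1}\mathcal U$ a finitely generated projective right $A$-module, and $\Delta(F^n\mathcal U)\subseteq\sum_{p+q=n}F^p\mathcal U_A\otimes_AF^q\mathcal U_A$. **Convolution algebra.** $\mathcal U^*=\mathrm{Hom}_{-A}(\mathcal U,A)$ (right $A$-linear maps), product $(f*g)(u)=f(u_1)g(u_2)$, unit $\varepsilon$, filtration $F_0\mathcal U^*=\mathcal U^*$, $F_{n+1}\mathcal U^*=\{f\mid f(F^n\mathcal U)=0\}$; it is complete. **Finite dual.** $\mathcal A_{\mathcal U}$ is the category of right $\mathcal U$-modules whose underlying right $A$-module is finitely generated projective, with unit $A$ ($a\cdot u=\varepsilon(au)$), tensor product $M\otimes_AN$ ($(m\otimes n)u=mu_1\otimes nu_2$), dual $M^*=\mathrm{Hom}_{-A}(M,A)$ ($(\varphi\cdot u)(m)=\varphi(mu_-)\cdot u_+$). With $T_{MN}=\mathrm{Hom}_{\mathcal A_{\mathcal U}}(M,N)$, $T_M=T_{MM}$, $\mathcal U^\circ$ is the quotient of $\bigoplus_{M\in\mathcal A_{\mathcal U}}M^*\otimes_{T_M}M$ by the ideal generated by all $\varphi\otimes_{T_N}f(m)-\varphi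 f\otimes_{T_M}m$ ($\varphi\in N^*$, $m\in M$, $f\in T_{MN}$), a commutative algebra with unit $\overline{\mathrm{id}_A\otimes1}$ and product $\overline{\psi\otimes_{T_N}n}\cdot\overline{\varphi\otimes_{T_M}m}=\overline{(\psi\star\varphi)\otimes_{T_{M\otimes_A N}}(m\otimes_An)}$, $(\psi\star\varphi)(m\otimes_An)=\varphi(m)\psi(n)$; it is a commutative Hopf algebroid over $A$ with counit $\varepsilon_\circ(\overline{\varphi\otimes m})=\varphi(m)$. $\mathcal U^\circ$ has the $\mathcal K$-adic filtration $F_n\mathcal U^\circ=\mathcal K^n$, $\mathcal K=\ker\varepsilon_\circ$. The algebra map $\zeta:\mathcal U^\circ\to\mathcal U^*$, $\zeta(\overline{\varphi\otimes_{T_M}m})(u)=\varphi(mu)$, is filtered, and $\widehat\zeta:\widehat{\mathcal U^\circ}\to\mathcal U^*$ is the induced map on completions. **Filtrations.** For a decreasingly filtered $M$: the linear topology has the $F_nM$ as neighbourhoods of $0$; $\widehat M=\varprojlim M/F_nM$ with $F_n\widehat M=\ker(\widehat M\to M/F_nM)$; $\mathrm{gr}(M)=\bigoplus_nF_nM/F_{n+1}M$. A filtered map $f:M\to N$ satisfies $f(F_nM)\subseteq F_nN$; a filtered isomorphism is a bijective filtered map with filtered inverse. The filtration (topology) on $\mathcal U^\circ$ induced from $\mathcal U^*$ via $\zeta$ is $\zeta^{-1}(F_n\mathcal U^* )$. $A$ is trivially filtered and $A\otimes A$ has the $K$-adic filtration, $K=\ker(A\otimes A\to A,\ a\otimes b\mapsto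 ab)$. *)

theory Defs
  imports "HOL-Algebra.Module" "HOL-Algebra.QuotRing" "HOL-Algebra.Ideal_Product"
    "HOL-Algebra.Free_Abelian_Groups" "HOL-Analysis.Abstract_Topology"
begin

section \<open>Right modules\<close>

text \<open>
  As for \<^type>\<open>module\<close>, the record extends \<^type>\<open>ring\<close> only in order to inherit the additive
  structure; the fields \<^const>\<open>monoid.mult\<close> and \<^const>\<open>one\<close> of a module carry no meaning.
\<close>

record ('s, 'm) rmod = "'m ring" +
  ract :: "'m \<Rightarrow> 's \<Rightarrow> 'm" (infixl "\<triangleleft>\<index>" 70)

locale right_module = R?: ring R + M?: abelian_group M
  for R :: "('s, 'c) ring_scheme" (structure) and M :: "('s, 'm, 'd) rmod_scheme" (structure) +
  assumes ract_closed: "\<lbrakk>m \<in> carrier M; r \<in> carrier R\<rbrakk> \<Longrightarrow> m \<triangleleft>\<^bsub>M\<^esub> r \<in> carrier M"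
    and ract_add_left: "\<lbrakk>m \<in> carrier M; n \<in> carrier M; r \<in> carrier R\<rbrakk> \<Longrightarrow>
      (m \<oplus>\<^bsub>M\<^esub> n) \<triangleleft>\<^bsub>M\<^esub> r = m \<triangleleft>\<^bsub>M\<^esub> r \<oplus>\<^bsub>M\<^esub> n \<triangleleft>\<^bsub>M\<^esub> r"
    and ract_add_right: "\<lbrakk>m \<in> carrier M; r \<in> carrier R; s \<in> carrier R\<rbrakk> \<Longrightarrow>
      m \<triangleleft>\<^bsub>M\<^esub> (r \<oplus> s) = m \<triangleleft>\<^bsub>M\<^esub> r \<oplus>\<^bsub>M\<^esub> m \<triangleleft>\<^bsub>M\<^esub> s"
    and ract_mult: "\<lbrakk>m \<in> carrier M; r \<in> carrier R; s \<in> carrier R\<rbrakk> \<Longrightarrow>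
      m \<triangleleft>\<^bsub>M\<^esub> (r \<otimes> s) = (m \<triangleleft>\<^bsub>M\<^esub> r) \<triangleleft>\<^bsub>M\<^esub> s"
    and ract_one: "m \<in> carrier M \<Longrightarrow> m \<triangleleft>\<^bsub>M\<^esub> \<one> = m"

text \<open>Maps are extensional, so that equality in a Hom set is equality on the carrier.\<close>

definition rlin :: "('s, 'c) ring_scheme \<Rightarrow> ('s, 'm, 'd) rmod_scheme \<Rightarrow> ('s, 'n, 'e) rmod_scheme
    \<Rightarrow> ('m \<Rightarrow> 'n) set"
  where "rlin R M N = {f \<in> carrier M \<rightarrow>\<^sub>E carrier N.
    (\<forall>x\<in>carrier M. \<forall>y\<in>carrier M. f (x \<oplus>\<^bsub>M\<^esub> y) = f x \<oplus>\<^bsub>N\<^esub> f y) \<and>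
    (\<forall>x\<in>carrier M. \<forall>r\<in>carrier R. f (x \<triangleleft>\<^bsub>M\<^esub> r) = f x \<triangleleft>\<^bsub>N\<^esub> r)}"

definition rmod_iso :: "('s, 'c) ring_scheme \<Rightarrow> ('s, 'm, 'd) rmod_scheme
    \<Rightarrow> ('s, 'n, 'e) rmod_scheme \<Rightarrow> ('m \<Rightarrow> 'n) set"
  where "rmod_iso R M N = {f \<in> rlin R M N. bij_betw f (carrier M) (carrier N)}"

definition regular_rmod :: "('s, 'c) ring_scheme \<Rightarrow> ('s, 's) rmod"
  where "regular_rmod R = ring.extend (ring.truncate R) (rmod.fields (\<lambda>x r. x \<otimes>\<^bsub>R\<^esub> r))"

definition free_rmod :: "('s, 'c) ring_scheme \<Rightarrow> nat \<Rightarrow> ('s, nat \<Rightarrow> 's) rmod"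
  where "free_rmod R n =
    \<lparr>carrier = {..<n} \<rightarrow>\<^sub>E carrier R, monoid.mult = undefined, one = undefined,
     ring.zero = (\<lambda>i\<in>{..<n}. \<zero>\<^bsub>R\<^esub>), add = (\<lambda>x y. \<lambda>i\<in>{..<n}. x i \<oplus>\<^bsub>R\<^esub> y i),
     ract = (\<lambda>x r. \<lambda>i\<in>{..<n}. x i \<otimes>\<^bsub>R\<^esub> r)\<rparr>"

text \<open>Finitely generated projective: a direct summand, via a split surjection, of some \<open>R^n\<close>.\<close>

definition fg_projective :: "('s, 'c) ring_scheme \<Rightarrow> ('s, 'm, 'd) rmod_scheme \<Rightarrow> bool"
  where "fg_projective R M \<longleftrightarrow> right_module R M \<and>
    (\<exists>n. \<exists>p\<in>rlin R (free_rmod R n) M. \<exists>s\<in>rlin R M (free_rmod R n). \<forall>m\<in>carrier M. p (s m) = m)"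

definition quot_rmod :: "('s, 'm, 'd) rmod_scheme \<Rightarrow> 'm set \<Rightarrow> ('s, 'm set) rmod"
  where "quot_rmod M N =
    \<lparr>carrier = a_rcosets\<^bsub>M\<^esub> N, monoid.mult = undefined, one = undefined, ring.zero = N, add = set_add M,
     ract = (\<lambda>X r. the_elem ((\<lambda>x. N +>\<^bsub>M\<^esub> (x \<triangleleft>\<^bsub>M\<^esub> r)) ` X))\<rparr>"

definition dual_group :: "('a, 'c) ring_scheme \<Rightarrow> ('a, 'm, 'd) rmod_scheme \<Rightarrow> ('m \<Rightarrow> 'a) ring"
  where "dual_group A M =
    \<lparr>carrier = rlin A M (regular_rmod A), monoid.mult = undefined, one = undefined,
     ring.zero = (\<lambda>m\<in>carrier M. \<zero>\<^bsub>A\<^esub>), add = (\<lambda>f g. \<lambda>m\<in>carrier M. f m \<oplus>\<^bsub>A\<^esub> g m)\<rparr>"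


section \<open>Balanced tensor products\<close>

text \<open>
  The parameter \<open>B\<close> is a set of pairs of maps \<open>(r, l)\<close>; besides biadditivity one imposes
  \<open>r x \<otimes> y = x \<otimes> l y\<close>.  For \<open>X \<otimes>\<^sub>S Y\<close> these are the pairs (action of \<open>s\<close> on \<open>X\<close>, action of \<open>s\<close>
  on \<open>Y\<close>) for \<open>s \<in> S\<close>.
  Elements of the tensor product are cosets of formal integral combinations of pairs.
\<close>

type_synonym ('x, 'y) balance = "(('x \<Rightarrow> 'x) \<times> ('y \<Rightarrow> 'y)) set"
type_synonym ('x, 'y) tens = "('x \<times> 'y \<Rightarrow>\<^sub>0 int) set"

definition tensor_rels :: "('x, 'y) balance \<Rightarrow> ('x, 'c) ring_scheme \<Rightarrow> ('y, 'd) ring_scheme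
    \<Rightarrow> ('x \<times> 'y \<Rightarrow>\<^sub>0 int) set"
  where "tensor_rels B X Y =
    {frag_of (x \<oplus>\<^bsub>X\<^esub> x', y) - (frag_of (x, y) + frag_of (x', y)) | x x' y.
       x \<in> carrier X \<and> x' \<in> carrier X \<and> y \<in> carrier Y} \<union>
    {frag_of (x, y \<oplus>\<^bsub>Y\<^esub> y') - (frag_of (x, y) + frag_of (x, y')) | x y y'.
       x \<in> carrier X \<and> y \<in> carrier Y \<and> y' \<in> carrier Y} \<union>
    {frag_of (r x, y) - frag_of (x, l y) | r l x y.
       (r, l) \<in> B \<and> x \<in> carrier X \<and> y \<in> carrier Y}"

definition tensor_zero :: "('x, 'y) balance \<Rightarrow> ('x, 'c) ring_scheme \<Rightarrow> ('y, 'd) ring_scheme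
    \<Rightarrow> ('x, 'y) tens"
  where "tensor_zero B X Y =
    generate (free_Abelian_group (carrier X \<times> carrier Y)) (tensor_rels B X Y)"

definition tensor_class :: "('x, 'y) balance \<Rightarrow> ('x, 'c) ring_scheme \<Rightarrow> ('y, 'd) ring_scheme
    \<Rightarrow> ('x \<times> 'y \<Rightarrow>\<^sub>0 int) \<Rightarrow> ('x, 'y) tens"
  where "tensor_class B X Y w =
    tensor_zero B X Y #>\<^bsub>free_Abelian_group (carrier X \<times> carrier Y)\<^esub> w"

definition pure_tensor :: "('x, 'y) balance \<Rightarrow> ('x, 'c) ring_scheme \<Rightarrow> ('y, 'd) ring_scheme
    \<Rightarrow> 'x \<Rightarrow> 'y \<Rightarrow> ('x, 'y) tens"
  where "pure_tensor B X Y x y = tensor_class B X Y (frag_of (x, y))"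

text \<open>
  The field \<^const>\<open>monoid.mult\<close> is the componentwise product \<open>(x \<otimes> y)(x' \<otimes> y') = xx' \<otimes> yy'\<close>.  It is
  only meaningful where that formula is independent of representatives, such as on \<open>A \<otimes>\<^sub>k A\<close> or on
  the Takeuchi product inside \<open>U\<^sub>A \<otimes>\<^sub>A U\<^sub>A\<close>.
\<close>

definition tensor :: "('x, 'y) balance \<Rightarrow> ('x, 'c) ring_scheme \<Rightarrow> ('y, 'd) ring_scheme
    \<Rightarrow> ('x, 'y) tens ring"
  where "tensor B X Y =
    (let Q = free_Abelian_group (carrier X \<times> carrier Y) Mod tensor_zero B X Y in
     \<lparr>carrier = carrier Q,
      monoid.mult = (\<lambda>s t. the_elem {tensor_class B X Y (frag_extend (\<lambda>(x, y). frag_extend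
         (\<lambda>(x', y'). frag_of (x \<otimes>\<^bsub>X\<^esub> x', y \<otimes>\<^bsub>Y\<^esub> y')) w') w) | w w'. w \<in> s \<and> w' \<in> t}),
      one = pure_tensor B X Y \<one>\<^bsub>X\<^esub> \<one>\<^bsub>Y\<^esub>,
      ring.zero = \<one>\<^bsub>Q\<^esub>,
      add = (\<otimes>\<^bsub>Q\<^esub>)\<rparr>)"

text \<open>
  \<open>tlift G f\<close> is the additive map out of a tensor product given by \<open>x \<otimes> y \<mapsto> f (x, y)\<close>, for
  biadditive balanced \<open>f\<close>.
\<close>

definition frag_lift :: "('g, 'c) ring_scheme \<Rightarrow> ('x \<Rightarrow> 'g) \<Rightarrow> ('x \<Rightarrow>\<^sub>0 int) \<Rightarrow> 'g"
  where "frag_lift G f w =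
    (\<Oplus>\<^bsub>G\<^esub> p\<in>Poly_Mapping.keys w. [Poly_Mapping.lookup w p] \<cdot>\<^bsub>G\<^esub> f p)"

definition tlift :: "('g, 'c) ring_scheme \<Rightarrow> ('x \<times> 'y \<Rightarrow> 'g) \<Rightarrow> ('x, 'y) tens \<Rightarrow> 'g"
  where "tlift G f t = the_elem (frag_lift G f ` t)"

text \<open>Tensor product over a commutative ring of two right modules.\<close>

definition rbalance :: "('a, 'c) ring_scheme \<Rightarrow> ('a, 'x, 'd) rmod_scheme
    \<Rightarrow> ('a, 'y, 'e) rmod_scheme \<Rightarrow> ('x, 'y) balance"
  where "rbalance A X Y = {(\<lambda>x. x \<triangleleft>\<^bsub>X\<^esub> a, \<lambda>y. y \<triangleleft>\<^bsub>Y\<^esub> a) | a. a \<in> carrier A}"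

definition rpure :: "('a, 'c) ring_scheme \<Rightarrow> ('a, 'x, 'd) rmod_scheme
    \<Rightarrow> ('a, 'y, 'e) rmod_scheme \<Rightarrow> 'x \<Rightarrow> 'y \<Rightarrow> ('x, 'y) tens"
  where "rpure A X Y = pure_tensor (rbalance A X Y) X Y"

definition rtensor :: "('a, 'c) ring_scheme \<Rightarrow> ('a, 'x, 'd) rmod_scheme
    \<Rightarrow> ('a, 'y, 'e) rmod_scheme \<Rightarrow> ('a, ('x, 'y) tens) rmod"
  where "rtensor A X Y = (let T = tensor (rbalance A X Y) X Y in
    ring.extend T (rmod.fields (\<lambda>t a. tlift T (\<lambda>(x, y). rpure A X Y x (y \<triangleleft>\<^bsub>Y\<^esub> a)) t)))"


section \<open>Co-commutative Hopf algebroids\<close>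

text \<open>
  \<open>base\<close> is \<open>A\<close>, \<open>total\<close> is \<open>U\<close>, \<open>src\<close> is the algebra map \<open>A \<rightarrow> U\<close>.
\<close>

record ('k, 'a, 'u) hopf_data =
  base :: "('k, 'a) module"
  total :: "('k, 'u) module"
  src :: "'a \<Rightarrow> 'u"
  counit :: "'u \<Rightarrow> 'a"
  comult :: "'u \<Rightarrow> ('u, 'u) tens"

definition k_algebra :: "('k, 'c) ring_scheme \<Rightarrow> ('k, 'b, 'd) module_scheme \<Rightarrow> bool"
  where "k_algebra k B \<longleftrightarrow> Module.module k B \<and> ring B \<and>
    (\<forall>c\<in>carrier k. \<forall>x\<in>carrier B. \<forall>y\<in>carrier B.
       (c \<odot>\<^bsub>B\<^esub> x) \<otimes>\<^bsub>B\<^esub> y = c \<odot>\<^bsub>B\<^esub> (x \<otimes>\<^bsub>B\<^esub> y) \<and> x \<otimes>\<^bsub>B\<^esub> (c \<odot>\<^bsub>B\<^esub> y) = c \<odot>\<^bsub>B\<^esub> (x \<otimes>\<^bsub>B\<^esub> y))"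

definition UA :: "('k, 'a, 'u) hopf_data \<Rightarrow> ('a, 'u) rmod"
  where "UA H = ring.extend (ring.truncate (total H))
    (rmod.fields (\<lambda>u a. u \<otimes>\<^bsub>total H\<^esub> src H a))"

abbreviation UU :: "('k, 'a, 'u) hopf_data \<Rightarrow> ('a, ('u, 'u) tens) rmod"
  where "UU H \<equiv> rtensor (base H) (UA H) (UA H)"

abbreviation uu :: "('k, 'a, 'u) hopf_data \<Rightarrow> 'u \<Rightarrow> 'u \<Rightarrow> ('u, 'u) tens"
  where "uu H \<equiv> rpure (base H) (UA H) (UA H)"

text \<open>The triple tensor product, bracketed as \<open>(U \<otimes>\<^sub>A U) \<otimes>\<^sub>A U\<close>.\<close>

abbreviation UUU :: "('k, 'a, 'u) hopf_data \<Rightarrow> ('a, (('u, 'u) tens, 'u) tens) rmod"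
  where "UUU H \<equiv> rtensor (base H) (UU H) (UA H)"

abbreviation uuu :: "('k, 'a, 'u) hopf_data \<Rightarrow> ('u, 'u) tens \<Rightarrow> 'u \<Rightarrow> (('u, 'u) tens, 'u) tens"
  where "uuu H \<equiv> rpure (base H) (UU H) (UA H)"

definition takeuchi :: "('k, 'a, 'u) hopf_data \<Rightarrow> ('u, 'u) tens set"
  where "takeuchi H = {t \<in> carrier (UU H). \<forall>a\<in>carrier (base H).
    tlift (UU H) (\<lambda>(x, y). uu H (src H a \<otimes>\<^bsub>total H\<^esub> x) y) t =
    tlift (UU H) (\<lambda>(x, y). uu H x (src H a \<otimes>\<^bsub>total H\<^esub> y)) t}"

text \<open>\<open>U\<^sub>A \<otimes>\<^sub>A \<^sub>AU\<close>, where \<open>ua \<otimes> v = u \<otimes> av\<close>: the domain of \<open>\<beta>\<close>.\<close>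

definition U_bimod_U :: "('k, 'a, 'u) hopf_data \<Rightarrow> ('u, 'u) tens ring"
  where "U_bimod_U H = tensor
    {(\<lambda>u. u \<otimes>\<^bsub>total H\<^esub> src H a, \<lambda>v. src H a \<otimes>\<^bsub>total H\<^esub> v) | a. a \<in> carrier (base H)}
    (total H) (total H)"

definition hopf_beta :: "('k, 'a, 'u) hopf_data \<Rightarrow> ('u, 'u) tens \<Rightarrow> ('u, 'u) tens"
  where "hopf_beta H = tlift (UU H) (\<lambda>(u, v).
    tlift (UU H) (\<lambda>(v1, v2). uu H (u \<otimes>\<^bsub>total H\<^esub> v1) v2) (comult H v))"

locale cocomm_hopf_algebroid =
  fixes k :: "('k, 'c) ring_scheme" and H :: "('k, 'a, 'u) hopf_data"
  assumes field_k: "field k"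
    and base_algebra: "algebra k (base H)"
    and Spec_nonempty: "\<exists>P. primeideal P (base H)"
    and total_algebra: "k_algebra k (total H)"
    and src_hom: "src H \<in> ring_hom (base H) (total H)"
    and src_smult: "\<lbrakk>c \<in> carrier k; a \<in> carrier (base H)\<rbrakk> \<Longrightarrow>
      src H (c \<odot>\<^bsub>base H\<^esub> a) = c \<odot>\<^bsub>total H\<^esub> src H a"
    and counit_closed: "u \<in> carrier (total H) \<Longrightarrow> counit H u \<in> carrier (base H)"
    and counit_add: "\<lbrakk>u \<in> carrier (total H); v \<in> carrier (total H)\<rbrakk> \<Longrightarrow>
      counit H (u \<oplus>\<^bsub>total H\<^esub> v) = counit H u \<oplus>\<^bsub>base H\<^esub> counit H v"
    and counit_right_linear: "\<lbrakk>u \<in> carrier (total H); a \<in> carrier (base H)\<rbrakk> \<Longrightarrow>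
      counit H (u \<otimes>\<^bsub>total H\<^esub> src H a) = counit H u \<otimes>\<^bsub>base H\<^esub> a"
    and counit_mult: "\<lbrakk>u \<in> carrier (total H); v \<in> carrier (total H)\<rbrakk> \<Longrightarrow>
      counit H (u \<otimes>\<^bsub>total H\<^esub> v) = counit H (src H (counit H u) \<otimes>\<^bsub>total H\<^esub> v)"
    and comult_hom: "comult H \<in> ring_hom (total H) ((UU H)\<lparr>carrier := takeuchi H\<rparr>)"
    and comult_src: "a \<in> carrier (base H) \<Longrightarrow>
      comult H (src H a) = uu H (src H a) \<one>\<^bsub>total H\<^esub>"
    and coassoc: "u \<in> carrier (total H) \<Longrightarrow>
      tlift (UUU H) (\<lambda>(x, y). uuu H (comult H x) y) (comult H u) =
      tlift (UUU H) (\<lambda>(x, y). tlift (UUU H) (\<lambda>(y1, y2). uuu H (uu H x y1) y2) (comult H y))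
        (comult H u)"
    and cocomm: "u \<in> carrier (total H) \<Longrightarrow>
      tlift (UU H) (\<lambda>(x, y). uu H y x) (comult H u) = comult H u"
    and counital_right: "u \<in> carrier (total H) \<Longrightarrow>
      tlift (total H) (\<lambda>(x, y). x \<otimes>\<^bsub>total H\<^esub> src H (counit H y)) (comult H u) = u"
    and counital_left: "u \<in> carrier (total H) \<Longrightarrow>
      tlift (total H) (\<lambda>(x, y). y \<otimes>\<^bsub>total H\<^esub> src H (counit H x)) (comult H u) = u"
    and beta_bij: "bij_betw (hopf_beta H) (carrier (U_bimod_U H)) (carrier (UU H))"

text \<open>
  In \<open>gr_projective\<close>, \<open>F\<^sup>-\<^sup>1 = 0\<close>.  In \<open>comult_filtered\<close>, the summand
  \<open>F\<^sup>p \<otimes>\<^sub>A F\<^sup>q\<close> is read as its image in \<open>U\<^sub>A \<otimes>\<^sub>A U\<^sub>A\<close>.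
\<close>

locale admissible_filtration =
  fixes H :: "('k, 'a, 'u) hopf_data" and F :: "nat \<Rightarrow> 'u set"
  assumes src_inj: "inj_on (src H) (carrier (base H))"
    and exhaustive: "(\<Union>n. F n) = carrier (total H)"
    and increasing: "F n \<subseteq> F (Suc n)"
    and subgroup: "additive_subgroup (F n) (total H)"
    and left_closed: "\<lbrakk>a \<in> carrier (base H); u \<in> F n\<rbrakk> \<Longrightarrow> src H a \<otimes>\<^bsub>total H\<^esub> u \<in> F n"
    and right_closed: "\<lbrakk>a \<in> carrier (base H); u \<in> F n\<rbrakk> \<Longrightarrow> u \<otimes>\<^bsub>total H\<^esub> src H a \<in> F n"
    and F_zero: "F 0 = src H ` carrier (base H)"
    and F_mult: "\<lbrakk>u \<in> F n; v \<in> F m\<rbrakk> \<Longrightarrow> u \<otimes>\<^bsub>total H\<^esub> v \<in> F (n + m)"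
    and gr_projective: "fg_projective (base H) (quot_rmod ((UA H)\<lparr>carrier := F n\<rparr>)
      (case n of 0 \<Rightarrow> {\<zero>\<^bsub>total H\<^esub>} | Suc m \<Rightarrow> F m))"
    and comult_filtered: "u \<in> F n \<Longrightarrow> comult H u \<in> generate (add_monoid (UU H))
      {uu H x y | x y p q. p + q = n \<and> x \<in> F p \<and> y \<in> F q}"


section \<open>The convolution algebra\<close>

definition conv_algebra :: "('k, 'a, 'u) hopf_data \<Rightarrow> ('u \<Rightarrow> 'a) ring"
  where "conv_algebra H = (dual_group (base H) (UA H))
    \<lparr>monoid.mult := (\<lambda>f g. \<lambda>u\<in>carrier (total H).
       tlift (base H) (\<lambda>(x, y). f x \<otimes>\<^bsub>base H\<^esub> g y) (comult H u)),
     one := restrict (counit H) (carrier (total H))\<rparr>"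

fun conv_filtration :: "('k, 'a, 'u) hopf_data \<Rightarrow> (nat \<Rightarrow> 'u set) \<Rightarrow> nat \<Rightarrow> ('u \<Rightarrow> 'a) set"
  where
    "conv_filtration H F 0 = carrier (conv_algebra H)"
  | "conv_filtration H F (Suc n) = {f \<in> carrier (conv_algebra H). \<forall>u\<in>F n. f u = \<zero>\<^bsub>base H\<^esub>}"


section \<open>The finite dual\<close>

definition restrict_scalars :: "('k, 'a, 'u) hopf_data \<Rightarrow> ('u, 'm, 'd) rmod_scheme \<Rightarrow> ('a, 'm) rmod"
  where "restrict_scalars H M = ring.extend (ring.truncate M)
    (rmod.fields (\<lambda>m a. m \<triangleleft>\<^bsub>M\<^esub> src H a))"

text \<open>
  The category of right \<open>U\<close>-modules that are finitely generated projective over \<open>A\<close> is only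
  essentially small.  The direct sum defining the finite dual is taken over its full subcategory
  of modules whose carrier is a set of functions \<open>nat \<Rightarrow> 'a\<close>.  Every object is isomorphic
  to one of these, being a direct summand of some \<open>A^n\<close>; by the relations
  in \<open>finite_dual\<close> below, enlarging the set of objects does not change the finite dual.
\<close>

type_synonym ('a, 'u) fobj = "('u, nat \<Rightarrow> 'a) rmod"

definition fmods :: "('k, 'a, 'u) hopf_data \<Rightarrow> ('a, 'u) fobj set"
  where "fmods H = {M. right_module (total H) M \<and> fg_projective (base H) (restrict_scalars H M)}"

text \<open>A chosen isomorphic copy in \<^const>\<open>fmods\<close> of a module that may live on another type.\<close>

definition model :: "('k, 'a, 'u) hopf_data \<Rightarrow> ('u, 'm) rmod \<Rightarrow> ('a, 'u) fobj"
  where "model H M = (SOME P. P \<in> fmods H \<and> rmod_iso (total H) M P \<noteq> {})"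

definition to_model :: "('k, 'a, 'u) hopf_data \<Rightarrow> ('u, 'm) rmod \<Rightarrow> 'm \<Rightarrow> nat \<Rightarrow> 'a"
  where "to_model H M = (SOME f. f \<in> rmod_iso (total H) M (model H M))"

definition unit_mod :: "('k, 'a, 'u) hopf_data \<Rightarrow> ('u, 'a) rmod"
  where "unit_mod H = ring.extend (ring.truncate (base H))
    (rmod.fields (\<lambda>a u. counit H (src H a \<otimes>\<^bsub>total H\<^esub> u)))"

definition mod_pure :: "('k, 'a, 'u) hopf_data \<Rightarrow> ('u, 'm) rmod \<Rightarrow> ('u, 'n) rmod
    \<Rightarrow> 'm \<Rightarrow> 'n \<Rightarrow> ('m, 'n) tens"
  where "mod_pure H M N = rpure (base H) (restrict_scalars H M) (restrict_scalars H N)"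

definition mod_tensor :: "('k, 'a, 'u) hopf_data \<Rightarrow> ('u, 'm) rmod \<Rightarrow> ('u, 'n) rmod
    \<Rightarrow> ('u, ('m, 'n) tens) rmod"
  where "mod_tensor H M N =
    (let T = rtensor (base H) (restrict_scalars H M) (restrict_scalars H N) in
     ring.extend (ring.truncate T) (rmod.fields (\<lambda>t u.
       tlift T (\<lambda>(m, n). tlift T (\<lambda>(u1, u2). mod_pure H M N (m \<triangleleft>\<^bsub>M\<^esub> u1) (n \<triangleleft>\<^bsub>N\<^esub> u2))
         (comult H u)) t)))"

abbreviation mod_dual :: "('k, 'a, 'u) hopf_data \<Rightarrow> ('u, 'm) rmod \<Rightarrow> ('m \<Rightarrow> 'a) ring"
  where "mod_dual H M \<equiv> dual_group (base H) (restrict_scalars H M)"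

text \<open>\<open>M\<^sup>* \<otimes>\<^sub>T M\<close> with \<open>T = End(M)\<close>: balanced by \<open>\<phi>f \<otimes> m = \<phi> \<otimes> f(m)\<close>.\<close>

definition end_balance :: "('k, 'a, 'u) hopf_data \<Rightarrow> ('u, 'm) rmod \<Rightarrow> ('m \<Rightarrow> 'a, 'm) balance"
  where "end_balance H M = {(\<lambda>\<phi>. compose (carrier M) \<phi> f, f) | f. f \<in> rlin (total H) M M}"

definition summand :: "('k, 'a, 'u) hopf_data \<Rightarrow> ('u, 'm) rmod \<Rightarrow> ('m \<Rightarrow> 'a, 'm) tens ring"
  where "summand H M = tensor (end_balance H M) (mod_dual H M) M"

type_synonym ('a, 'u) fsum = "('a, 'u) fobj \<Rightarrow> ((nat \<Rightarrow> 'a) \<Rightarrow> 'a, nat \<Rightarrow> 'a) tens"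

definition dsum_group :: "('k, 'a, 'u) hopf_data \<Rightarrow> ('a, 'u) fsum ring"
  where "dsum_group H = (let S = sum_group (fmods H) (\<lambda>M. add_monoid (summand H M)) in
    \<lparr>carrier = carrier S, monoid.mult = undefined, one = undefined, ring.zero = \<one>\<^bsub>S\<^esub>, add = (\<otimes>\<^bsub>S\<^esub>)\<rparr>)"

text \<open>The element \<open>\<phi> \<otimes> m\<close> of the summand at \<open>M\<close>.\<close>

definition dsum_elt :: "('k, 'a, 'u) hopf_data \<Rightarrow> ('a, 'u) fobj \<Rightarrow> ((nat \<Rightarrow> 'a) \<Rightarrow> 'a)
    \<Rightarrow> (nat \<Rightarrow> 'a) \<Rightarrow> ('a, 'u) fsum"
  where "dsum_elt H M \<phi> m = (\<lambda>N\<in>fmods H.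
    if N = M then pure_tensor (end_balance H M) (mod_dual H M) M \<phi> m else \<zero>\<^bsub>summand H N\<^esub>)"

text \<open>The same for a module on another type, transported to its copy in \<^const>\<open>fmods\<close>.\<close>

definition transport_elt :: "('k, 'a, 'u) hopf_data \<Rightarrow> ('u, 'm) rmod \<Rightarrow> ('m \<Rightarrow> 'a) \<Rightarrow> 'm
    \<Rightarrow> ('a, 'u) fsum"
  where "transport_elt H M \<phi> m = dsum_elt H (model H M)
    (\<lambda>x\<in>carrier (model H M). \<phi> (inv_into (carrier M) (to_model H M) x)) (to_model H M m)"

text \<open>The additive map out of the direct sum with \<open>\<phi> \<otimes> m \<mapsto> h M \<phi> m\<close> on the summand at \<open>M\<close>.\<close>

definition dsum_lift :: "('k, 'a, 'u) hopf_data \<Rightarrow> ('g, 'c) ring_scheme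
    \<Rightarrow> (('a, 'u) fobj \<Rightarrow> ((nat \<Rightarrow> 'a) \<Rightarrow> 'a) \<Rightarrow> (nat \<Rightarrow> 'a) \<Rightarrow> 'g) \<Rightarrow> ('a, 'u) fsum \<Rightarrow> 'g"
  where "dsum_lift H G h d =
    (\<Oplus>\<^bsub>G\<^esub> M\<in>{M \<in> fmods H. d M \<noteq> \<zero>\<^bsub>summand H M\<^esub>}. tlift G (\<lambda>(\<phi>, m). h M \<phi> m) (d M))"

definition star :: "('k, 'a, 'u) hopf_data \<Rightarrow> ('u, 'm) rmod \<Rightarrow> ('u, 'n) rmod
    \<Rightarrow> ('n \<Rightarrow> 'a) \<Rightarrow> ('m \<Rightarrow> 'a) \<Rightarrow> ('m, 'n) tens \<Rightarrow> 'a"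
  where "star H M N \<psi> \<phi> = (\<lambda>t\<in>carrier (mod_tensor H M N).
    tlift (base H) (\<lambda>(m, n). \<phi> m \<otimes>\<^bsub>base H\<^esub> \<psi> n) t)"

text \<open>The product is \<open>(\<psi> \<otimes> n) \<cdot> (\<phi> \<otimes> m) = (\<psi> \<star> \<phi>) \<otimes> (m \<otimes> n)\<close>, for \<open>n \<in> N\<close> and \<open>m \<in> M\<close>.\<close>

definition dsum_algebra :: "('k, 'a, 'u) hopf_data \<Rightarrow> ('a, 'u) fsum ring"
  where "dsum_algebra H = (dsum_group H)
    \<lparr>monoid.mult := (\<lambda>d e. dsum_lift H (dsum_group H) (\<lambda>N \<psi> n.
       dsum_lift H (dsum_group H) (\<lambda>M \<phi> m.
         transport_elt H (mod_tensor H M N) (star H M N \<psi> \<phi>) (mod_pure H M N m n)) e) d),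
     one := transport_elt H (unit_mod H) (\<lambda>a\<in>carrier (base H). a) \<one>\<^bsub>base H\<^esub>\<rparr>"

text \<open>
  The direct sum is neither associative nor unital on the nose, so \<^const>\<open>genideal\<close>, which
  presupposes a ring, is not applicable.
\<close>

definition ideal_generated :: "('r, 'c) ring_scheme \<Rightarrow> 'r set \<Rightarrow> 'r set"
  where "ideal_generated R S = \<Inter>{I. additive_subgroup I R \<and> S \<subseteq> I \<and>
    (\<forall>x\<in>I. \<forall>r\<in>carrier R. r \<otimes>\<^bsub>R\<^esub> x \<in> I \<and> x \<otimes>\<^bsub>R\<^esub> r \<in> I)}"

definition dual_rels :: "('k, 'a, 'u) hopf_data \<Rightarrow> ('a, 'u) fsum set"
  where "dual_rels H =
    {dsum_elt H N \<phi> (f m) \<ominus>\<^bsub>dsum_algebra H\<^esub> dsum_elt H M (compose (carrier M) \<phi> f) m | M N \<phi> m f.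
       M \<in> fmods H \<and> N \<in> fmods H \<and> \<phi> \<in> carrier (mod_dual H N) \<and> m \<in> carrier M \<and>
       f \<in> rlin (total H) M N}"

definition finite_dual :: "('k, 'a, 'u) hopf_data \<Rightarrow> ('a, 'u) fsum set ring"
  where "finite_dual H = dsum_algebra H Quot ideal_generated (dsum_algebra H) (dual_rels H)"

definition finite_dual_lift :: "('k, 'a, 'u) hopf_data \<Rightarrow> ('g, 'c) ring_scheme
    \<Rightarrow> (('a, 'u) fobj \<Rightarrow> ((nat \<Rightarrow> 'a) \<Rightarrow> 'a) \<Rightarrow> (nat \<Rightarrow> 'a) \<Rightarrow> 'g) \<Rightarrow> ('a, 'u) fsum set \<Rightarrow> 'g"
  where "finite_dual_lift H G h X = the_elem (dsum_lift H G h ` X)"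

definition counit_circ :: "('k, 'a, 'u) hopf_data \<Rightarrow> ('a, 'u) fsum set \<Rightarrow> 'a"
  where "counit_circ H = finite_dual_lift H (base H) (\<lambda>M \<phi> m. \<phi> m)"

definition zeta :: "('k, 'a, 'u) hopf_data \<Rightarrow> ('a, 'u) fsum set \<Rightarrow> 'u \<Rightarrow> 'a"
  where "zeta H = finite_dual_lift H (conv_algebra H)
    (\<lambda>M \<phi> m. \<lambda>u\<in>carrier (total H). \<phi> (m \<triangleleft>\<^bsub>M\<^esub> u))"

primrec ideal_power :: "('r, 'c) ring_scheme \<Rightarrow> 'r set \<Rightarrow> nat \<Rightarrow> 'r set"
  where
    "ideal_power R I 0 = carrier R"
  | "ideal_power R I (Suc n) = ideal_prod R I (ideal_power R I n)"

definition finite_dual_filtration :: "('k, 'a, 'u) hopf_data \<Rightarrow> nat \<Rightarrow> ('a, 'u) fsum set set"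
  where "finite_dual_filtration H = ideal_power (finite_dual H)
    {x \<in> carrier (finite_dual H). counit_circ H x = \<zero>\<^bsub>base H\<^esub>}"


section \<open>The map from \<open>A \<otimes> A\<close>\<close>

definition base_tensor :: "('k, 'c) ring_scheme \<Rightarrow> ('k, 'a, 'u) hopf_data \<Rightarrow> ('a, 'a) tens ring"
  where "base_tensor k H = tensor
    {(\<lambda>a. c \<odot>\<^bsub>base H\<^esub> a, \<lambda>b. c \<odot>\<^bsub>base H\<^esub> b) | c. c \<in> carrier k} (base H) (base H)"

definition base_tensor_filtration :: "('k, 'c) ring_scheme \<Rightarrow> ('k, 'a, 'u) hopf_data
    \<Rightarrow> nat \<Rightarrow> ('a, 'a) tens set"
  where "base_tensor_filtration k H = ideal_power (base_tensor k H)
    {t \<in> carrier (base_tensor k H). tlift (base H) (\<lambda>(a, b). a \<otimes>\<^bsub>base H\<^esub> b) t = \<zero>\<^bsub>base H\<^esub>}"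

definition theta :: "('k, 'a, 'u) hopf_data \<Rightarrow> ('a, 'a) tens \<Rightarrow> 'u \<Rightarrow> 'a"
  where "theta H = tlift (conv_algebra H) (\<lambda>(a', a). \<lambda>u\<in>carrier (total H).
    counit H (src H a \<otimes>\<^bsub>total H\<^esub> u) \<otimes>\<^bsub>base H\<^esub> a')"


section \<open>Decreasing filtrations\<close>

text \<open>
  The inverse limit consists of the sequences of cosets \<open>x n \<in> M/F\<^sub>n\<close> that are compatible with
  the projections; compatibility is reverse inclusion of cosets.
\<close>

definition completion :: "('m, 'c) ring_scheme \<Rightarrow> (nat \<Rightarrow> 'm set) \<Rightarrow> (nat \<Rightarrow> 'm set) ring"
  where "completion M F =
    \<lparr>carrier = {x. (\<forall>n. x n \<in> carrier (M Quot F n)) \<and> (\<forall>n m. n \<le> m \<longrightarrow> x m \<subseteq> x n)},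
     monoid.mult = (\<lambda>x y n. x n \<otimes>\<^bsub>M Quot F n\<^esub> y n), one = (\<lambda>n. \<one>\<^bsub>M Quot F n\<^esub>),
     ring.zero = (\<lambda>n. \<zero>\<^bsub>M Quot F n\<^esub>), add = (\<lambda>x y n. x n \<oplus>\<^bsub>M Quot F n\<^esub> y n)\<rparr>"

definition completion_filtration :: "('m, 'c) ring_scheme \<Rightarrow> (nat \<Rightarrow> 'm set) \<Rightarrow> nat
    \<Rightarrow> (nat \<Rightarrow> 'm set) set"
  where "completion_filtration M F n = {x \<in> carrier (completion M F). x n = \<zero>\<^bsub>M Quot F n\<^esub>}"

text \<open>
  The map \<open>completion M F \<rightarrow> N\<close> induced by a filtered map \<open>f : M \<rightarrow> N\<close> into a complete \<open>(N, G)\<close>: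
  the image of \<open>x\<close> is the unique \<open>y\<close> with the same class as \<open>f (x n)\<close> in \<open>N/G\<^sub>n\<close>, for all \<open>n\<close>.
\<close>

definition hat_map :: "('n, 'c) ring_scheme \<Rightarrow> (nat \<Rightarrow> 'n set) \<Rightarrow> ('m \<Rightarrow> 'n) \<Rightarrow> (nat \<Rightarrow> 'm set) \<Rightarrow> 'n"
  where "hat_map N G f x = (THE y. y \<in> carrier N \<and> (\<forall>n. f ` x n \<subseteq> G n +>\<^bsub>N\<^esub> y))"

definition gr :: "('m, 'c) ring_scheme \<Rightarrow> (nat \<Rightarrow> 'm set) \<Rightarrow> (nat \<Rightarrow> 'm set) monoid"
  where "gr M F = sum_group UNIV (\<lambda>n. add_monoid (M\<lparr>carrier := F n\<rparr>) Mod F (Suc n))"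

definition gr_map :: "('n, 'c) ring_scheme \<Rightarrow> (nat \<Rightarrow> 'n set) \<Rightarrow> ('m \<Rightarrow> 'n)
    \<Rightarrow> (nat \<Rightarrow> 'm set) \<Rightarrow> nat \<Rightarrow> 'n set"
  where "gr_map N G f x = (\<lambda>n. the_elem ((\<lambda>a. G (Suc n) +>\<^bsub>N\<^esub> f a) ` x n))"

definition filtered_iso :: "('m, 'c) ring_scheme \<Rightarrow> (nat \<Rightarrow> 'm set) \<Rightarrow> ('n, 'd) ring_scheme
    \<Rightarrow> (nat \<Rightarrow> 'n set) \<Rightarrow> ('m \<Rightarrow> 'n) \<Rightarrow> bool"
  where "filtered_iso M F N G f \<longleftrightarrow> bij_betw f (carrier M) (carrier N) \<and>
    (\<forall>n. f ` F n \<subseteq> G n) \<and> (\<forall>n. inv_into (carrier M) f ` G n \<subseteq> F n)"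

definition linear_topology :: "('m, 'c) ring_scheme \<Rightarrow> (nat \<Rightarrow> 'm set) \<Rightarrow> 'm topology"
  where "linear_topology M F =
    topology (\<lambda>S. S \<subseteq> carrier M \<and> (\<forall>x\<in>S. \<exists>n. F n +>\<^bsub>M\<^esub> x \<subseteq> S))"

definition all_equivalent :: "bool list \<Rightarrow> bool"
  where "all_equivalent Ps \<longleftrightarrow> (\<forall>P\<in>set Ps. \<forall>Q\<in>set Ps. P \<longleftrightarrow> Q)"

end

theory Submission
  imports Defs
begin

text \<open>
  Both groups of equivalences hold for any filtered homomorphism \<open>f : (M, F) \<rightarrow> (N, G)\<close> into a
  complete separated filtered abelian group.  By successive approximation each of (a)--(e) says that
  \<open>gr f\<close> is surjective and \<open>F n = f\<^sup>-\<^sup>1 (G n)\<close> for all \<open>n\<close>, the latter being injectivity of \<open>gr f\<close>;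
  each of (f)--(h) says that every \<open>F n\<close> contains some \<open>f\<^sup>-\<^sup>1 (G m)\<close> and that the image of \<open>f\<close> is dense.
  If moreover \<open>G n \<subseteq> f (F n) + G m\<close> for all \<open>n\<close> and \<open>m\<close>, surjectivity of \<open>gr f\<close> and density are
  automatic and the two conditions on preimages coincide.  A filtered isomorphism induced by \<open>\<theta>\<close>
  provides this for \<open>f = \<zeta>\<close>: both maps are multiplicative and \<open>\<theta> (a' \<otimes> a)\<close> is a matrix coefficient of the
  unit module, so \<open>\<theta>\<close> maps each power of the kernel of the multiplication of \<open>A\<close> into the image under
  \<open>\<zeta>\<close> of the same power of the augmentation ideal.
\<close>

section \<open>Filtered abelian groups and their completions\<close>

text \<open>The obstacle is the finite dual: a quotient of a direct sum whose product is neither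
  associative nor unital, with operations on cosets that depend a priori on representatives. It is
  therefore studied through \<open>conv_algebra H\<close>. A map \<open>Z\<close> on the direct sum,
  which induces \<zeta>, is additive and multiplicative and kills the ideal of relations;
  injectivity of \<zeta> then turns equalities of images into equalities of classes, which gives the
  product of classes and its left distributivity. The counit becomes evaluation at 1. So does the
  multiplication of A under \<theta>, and this is why the two augmentation ideals correspond.
  Identities in tensor products are proved by checking additive maps on pure tensors. The price is
  that every nested lift must be shown balanced, and this is where the Takeuchi condition and the
  commutativity of A enter. On the abstract side, completions are handled by sequences with a fixed
  rate: the term of index n is correct modulo level n. Statements about degree n hence use the term
  of index n + 1. The same shift appears in U*, where level n + 1 annihilates
  \<open>F n\<close>.\<close>

lemma abelian_group_hom_intro:
  assumes "abelian_group G" "abelian_group H"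
    and "\<And>x. x \<in> carrier G \<Longrightarrow> h x \<in> carrier H"
    and "\<And>x y. \<lbrakk>x \<in> carrier G; y \<in> carrier G\<rbrakk> \<Longrightarrow> h (x \<oplus>\<^bsub>G\<^esub> y) = h x \<oplus>\<^bsub>H\<^esub> h y"
  shows "abelian_group_hom G H h"
proof -
  interpret G: abelian_group G by fact
  interpret H: abelian_group H by fact
  show ?thesis
    by (rule abelian_group_homI)
      (auto simp: group_hom_def group_hom_axioms_def hom_def assms G.a_group H.a_group)
qed

lemma abelian_group_hom_add:
  assumes "abelian_group_hom G G' h" "abelian_group_hom G G' h'"
  shows "abelian_group_hom G G' (\<lambda>t. h t \<oplus>\<^bsub>G'\<^esub> h' t)"
proof -
  interpret h: abelian_group_hom G G' h by fact
  interpret h': abelian_group_hom G G' h' by fact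
  show ?thesis
    by (intro abelian_group_hom_intro h.G.abelian_group_axioms h.H.abelian_group_axioms)
      (simp_all add: h.H.a_ac)
qed

lemma abelian_group_hom_comp:
  assumes "abelian_group_hom G G' h" "abelian_group_hom G' G'' h'"
  shows "abelian_group_hom G G'' (\<lambda>x. h' (h x))"
proof -
  interpret h: abelian_group_hom G G' h by fact
  interpret h': abelian_group_hom G' G'' h' by fact
  show ?thesis
    by (intro abelian_group_hom_intro h.G.abelian_group_axioms h'.H.abelian_group_axioms) simp_all
qed

section \<open>Differences and cosets in abelian groups\<close>

context abelian_group begin

lemma diff_add_diff:
  assumes "x \<in> carrier G" "y \<in> carrier G" "x' \<in> carrier G" "y' \<in> carrier G"
  shows "(x \<oplus> y) \<ominus> (x' \<oplus> y') = (x \<ominus> x') \<oplus> (y \<ominus> y')"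
  using assms by (simp add: a_minus_def minus_add a_ac)

lemma diff_trans:
  assumes "x \<in> carrier G" "y \<in> carrier G" "z \<in> carrier G"
  shows "(x \<ominus> y) \<oplus> (y \<ominus> z) = x \<ominus> z"
  using assms by (simp add: a_minus_def a_assoc r_neg1)

lemma minus_diff:
  assumes "x \<in> carrier G" "y \<in> carrier G"
  shows "\<ominus> (x \<ominus> y) = y \<ominus> x"
  using assms by (simp add: a_minus_def minus_add a_ac)

lemma diff_neg_neg:
  assumes "x \<in> carrier G" "y \<in> carrier G"
  shows "\<ominus> x \<ominus> \<ominus> y = \<ominus> (x \<ominus> y)"
  using assms by (simp add: a_minus_def minus_add)

lemma diff_zero:
  assumes "x \<in> carrier G"
  shows "x \<ominus> \<zero> = x"
  using assms by (simp add: a_minus_def)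

lemma diff_self:
  assumes "x \<in> carrier G"
  shows "x \<ominus> x = \<zero>"
  using assms by (simp add: a_minus_def r_neg)

lemma diff_add_cancel:
  assumes "x \<in> carrier G" "y \<in> carrier G"
  shows "(x \<ominus> y) \<oplus> y = x"
  using assms by (simp add: a_minus_def a_assoc l_neg)

lemma add_diff_cancel:
  assumes "x \<in> carrier G" "y \<in> carrier G"
  shows "(x \<oplus> y) \<ominus> y = x"
  using assms by (simp add: a_minus_def a_assoc r_neg)

lemma diff_eq_zero_iff:
  assumes "x \<in> carrier G" "y \<in> carrier G"
  shows "x \<ominus> y = \<zero> \<longleftrightarrow> x = y"
  using assms by (metis diff_add_cancel diff_self l_zero)

lemma diff_in_subgroup_trans:
  assumes "additive_subgroup H G" "x \<ominus> y \<in> H" "y \<ominus> z \<in> H"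
    and "x \<in> carrier G" "y \<in> carrier G" "z \<in> carrier G"
  shows "x \<ominus> z \<in> H"
  using additive_subgroup.a_closed[OF assms(1-3)] diff_trans assms by simp

lemma diff_in_subgroup_sym:
  assumes "additive_subgroup H G" "x \<ominus> y \<in> H" "x \<in> carrier G" "y \<in> carrier G"
  shows "y \<ominus> x \<in> H"
  using additive_subgroup.a_inv_closed[OF assms(1,2)] minus_diff assms by simp

lemma coset_eq_diff:
  assumes "additive_subgroup H G" "x \<in> carrier G"
  shows "H +> x = {y \<in> carrier G. y \<ominus> x \<in> H}"
proof -
  interpret additive_subgroup H G by fact
  have "abelian_subgroup H G" using abelian_subgroupI3 assms abelian_group_axioms by blast
  then interpret abelian_subgroup H G .
  show ?thesis
    using a_rcos_module[OF assms(2)] a_elemrcos_carrier[OF assms(2)]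
    unfolding a_minus_def by blast
qed

lemma coset_eq_iff:
  assumes "additive_subgroup H G" "x \<in> carrier G" "y \<in> carrier G"
  shows "H +> x = H +> y \<longleftrightarrow> x \<ominus> y \<in> H"
proof -
  interpret additive_subgroup H G by fact
  have "abelian_subgroup H G" using abelian_subgroupI3 assms abelian_group_axioms by blast
  then interpret abelian_subgroup H G .
  show ?thesis
    using a_repr_independence'[of x y] a_rcos_self[OF assms(2)] coset_eq_diff[OF assms(1,3)] assms(2,3)
      a_repr_independence'[of y x] by auto
qed

lemma additive_subgroup_intro:
  assumes "H \<subseteq> carrier G" "\<zero> \<in> H" "\<And>x y. \<lbrakk>x \<in> H; y \<in> H\<rbrakk> \<Longrightarrow> x \<oplus> y \<in> H"
    and "\<And>x. x \<in> H \<Longrightarrow> \<ominus> x \<in> H"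
  shows "additive_subgroup H G"
  using assms by (auto intro!: additive_subgroupI add.subgroupI simp: a_inv_def)

end

context abelian_group_hom begin

lemma hom_minus:
  assumes "x \<in> carrier G" "y \<in> carrier G"
  shows "h (x \<ominus>\<^bsub>G\<^esub> y) = h x \<ominus>\<^bsub>H\<^esub> h y"
  using assms by (simp add: a_minus_def)

end

lemma (in abelian_group_hom) hom_finsum:
  assumes "finite S" "f \<in> S \<rightarrow> carrier G"
  shows "h (finsum G f S) = finsum H (\<lambda>i. h (f i)) S"
  using assms
proof (induction S rule: finite_induct)
  case (insert i S)
  then have "f i \<in> carrier G" "f \<in> S \<rightarrow> carrier G" by auto
  moreover have "(\<lambda>i. h (f i)) \<in> S \<rightarrow> carrier H" using calculation by (auto simp: Pi_def)
  ultimately show ?case using insert by simp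
qed simp

lemma (in abelian_group) finsum_Times:
  assumes I: "finite I" and J: "finite J" and f: "f \<in> I \<times> J \<rightarrow> carrier G"
  shows "(\<Oplus>i\<in>I. \<Oplus>j\<in>J. f (i, j)) = finsum G f (I \<times> J)"
  using I f
proof (induction I rule: finite_induct)
  case (insert i I)
  have f1: "f \<in> {i} \<times> J \<rightarrow> carrier G" and f2: "f \<in> I \<times> J \<rightarrow> carrier G" using insert.prems by auto
  have "finsum G f (insert i I \<times> J) = finsum G f ({i} \<times> J \<union> I \<times> J)" by (simp add: insert_Times_insert Sigma_Un_distrib1[symmetric])
  also have "\<dots> = finsum G f ({i} \<times> J) \<oplus> finsum G f (I \<times> J)"
    using insert.hyps J f1 f2 by (intro finsum_Un_disjoint) auto
  also have "finsum G f ({i} \<times> J) = (\<Oplus>j\<in>J. f (i, j))"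
  proof -
    have "inj_on (Pair i) J" by (rule inj_onI) simp
    moreover have "{i} \<times> J = Pair i ` J" by auto
    ultimately show ?thesis using finsum_reindex[of f "Pair i" J] f1 by simp
  qed
  also have "finsum G f (I \<times> J) = (\<Oplus>i\<in>I. \<Oplus>j\<in>J. f (i, j))" using insert.IH[OF f2] by simp
  finally show ?case
    using insert.hyps f1 f2 J by (simp add: Pi_iff)
qed simp

section \<open>Filtered groups and representatives for elements of their completions\<close>

locale filtered_group = abelian_group M for M :: "('m, 'c) ring_scheme" (structure) +
  fixes F :: "nat \<Rightarrow> 'm set"
  assumes F_subgroup: "additive_subgroup (F n) M"
    and F_Suc: "F (Suc n) \<subseteq> F n"
    and F_0: "F 0 = carrier M"
begin

lemma F_mono: "n \<le> m \<Longrightarrow> F m \<subseteq> F n"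
  by (rule lift_Suc_antimono_le[of F]) (rule F_Suc)

lemma F_carr: "x \<in> F n \<Longrightarrow> x \<in> carrier M"
  using F_subgroup[of n] additive_subgroup.a_subset by blast

lemma F_zero: "\<zero> \<in> F n"
  by (rule additive_subgroup.zero_closed[OF F_subgroup])

lemma F_add: "\<lbrakk>x \<in> F n; y \<in> F n\<rbrakk> \<Longrightarrow> x \<oplus> y \<in> F n"
  by (rule additive_subgroup.a_closed[OF F_subgroup])

lemma F_neg: "x \<in> F n \<Longrightarrow> \<ominus> x \<in> F n"
  by (rule additive_subgroup.a_inv_closed[OF F_subgroup])

lemma F_diff: "\<lbrakk>x \<in> F n; y \<in> F n\<rbrakk> \<Longrightarrow> x \<ominus> y \<in> F n"
  using F_add F_neg by (simp add: a_minus_def)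

lemma F_trans: "\<lbrakk>x \<ominus> y \<in> F n; y \<ominus> z \<in> F n; x \<in> carrier M; y \<in> carrier M; z \<in> carrier M\<rbrakk>
    \<Longrightarrow> x \<ominus> z \<in> F n"
  by (rule diff_in_subgroup_trans[OF F_subgroup])

lemma F_sym: "\<lbrakk>x \<ominus> y \<in> F n; x \<in> carrier M; y \<in> carrier M\<rbrakk> \<Longrightarrow> y \<ominus> x \<in> F n"
  by (rule diff_in_subgroup_sym[OF F_subgroup])

lemma F_shift: "\<lbrakk>x \<ominus> y \<in> F n; y \<in> F n; x \<in> carrier M\<rbrakk> \<Longrightarrow> x \<in> F n"
  using F_add[of "x \<ominus> y" n y] diff_add_cancel[of x y] F_carr by simp

lemma F_shift': "\<lbrakk>x \<ominus> y \<in> F n; x \<in> F n; y \<in> carrier M\<rbrakk> \<Longrightarrow> y \<in> F n"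
  using F_sym F_shift F_carr by blast

lemma coset_F: "x \<in> carrier M \<Longrightarrow> F n +> x = {y \<in> carrier M. y \<ominus> x \<in> F n}"
  by (rule coset_eq_diff[OF F_subgroup])

lemma coset_F_eq: "\<lbrakk>x \<in> carrier M; y \<in> carrier M\<rbrakk> \<Longrightarrow> F n +> x = F n +> y \<longleftrightarrow> x \<ominus> y \<in> F n"
  by (rule coset_eq_iff[OF F_subgroup])

lemma coset_F_zero: "F n +> \<zero> = F n"
  using F_subgroup[of n] by (simp add: additive_subgroup.a_subset)

text \<open>The rate is built in: the term of index n already determines the class modulo
  \<open>F n\<close>. These are exactly the systems of representatives of compatible coset
  sequences.\<close>

definition cauchy :: "(nat \<Rightarrow> 'm) \<Rightarrow> bool"
  where "cauchy a \<longleftrightarrow> (\<forall>n. a n \<in> carrier M) \<and> (\<forall>n m. n \<le> m \<longrightarrow> a m \<ominus> a n \<in> F n)"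

definition cls :: "(nat \<Rightarrow> 'm) \<Rightarrow> nat \<Rightarrow> 'm set"
  where "cls a = (\<lambda>n. F n +> a n)"

lemma cauchyD: "cauchy a \<Longrightarrow> n \<le> m \<Longrightarrow> a m \<ominus> a n \<in> F n"
  by (simp add: cauchy_def)

lemma cauchy_carr: "cauchy a \<Longrightarrow> a n \<in> carrier M"
  by (simp add: cauchy_def)

text \<open>Choose a representative in every coset: since the coset at m lies inside the one at n,
  the two representatives differ by an element of \<open>F n\<close>. All later work on completions
  uses such sequences instead of cosets.\<close>

lemma carrier_completion: "carrier (completion M F) = cls ` {a. cauchy a}"
proof (intro equalityI subsetI)
  fix x assume x: "x \<in> carrier (completion M F)"
  then have "\<forall>n. \<exists>a. a \<in> carrier M \<and> x n = F n +> a"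
    by (fastforce simp: completion_def FactRing_def A_RCOSETS_def')
  then obtain a where a: "\<And>n. a n \<in> carrier M" "\<And>n. x n = F n +> a n" by metis
  have "a m \<ominus> a n \<in> F n" if "n \<le> m" for n m
  proof -
    have "x m \<subseteq> x n" using x that by (simp add: completion_def)
    moreover have "a m \<in> x m" using a coset_F F_zero by (simp add: diff_self)
    ultimately show ?thesis using a coset_F by auto
  qed
  then have "cauchy a" using a by (simp add: cauchy_def)
  moreover have "x = cls a" using a by (auto simp: cls_def)
  ultimately show "x \<in> cls ` {a. cauchy a}" by blast
next
  fix x assume "x \<in> cls ` {a. cauchy a}"
  then obtain a where a: "cauchy a" "x = cls a" by auto
  have "F m +> a m \<subseteq> F n +> a n" if "n \<le> m" for n m
    using that a(1) F_mono[OF that] F_trans[of _ "a m" n "a n"]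
    by (auto simp: coset_F cauchy_def)
  then show "x \<in> carrier (completion M F)"
    using a cauchy_carr by (auto simp: completion_def FactRing_def A_RCOSETS_def' cls_def)
qed

lemma completion_cases:
  assumes "x \<in> carrier (completion M F)"
  obtains a where "cauchy a" "x = cls a"
  using assms carrier_completion by auto

lemma cls_closed: "cauchy a \<Longrightarrow> cls a \<in> carrier (completion M F)"
  using carrier_completion by auto

lemma cls_eq_iff: "\<lbrakk>cauchy a; cauchy b\<rbrakk> \<Longrightarrow> cls a = cls b \<longleftrightarrow> (\<forall>n. a n \<ominus> b n \<in> F n)"
  using coset_F_eq cauchy_carr by (auto simp: cls_def fun_eq_iff)

lemma cauchy_const: "x \<in> carrier M \<Longrightarrow> cauchy (\<lambda>_. x)"
  using F_zero by (auto simp: cauchy_def diff_self)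

lemma cauchy_add: "\<lbrakk>cauchy a; cauchy b\<rbrakk> \<Longrightarrow> cauchy (\<lambda>n. a n \<oplus> b n)"
  using F_add by (auto simp: cauchy_def diff_add_diff)

lemma cauchy_neg: "cauchy a \<Longrightarrow> cauchy (\<lambda>n. \<ominus> a n)"
  using F_neg by (auto simp: cauchy_def diff_neg_neg)

lemma cls_add: "\<lbrakk>cauchy a; cauchy b\<rbrakk> \<Longrightarrow>
    cls a \<oplus>\<^bsub>completion M F\<^esub> cls b = cls (\<lambda>n. a n \<oplus> b n)"
  using abelian_subgroup.a_rcos_sum[OF abelian_subgroupI3[OF F_subgroup abelian_group_axioms]] cauchy_carr
  by (auto simp: completion_def FactRing_def cls_def fun_eq_iff)

lemma cls_zero: "\<zero>\<^bsub>completion M F\<^esub> = cls (\<lambda>_. \<zero>)"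
  by (auto simp: completion_def FactRing_def cls_def fun_eq_iff coset_F_zero)

lemma abelian_group_completion: "abelian_group (completion M F)"
proof (rule abelian_groupI)
  fix x y assume "x \<in> carrier (completion M F)" "y \<in> carrier (completion M F)"
  then obtain a b where "cauchy a" "x = cls a" "cauchy b" "y = cls b"
    by (elim completion_cases)
  then show "x \<oplus>\<^bsub>completion M F\<^esub> y \<in> carrier (completion M F)"
    by (simp add: cls_add cauchy_add cls_closed)
next
  show "\<zero>\<^bsub>completion M F\<^esub> \<in> carrier (completion M F)"
    by (simp add: cls_zero cls_closed cauchy_const)
next
  fix x y z
  assume xyz: "x \<in> carrier (completion M F)" "y \<in> carrier (completion M F)" "z \<in> carrier (completion M F)"
  obtain a b c where abc: "cauchy a" "x = cls a" "cauchy b" "y = cls b" "cauchy c" "z = cls c"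
    using xyz by (elim completion_cases)
  show "x \<oplus>\<^bsub>completion M F\<^esub> y \<oplus>\<^bsub>completion M F\<^esub> z = x \<oplus>\<^bsub>completion M F\<^esub> (y \<oplus>\<^bsub>completion M F\<^esub> z)"
    using abc by (simp add: cls_add cauchy_add cauchy_carr a_assoc)
  show "x \<oplus>\<^bsub>completion M F\<^esub> y = y \<oplus>\<^bsub>completion M F\<^esub> x"
    using abc by (simp add: cls_add cauchy_add cauchy_carr a_comm)
  show "\<zero>\<^bsub>completion M F\<^esub> \<oplus>\<^bsub>completion M F\<^esub> x = x"
    using abc by (simp add: cls_zero cls_add cauchy_const cauchy_carr)
  have "cls (\<lambda>n. \<ominus> a n) \<oplus>\<^bsub>completion M F\<^esub> x = \<zero>\<^bsub>completion M F\<^esub>"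
    using abc by (simp add: cls_zero cls_add cauchy_neg cauchy_carr l_neg)
  then show "\<exists>y\<in>carrier (completion M F). y \<oplus>\<^bsub>completion M F\<^esub> x = \<zero>\<^bsub>completion M F\<^esub>"
    using abc cls_closed cauchy_neg by blast
qed

lemma cls_neg: "cauchy a \<Longrightarrow> \<ominus>\<^bsub>completion M F\<^esub> cls a = cls (\<lambda>n. \<ominus> a n)"
  by (rule abelian_group.minus_equality[OF abelian_group_completion])
    (simp_all add: cls_zero cls_add cauchy_neg cauchy_carr l_neg cls_closed)

text \<open>A coset of \<open>F n\<close> is the zero class exactly when its representative lies in
  \<open>F n\<close>, so a level of the completion is decided by a single term of the
  sequence.\<close>

lemma cls_in_filtration: "cauchy a \<Longrightarrow> cls a \<in> completion_filtration M F n \<longleftrightarrow> a n \<in> F n"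
  using coset_F_eq[of "a n" "\<zero>" n] cauchy_carr cls_closed
  by (auto simp: completion_filtration_def FactRing_def cls_def coset_F_zero diff_zero)

lemma completion_filtration_subset: "completion_filtration M F n \<subseteq> carrier (completion M F)"
  by (auto simp: completion_filtration_def)

lemma filtered_group_completion: "filtered_group (completion M F) (completion_filtration M F)"
proof -
  interpret C: abelian_group "completion M F" by (rule abelian_group_completion)
  show ?thesis
  proof (intro filtered_group.intro filtered_group_axioms.intro abelian_group_completion)
    fix n
    show "additive_subgroup (completion_filtration M F n) (completion M F)"
    proof (rule C.additive_subgroup_intro)
      show "\<zero>\<^bsub>completion M F\<^esub> \<in> completion_filtration M F n"
        by (simp add: cls_zero cls_in_filtration cauchy_const F_zero)
      fix x assume x: "x \<in> completion_filtration M F n"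
      then obtain a where a: "cauchy a" "x = cls a"
        using completion_cases completion_filtration_subset by blast
      show "\<ominus>\<^bsub>completion M F\<^esub> x \<in> completion_filtration M F n"
        using a x by (simp add: cls_neg cls_in_filtration cauchy_neg F_neg)
      fix y assume y: "y \<in> completion_filtration M F n"
      then obtain b where b: "cauchy b" "y = cls b"
        using completion_cases completion_filtration_subset by blast
      show "x \<oplus>\<^bsub>completion M F\<^esub> y \<in> completion_filtration M F n"
        using a b x y by (simp add: cls_add cls_in_filtration cauchy_add F_add)
    qed (rule completion_filtration_subset)
    show "completion_filtration M F (Suc n) \<subseteq> completion_filtration M F n"
    proof
      fix x assume x: "x \<in> completion_filtration M F (Suc n)"
      then obtain a where a: "cauchy a" "x = cls a"
        using completion_cases completion_filtration_subset by blast
      \<comment> \<open>The hypothesis concerns the term of index \<open>Suc n\<close>, the claim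
        the term of index n; the Cauchy condition passes between them modulo
        \<open>F n\<close>.\<close>
      then have "a (Suc n) \<in> F n" using x cls_in_filtration F_Suc by auto
      then have "a n \<in> F n"
        using F_shift'[of "a (Suc n)" "a n" n] cauchyD[OF a(1), of n "Suc n"] cauchy_carr[OF a(1)] by simp
      then show "x \<in> completion_filtration M F n" using a cls_in_filtration by simp
    qed
    show "completion_filtration M F 0 = carrier (completion M F)"
      by (auto simp: cls_in_filtration F_0 cauchy_carr completion_filtration_subset[THEN subsetD] elim!: completion_cases)
  qed
qed

end

text \<open>Completeness includes the rate at which the limit is approached. Separatedness makes the
  limit unique, so that the definite description in \<open>hat_map\<close> denotes.\<close>

locale complete_filtered_group = filtered_group +
  assumes complete: "cauchy a \<Longrightarrow> \<exists>y\<in>carrier M. \<forall>n. a n \<ominus> y \<in> F n"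
    and separated: "\<lbrakk>x \<in> carrier M; \<And>n. x \<in> F n\<rbrakk> \<Longrightarrow> x = \<zero>"

locale filtered_hom = M: filtered_group M F + N: filtered_group N G + abelian_group_hom M N f
  for M :: "('m, 'c) ring_scheme" (structure) and F :: "nat \<Rightarrow> 'm set"
    and N :: "('n, 'd) ring_scheme" and G :: "nat \<Rightarrow> 'n set" and f :: "'m \<Rightarrow> 'n" +
  assumes filtered: "x \<in> F n \<Longrightarrow> f x \<in> G n"
begin

text \<open>The elementwise, degree by degree form; \<open>gr_map_surj_iff\<close> identifies it
  with surjectivity on the direct sums. It can be compared between a map and its completion without
  touching cosets.\<close>

definition gr_surjective :: bool
  where "gr_surjective \<longleftrightarrow> (\<forall>n. \<forall>y\<in>G n. \<exists>x\<in>F n. f x \<ominus>\<^bsub>N\<^esub> y \<in> G (Suc n))"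

definition gr_injective :: bool
  where "gr_injective \<longleftrightarrow> (\<forall>n. \<forall>x\<in>F n. f x \<in> G (Suc n) \<longrightarrow> x \<in> F (Suc n))"

text \<open>An element whose image lies in \<open>G n\<close> starts in \<open>F 0\<close>, the
  whole group, and climbs one level at a time, each step being injectivity in one degree.\<close>

lemma gr_injective_iff: "gr_injective \<longleftrightarrow> (\<forall>n. F n = {x \<in> carrier M. f x \<in> G n})"
proof
  assume I: gr_injective
  have "x \<in> F n" if "x \<in> carrier M" "f x \<in> G n" for n x
    using that
  proof (induction n)
    case 0 then show ?case by (simp add: M.F_0)
  next
    case (Suc n) then show ?case using I N.F_Suc by (auto simp: gr_injective_def)
  qed
  then show "\<forall>n. F n = {x \<in> carrier M. f x \<in> G n}" using filtered M.F_carr by blast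
next
  assume "\<forall>n. F n = {x \<in> carrier M. f x \<in> G n}"
  then show gr_injective unfolding gr_injective_def by blast
qed

end

section \<open>The associated graded group and the maps induced on it\<close>

context filtered_group begin

lemma comm_group_gr_component: "comm_group (add_monoid (M\<lparr>carrier := F n\<rparr>) Mod F (Suc n))"
proof -
  interpret S: additive_subgroup "F n" M by (rule F_subgroup)
  have sub: "abelian_group (M\<lparr>carrier := F n\<rparr>)"
  proof (rule abelian_groupI)
    show "\<exists>y\<in>carrier (M\<lparr>carrier := F n\<rparr>). y \<oplus>\<^bsub>M\<lparr>carrier := F n\<rparr>\<^esub> x = \<zero>\<^bsub>M\<lparr>carrier := F n\<rparr>\<^esub>"
      if "x \<in> carrier (M\<lparr>carrier := F n\<rparr>)" for x
      using that F_neg F_carr l_neg by (auto intro!: bexI[of _ "\<ominus> x"])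
  qed (use F_add F_zero F_carr in \<open>auto intro: a_assoc a_comm\<close>)
  then interpret A: abelian_group "M\<lparr>carrier := F n\<rparr>" .
  have "additive_subgroup (F (Suc n)) (M\<lparr>carrier := F n\<rparr>)"
  proof (rule A.additive_subgroup_intro)
    show "\<ominus>\<^bsub>M\<lparr>carrier := F n\<rparr>\<^esub> x \<in> F (Suc n)" if "x \<in> F (Suc n)" for x
    proof -
      \<comment> \<open>Inverses are defined relative to the carrier, so the inverse in the
        restricted group must first be identified with the one in M.\<close>
      have "\<ominus>\<^bsub>M\<lparr>carrier := F n\<rparr>\<^esub> x = \<ominus> x"
        by (rule A.minus_equality) (use that F_Suc F_neg F_carr in \<open>auto simp: l_neg\<close>)
      then show ?thesis using that F_neg by simp
    qed
  qed (use F_add F_zero F_Suc in auto)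
  then have "abelian_subgroup (F (Suc n)) (M\<lparr>carrier := F n\<rparr>)"
    using abelian_subgroupI3 sub by blast
  then show ?thesis
    using abelian_subgroup.a_factorgroup_is_comm_group unfolding A_FactGroup_def by blast
qed

text \<open>A coset of \<open>F (Suc n)\<close> is zero exactly when its representative lies there,
  so finite support becomes a condition on one representative per degree.\<close>

lemma carrier_gr: "carrier (gr M F) =
    {x. \<exists>a. (\<forall>n. a n \<in> F n) \<and> (\<forall>n. x n = F (Suc n) +> a n) \<and> finite {n. a n \<notin> F (Suc n)}}"
proof -
  have c: "carrier (add_monoid (M\<lparr>carrier := F n\<rparr>) Mod F (Suc n)) = (\<lambda>a. F (Suc n) +> a) ` F n" for n
    by (auto simp: FactGroup_def RCOSETS_def a_r_coset_def r_coset_def)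
  have e: "F (Suc n) +> a = F (Suc n) \<longleftrightarrow> a \<in> F (Suc n)" if "a \<in> F n" for a n
    using coset_F_eq[of a \<zero> "Suc n"] F_carr[OF that] by (simp add: coset_F_zero diff_zero)
  have "carrier (gr M F) = {x. (\<forall>n. x n \<in> (\<lambda>a. F (Suc n) +> a) ` F n) \<and> finite {n. x n \<noteq> F (Suc n)}}"
  proof -
    have g: "group (add_monoid (M\<lparr>carrier := F n\<rparr>) Mod F (Suc n))" for n
      using comm_group_gr_component comm_group.axioms(2) by blast
    have o: "\<one>\<^bsub>add_monoid (M\<lparr>carrier := F n\<rparr>) Mod F (Suc n)\<^esub> = F (Suc n)" for n
      by (simp add: FactGroup_def)
    show ?thesis
      unfolding gr_def carrier_sum_group[OF g] c o by (simp add: PiE_def Pi_def)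
  qed
  also have "\<dots> = {x. \<exists>a. (\<forall>n. a n \<in> F n) \<and> (\<forall>n. x n = F (Suc n) +> a n) \<and> finite {n. a n \<notin> F (Suc n)}}"
    (is "?L = ?R")
  proof (intro equalityI subsetI)
    fix x assume x: "x \<in> ?L"
    then have "\<forall>n. \<exists>a. a \<in> F n \<and> x n = F (Suc n) +> a" by blast
    then obtain a where a: "\<And>n. a n \<in> F n" "\<And>n. x n = F (Suc n) +> a n" by metis
    then have "finite {n. a n \<notin> F (Suc n)}" using x e by simp
    then show "x \<in> ?R" using a by blast
  next
    fix x assume "x \<in> ?R"
    then obtain a where a: "\<And>n. a n \<in> F n" "\<And>n. x n = F (Suc n) +> a n" "finite {n. a n \<notin> F (Suc n)}"
      by blast
    then have "finite {n. x n \<noteq> F (Suc n)}" using e by simp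
    then show "x \<in> ?L" using a by blast
  qed
  finally show ?thesis .
qed

lemma mult_gr: "x \<otimes>\<^bsub>gr M F\<^esub> y = (\<lambda>n. x n <+>\<^bsub>M\<^esub> y n)"
  by (simp add: gr_def FactGroup_def set_add_def set_mult_def restrict_UNIV)

lemma gr_coset_add: "\<lbrakk>x \<in> carrier M; y \<in> carrier M\<rbrakk> \<Longrightarrow> (F n +> x) <+> (F n +> y) = F n +> (x \<oplus> y)"
  using abelian_subgroup.a_rcos_sum[OF abelian_subgroupI3[OF F_subgroup abelian_group_axioms]] .

end

context filtered_hom begin

text \<open>Since f sends \<open>F (Suc n)\<close> into \<open>G (Suc n)\<close>, all elements of
  one coset have the same image class, so the set under \<open>the_elem\<close> in
  \<open>gr_map\<close> is a singleton.\<close>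

lemma gr_map_apply:
  assumes "\<And>n. a n \<in> F n"
  shows "gr_map N G f (\<lambda>n. F (Suc n) +> a n) = (\<lambda>n. G (Suc n) +>\<^bsub>N\<^esub> f (a n))"
proof
  fix n
  have "G (Suc n) +>\<^bsub>N\<^esub> f b = G (Suc n) +>\<^bsub>N\<^esub> f (a n)" if "b \<in> F (Suc n) +> a n" for b
  proof -
    have b: "b \<in> carrier M" "b \<ominus> a n \<in> F (Suc n)"
      using that M.coset_F[OF M.F_carr[OF assms]] by auto
    then have "f b \<ominus>\<^bsub>N\<^esub> f (a n) \<in> G (Suc n)"
      using filtered[OF b(2)] hom_minus[OF b(1) M.F_carr[OF assms]] by simp
    then show ?thesis using N.coset_F_eq b(1) M.F_carr[OF assms] by simp
  qed
  moreover have "a n \<in> F (Suc n) +> a n"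
    using M.coset_F[OF M.F_carr[OF assms]] M.F_carr[OF assms] M.F_zero by (simp add: M.diff_self)
  ultimately have "(\<lambda>b. G (Suc n) +>\<^bsub>N\<^esub> f b) ` (F (Suc n) +> a n) = {G (Suc n) +>\<^bsub>N\<^esub> f (a n)}"
    by blast
  then show "gr_map N G f (\<lambda>n. F (Suc n) +> a n) n = G (Suc n) +>\<^bsub>N\<^esub> f (a n)"
    by (simp add: gr_map_def)
qed

lemma gr_cases:
  assumes "x \<in> carrier (gr M F)"
  obtains a where "\<And>n. a n \<in> F n" "x = (\<lambda>n. F (Suc n) +> a n)" "finite {n. a n \<notin> F (Suc n)}"
proof -
  obtain a where a: "\<And>n. a n \<in> F n" "\<And>n. x n = F (Suc n) +> a n" "finite {n. a n \<notin> F (Suc n)}"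
    using assms M.carrier_gr by auto
  moreover have "x = (\<lambda>n. F (Suc n) +> a n)" using a(2) by (simp add: fun_eq_iff)
  ultimately show ?thesis using that by blast
qed

lemma gr_map_closed:
  assumes "x \<in> carrier (gr M F)"
  shows "gr_map N G f x \<in> carrier (gr N G)"
proof -
  obtain a where a: "\<And>n. a n \<in> F n" "x = (\<lambda>n. F (Suc n) +> a n)" "finite {n. a n \<notin> F (Suc n)}"
    using gr_cases[OF assms] by blast
  have "finite {n. f (a n) \<notin> G (Suc n)}"
    by (rule finite_subset[OF _ a(3)]) (use filtered in auto)
  moreover have "f (a n) \<in> G n" for n by (rule filtered[OF a(1)])
  ultimately show ?thesis
    unfolding a(2) gr_map_apply[OF a(1)] N.carrier_gr by (auto intro!: exI[of _ "\<lambda>n. f (a n)"])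
qed

lemma gr_map_surj_iff:
  "gr_map N G f ` carrier (gr M F) = carrier (gr N G) \<longleftrightarrow> gr_surjective"
proof
  assume S: "gr_map N G f ` carrier (gr M F) = carrier (gr N G)"
  show gr_surjective unfolding gr_surjective_def
  proof (intro allI ballI)
    fix n y assume y: "y \<in> G n"
    \<comment> \<open>The homogeneous element of degree n with component y; its preimage solves the
      problem in that degree.\<close>
    define b where "b = (\<lambda>m. if m = n then y else \<zero>\<^bsub>N\<^esub>)"
    have b: "b m \<in> G m" for m using y N.F_zero by (simp add: b_def)
    have "finite {m. b m \<notin> G (Suc m)}"
      by (rule finite_subset[of _ "{n}"]) (use N.F_zero in \<open>auto simp: b_def\<close>)
    then have "(\<lambda>m. G (Suc m) +>\<^bsub>N\<^esub> b m) \<in> carrier (gr N G)" using b N.carrier_gr by blast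
    then obtain x where x: "x \<in> carrier (gr M F)" "gr_map N G f x = (\<lambda>m. G (Suc m) +>\<^bsub>N\<^esub> b m)"
      using S by (metis (no_types, lifting) image_iff)
    obtain a where a: "\<And>n. a n \<in> F n" "x = (\<lambda>n. F (Suc n) +> a n)" using gr_cases[OF x(1)] by blast
    have "G (Suc n) +>\<^bsub>N\<^esub> f (a n) = G (Suc n) +>\<^bsub>N\<^esub> b n"
      using x(2) gr_map_apply[OF a(1)] a(2) by (simp add: fun_eq_iff)
    then have "f (a n) \<ominus>\<^bsub>N\<^esub> y \<in> G (Suc n)"
      using N.coset_F_eq[OF hom_closed[OF M.F_carr[OF a(1)]] N.F_carr[OF y]] by (simp add: b_def)
    then show "\<exists>x\<in>F n. f x \<ominus>\<^bsub>N\<^esub> y \<in> G (Suc n)" using a(1) by blast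
  qed
next
  assume S: gr_surjective
  show "gr_map N G f ` carrier (gr M F) = carrier (gr N G)"
  proof (intro equalityI subsetI)
    fix y assume "y \<in> carrier (gr N G)"
    then obtain b where b: "\<And>n. b n \<in> G n" "\<And>n. y n = G (Suc n) +>\<^bsub>N\<^esub> b n" "finite {n. b n \<notin> G (Suc n)}"
      using N.carrier_gr by auto
    \<comment> \<open>The lift is required to be zero wherever the class of \<open>b n\<close>
      vanishes; otherwise the chosen family might have infinite support and not lie in the direct
      sum.\<close>
    have "\<forall>n. \<exists>x. x \<in> F n \<and> f x \<ominus>\<^bsub>N\<^esub> b n \<in> G (Suc n) \<and> (b n \<in> G (Suc n) \<longrightarrow> x = \<zero>)"
    proof
      fix n
      show "\<exists>x. x \<in> F n \<and> f x \<ominus>\<^bsub>N\<^esub> b n \<in> G (Suc n) \<and> (b n \<in> G (Suc n) \<longrightarrow> x = \<zero>)"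
      proof (cases "b n \<in> G (Suc n)")
        case True
        then have "f \<zero> \<ominus>\<^bsub>N\<^esub> b n \<in> G (Suc n)" using N.F_zero N.F_diff by simp
        then show ?thesis using M.F_zero by blast
      next
        case False then show ?thesis using S b(1)[of n] unfolding gr_surjective_def by blast
      qed
    qed
    then obtain a where a: "\<And>n. a n \<in> F n" "\<And>n. f (a n) \<ominus>\<^bsub>N\<^esub> b n \<in> G (Suc n)"
      "\<And>n. b n \<in> G (Suc n) \<longrightarrow> a n = \<zero>" by metis
    have "finite {n. a n \<notin> F (Suc n)}"
      by (rule finite_subset[OF _ b(3)]) (use a(3) M.F_zero in auto)
    then have "(\<lambda>n. F (Suc n) +> a n) \<in> carrier (gr M F)" using a(1) M.carrier_gr by blast
    moreover have "y = gr_map N G f (\<lambda>n. F (Suc n) +> a n)"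
      unfolding gr_map_apply[OF a(1)]
    proof
      fix n
      show "y n = G (Suc n) +>\<^bsub>N\<^esub> f (a n)"
        using N.coset_F_eq[OF hom_closed[OF M.F_carr[OF a(1)]] N.F_carr[OF b(1)]] a(2) b(2) by metis
    qed
    ultimately show "y \<in> gr_map N G f ` carrier (gr M F)" by blast
  qed (use gr_map_closed in auto)
qed

lemma gr_map_hom: "gr_map N G f \<in> hom (gr M F) (gr N G)"
proof (rule homI)
  fix x y assume xy: "x \<in> carrier (gr M F)" "y \<in> carrier (gr M F)"
  obtain a where a: "\<And>n. a n \<in> F n" "x = (\<lambda>n. F (Suc n) +> a n)" using gr_cases[OF xy(1)] by blast
  obtain b where b: "\<And>n. b n \<in> F n" "y = (\<lambda>n. F (Suc n) +> b n)" using gr_cases[OF xy(2)] by blast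
  have ab: "\<And>n. a n \<oplus> b n \<in> F n" by (rule M.F_add[OF a(1) b(1)])
  have "x \<otimes>\<^bsub>gr M F\<^esub> y = (\<lambda>n. F (Suc n) +> (a n \<oplus> b n))"
    using a b M.F_carr[OF a(1)] M.F_carr[OF b(1)] by (simp add: M.mult_gr M.gr_coset_add)
  then show "gr_map N G f (x \<otimes>\<^bsub>gr M F\<^esub> y) = gr_map N G f x \<otimes>\<^bsub>gr N G\<^esub> gr_map N G f y"
    using a(2) b(2) gr_map_apply[OF a(1)] gr_map_apply[OF b(1)] gr_map_apply[OF ab] M.F_carr[OF a(1)] M.F_carr[OF b(1)]
    by (simp add: N.mult_gr N.gr_coset_add)
qed (rule gr_map_closed)

lemma gr_map_inj_iff:
  "inj_on (gr_map N G f) (carrier (gr M F)) \<longleftrightarrow> gr_injective"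
proof
  assume I: "inj_on (gr_map N G f) (carrier (gr M F))"
  show gr_injective unfolding gr_injective_def
  proof (intro allI ballI impI)
    fix n x assume x: "x \<in> F n" "f x \<in> G (Suc n)"
    define a where "a = (\<lambda>m. if m = n then x else \<zero>)"
    have a: "\<And>m. a m \<in> F m" using x M.F_zero by (simp add: a_def)
    have z: "\<And>m. \<zero> \<in> F m" by (rule M.F_zero)
    have "finite {m. a m \<notin> F (Suc m)}"
      by (rule finite_subset[of _ "{n}"]) (use M.F_zero in \<open>auto simp: a_def\<close>)
    then have "(\<lambda>m. F (Suc m) +> a m) \<in> carrier (gr M F)" using a M.carrier_gr by blast
    moreover have "(\<lambda>m. F (Suc m) +> \<zero>) \<in> carrier (gr M F)"
      unfolding M.carrier_gr using z by (auto intro!: exI[of _ "\<lambda>_. \<zero>"])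
    moreover have "gr_map N G f (\<lambda>m. F (Suc m) +> a m) = gr_map N G f (\<lambda>m. F (Suc m) +> \<zero>)"
      unfolding gr_map_apply[OF a] gr_map_apply[OF z]
    proof
      fix m
      show "G (Suc m) +>\<^bsub>N\<^esub> f (a m) = G (Suc m) +>\<^bsub>N\<^esub> f \<zero>"
        using N.coset_F_eq[of "f x" "f \<zero>" "Suc n"] x M.F_carr[OF x(1)]
        by (auto simp: a_def N.diff_zero)
    qed
    ultimately have "(\<lambda>m. F (Suc m) +> a m) = (\<lambda>m. F (Suc m) +> \<zero>)" using I by (auto dest: inj_onD)
    then have "F (Suc n) +> a n = F (Suc n) +> \<zero>" by (rule fun_cong)
    then have "F (Suc n) +> x = F (Suc n) +> \<zero>" by (simp add: a_def)
    then show "x \<in> F (Suc n)" using M.coset_F_eq[of x \<zero>] M.F_carr[OF x(1)] by (simp add: M.diff_zero)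
  qed
next
  assume I: gr_injective
  show "inj_on (gr_map N G f) (carrier (gr M F))"
  proof (rule inj_onI)
    fix x y assume xy: "x \<in> carrier (gr M F)" "y \<in> carrier (gr M F)" "gr_map N G f x = gr_map N G f y"
    obtain a where a: "\<And>n. a n \<in> F n" "x = (\<lambda>n. F (Suc n) +> a n)" using gr_cases[OF xy(1)] by blast
    obtain b where b: "\<And>n. b n \<in> F n" "y = (\<lambda>n. F (Suc n) +> b n)" using gr_cases[OF xy(2)] by blast
    show "x = y" unfolding a(2) b(2)
    proof
      fix n
      have ab: "a n \<in> carrier M" "b n \<in> carrier M" using a b M.F_carr by blast+
      have "G (Suc n) +>\<^bsub>N\<^esub> f (a n) = G (Suc n) +>\<^bsub>N\<^esub> f (b n)"
        using xy(3) a(2) b(2) gr_map_apply[OF a(1)] gr_map_apply[OF b(1)] by (simp add: fun_eq_iff)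
      then have "f (a n \<ominus> b n) \<in> G (Suc n)" using N.coset_F_eq ab by (simp add: hom_minus)
      then have "a n \<ominus> b n \<in> F (Suc n)" using I M.F_diff[OF a(1) b(1)] by (auto simp: gr_injective_def)
      then show "F (Suc n) +> a n = F (Suc n) +> b n" using M.coset_F_eq ab by simp
    qed
  qed
qed

lemma gr_map_iso_iff:
  "gr_map N G f \<in> iso (gr M F) (gr N G) \<longleftrightarrow> gr_surjective \<and> gr_injective"
  using gr_map_hom gr_map_surj_iff gr_map_inj_iff by (auto simp: iso_def bij_betw_def)

end

section \<open>The map induced on the completion, when the target is complete\<close>

locale completed_hom = filtered_hom M F N G f + N: complete_filtered_group N G
  for M :: "('m, 'c) ring_scheme" (structure) and F :: "nat \<Rightarrow> 'm set"
    and N :: "('n, 'd) ring_scheme" and G :: "nat \<Rightarrow> 'n set" and f :: "'m \<Rightarrow> 'n"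
begin

abbreviation "C \<equiv> completion M F"
abbreviation "CF \<equiv> completion_filtration M F"
abbreviation "hat \<equiv> hat_map N G f"

lemma cauchy_image: "M.cauchy a \<Longrightarrow> N.cauchy (\<lambda>n. f (a n))"
  unfolding M.cauchy_def N.cauchy_def using filtered by (simp flip: hom_minus)

text \<open>The condition in \<open>hat_map\<close> on the image of a whole coset is equivalent to
  the one on its representative, because f is filtered. Two solutions differ by an element of every
  \<open>G n\<close>, hence agree by separatedness.\<close>

lemma hat_unique:
  assumes a: "M.cauchy a" and y: "y \<in> carrier N" "\<And>n. f (a n) \<ominus>\<^bsub>N\<^esub> y \<in> G n"
  shows "hat (M.cls a) = y"
proof -
  have ac: "a n \<in> carrier M" for n by (rule M.cauchy_carr[OF a])
  have cond: "(f ` M.cls a n \<subseteq> G n +>\<^bsub>N\<^esub> z) = (f (a n) \<ominus>\<^bsub>N\<^esub> z \<in> G n)" if z: "z \<in> carrier N" for z n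
  proof
    assume "f ` M.cls a n \<subseteq> G n +>\<^bsub>N\<^esub> z"
    moreover have "a n \<in> M.cls a n"
      using M.coset_F[OF ac] ac M.F_zero by (simp add: M.cls_def M.diff_self)
    ultimately show "f (a n) \<ominus>\<^bsub>N\<^esub> z \<in> G n" using N.coset_F[OF z] by auto
  next
    assume fz: "f (a n) \<ominus>\<^bsub>N\<^esub> z \<in> G n"
    show "f ` M.cls a n \<subseteq> G n +>\<^bsub>N\<^esub> z"
    proof
      fix w assume "w \<in> f ` M.cls a n"
      then obtain b where b: "b \<in> carrier M" "b \<ominus> a n \<in> F n" "w = f b"
        using M.coset_F[OF ac] by (auto simp: M.cls_def)
      have "f b \<ominus>\<^bsub>N\<^esub> f (a n) \<in> G n" using filtered[OF b(2)] hom_minus[OF b(1) ac] by simp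
      then have "f b \<ominus>\<^bsub>N\<^esub> z \<in> G n" using N.F_trans[OF _ fz] b(1) ac z by simp
      then show "w \<in> G n +>\<^bsub>N\<^esub> z" using b N.coset_F[OF z] by simp
    qed
  qed
  show ?thesis
    unfolding hat_map_def
  proof (rule the_equality)
    show "y \<in> carrier N \<and> (\<forall>n. f ` M.cls a n \<subseteq> G n +>\<^bsub>N\<^esub> y)" using y cond by blast
    fix z assume z: "z \<in> carrier N \<and> (\<forall>n. f ` M.cls a n \<subseteq> G n +>\<^bsub>N\<^esub> z)"
    then have "z \<ominus>\<^bsub>N\<^esub> y \<in> G n" for n
      using cond[of z n] y N.F_trans[of z "f (a n)" n y] N.F_sym[of "f (a n)" z n] ac by simp
    then have "z \<ominus>\<^bsub>N\<^esub> y = \<zero>\<^bsub>N\<^esub>" using N.separated z y by simp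
    then show "z = y" using N.diff_eq_zero_iff z y by simp
  qed
qed

lemma hat_cls:
  assumes "M.cauchy a"
  shows "hat (M.cls a) \<in> carrier N" "f (a n) \<ominus>\<^bsub>N\<^esub> hat (M.cls a) \<in> G n"
proof -
  obtain y where y: "y \<in> carrier N" "\<And>n. f (a n) \<ominus>\<^bsub>N\<^esub> y \<in> G n"
    using N.complete[OF cauchy_image[OF assms]] by blast
  show "hat (M.cls a) \<in> carrier N" "f (a n) \<ominus>\<^bsub>N\<^esub> hat (M.cls a) \<in> G n"
    using hat_unique[OF assms y] y by simp_all
qed

lemma hat_const: "x \<in> carrier M \<Longrightarrow> hat (M.cls (\<lambda>_. x)) = f x"
  by (rule hat_unique) (simp_all add: M.cauchy_const N.diff_self N.F_zero)

lemma hat_filtered: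
  assumes "x \<in> CF n"
  shows "hat x \<in> G n"
proof -
  obtain a where a: "M.cauchy a" "x = M.cls a"
    using M.completion_cases assms M.completion_filtration_subset by blast
  then have "f (a n) \<in> G n" using assms M.cls_in_filtration filtered by simp
  then show ?thesis using N.F_shift'[OF hat_cls(2)] hat_cls(1) a by simp
qed

text \<open>Makes the results on gradings, continuity and openness available for the completed map
  as well as for f.\<close>

sublocale hat: filtered_hom C CF N G hat
proof -
  interpret Cf: filtered_group C CF by (rule M.filtered_group_completion)
  have "abelian_group_hom C N hat"
  proof (rule abelian_group_hom_intro)
    fix x y assume xy: "x \<in> carrier C" "y \<in> carrier C"
    obtain a where a: "M.cauchy a" "x = M.cls a" using M.completion_cases xy(1) by blast
    obtain b where b: "M.cauchy b" "y = M.cls b" using M.completion_cases xy(2) by blast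
    have "f (a n \<oplus> b n) \<ominus>\<^bsub>N\<^esub> (hat x \<oplus>\<^bsub>N\<^esub> hat y) \<in> G n" for n
      using N.F_add[OF hat_cls(2)[OF a(1), of n] hat_cls(2)[OF b(1)]] hat_cls(1)[OF a(1)] hat_cls(1)[OF b(1)]
        M.cauchy_carr[OF a(1)] M.cauchy_carr[OF b(1)] a(2) b(2)
      by (simp add: N.diff_add_diff)
    then show "hat (x \<oplus>\<^bsub>C\<^esub> y) = hat x \<oplus>\<^bsub>N\<^esub> hat y"
      using hat_unique[OF M.cauchy_add[OF a(1) b(1)]] hat_cls(1) a b by (simp add: M.cls_add)
  qed (use M.completion_cases hat_cls(1) M.abelian_group_completion N.abelian_group_axioms in blast)+
  then show "filtered_hom C CF N G hat"
    using hat_filtered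
    by (intro filtered_hom.intro filtered_hom_axioms.intro M.filtered_group_completion N.filtered_group_axioms) auto
qed

text \<open>Completion does not change the graded map: a class in level n is represented in degree n
  by its term of index \<open>Suc n\<close>, and conversely constant sequences embed M.\<close>

lemma hat_gr_surjective_iff: "hat.gr_surjective \<longleftrightarrow> gr_surjective"
proof
  assume S: hat.gr_surjective
  show gr_surjective unfolding gr_surjective_def
  proof (intro allI ballI)
    fix n y assume y: "y \<in> G n"
    obtain x where x: "x \<in> CF n" "hat x \<ominus>\<^bsub>N\<^esub> y \<in> G (Suc n)" using S y unfolding hat.gr_surjective_def by blast
    obtain a where a: "M.cauchy a" "x = M.cls a"
      using M.completion_cases x(1) M.completion_filtration_subset by blast
    have ac: "a m \<in> carrier M" for m by (rule M.cauchy_carr[OF a(1)])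
    have "a n \<in> F n" using x(1) a M.cls_in_filtration by simp
    \<comment> \<open>The term of index n would fix the image only modulo \<open>G n\<close>; the
      next term still lies in \<open>F n\<close> and fixes it modulo
      \<open>G (Suc n)\<close>.\<close>
    then have "a (Suc n) \<in> F n" using M.F_shift[OF M.cauchyD[OF a(1), of n "Suc n"]] ac by simp
    moreover have "f (a (Suc n)) \<ominus>\<^bsub>N\<^esub> y \<in> G (Suc n)"
      using N.F_trans[OF hat_cls(2)[OF a(1), of "Suc n"], of y] x(2) a(2) ac hat_cls(1)[OF a(1)] N.F_carr[OF y] by simp
    ultimately show "\<exists>x\<in>F n. f x \<ominus>\<^bsub>N\<^esub> y \<in> G (Suc n)" by blast
  qed
next
  assume S: gr_surjective
  show hat.gr_surjective unfolding hat.gr_surjective_def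
  proof (intro allI ballI)
    fix n y assume y: "y \<in> G n"
    obtain x where x: "x \<in> F n" "f x \<ominus>\<^bsub>N\<^esub> y \<in> G (Suc n)" using S y unfolding gr_surjective_def by blast
    have "M.cls (\<lambda>_. x) \<in> CF n" using x M.F_carr M.cauchy_const M.cls_in_filtration by simp
    then show "\<exists>x\<in>CF n. hat x \<ominus>\<^bsub>N\<^esub> y \<in> G (Suc n)"
      using x hat_const[OF M.F_carr[OF x(1)]] by (intro bexI[of _ "M.cls (\<lambda>_. x)"]) simp_all
  qed
qed

text \<open>The term of index \<open>Suc n\<close> decides again: if the limit lies in
  \<open>G (Suc n)\<close>, so does the image of that term, and the preimage form of injectivity
  applies. The converse tests constant sequences.\<close>

lemma hat_gr_injective_iff: "hat.gr_injective \<longleftrightarrow> gr_injective"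
proof
  assume I: hat.gr_injective
  show gr_injective unfolding gr_injective_def
  proof (intro allI ballI impI)
    fix n x assume x: "x \<in> F n" "f x \<in> G (Suc n)"
    have c: "M.cauchy (\<lambda>_. x)" using x M.F_carr M.cauchy_const by blast
    have "M.cls (\<lambda>_. x) \<in> CF n" "hat (M.cls (\<lambda>_. x)) \<in> G (Suc n)"
      using x c M.cls_in_filtration hat_const[OF M.F_carr[OF x(1)]] by simp_all
    then have "M.cls (\<lambda>_. x) \<in> CF (Suc n)" using I unfolding hat.gr_injective_def by blast
    then show "x \<in> F (Suc n)" using c M.cls_in_filtration by simp
  qed
next
  assume I: gr_injective
  show hat.gr_injective unfolding hat.gr_injective_def
  proof (intro allI ballI impI)
    fix n x assume x: "x \<in> CF n" "hat x \<in> G (Suc n)"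
    obtain a where a: "M.cauchy a" "x = M.cls a"
      using M.completion_cases x(1) M.completion_filtration_subset by blast
    have ac: "a m \<in> carrier M" for m by (rule M.cauchy_carr[OF a(1)])
    have "f (a (Suc n)) \<in> G (Suc n)"
      using N.F_shift[OF hat_cls(2)[OF a(1)], of "Suc n"] x(2) a(2) ac by simp
    then have "a (Suc n) \<in> F (Suc n)" using I ac unfolding gr_injective_iff by blast
    then show "x \<in> CF (Suc n)" using a M.cls_in_filtration by simp
  qed
qed

text \<open>Each correction of the approximation starts at depth n instead of 0, so all partial sums
  stay in \<open>F n\<close> and the preimage lies in level n of the completion. This is what makes
  the inverse map filtered.\<close>

lemma hat_onto_filtration:
  assumes S: gr_surjective and y: "y \<in> G n"
  shows "y \<in> hat ` CF n"
proof -
  have "\<forall>k z. \<exists>d. z \<in> G k \<longrightarrow> d \<in> F k \<and> f d \<ominus>\<^bsub>N\<^esub> z \<in> G (Suc k)"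
    using S unfolding gr_surjective_def by blast
  then obtain d where d: "\<And>k z. z \<in> G k \<Longrightarrow> d k z \<in> F k" "\<And>k z. z \<in> G k \<Longrightarrow> f (d k z) \<ominus>\<^bsub>N\<^esub> z \<in> G (Suc k)"
    by metis
  \<comment> \<open>Partial sums: \<open>s k\<close> leaves an error in \<open>G (n + k)\<close>,
    and d supplies an element of \<open>F (n + k)\<close> whose image removes that error modulo the
    next level.\<close>
  define s where "s = rec_nat \<zero> (\<lambda>k x. x \<oplus> d (n + k) (y \<ominus>\<^bsub>N\<^esub> f x))"
  have s0: "s 0 = \<zero>" and sS: "\<And>k. s (Suc k) = s k \<oplus> d (n + k) (y \<ominus>\<^bsub>N\<^esub> f (s k))"
    by (simp_all add: s_def)
  note yc = N.F_carr[OF y]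
  have s: "s k \<in> F n \<and> y \<ominus>\<^bsub>N\<^esub> f (s k) \<in> G (n + k)" for k
  proof (induction k)
    case 0 then show ?case using y M.F_zero yc by (simp add: s0 N.diff_zero)
  next
    case (Suc k)
    let ?d = "d (n + k) (y \<ominus>\<^bsub>N\<^esub> f (s k))"
    have dk: "?d \<in> F (n + k)" "f ?d \<ominus>\<^bsub>N\<^esub> (y \<ominus>\<^bsub>N\<^esub> f (s k)) \<in> G (Suc (n + k))"
      using d Suc by blast+
    have c: "s k \<in> carrier M" "?d \<in> carrier M" using Suc dk M.F_carr by blast+
    have "y \<ominus>\<^bsub>N\<^esub> f (s (Suc k)) = (y \<ominus>\<^bsub>N\<^esub> f (s k)) \<ominus>\<^bsub>N\<^esub> f ?d"
      using c yc by (simp add: sS a_minus_def N.minus_add N.a_ac)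
    also have "\<dots> \<in> G (Suc (n + k))"
      using N.F_sym[OF dk(2)] c yc by simp
    finally show ?case
      using Suc dk M.F_mono[of n "n + k"] M.F_add by (auto simp: sS)
  qed
  have sc: "s k \<in> carrier M" for k using s M.F_carr by blast
  have step: "s (Suc k) \<ominus> s k \<in> F k" for k
  proof -
    have dk: "d (n + k) (y \<ominus>\<^bsub>N\<^esub> f (s k)) \<in> F (n + k)" using d s by blast
    then have "s (Suc k) \<ominus> s k = d (n + k) (y \<ominus>\<^bsub>N\<^esub> f (s k))"
      using sc M.F_carr[OF dk] by (simp add: sS a_minus_def M.a_ac M.r_neg1 M.r_neg2)
    then show ?thesis using dk M.F_mono[of k "n + k"] by auto
  qed
  have "s (k + j) \<ominus> s k \<in> F k" for k j
  proof (induction j)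
    case 0 then show ?case using sc M.F_zero by (simp add: M.diff_self)
  next
    case (Suc j)
    then show ?case
      using M.F_trans[of "s (Suc (k + j))" "s (k + j)" k "s k"] step[of "k + j"] M.F_mono[of k "k + j"] sc by auto
  qed
  then have "s m \<ominus> s k \<in> F k" if "k \<le> m" for k m
    using le_add_diff_inverse[OF that] by metis
  then have c: "M.cauchy s"
    unfolding M.cauchy_def using sc by blast
  have "f (s k) \<ominus>\<^bsub>N\<^esub> y \<in> G k" for k
    using N.F_sym[of y "f (s k)" k] s[of k] N.F_mono[of k "n + k"] hom_closed[OF sc] yc by (auto dest: subsetD)
  then have "hat (M.cls s) = y" using hat_unique[OF c yc] by blast
  moreover have "M.cls s \<in> CF n" using c s M.cls_in_filtration by simp
  ultimately show ?thesis by blast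
qed

text \<open>Plain surjectivity becomes surjectivity in each degree: the term of index
  \<open>Suc n\<close> of a preimage of y has image y modulo \<open>G (Suc n)\<close>, hence image
  in \<open>G n\<close>, and the preimage condition puts the term itself into
  \<open>F n\<close>.\<close>

lemma hat_surj_preimage:
  assumes "\<forall>n. F n = {x \<in> carrier M. f x \<in> G n}" "hat ` carrier C = carrier N"
  shows gr_surjective
  unfolding gr_surjective_def
proof (intro allI ballI)
  fix n y assume y: "y \<in> G n"
  then have "y \<in> hat ` carrier C" using assms(2) N.F_carr by simp
  then obtain x where x: "x \<in> carrier C" "hat x = y" by blast
  obtain a where a: "M.cauchy a" "x = M.cls a" using M.completion_cases x(1) by blast
  have ac: "a m \<in> carrier M" for m by (rule M.cauchy_carr[OF a(1)])
  have l: "f (a (Suc n)) \<ominus>\<^bsub>N\<^esub> y \<in> G (Suc n)" using hat_cls(2)[OF a(1)] a(2) x(2) by simp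
  then have "f (a (Suc n)) \<in> G n" using N.F_shift[OF subsetD[OF N.F_Suc] y] ac by simp
  then have "a (Suc n) \<in> F n" using assms(1) ac by simp
  then show "\<exists>x\<in>F n. f x \<ominus>\<^bsub>N\<^esub> y \<in> G (Suc n)" using l by blast
qed

lemma hat_surj: "gr_surjective \<Longrightarrow> hat ` carrier C = carrier N"
  using hat_onto_filtration[of _ 0] hat.hom_closed unfolding N.F_0 hat.M.F_0 by blast

text \<open>If the limit of the images is 0, the image of the term of index m lies in
  \<open>G m\<close>. Far enough out the terms therefore lie in a given \<open>F n\<close>, and the
  Cauchy condition carries this back to the term of index n.\<close>

lemma hat_inj:
  assumes "\<forall>n. \<exists>m. {x \<in> carrier M. f x \<in> G m} \<subseteq> F n"
  shows "inj_on hat (carrier C)"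
proof -
  have "x = \<zero>\<^bsub>C\<^esub>" if x: "x \<in> carrier C" "hat x = \<zero>\<^bsub>N\<^esub>" for x
  proof -
    obtain a where a: "M.cauchy a" "x = M.cls a" using M.completion_cases x(1) by blast
    have ac: "a m \<in> carrier M" for m by (rule M.cauchy_carr[OF a(1)])
    have fa: "f (a m) \<in> G m" for m using hat_cls(2)[OF a(1), of m] x(2) a(2) ac by (simp add: N.diff_zero)
    have "a n \<in> F n" for n
    proof -
      obtain m where m: "{x \<in> carrier M. f x \<in> G m} \<subseteq> F n" using assms by blast
      \<comment> \<open>The index must be at least m for the hypothesis on preimages, and at least n
        to be comparable with the term of index n modulo \<open>F n\<close>.\<close>
      have "a (max m n) \<in> F n" using m fa[of "max m n"] N.F_mono[of m "max m n"] ac by auto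
      then show ?thesis using M.F_shift'[OF M.cauchyD[OF a(1), of n "max m n"]] ac by simp
    qed
    then show ?thesis
      using M.cls_eq_iff[OF a(1) M.cauchy_const[OF M.zero_closed]] a(2) ac by (simp add: M.cls_zero M.diff_zero)
  qed
  then show ?thesis
    using hat.M.diff_eq_zero_iff hat.hom_minus N.diff_self
    by (intro inj_onI) (metis hat.M.minus_closed hat.hom_closed)
qed

text \<open>A filtered inverse, evaluated on the images of constant sequences, says that f reflects
  levels; surjectivity then gives each degree by \<open>hat_surj_preimage\<close>. Conversely,
  \<open>hat_onto_filtration\<close> yields preimages in the right level.\<close>

lemma filtered_iso_hat_iff: "filtered_iso C CF N G hat \<longleftrightarrow> gr_surjective \<and> gr_injective"
proof
  assume fi: "filtered_iso C CF N G hat"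
  then have inj: "inj_on hat (carrier C)" and surj: "hat ` carrier C = carrier N"
    and inv: "\<And>n. inv_into (carrier C) hat ` G n \<subseteq> CF n"
    by (auto simp: filtered_iso_def bij_betw_def)
  have I: gr_injective unfolding gr_injective_def
  proof (intro allI ballI impI)
    fix n x assume x: "x \<in> F n" "f x \<in> G (Suc n)"
    have xc: "x \<in> carrier M" using x M.F_carr by blast
    have "inv_into (carrier C) hat (f x) = M.cls (\<lambda>_. x)"
      using inj hat_const[OF xc] M.cls_closed[OF M.cauchy_const[OF xc]] by (metis inv_into_f_f)
    then have "M.cls (\<lambda>_. x) \<in> CF (Suc n)" using inv x(2) by (metis image_subset_iff)
    then show "x \<in> F (Suc n)" using M.cls_in_filtration[OF M.cauchy_const[OF xc]] by simp
  qed
  moreover have gr_surjective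
    using hat_surj_preimage surj I gr_injective_iff by blast
  ultimately show "gr_surjective \<and> gr_injective" by blast
next
  assume SI: "gr_surjective \<and> gr_injective"
  then have inj: "inj_on hat (carrier C)"
    by (intro hat_inj) (metis gr_injective_iff order_refl)
  have "inv_into (carrier C) hat ` G n \<subseteq> CF n" for n
  proof
    fix x assume "x \<in> inv_into (carrier C) hat ` G n"
    then obtain y where y: "y \<in> G n" "x = inv_into (carrier C) hat y" by blast
    obtain z where z: "z \<in> CF n" "y = hat z" using hat_onto_filtration y(1) SI by blast
    then show "x \<in> CF n" using y(2) inj M.completion_filtration_subset by (metis inv_into_f_f subsetD)
  qed
  then show "filtered_iso C CF N G hat"
    using inj hat_surj SI hat_filtered by (auto simp: filtered_iso_def bij_betw_def)
qed

end

section \<open>Linear topologies: continuity, openness, density and comparison\<close>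

context filtered_group begin

text \<open>The predicate under \<open>topology\<close> has to be shown to define a topology before
  it can be read off; for an intersection the deeper of the two levels serves.\<close>

lemma openin_linear: "openin (linear_topology M F) S \<longleftrightarrow> S \<subseteq> carrier M \<and> (\<forall>x\<in>S. \<exists>n. F n +> x \<subseteq> S)"
proof -
  have "istopology (\<lambda>S. S \<subseteq> carrier M \<and> (\<forall>x\<in>S. \<exists>n. F n +> x \<subseteq> S))"
    unfolding istopology_def
  proof (intro conjI allI impI ballI; (elim conjE)?)
    fix S T x assume S: "\<forall>x\<in>S. \<exists>n. F n +> x \<subseteq> S" "S \<subseteq> carrier M"
      and T: "\<forall>x\<in>T. \<exists>n. F n +> x \<subseteq> T" and x: "x \<in> S \<inter> T"
    obtain n m where nm: "F n +> x \<subseteq> S" "F m +> x \<subseteq> T" using S T x by blast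
    have "F (max n m) +> x \<subseteq> F n +> x" "F (max n m) +> x \<subseteq> F m +> x"
      using F_mono[of n "max n m"] F_mono[of m "max n m"] by (auto simp: a_r_coset_def r_coset_def)
    then show "\<exists>n. F n +> x \<subseteq> S \<inter> T" using nm by blast
  next
    fix K x assume "\<forall>S\<in>K. S \<subseteq> carrier M \<and> (\<forall>x\<in>S. \<exists>n. F n +> x \<subseteq> S)" "x \<in> \<Union>K"
    then show "\<exists>n. F n +> x \<subseteq> \<Union>K" by (meson Union_iff Union_upper order_trans)
  qed blast+
  then show ?thesis by (simp add: linear_topology_def topology_inverse')
qed

lemma topspace_linear: "topspace (linear_topology M F) = carrier M"
proof -
  have "openin (linear_topology M F) (carrier M)"
    unfolding openin_linear using coset_F by auto
  then show ?thesis
    by (metis openin_linear openin_subset openin_topspace subset_antisym)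
qed

lemma open_coset:
  assumes "x \<in> carrier M"
  shows "openin (linear_topology M F) (F n +> x)"
  unfolding openin_linear
proof (intro conjI ballI)
  show "F n +> x \<subseteq> carrier M" using coset_F[OF assms] by blast
  fix y assume "y \<in> F n +> x"
  then have "y \<in> carrier M" "y \<ominus> x \<in> F n" using coset_F[OF assms] by auto
  then have "F n +> y = F n +> x" using coset_F_eq assms by simp
  then show "\<exists>m. F m +> y \<subseteq> F n +> x" by blast
qed

lemma open_filtration: "openin (linear_topology M F) (F n)"
  using open_coset[OF zero_closed] coset_F_zero by simp

lemma closure_of_linear:
  assumes "S \<subseteq> carrier M"
  shows "linear_topology M F closure_of S = {y \<in> carrier M. \<forall>n. \<exists>x\<in>S. x \<ominus> y \<in> F n}"
proof (intro equalityI subsetI)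
  fix y assume y: "y \<in> linear_topology M F closure_of S"
  then have yc: "y \<in> carrier M" by (simp add: in_closure_of topspace_linear)
  have "\<exists>x\<in>S. x \<ominus> y \<in> F n" for n
  proof -
    have "y \<in> F n +> y" using coset_F yc F_zero by (simp add: diff_self)
    then obtain x where "x \<in> S" "x \<in> F n +> y" using y open_coset[OF yc, of n] unfolding in_closure_of by blast
    then show ?thesis using coset_F[OF yc] by auto
  qed
  then show "y \<in> {y \<in> carrier M. \<forall>n. \<exists>x\<in>S. x \<ominus> y \<in> F n}" using yc by blast
next
  fix y assume y: "y \<in> {y \<in> carrier M. \<forall>n. \<exists>x\<in>S. x \<ominus> y \<in> F n}"
  show "y \<in> linear_topology M F closure_of S"
    unfolding in_closure_of topspace_linear
  proof (intro conjI allI impI)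
    show "y \<in> carrier M" using y by blast
    fix T assume T: "y \<in> T \<and> openin (linear_topology M F) T"
    then obtain n where n: "F n +> y \<subseteq> T" using openin_linear by blast
    obtain x where x: "x \<in> S" "x \<ominus> y \<in> F n" using y by blast
    then have "x \<in> F n +> y" using coset_F y assms by blast
    then show "\<exists>x. x \<in> S \<and> x \<in> T" using n x by blast
  qed
qed

end

context filtered_hom begin

lemma continuous_linear: "continuous_map (linear_topology M F) (linear_topology N G) f"
  unfolding continuous_map_def M.topspace_linear N.topspace_linear
proof (intro conjI allI impI)
  show "f \<in> carrier M \<rightarrow> carrier N" by simp
  fix U assume U: "openin (linear_topology N G) U"
  show "openin (linear_topology M F) {x \<in> carrier M. f x \<in> U}"
    unfolding M.openin_linear
  proof (intro conjI ballI)
    fix x assume x: "x \<in> {x \<in> carrier M. f x \<in> U}"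
    then obtain n where n: "G n +>\<^bsub>N\<^esub> f x \<subseteq> U" using U N.openin_linear by blast
    have "F n +> x \<subseteq> {x \<in> carrier M. f x \<in> U}"
    proof
      fix y assume "y \<in> F n +> x"
      then have y: "y \<in> carrier M" "y \<ominus> x \<in> F n" using M.coset_F x by auto
      then have "f y \<ominus>\<^bsub>N\<^esub> f x \<in> G n" using filtered[OF y(2)] x by (simp add: hom_minus)
      then have "f y \<in> G n +>\<^bsub>N\<^esub> f x" using N.coset_F x y by simp
      then show "y \<in> {x \<in> carrier M. f x \<in> U}" using n y by blast
    qed
    then show "\<exists>n. F n +> x \<subseteq> {x \<in> carrier M. f x \<in> U}" by blast
  qed blast
qed

text \<open>By additivity, openness is tested at 0: a neighbourhood of f x inside an image is the
  translate by f x of one inside the image of \<open>F n\<close>.\<close>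

lemma open_map_linear_iff:
  "open_map (linear_topology M F) (linear_topology N G) f \<longleftrightarrow> (\<forall>n. \<exists>m. G m \<subseteq> f ` F n)"
proof
  assume o: "open_map (linear_topology M F) (linear_topology N G) f"
  show "\<forall>n. \<exists>m. G m \<subseteq> f ` F n"
  proof
    fix n
    have "openin (linear_topology N G) (f ` F n)" using o M.open_filtration by (simp add: open_map_def)
    moreover have "\<zero>\<^bsub>N\<^esub> \<in> f ` F n" using hom_zero M.F_zero by (metis image_eqI)
    ultimately show "\<exists>m. G m \<subseteq> f ` F n" unfolding N.openin_linear using N.coset_F_zero by metis
  qed
next
  assume o: "\<forall>n. \<exists>m. G m \<subseteq> f ` F n"
  show "open_map (linear_topology M F) (linear_topology N G) f"
    unfolding open_map_def
  proof (intro allI impI)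
    fix U assume U: "openin (linear_topology M F) U"
    have Uc: "U \<subseteq> carrier M" using U M.openin_linear by blast
    show "openin (linear_topology N G) (f ` U)"
      unfolding N.openin_linear
    proof (intro conjI ballI)
      show "f ` U \<subseteq> carrier N" using Uc by auto
      fix y assume "y \<in> f ` U"
      then obtain x where x: "x \<in> U" "y = f x" by blast
      have xc: "x \<in> carrier M" using x Uc by blast
      obtain n where n: "F n +> x \<subseteq> U" using U x M.openin_linear by blast
      obtain m where m: "G m \<subseteq> f ` F n" using o by blast
      have "G m +>\<^bsub>N\<^esub> y \<subseteq> f ` U"
      proof
        fix z assume "z \<in> G m +>\<^bsub>N\<^esub> y"
        then have z: "z \<in> carrier N" "z \<ominus>\<^bsub>N\<^esub> y \<in> G m" using N.coset_F[of y m] x xc by auto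
        then obtain w where w: "w \<in> F n" "z \<ominus>\<^bsub>N\<^esub> y = f w" using m by blast
        have wc: "w \<in> carrier M" using w M.F_carr by blast
        have "z = f (w \<oplus> x)" using w(2) x(2) z xc wc N.diff_add_cancel[of z y] by simp
        moreover have "w \<oplus> x \<in> F n +> x"
          using M.coset_F[OF xc] xc wc w by (simp add: M.add_diff_cancel)
        ultimately show "z \<in> f ` U" using n by blast
      qed
      then show "\<exists>m. G m +>\<^bsub>N\<^esub> y \<subseteq> f ` U" by blast
    qed
  qed
qed

lemma dense_linear_iff:
  "linear_topology N G closure_of (f ` carrier M) = topspace (linear_topology N G) \<longleftrightarrow>
    (\<forall>y\<in>carrier N. \<forall>n. \<exists>x\<in>carrier M. f x \<ominus>\<^bsub>N\<^esub> y \<in> G n)"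
proof -
  have "f ` carrier M \<subseteq> carrier N" by auto
  then show ?thesis by (auto simp: N.closure_of_linear N.topspace_linear)
qed

lemma filtered_group_induced: "filtered_group M (\<lambda>n. {x \<in> carrier M. f x \<in> G n})"
proof (intro filtered_group.intro filtered_group_axioms.intro M.abelian_group_axioms M.additive_subgroup_intro)
qed (use N.F_zero N.F_add N.F_neg N.F_Suc[THEN subsetD] N.F_0 in auto)

text \<open>As f is filtered, each \<open>F n\<close> lies in the induced level n, so one comparison
  of topologies is automatic. The other one says that \<open>F n\<close> is a neighbourhood of 0 in
  the induced topology.\<close>

lemma induced_topology_iff:
  "linear_topology M F = linear_topology M (\<lambda>n. {x \<in> carrier M. f x \<in> G n}) \<longleftrightarrow>
    (\<forall>n. \<exists>m. {x \<in> carrier M. f x \<in> G m} \<subseteq> F n)" (is "?T = ?T' \<longleftrightarrow> _")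
proof -
  interpret I: filtered_group M "\<lambda>n. {x \<in> carrier M. f x \<in> G n}" by (rule filtered_group_induced)
  show ?thesis
  proof
    assume eq: "?T = ?T'"
    show "\<forall>n. \<exists>m. {x \<in> carrier M. f x \<in> G m} \<subseteq> F n"
    proof
      fix n
      have "openin ?T' (F n)" using M.open_filtration eq by metis
      then obtain m where "{x \<in> carrier M. f x \<in> G m} +> \<zero> \<subseteq> F n"
        unfolding I.openin_linear using M.F_zero by blast
      then show "\<exists>m. {x \<in> carrier M. f x \<in> G m} \<subseteq> F n" unfolding I.coset_F_zero by blast
    qed
  next
    assume E: "\<forall>n. \<exists>m. {x \<in> carrier M. f x \<in> G m} \<subseteq> F n"
    have sub: "F n \<subseteq> {x \<in> carrier M. f x \<in> G n}" for n using filtered M.F_carr by blast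
    have mono: "A +> x \<subseteq> B +> x" if "A \<subseteq> B" for A B x
      using that by (auto simp: a_r_coset_def r_coset_def)
    have "(\<exists>n. F n +> x \<subseteq> S) \<longleftrightarrow> (\<exists>n. {x \<in> carrier M. f x \<in> G n} +> x \<subseteq> S)" for x S
    proof
      assume "\<exists>n. F n +> x \<subseteq> S"
      then obtain n where n: "F n +> x \<subseteq> S" by blast
      obtain m where "{x \<in> carrier M. f x \<in> G m} \<subseteq> F n" using E by blast
      then have "{x \<in> carrier M. f x \<in> G m} +> x \<subseteq> S" using n by (rule order_trans[OF mono])
      then show "\<exists>n. {x \<in> carrier M. f x \<in> G n} +> x \<subseteq> S" by blast
    next
      assume "\<exists>n. {x \<in> carrier M. f x \<in> G n} +> x \<subseteq> S"
      then obtain n where n: "{x \<in> carrier M. f x \<in> G n} +> x \<subseteq> S" by blast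
      have "F n +> x \<subseteq> S" by (rule order_trans[OF mono[OF sub] n])
      then show "\<exists>n. F n +> x \<subseteq> S" by blast
    qed
    then show "?T = ?T'"
      unfolding topology_eq M.openin_linear I.openin_linear by simp
  qed
qed

end

section \<open>The topological conditions, and when they coincide with the graded ones\<close>

context completed_hom begin

text \<open>An element y of a deep level is approximated by density with elements whose images
  approach y; control of preimages makes these approximants Cauchy and puts the term of index n into
  \<open>F n\<close>. Their class maps to y.\<close>

lemma open_map_hat:
  assumes E: "\<forall>n. \<exists>m. {x \<in> carrier M. f x \<in> G m} \<subseteq> F n"
    and D: "\<forall>y\<in>carrier N. \<forall>n. \<exists>x\<in>carrier M. f x \<ominus>\<^bsub>N\<^esub> y \<in> G n"
  shows "\<exists>m. G m \<subseteq> hat ` CF n"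
proof -
  obtain \<mu> where \<mu>: "\<And>n. {x \<in> carrier M. f x \<in> G (\<mu> n)} \<subseteq> F n" using E by metis
  \<comment> \<open>Adding n and summing \<mu> over all smaller indices makes \<nu> monotone, at
    least \<mu> and at least the identity. Monotonicity makes the approximants Cauchy, the bound by
    \<mu> gives control of preimages, and the last property gives convergence at the required
    rate.\<close>
  define \<nu> where "\<nu> n = n + (\<Sum>i\<le>n. \<mu> i)" for n
  have "\<mu> n \<le> (\<Sum>i\<le>n. \<mu> i)" for n by (rule member_le_sum) auto
  then have ge: "\<mu> n \<le> \<nu> n" for n unfolding \<nu>_def by (rule trans_le_add2)
  have mono: "\<nu> n \<le> \<nu> m" if "n \<le> m" for n m
    unfolding \<nu>_def using that by (intro add_mono sum_mono2) auto
  have \<nu>: "x \<in> F n" if "x \<in> carrier M" "f x \<in> G (\<nu> n)" for x n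
    using \<mu>[of n] that N.F_mono[OF ge[of n]] by auto
  have "G (\<nu> n) \<subseteq> hat ` CF n"
  proof
    fix y assume y: "y \<in> G (\<nu> n)"
    note yc = N.F_carr[OF y]
    have "\<forall>i. \<exists>x. x \<in> carrier M \<and> f x \<ominus>\<^bsub>N\<^esub> y \<in> G (\<nu> i)" using D yc by blast
    then obtain a where a: "\<And>i. a i \<in> carrier M" "\<And>i. f (a i) \<ominus>\<^bsub>N\<^esub> y \<in> G (\<nu> i)" by metis
    have "a m \<ominus> a i \<in> F i" if "i \<le> m" for i m
    proof (rule \<nu>)
      have "f (a m) \<ominus>\<^bsub>N\<^esub> y \<in> G (\<nu> i)" using a(2)[of m] N.F_mono[OF mono[OF that]] by blast
      then have "f (a m) \<ominus>\<^bsub>N\<^esub> f (a i) \<in> G (\<nu> i)"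
        using N.F_trans[OF _ N.F_sym[OF a(2)]] a(1) yc by simp
      then show "f (a m \<ominus> a i) \<in> G (\<nu> i)" using a(1) by (simp add: hom_minus)
    qed (use a in simp)
    then have c: "M.cauchy a" using a by (simp add: M.cauchy_def)
    have "i \<le> \<nu> i" for i by (simp add: \<nu>_def)
    then have "f (a i) \<ominus>\<^bsub>N\<^esub> y \<in> G i" for i using a(2)[of i] N.F_mono by blast
    then have "hat (M.cls a) = y" by (rule hat_unique[OF c yc])
    moreover have "f (a n) \<in> G (\<nu> n)" using N.F_shift[OF a(2) y] a(1) by simp
    then have "M.cls a \<in> CF n" using \<nu> a(1) M.cls_in_filtration[OF c] by simp
    ultimately show "y \<in> hat ` CF n" by blast
  qed
  then show ?thesis by blast
qed

lemma dense_of_surj: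
  assumes "hat ` carrier C = carrier N" "y \<in> carrier N"
  shows "\<exists>x\<in>carrier M. f x \<ominus>\<^bsub>N\<^esub> y \<in> G n"
proof -
  obtain x where x: "x \<in> carrier C" "hat x = y" using assms by (metis imageE)
  obtain a where a: "M.cauchy a" "x = M.cls a" using M.completion_cases x(1) by blast
  then show ?thesis using hat_cls(2)[OF a(1)] M.cauchy_carr[OF a(1)] x(2) by blast
qed

text \<open>Openness puts some \<open>G m\<close> into the image, and density moves any y into
  \<open>G m\<close> by subtracting a value of f. Both pieces lie in the image, which is a
  subgroup.\<close>

lemma surj_of_open_dense:
  assumes o: "\<forall>n. \<exists>m. G m \<subseteq> hat ` CF n"
    and D: "\<forall>y\<in>carrier N. \<forall>n. \<exists>x\<in>carrier M. f x \<ominus>\<^bsub>N\<^esub> y \<in> G n"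
  shows "hat ` carrier C = carrier N"
proof (intro equalityI subsetI)
  fix y assume y: "y \<in> carrier N"
  obtain m where m: "G m \<subseteq> hat ` CF 0" using o by blast
  obtain x where x: "x \<in> carrier M" "f x \<ominus>\<^bsub>N\<^esub> y \<in> G m" using D y by blast
  have "y \<ominus>\<^bsub>N\<^esub> f x \<in> hat ` CF 0" using m N.F_sym[OF x(2)] x(1) y by auto
  then obtain z where z: "z \<in> carrier C" "y \<ominus>\<^bsub>N\<^esub> f x = hat z" unfolding hat.M.F_0 by blast
  have c: "M.cls (\<lambda>_. x) \<in> carrier C" using x M.cauchy_const M.cls_closed by blast
  have "y = hat (z \<oplus>\<^bsub>C\<^esub> M.cls (\<lambda>_. x))"
    using N.diff_add_cancel[OF y, of "f x"] z c x(1) hat_const[OF x(1)] by simp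
  then show "y \<in> hat ` carrier C" using z(1) c hat.M.add.m_closed by blast
qed (use hat.hom_closed in blast)

definition topological_iso :: bool
  where "topological_iso \<longleftrightarrow> (\<forall>n. \<exists>m. {x \<in> carrier M. f x \<in> G m} \<subseteq> F n) \<and>
    (\<forall>y\<in>carrier N. \<forall>n. \<exists>x\<in>carrier M. f x \<ominus>\<^bsub>N\<^esub> y \<in> G n)"

text \<open>If the image of x lies in a \<open>G m\<close> contained in the image of level n of the
  completion, injectivity identifies the preimage found there with the constant sequence at x; hence
  x lies in \<open>F n\<close>.\<close>

lemma open_inj_dense_iff:
  "open_map (linear_topology C CF) (linear_topology N G) hat \<and> inj_on hat (carrier C) \<and>
    (\<forall>y\<in>carrier N. \<forall>n. \<exists>x\<in>carrier M. f x \<ominus>\<^bsub>N\<^esub> y \<in> G n) \<longleftrightarrow> topological_iso"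
  unfolding hat.open_map_linear_iff
proof (intro iffI; (elim conjE)?)
  assume o: "\<forall>n. \<exists>m. G m \<subseteq> hat ` CF n" and inj: "inj_on hat (carrier C)"
    and D: "\<forall>y\<in>carrier N. \<forall>n. \<exists>x\<in>carrier M. f x \<ominus>\<^bsub>N\<^esub> y \<in> G n"
  have "\<exists>m. {x \<in> carrier M. f x \<in> G m} \<subseteq> F n" for n
  proof -
    obtain m where m: "G m \<subseteq> hat ` CF n" using o by blast
    have "x \<in> F n" if x: "x \<in> carrier M" "f x \<in> G m" for x
    proof -
      have "f x \<in> hat ` CF n" using m x(2) by (rule subsetD)
      then obtain z where z: "z \<in> CF n" "f x = hat z" by blast
      have c: "M.cauchy (\<lambda>_. x)" using x M.cauchy_const by blast
      have "hat z = hat (M.cls (\<lambda>_. x))" using z hat_const x by simp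
      then have "z = M.cls (\<lambda>_. x)"
        using inj_onD[OF inj _ hat.M.F_carr[OF z(1)] M.cls_closed[OF c]] by simp
      then show ?thesis using z(1) M.cls_in_filtration[OF c] by simp
    qed
    then show ?thesis by blast
  qed
  then show topological_iso unfolding topological_iso_def using D by blast
next
  assume topological_iso
  then have E: "\<forall>n. \<exists>m. {x \<in> carrier M. f x \<in> G m} \<subseteq> F n"
    and D: "\<forall>y\<in>carrier N. \<forall>n. \<exists>x\<in>carrier M. f x \<ominus>\<^bsub>N\<^esub> y \<in> G n"
    by (auto simp: topological_iso_def)
  show "(\<forall>n. \<exists>m. G m \<subseteq> hat ` CF n) \<and> inj_on hat (carrier C) \<and>
    (\<forall>y\<in>carrier N. \<forall>n. \<exists>x\<in>carrier M. f x \<ominus>\<^bsub>N\<^esub> y \<in> G n)"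
    using open_map_hat[OF E D] hat_inj[OF E] D by blast
qed

lemma homeomorphic_hat_iff:
  "homeomorphic_map (linear_topology C CF) (linear_topology N G) hat \<longleftrightarrow> topological_iso"
proof
  assume "homeomorphic_map (linear_topology C CF) (linear_topology N G) hat"
  then have "open_map (linear_topology C CF) (linear_topology N G) hat"
    "inj_on hat (carrier C)" "hat ` carrier C = carrier N"
    using homeomorphic_imp_open_map homeomorphic_imp_injective_map homeomorphic_imp_surjective_map
      hat.M.topspace_linear N.topspace_linear by metis+
  then show topological_iso using open_inj_dense_iff dense_of_surj by blast
next
  assume t: topological_iso
  then have o: "open_map (linear_topology C CF) (linear_topology N G) hat"
    and i: "inj_on hat (carrier C)"
    and D: "\<forall>y\<in>carrier N. \<forall>n. \<exists>x\<in>carrier M. f x \<ominus>\<^bsub>N\<^esub> y \<in> G n"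
    using open_inj_dense_iff by blast+
  have s: "hat ` carrier C = carrier N"
    using o D surj_of_open_dense hat.open_map_linear_iff by blast
  show "homeomorphic_map (linear_topology C CF) (linear_topology N G) hat"
    by (rule bijective_open_imp_homeomorphic_map)
      (simp_all add: hat.continuous_linear o hat.M.topspace_linear N.topspace_linear s i)
qed

text \<open>One rewrite rule for each of (a) to (h), in this order, with a common right-hand side in
  each of the two groups. Written with the unfolded notions, so that the final theorem is obtained
  by rewriting.\<close>

lemma equivalent_conditions_iff:
  defines "induced \<equiv> (\<lambda>n. {x \<in> carrier M. f x \<in> G n})"
    and "dense \<equiv> linear_topology N G closure_of (f ` carrier M) = topspace (linear_topology N G)"
  shows "filtered_iso C CF N G hat \<longleftrightarrow> gr_surjective \<and> gr_injective"
    and "gr_map N G hat \<in> iso (gr C CF) (gr N G) \<longleftrightarrow> gr_surjective \<and> gr_injective"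
    and "hat ` carrier C = carrier N \<and> (\<forall>n. F n = induced n) \<longleftrightarrow> gr_surjective \<and> gr_injective"
    and "gr_map N G hat ` carrier (gr C CF) = carrier (gr N G) \<and> (\<forall>n. F n = induced n) \<longleftrightarrow>
      gr_surjective \<and> gr_injective"
    and "gr_map N G f ` carrier (gr M F) = carrier (gr N G) \<and> (\<forall>n. F n = induced n) \<longleftrightarrow>
      gr_surjective \<and> gr_injective"
    and "homeomorphic_map (linear_topology C CF) (linear_topology N G) hat \<longleftrightarrow> topological_iso"
    and "open_map (linear_topology C CF) (linear_topology N G) hat \<and> inj_on hat (carrier C) \<and> dense \<longleftrightarrow>
      topological_iso"
    and "linear_topology M F = linear_topology M induced \<and> dense \<longleftrightarrow> topological_iso"
  unfolding induced_def dense_def dense_linear_iff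
  subgoal by (rule filtered_iso_hat_iff)
  subgoal by (simp add: hat.gr_map_iso_iff hat_gr_surjective_iff hat_gr_injective_iff)
  subgoal using hat_surj hat_surj_preimage gr_injective_iff by blast
  subgoal by (simp add: hat.gr_map_surj_iff hat_gr_surjective_iff gr_injective_iff)
  subgoal by (simp add: gr_map_surj_iff gr_injective_iff)
  subgoal by (rule homeomorphic_hat_iff)
  subgoal by (rule open_inj_dense_iff)
  subgoal by (simp add: induced_topology_iff topological_iso_def)
  done

text \<open>The approximants of an element of \<open>G n\<close> come from \<open>F n\<close>, not
  merely from M. For x with image in \<open>G n\<close>, take such a z in \<open>F n\<close> with
  image so close to that of x that control of preimages forces z - x into \<open>F n\<close>; then x
  lies in \<open>F n\<close> too.\<close>

lemma strict_approximation:
  assumes "\<And>n m y. y \<in> G n \<Longrightarrow> \<exists>x\<in>F n. f x \<ominus>\<^bsub>N\<^esub> y \<in> G m"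
  shows "topological_iso \<longleftrightarrow> gr_surjective \<and> gr_injective"
proof -
  have S: gr_surjective unfolding gr_surjective_def using assms by blast
  have D: "\<forall>y\<in>carrier N. \<forall>n. \<exists>x\<in>carrier M. f x \<ominus>\<^bsub>N\<^esub> y \<in> G n"
    using assms[of _ 0] N.F_0 M.F_0 by blast
  have "gr_injective" if E: "\<forall>n. \<exists>m. {x \<in> carrier M. f x \<in> G m} \<subseteq> F n"
    unfolding gr_injective_iff
  proof (intro allI equalityI subsetI)
    fix n x assume "x \<in> {x \<in> carrier M. f x \<in> G n}"
    then have x: "x \<in> carrier M" "f x \<in> G n" by auto
    obtain m where m: "{x \<in> carrier M. f x \<in> G m} \<subseteq> F n" using E by blast
    obtain z where z: "z \<in> F n" "f z \<ominus>\<^bsub>N\<^esub> f x \<in> G m" using assms x(2) by blast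
    note zc = M.F_carr[OF z(1)]
    have "z \<ominus> x \<in> F n" using m z(2) zc x(1) hom_minus by auto
    then show "x \<in> F n" using M.F_shift' z(1) x(1) by blast
  qed (use filtered M.F_carr in blast)
  moreover have "\<forall>n. \<exists>m. {x \<in> carrier M. f x \<in> G m} \<subseteq> F n" if gr_injective
    using that unfolding gr_injective_iff by (metis order_refl)
  ultimately show ?thesis using S D unfolding topological_iso_def by blast
qed

text \<open>A preimage in level n of the completion is cut off at the index \<open>max n m\<close>:
  the term there still lies in \<open>F n\<close>, and its image is accurate modulo
  \<open>G m\<close>. This is to be applied to \<theta>.\<close>

lemma approximation_of_filtered_iso:
  assumes "filtered_iso C CF N G hat" "y \<in> G n"
  shows "\<exists>x\<in>F n. f x \<ominus>\<^bsub>N\<^esub> y \<in> G m"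
proof -
  have gr_surjective using assms(1) filtered_iso_hat_iff by blast
  then obtain z where z: "z \<in> CF n" "y = hat z" using hat_onto_filtration assms(2) by blast
  obtain a where a: "M.cauchy a" "z = M.cls a"
    using M.completion_cases z(1) M.completion_filtration_subset by blast
  have ac: "a i \<in> carrier M" for i by (rule M.cauchy_carr[OF a(1)])
  have "a n \<in> F n" using z(1) a M.cls_in_filtration by simp
  then have "a (max n m) \<in> F n" using M.F_shift[OF M.cauchyD[OF a(1), of n "max n m"]] ac by simp
  moreover have "f (a (max n m)) \<ominus>\<^bsub>N\<^esub> y \<in> G m"
    using hat_cls(2)[OF a(1), of "max n m"] z(2) a(2) N.F_mono[of m "max n m"] by auto
  ultimately show ?thesis by blast
qed

end

section \<open>Tensor products\<close>

text \<open>The hypothesis under which \<open>tlift G f\<close> is independent of representatives,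
  stated for a function of pairs because \<open>tlift\<close> takes its argument in that
  form.\<close>

definition balanced :: "('x, 'y) balance \<Rightarrow> ('x, 'c) ring_scheme \<Rightarrow> ('y, 'd) ring_scheme
    \<Rightarrow> ('g, 'e) ring_scheme \<Rightarrow> ('x \<times> 'y \<Rightarrow> 'g) \<Rightarrow> bool"
  where "balanced B X Y G f \<longleftrightarrow>
    (\<forall>x\<in>carrier X. \<forall>y\<in>carrier Y. f (x, y) \<in> carrier G) \<and>
    (\<forall>x\<in>carrier X. \<forall>x'\<in>carrier X. \<forall>y\<in>carrier Y. f (x \<oplus>\<^bsub>X\<^esub> x', y) = f (x, y) \<oplus>\<^bsub>G\<^esub> f (x', y)) \<and>
    (\<forall>x\<in>carrier X. \<forall>y\<in>carrier Y. \<forall>y'\<in>carrier Y. f (x, y \<oplus>\<^bsub>Y\<^esub> y') = f (x, y) \<oplus>\<^bsub>G\<^esub> f (x, y')) \<and>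
    (\<forall>r l. (r, l) \<in> B \<longrightarrow> (\<forall>x\<in>carrier X. \<forall>y\<in>carrier Y. f (r x, y) = f (x, l y)))"

lemma balancedI:
  assumes "\<And>x y. \<lbrakk>x \<in> carrier X; y \<in> carrier Y\<rbrakk> \<Longrightarrow> f (x, y) \<in> carrier G"
    and "\<And>x x' y. \<lbrakk>x \<in> carrier X; x' \<in> carrier X; y \<in> carrier Y\<rbrakk> \<Longrightarrow>
      f (x \<oplus>\<^bsub>X\<^esub> x', y) = f (x, y) \<oplus>\<^bsub>G\<^esub> f (x', y)"
    and "\<And>x y y'. \<lbrakk>x \<in> carrier X; y \<in> carrier Y; y' \<in> carrier Y\<rbrakk> \<Longrightarrow>
      f (x, y \<oplus>\<^bsub>Y\<^esub> y') = f (x, y) \<oplus>\<^bsub>G\<^esub> f (x, y')"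
    and "\<And>r l x y. \<lbrakk>(r, l) \<in> B; x \<in> carrier X; y \<in> carrier Y\<rbrakk> \<Longrightarrow> f (r x, y) = f (x, l y)"
  shows "balanced B X Y G f"
  using assms unfolding balanced_def by simp

section \<open>The universal property of the balanced tensor product\<close>

context abelian_group begin

text \<open>Keys outside the support contribute 0. Enlarging the index set lets two formal
  combinations and their sum be evaluated over the same set, whence additivity.\<close>

lemma frag_lift_superset:
  assumes f: "f \<in> S \<rightarrow> carrier G" and w: "Poly_Mapping.keys w \<subseteq> T" "T \<subseteq> S" "finite T"
  shows "frag_lift G f w = (\<Oplus>p\<in>T. [Poly_Mapping.lookup w p] \<cdot> f p)"
  unfolding frag_lift_def
proof (rule add.finprod_mono_neutral_cong_left)
  show "(\<lambda>p. [Poly_Mapping.lookup w p] \<cdot> f p) \<in> T \<rightarrow> carrier G"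
    using f w by (auto intro!: add.int_pow_closed)
  show "[Poly_Mapping.lookup w p] \<cdot> f p = \<zero>" if "p \<in> T - Poly_Mapping.keys w" for p
    using that by (simp add: in_keys_iff add_pow_def)
qed (use w in auto)

lemma frag_lift_hom:
  assumes f: "f \<in> S \<rightarrow> carrier G"
  shows "frag_lift G f \<in> hom (free_Abelian_group S) (add_monoid G)"
proof (rule homI)
  fix v assume v: "v \<in> carrier (free_Abelian_group S)"
  then have c: "(\<lambda>p. [Poly_Mapping.lookup v p] \<cdot> f p) \<in> T \<rightarrow> carrier G" if "T \<subseteq> S" for T
    using f that by (auto intro!: add.int_pow_closed)
  then show "frag_lift G f v \<in> carrier (add_monoid G)"
    using v by (auto simp: frag_lift_def intro!: finsum_closed)
  fix w assume w: "w \<in> carrier (free_Abelian_group S)"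
  let ?T = "Poly_Mapping.keys v \<union> Poly_Mapping.keys w"
  have T: "?T \<subseteq> S" using v w by simp
  have cw: "(\<lambda>p. [Poly_Mapping.lookup w p] \<cdot> f p) \<in> ?T \<rightarrow> carrier G"
    using f T by (auto intro!: add.int_pow_closed)
  have "frag_lift G f (v + w) = (\<Oplus>p\<in>?T. [Poly_Mapping.lookup (v + w) p] \<cdot> f p)"
    by (rule frag_lift_superset[OF f keys_add T]) simp
  also have "\<dots> = (\<Oplus>p\<in>?T. [Poly_Mapping.lookup v p] \<cdot> f p \<oplus> [Poly_Mapping.lookup w p] \<cdot> f p)"
  proof (rule finsum_cong')
    fix p assume "p \<in> ?T"
    then have "f p \<in> carrier G" using f T by blast
    then show "[Poly_Mapping.lookup (v + w) p] \<cdot> f p = [Poly_Mapping.lookup v p] \<cdot> f p \<oplus> [Poly_Mapping.lookup w p] \<cdot> f p"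
      by (simp add: lookup_add add.int_pow_mult)
  qed (use c[OF T] cw in auto)
  also have "\<dots> = (\<Oplus>p\<in>?T. [Poly_Mapping.lookup v p] \<cdot> f p) \<oplus> (\<Oplus>p\<in>?T. [Poly_Mapping.lookup w p] \<cdot> f p)"
    by (rule finsum_addf[OF c[OF T] cw])
  also have "\<dots> = frag_lift G f v \<oplus> frag_lift G f w"
    using frag_lift_superset[OF f Un_upper1 T] frag_lift_superset[OF f Un_upper2 T] by simp
  finally show "frag_lift G f (v \<otimes>\<^bsub>free_Abelian_group S\<^esub> w) = frag_lift G f v \<otimes>\<^bsub>add_monoid G\<^esub> frag_lift G f w"
    by simp
qed

lemma frag_lift_of:
  assumes "f p \<in> carrier G"
  shows "frag_lift G f (frag_of p) = f p"
proof -
  have "frag_lift G f (frag_of p) = (\<Oplus>q\<in>{p}. [Poly_Mapping.lookup (frag_of p) q] \<cdot> f q)"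
    using frag_lift_superset[of f "{p}" "frag_of p" "{p}"] assms by simp
  also have "\<dots> = f p" using assms by (simp add: finsum_insert[of "{}"])
  finally show ?thesis .
qed

lemma frag_lift_cong:
  assumes "\<And>p. p \<in> S \<Longrightarrow> f p = g p" "g \<in> S \<rightarrow> carrier G" "Poly_Mapping.keys w \<subseteq> S"
  shows "frag_lift G f w = frag_lift G g w"
  unfolding frag_lift_def
  by (rule finsum_cong') (use assms in \<open>auto intro!: add.int_pow_closed\<close>)

end

lemma frag_hom_eq:
  assumes "h \<in> hom (free_Abelian_group S) G" "h' \<in> hom (free_Abelian_group S) G" "group G"
    and "\<And>p. p \<in> S \<Longrightarrow> h (frag_of p) = h' (frag_of p)" and w: "Poly_Mapping.keys w \<subseteq> S"
  shows "h w = h' w"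
proof -
  interpret h: group_hom "free_Abelian_group S" G h
    using assms by (simp add: group_hom_def group_hom_axioms_def)
  interpret h': group_hom "free_Abelian_group S" G h'
    using assms by (simp add: group_hom_def group_hom_axioms_def)
  show ?thesis using w
  proof (induction w rule: free_Abelian_group_induct[consumes 1])
    case 1 then show ?case using h.hom_one h'.hom_one by simp
  next
    case (2 x y)
    have "h (x + - y) = h' (x + - y)"
      using 2 h.hom_mult[of x "- y"] h'.hom_mult[of x "- y"] h.hom_inv[of y] h'.hom_inv[of y] by simp
    then show ?case by simp
  qed (use assms in auto)
qed

text \<open>T is any record that shares its additive structure with \<open>tensor\<close>, so that
  the same facts serve \<open>rtensor\<close>, which adds an action, as well as
  \<open>summand\<close> and \<open>base_tensor\<close>.\<close>

locale tensor_product = X: abelian_group X + Y: abelian_group Y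
  for B :: "('x, 'y) balance" and X :: "('x, 'c) ring_scheme" and Y :: "('y, 'd) ring_scheme"
    and T :: "(('x, 'y) tens, 'e) ring_scheme" +
  assumes balance_closed: "\<lbrakk>(r, l) \<in> B; x \<in> carrier X; y \<in> carrier Y\<rbrakk> \<Longrightarrow> r x \<in> carrier X \<and> l y \<in> carrier Y"
    and carrier_T: "carrier T = carrier (tensor B X Y)"
    and add_T: "add T = add (tensor B X Y)"
    and zero_T: "ring.zero T = ring.zero (tensor B X Y)"
begin

abbreviation "Fr \<equiv> free_Abelian_group (carrier X \<times> carrier Y)"
abbreviation "tz \<equiv> tensor_zero B X Y"
abbreviation "tcls \<equiv> tensor_class B X Y"
abbreviation "pure \<equiv> pure_tensor B X Y"

lemma rels_subset: "tensor_rels B X Y \<subseteq> carrier Fr"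
proof -
  have *: "Poly_Mapping.keys (frag_of a - (frag_of b + frag_of c)) \<subseteq> {a, b, c}"
    "Poly_Mapping.keys (frag_of a - frag_of b) \<subseteq> {a, b}" for a b c :: "'x \<times> 'y"
    using keys_diff[of "frag_of a" "frag_of b + frag_of c"] keys_add[of "frag_of b" "frag_of c"]
      keys_diff[of "frag_of a" "frag_of b"] by (auto simp: keys_frag_of)
  show ?thesis
    unfolding tensor_rels_def
    by (intro Un_least subsetI; clarsimp;
        (drule subsetD[OF *(1)] | drule subsetD[OF *(2)])) (auto dest: balance_closed)
qed

lemma tz_subgroup: "subgroup tz Fr"
  unfolding tensor_zero_def
  by (rule group.generate_is_subgroup[OF group_free_Abelian_group rels_subset])

lemma tz_normal: "normal tz Fr"
  by (rule comm_group.subgroup_imp_normal[OF abelian_free_Abelian_group tz_subgroup])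

lemma tensor_simps:
  "carrier T = (\<lambda>w. tcls w) ` carrier Fr"
  "s \<oplus>\<^bsub>T\<^esub> t = s <#>\<^bsub>Fr\<^esub> t"
  "\<zero>\<^bsub>T\<^esub> = tz"
  by (auto simp: carrier_T add_T zero_T tensor_def Let_def FactGroup_def RCOSETS_def tensor_class_def)

lemma T_abelian: "abelian_group T"
proof -
  interpret Q: comm_group "Fr Mod tz"
    by (rule comm_group.abelian_FactGroup[OF abelian_free_Abelian_group tz_subgroup])
  have Q: "carrier (Fr Mod tz) = carrier T" "x \<otimes>\<^bsub>Fr Mod tz\<^esub> y = x \<oplus>\<^bsub>T\<^esub> y" "\<one>\<^bsub>Fr Mod tz\<^esub> = \<zero>\<^bsub>T\<^esub>" for x y
    by (simp_all add: carrier_T add_T zero_T tensor_def Let_def)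
  show ?thesis
    by (rule abelian_groupI)
      (use Q.m_closed Q.one_closed Q.m_assoc Q.m_comm Q.l_one Q.l_inv_ex in \<open>unfold Q, auto\<close>)
qed

sublocale T: abelian_group T by (rule T_abelian)

lemma tcls_closed: "Poly_Mapping.keys w \<subseteq> carrier X \<times> carrier Y \<Longrightarrow> tcls w \<in> carrier T"
  by (auto simp: tensor_simps)

lemma tcls_add:
  "\<lbrakk>Poly_Mapping.keys v \<subseteq> carrier X \<times> carrier Y; Poly_Mapping.keys w \<subseteq> carrier X \<times> carrier Y\<rbrakk>
    \<Longrightarrow> tcls (v + w) = tcls v \<oplus>\<^bsub>T\<^esub> tcls w"
  using normal.rcos_sum[OF tz_normal, of v w] by (simp add: tensor_simps tensor_class_def)

lemma tcls_hom: "tcls \<in> hom Fr (add_monoid T)"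
  by (rule homI) (simp_all add: tcls_closed tcls_add)

lemma tcls_rel:
  assumes "v - w \<in> tz" "Poly_Mapping.keys v \<subseteq> carrier X \<times> carrier Y" "Poly_Mapping.keys w \<subseteq> carrier X \<times> carrier Y"
  shows "tcls v = tcls w"
proof -
  have "v \<in> tz #>\<^bsub>Fr\<^esub> w" unfolding r_coset_def using assms(1) by force
  then show ?thesis
    unfolding tensor_class_def
    using group.repr_independence[OF group_free_Abelian_group _ _ tz_subgroup] assms by simp
qed

lemma pure_closed: "\<lbrakk>x \<in> carrier X; y \<in> carrier Y\<rbrakk> \<Longrightarrow> pure x y \<in> carrier T"
  by (simp add: pure_tensor_def tcls_closed)

lemma rel_in_tz: "w \<in> tensor_rels B X Y \<Longrightarrow> w \<in> tz"
  unfolding tensor_zero_def by (rule generate.incl)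

lemma pure_add_left:
  assumes "x \<in> carrier X" "x' \<in> carrier X" "y \<in> carrier Y"
  shows "pure (x \<oplus>\<^bsub>X\<^esub> x') y = pure x y \<oplus>\<^bsub>T\<^esub> pure x' y"
proof -
  have "frag_of (x \<oplus>\<^bsub>X\<^esub> x', y) - (frag_of (x, y) + frag_of (x', y)) \<in> tz"
    by (rule rel_in_tz) (use assms in \<open>auto simp: tensor_rels_def\<close>)
  then have "tcls (frag_of (x \<oplus>\<^bsub>X\<^esub> x', y)) = tcls (frag_of (x, y) + frag_of (x', y))"
    by (rule tcls_rel) (use assms keys_add[of "frag_of (x, y)" "frag_of (x', y)"] in auto)
  then show ?thesis using assms by (simp add: pure_tensor_def tcls_add)
qed

lemma pure_add_right:
  assumes "x \<in> carrier X" "y \<in> carrier Y" "y' \<in> carrier Y"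
  shows "pure x (y \<oplus>\<^bsub>Y\<^esub> y') = pure x y \<oplus>\<^bsub>T\<^esub> pure x y'"
proof -
  have "frag_of (x, y \<oplus>\<^bsub>Y\<^esub> y') - (frag_of (x, y) + frag_of (x, y')) \<in> tz"
    by (rule rel_in_tz) (use assms in \<open>auto simp: tensor_rels_def\<close>)
  then have "tcls (frag_of (x, y \<oplus>\<^bsub>Y\<^esub> y')) = tcls (frag_of (x, y) + frag_of (x, y'))"
    by (rule tcls_rel) (use assms keys_add[of "frag_of (x, y)" "frag_of (x, y')"] in auto)
  then show ?thesis using assms by (simp add: pure_tensor_def tcls_add)
qed

lemma pure_balance:
  assumes "(r, l) \<in> B" "x \<in> carrier X" "y \<in> carrier Y"
  shows "pure (r x) y = pure x (l y)"
proof -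
  have "frag_of (r x, y) - frag_of (x, l y) \<in> tz"
    by (rule rel_in_tz) (use assms in \<open>auto simp: tensor_rels_def\<close>)
  then show ?thesis
    unfolding pure_tensor_def by (rule tcls_rel) (use assms balance_closed in auto)
qed

lemma tensor_cases:
  assumes "t \<in> carrier T"
  obtains w where "Poly_Mapping.keys w \<subseteq> carrier X \<times> carrier Y" "t = tcls w" "w \<in> t"
proof -
  obtain w where w: "Poly_Mapping.keys w \<subseteq> carrier X \<times> carrier Y" "t = tcls w"
    using assms by (auto simp: tensor_simps)
  moreover have "w \<in> t"
    using group.rcos_self[OF group_free_Abelian_group _ tz_subgroup] w by (simp add: tensor_class_def)
  ultimately show ?thesis using that by blast
qed

lemma tensor_rep:
  assumes "t \<in> carrier T" "w \<in> t"
  shows "Poly_Mapping.keys w \<subseteq> carrier X \<times> carrier Y" "tcls w = t"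
proof -
  obtain v where v: "Poly_Mapping.keys v \<subseteq> carrier X \<times> carrier Y" "t = tcls v" "v \<in> t"
    using tensor_cases[OF assms(1)] by blast
  have wv: "w \<in> tz #>\<^bsub>Fr\<^esub> v" using assms(2) v(2) by (simp add: tensor_class_def)
  then show "Poly_Mapping.keys w \<subseteq> carrier X \<times> carrier Y"
    using subgroup.elemrcos_carrier[OF tz_subgroup group_free_Abelian_group _ wv] v(1) by simp
  show "tcls w = t"
    using group.repr_independence[OF group_free_Abelian_group wv _ tz_subgroup] v
    by (simp add: tensor_class_def)
qed

text \<open>The inductive step is subtraction, as in the induction principle for free abelian
  groups: negatives then need no case of their own, and zero arises as p - p.\<close>

lemma tensor_induct [consumes 1, case_names pure diff]:
  assumes "t \<in> carrier T"
    and pure: "\<And>x y. \<lbrakk>x \<in> carrier X; y \<in> carrier Y\<rbrakk> \<Longrightarrow> P (pure x y)"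
    and diff: "\<And>s t. \<lbrakk>s \<in> carrier T; t \<in> carrier T; P s; P t\<rbrakk> \<Longrightarrow> P (s \<ominus>\<^bsub>T\<^esub> t)"
  shows "P t"
proof -
  interpret h: group_hom Fr "add_monoid T" tcls
    using tcls_hom by (simp add: group_hom_def group_hom_axioms_def T.a_group)
  obtain w where w: "Poly_Mapping.keys w \<subseteq> carrier X \<times> carrier Y" "t = tcls w"
    using tensor_cases[OF assms(1)] by blast
  show ?thesis using w(1) unfolding w(2)
  proof (induction w rule: free_Abelian_group_induct[consumes 1])
    case 1
    have p: "pure \<zero>\<^bsub>X\<^esub> \<zero>\<^bsub>Y\<^esub> \<in> carrier T" by (simp add: pure_closed)
    have "P (pure \<zero>\<^bsub>X\<^esub> \<zero>\<^bsub>Y\<^esub> \<ominus>\<^bsub>T\<^esub> pure \<zero>\<^bsub>X\<^esub> \<zero>\<^bsub>Y\<^esub>)" by (rule diff[OF p p]) (simp_all add: pure)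
    then show ?case using h.hom_one T.diff_self[OF p] by simp
  next
    case (2 x y)
    have "tcls (x - y) = tcls x \<ominus>\<^bsub>T\<^esub> tcls y"
      using 2 h.hom_mult[of x "- y"] h.hom_inv[of y] by (simp add: a_minus_def a_inv_def)
    then show ?case using diff[OF tcls_closed tcls_closed] 2 by simp
  next
    case (3 a) then show ?case using pure by (cases a) (auto simp: pure_tensor_def)
  qed
qed

text \<open>The standard way to prove identities between tensors below: both sides are exhibited as
  additive maps and compared on pure tensors.\<close>

lemma tensor_hom_eqI:
  assumes h: "abelian_group_hom T G h" and h': "abelian_group_hom T G h'"
    and eq: "\<And>x y. \<lbrakk>x \<in> carrier X; y \<in> carrier Y\<rbrakk> \<Longrightarrow> h (pure x y) = h' (pure x y)"
    and t: "t \<in> carrier T"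
  shows "h t = h' t"
  using t
proof (induction rule: tensor_induct)
  case (diff s t)
  then show ?case using abelian_group_hom.hom_minus[OF h] abelian_group_hom.hom_minus[OF h'] by simp
qed (rule eq)

text \<open>Each clause of balancedness sends one kind of defining relation to 0; the kernel is a
  subgroup, so it contains everything that the relations generate.\<close>

lemma frag_lift_tz:
  assumes G: "abelian_group G" and f: "balanced B X Y G f" and w: "w \<in> tz"
  shows "frag_lift G f w = \<zero>\<^bsub>G\<^esub>"
proof -
  interpret G: abelian_group G by fact
  have fc: "f \<in> carrier X \<times> carrier Y \<rightarrow> carrier G" using f by (auto simp: balanced_def)
  interpret h: group_hom Fr "add_monoid G" "frag_lift G f"
    using G.frag_lift_hom[OF fc] by (simp add: group_hom_def group_hom_axioms_def G.a_group)
  have gen: "frag_lift G f (frag_of p) = f p" if "p \<in> carrier X \<times> carrier Y" for p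
    by (rule G.frag_lift_of[where f = f, OF funcset_mem[OF fc that]])
  have add: "frag_lift G f (frag_of p + frag_of q) = f p \<oplus>\<^bsub>G\<^esub> f q"
    if "p \<in> carrier X \<times> carrier Y" "q \<in> carrier X \<times> carrier Y" for p q
    using h.hom_mult[of "frag_of p" "frag_of q"] gen that by simp
  have minus: "frag_lift G f (a - b) = frag_lift G f a \<ominus>\<^bsub>G\<^esub> frag_lift G f b"
    if "Poly_Mapping.keys a \<subseteq> carrier X \<times> carrier Y" "Poly_Mapping.keys b \<subseteq> carrier X \<times> carrier Y" for a b
    using that h.hom_mult[of a "- b"] h.hom_inv[of b] by (simp add: a_minus_def a_inv_def)
  have "tensor_rels B X Y \<subseteq> kernel Fr (add_monoid G) (frag_lift G f)"
  proof
    fix z assume z: "z \<in> tensor_rels B X Y"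
    have zc: "z \<in> carrier Fr" using z rels_subset by blast
    consider (1) x x' y where "z = frag_of (x \<oplus>\<^bsub>X\<^esub> x', y) - (frag_of (x, y) + frag_of (x', y))"
        "x \<in> carrier X" "x' \<in> carrier X" "y \<in> carrier Y"
      | (2) x y y' where "z = frag_of (x, y \<oplus>\<^bsub>Y\<^esub> y') - (frag_of (x, y) + frag_of (x, y'))"
        "x \<in> carrier X" "y \<in> carrier Y" "y' \<in> carrier Y"
      | (3) r l x y where "z = frag_of (r x, y) - frag_of (x, l y)" "(r, l) \<in> B" "x \<in> carrier X" "y \<in> carrier Y"
      using z unfolding tensor_rels_def by blast
    then have "frag_lift G f z = \<zero>\<^bsub>G\<^esub>"
    proof cases
      case 1
      have "f (x \<oplus>\<^bsub>X\<^esub> x', y) = f (x, y) \<oplus>\<^bsub>G\<^esub> f (x', y)" using f 1 by (simp add: balanced_def)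
      moreover have "Poly_Mapping.keys (frag_of (x, y) + frag_of (x', y)) \<subseteq> carrier X \<times> carrier Y"
        using 1 keys_add[of "frag_of (x, y)" "frag_of (x', y)"] by auto
      moreover have "f (x, y) \<in> carrier G" "f (x', y) \<in> carrier G" using fc 1 by auto
      ultimately show ?thesis using 1 by (simp add: minus gen add G.diff_self)
    next
      case 2
      have "f (x, y \<oplus>\<^bsub>Y\<^esub> y') = f (x, y) \<oplus>\<^bsub>G\<^esub> f (x, y')" using f 2 by (simp add: balanced_def)
      moreover have "Poly_Mapping.keys (frag_of (x, y) + frag_of (x, y')) \<subseteq> carrier X \<times> carrier Y"
        using 2 keys_add[of "frag_of (x, y)" "frag_of (x, y')"] by auto
      moreover have "f (x, y) \<in> carrier G" "f (x, y') \<in> carrier G" using fc 2 by auto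
      ultimately show ?thesis using 2 by (simp add: minus gen add G.diff_self)
    next
      case 3
      have c: "r x \<in> carrier X" "l y \<in> carrier Y" using balance_closed 3 by blast+
      have "f (r x, y) = f (x, l y)" using f 3 unfolding balanced_def by blast
      moreover have "f (x, l y) \<in> carrier G" using fc 3 c by auto
      ultimately show ?thesis using 3 c by (simp add: minus gen G.diff_self)
    qed
    then show "z \<in> kernel Fr (add_monoid G) (frag_lift G f)" using zc by (simp add: kernel_def)
  qed
  then have "tz \<subseteq> kernel Fr (add_monoid G) (frag_lift G f)"
    unfolding tensor_zero_def
    by (intro group.generate_subgroup_incl[OF group_free_Abelian_group _ h.subgroup_kernel])
  then show ?thesis using w by (auto simp: kernel_def)
qed

text \<open>Representatives of a class differ by elements that the lift kills, so the set under
  \<open>the_elem\<close> is a singleton and any representative may be used.\<close>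

lemma tlift_rep:
  assumes G: "abelian_group G" and f: "balanced B X Y G f" and t: "t \<in> carrier T" and w: "w \<in> t"
  shows "tlift G f t = frag_lift G f w"
proof -
  interpret G: abelian_group G by fact
  have fc: "f \<in> carrier X \<times> carrier Y \<rightarrow> carrier G" using f by (auto simp: balanced_def)
  interpret h: group_hom Fr "add_monoid G" "frag_lift G f"
    using G.frag_lift_hom[OF fc] by (simp add: group_hom_def group_hom_axioms_def G.a_group)
  note wk = tensor_rep(1)[OF t w]
  have "frag_lift G f v = frag_lift G f w" if v: "v \<in> t" for v
  proof -
    have "v \<in> tz #>\<^bsub>Fr\<^esub> w" using v tensor_rep(2)[OF t w] by (simp add: tensor_class_def)
    then obtain z where z: "z \<in> tz" "v = z + w" by (auto simp: r_coset_def)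
    have "z \<in> carrier Fr" using z(1) subgroup.subset[OF tz_subgroup] by blast
    then show ?thesis
      using h.hom_mult[of z w] wk z frag_lift_tz[OF G f z(1)] h.hom_closed[of w] by simp
  qed
  then have "frag_lift G f ` t = {frag_lift G f w}" using w by blast
  then show ?thesis by (simp add: tlift_def)
qed

lemma tlift_hom:
  assumes G: "abelian_group G" and f: "balanced B X Y G f"
  shows "abelian_group_hom T G (tlift G f)"
proof -
  interpret G: abelian_group G by fact
  have fc: "f \<in> carrier X \<times> carrier Y \<rightarrow> carrier G" using f by (auto simp: balanced_def)
  interpret h: group_hom Fr "add_monoid G" "frag_lift G f"
    using G.frag_lift_hom[OF fc] by (simp add: group_hom_def group_hom_axioms_def G.a_group)
  show ?thesis
  proof (rule abelian_group_hom_intro[OF T_abelian G])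
    fix s assume s: "s \<in> carrier T"
    obtain v where v: "Poly_Mapping.keys v \<subseteq> carrier X \<times> carrier Y" "s = tcls v" "v \<in> s"
      using tensor_cases[OF s] by blast
    show "tlift G f s \<in> carrier G"
      using tlift_rep[OF G f s v(3)] h.hom_closed[of v] v(1) by simp
    fix t assume t: "t \<in> carrier T"
    obtain w where w: "Poly_Mapping.keys w \<subseteq> carrier X \<times> carrier Y" "t = tcls w" "w \<in> t"
      using tensor_cases[OF t] by blast
    have k: "Poly_Mapping.keys (v + w) \<subseteq> carrier X \<times> carrier Y" using v(1) w(1) keys_add[of v w] by blast
    have "s \<oplus>\<^bsub>T\<^esub> t = tcls (v + w)" using v w by (simp add: tcls_add)
    then have "v + w \<in> s \<oplus>\<^bsub>T\<^esub> t"
      using group.rcos_self[OF group_free_Abelian_group _ tz_subgroup, of "v + w"] k by (simp add: tensor_class_def)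
    then show "tlift G f (s \<oplus>\<^bsub>T\<^esub> t) = tlift G f s \<oplus>\<^bsub>G\<^esub> tlift G f t"
      using tlift_rep[OF G f T.add.m_closed[OF s t]] tlift_rep[OF G f s v(3)] tlift_rep[OF G f t w(3)]
        h.hom_mult[of v w] v(1) w(1) by simp
  qed
qed

lemma tlift_pure:
  assumes G: "abelian_group G" and f: "balanced B X Y G f" and "x \<in> carrier X" "y \<in> carrier Y"
  shows "tlift G f (pure x y) = f (x, y)"
proof -
  have "frag_of (x, y) \<in> pure x y"
    using group.rcos_self[OF group_free_Abelian_group _ tz_subgroup, of "frag_of (x, y)"] assms
    by (simp add: pure_tensor_def tensor_class_def)
  then show ?thesis
    using tlift_rep[OF G f pure_closed] assms abelian_group.frag_lift_of[OF G, of f "(x, y)"]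
    by (simp add: balanced_def)
qed

lemmas tlift_closed = abelian_group_hom.hom_closed[OF tlift_hom]
lemmas tlift_add = abelian_group_hom.hom_add[OF tlift_hom]

text \<open>The keys of every representative lie in the carriers, so agreement there is enough. This
  is how the functions under a lift get rewritten when they agree only for elements of the
  modules.\<close>

lemma tlift_cong:
  assumes G: "abelian_group G" and f: "balanced B X Y G f"
    and eq: "\<And>x y. \<lbrakk>x \<in> carrier X; y \<in> carrier Y\<rbrakk> \<Longrightarrow> g (x, y) = f (x, y)" and t: "t \<in> carrier T"
  shows "tlift G g t = tlift G f t"
proof -
  interpret G: abelian_group G by fact
  have fc: "f \<in> carrier X \<times> carrier Y \<rightarrow> carrier G" using f by (auto simp: balanced_def)
  have "frag_lift G g w = frag_lift G f w" if "w \<in> t" for w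
    by (rule G.frag_lift_cong[OF _ fc tensor_rep(1)[OF t that]]) (use eq in auto)
  then show ?thesis by (simp add: tlift_def)
qed

end

context tensor_product begin

lemma balanced_comp:
  assumes h: "abelian_group_hom G G' h" and g: "balanced B X Y G g"
  shows "balanced B X Y G' (\<lambda>p. h (g p))"
proof -
  interpret h: abelian_group_hom G G' h by fact
  show ?thesis using g unfolding balanced_def by (simp add: h.hom_add)
qed

lemma tlift_comp:
  assumes h: "abelian_group_hom G G' h" and g: "balanced B X Y G g" and t: "t \<in> carrier T"
  shows "h (tlift G g t) = tlift G' (\<lambda>p. h (g p)) t"
proof -
  interpret h: abelian_group_hom G G' h by fact
  have hg: "balanced B X Y G' (\<lambda>p. h (g p))" by (rule balanced_comp[OF h g])
  have "abelian_group_hom T G' (\<lambda>t. h (tlift G g t))"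
    using tlift_closed[OF h.G.abelian_group_axioms g] tlift_add[OF h.G.abelian_group_axioms g]
    by (intro abelian_group_hom_intro T_abelian h.H.abelian_group_axioms) auto
  then show ?thesis
    by (rule tensor_hom_eqI[OF _ tlift_hom[OF h.H.abelian_group_axioms hg] _ t])
      (simp add: tlift_pure[OF h.G.abelian_group_axioms g] tlift_pure[OF h.H.abelian_group_axioms hg])
qed

lemma tcls_frag_extend:
  assumes g: "\<And>p. p \<in> carrier X \<times> carrier Y \<Longrightarrow> Poly_Mapping.keys (g p) \<subseteq> carrier X \<times> carrier Y"
    and w: "Poly_Mapping.keys w \<subseteq> carrier X \<times> carrier Y"
  shows "tcls (frag_extend g w) = frag_lift T (\<lambda>p. tcls (g p)) w"
proof (rule frag_hom_eq[OF _ _ T.a_group _ w])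
  have k: "Poly_Mapping.keys (frag_extend g v) \<subseteq> carrier X \<times> carrier Y"
    if "Poly_Mapping.keys v \<subseteq> carrier X \<times> carrier Y" for v
    using keys_frag_extend[of g v] g that by blast
  show "(\<lambda>w. tcls (frag_extend g w)) \<in> hom Fr (add_monoid T)"
    by (rule homI) (simp_all add: k tcls_closed tcls_add frag_extend_add)
  show "frag_lift T (\<lambda>p. tcls (g p)) \<in> hom Fr (add_monoid T)"
    by (rule T.frag_lift_hom) (use g tcls_closed in auto)
  show "tcls (frag_extend g (frag_of p)) = frag_lift T (\<lambda>p. tcls (g p)) (frag_of p)"
    if "p \<in> carrier X \<times> carrier Y" for p
    using T.frag_lift_of[of "\<lambda>p. tcls (g p)" p] tcls_closed[OF g[OF that]] by simp
qed

text \<open>The field \<open>monoid.mult\<close> collects classes over all pairs of representatives;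
  the two balance conditions make this collection a singleton. Written as an iterated lift, the
  product can be compared on pure tensors.\<close>

lemma tensor_mult:
  assumes mult_T: "monoid.mult T = monoid.mult (tensor B X Y)"
    and multX: "\<And>x x'. \<lbrakk>x \<in> carrier X; x' \<in> carrier X\<rbrakk> \<Longrightarrow> x \<otimes>\<^bsub>X\<^esub> x' \<in> carrier X"
    and multY: "\<And>y y'. \<lbrakk>y \<in> carrier Y; y' \<in> carrier Y\<rbrakk> \<Longrightarrow> y \<otimes>\<^bsub>Y\<^esub> y' \<in> carrier Y"
    and inner: "\<And>x y. \<lbrakk>x \<in> carrier X; y \<in> carrier Y\<rbrakk> \<Longrightarrow>
      balanced B X Y T (\<lambda>(x', y'). pure (x \<otimes>\<^bsub>X\<^esub> x') (y \<otimes>\<^bsub>Y\<^esub> y'))"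
    and outer: "balanced B X Y T (\<lambda>(x, y). tlift T (\<lambda>(x', y'). pure (x \<otimes>\<^bsub>X\<^esub> x') (y \<otimes>\<^bsub>Y\<^esub> y')) t)"
    and s: "s \<in> carrier T" and t: "t \<in> carrier T"
  shows "s \<otimes>\<^bsub>T\<^esub> t = tlift T (\<lambda>(x, y). tlift T (\<lambda>(x', y'). pure (x \<otimes>\<^bsub>X\<^esub> x') (y \<otimes>\<^bsub>Y\<^esub> y')) t) s"
    (is "_ = ?R")
proof -
  let ?g = "\<lambda>w' (x, y). frag_extend (\<lambda>(x', y'). frag_of (x \<otimes>\<^bsub>X\<^esub> x', y \<otimes>\<^bsub>Y\<^esub> y')) w'"
  have R: "tcls (frag_extend (?g w') w) = ?R" if w: "w \<in> s" and w': "w' \<in> t" for w w'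
  proof -
    note wk = tensor_rep(1)[OF s w] and wk' = tensor_rep(1)[OF t w']
    have gk: "Poly_Mapping.keys (?g w' p) \<subseteq> carrier X \<times> carrier Y" if "p \<in> carrier X \<times> carrier Y" for p
    proof -
      obtain x y where p: "p = (x, y)" "x \<in> carrier X" "y \<in> carrier Y" using \<open>p \<in> _\<close> by blast
      have "Poly_Mapping.keys (frag_of (x \<otimes>\<^bsub>X\<^esub> fst q, y \<otimes>\<^bsub>Y\<^esub> snd q)) \<subseteq> carrier X \<times> carrier Y"
        if "q \<in> Poly_Mapping.keys w'" for q
      proof -
        have "fst q \<in> carrier X" "snd q \<in> carrier Y" using subsetD[OF wk' that] by auto
        then show ?thesis using p multX multY by simp
      qed
      then show ?thesis
        using keys_frag_extend[of "\<lambda>(x', y'). frag_of (x \<otimes>\<^bsub>X\<^esub> x', y \<otimes>\<^bsub>Y\<^esub> y')" w']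
        unfolding p(1) case_prod_beta by fastforce
    qed
    have in_t: "tcls (?g w' (x, y)) = tlift T (\<lambda>(x', y'). pure (x \<otimes>\<^bsub>X\<^esub> x') (y \<otimes>\<^bsub>Y\<^esub> y')) t"
      if xy: "x \<in> carrier X" "y \<in> carrier Y" for x y
    proof -
      have "tcls (?g w' (x, y)) = frag_lift T (\<lambda>p. tcls ((\<lambda>(x', y'). frag_of (x \<otimes>\<^bsub>X\<^esub> x', y \<otimes>\<^bsub>Y\<^esub> y')) p)) w'"
        unfolding prod.case by (rule tcls_frag_extend[OF _ wk']) (use xy multX multY in auto)
      also have "(\<lambda>p. tcls ((\<lambda>(x', y'). frag_of (x \<otimes>\<^bsub>X\<^esub> x', y \<otimes>\<^bsub>Y\<^esub> y')) p)) =
          (\<lambda>(x', y'). pure (x \<otimes>\<^bsub>X\<^esub> x') (y \<otimes>\<^bsub>Y\<^esub> y'))"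
        by (auto simp: pure_tensor_def)
      also have "frag_lift T \<dots> w' = tlift T (\<lambda>(x', y'). pure (x \<otimes>\<^bsub>X\<^esub> x') (y \<otimes>\<^bsub>Y\<^esub> y')) t"
        by (rule tlift_rep[OF T_abelian inner[OF xy] t w', symmetric])
      finally show ?thesis .
    qed
    have "tcls (frag_extend (?g w') w) = frag_lift T (\<lambda>p. tcls (?g w' p)) w"
      by (rule tcls_frag_extend[OF gk wk])
    also have "\<dots> = frag_lift T (\<lambda>(x, y). tlift T (\<lambda>(x', y'). pure (x \<otimes>\<^bsub>X\<^esub> x') (y \<otimes>\<^bsub>Y\<^esub> y')) t) w"
      by (rule T.frag_lift_cong[OF _ _ wk]) (use in_t outer in \<open>auto simp: balanced_def\<close>)
    also have "\<dots> = ?R" by (rule tlift_rep[OF T_abelian outer s w, symmetric])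
    finally show ?thesis .
  qed
  obtain w w' where "w \<in> s" "w' \<in> t" using tensor_cases s t by metis
  then have "{tcls (frag_extend (?g w') w) | w w'. w \<in> s \<and> w' \<in> t} = {?R}" using R by blast
  then show ?thesis unfolding mult_T tensor_def Let_def by simp
qed

end

section \<open>Right modules, their tensor products and duals over a commutative ring\<close>

lemma rlin_closed: "\<lbrakk>f \<in> rlin R M N; x \<in> carrier M\<rbrakk> \<Longrightarrow> f x \<in> carrier N"
  by (auto simp: rlin_def)

lemma rlin_add: "\<lbrakk>f \<in> rlin R M N; x \<in> carrier M; y \<in> carrier M\<rbrakk> \<Longrightarrow> f (x \<oplus>\<^bsub>M\<^esub> y) = f x \<oplus>\<^bsub>N\<^esub> f y"
  by (auto simp: rlin_def)

lemma rlin_ract: "\<lbrakk>f \<in> rlin R M N; x \<in> carrier M; r \<in> carrier R\<rbrakk> \<Longrightarrow> f (x \<triangleleft>\<^bsub>M\<^esub> r) = f x \<triangleleft>\<^bsub>N\<^esub> r"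
  by (auto simp: rlin_def)

lemma rlin_extensional: "f \<in> rlin R M N \<Longrightarrow> f \<in> extensional (carrier M)"
  by (auto simp: rlin_def PiE_def)

lemma rlin_eqI:
  assumes "f \<in> rlin R M N" "g \<in> rlin R M N" "\<And>x. x \<in> carrier M \<Longrightarrow> f x = g x"
  shows "f = g"
  using assms rlin_extensional by (metis extensionalityI)

lemma rlinI:
  assumes "\<And>x. x \<in> carrier M \<Longrightarrow> f x \<in> carrier N" "f \<in> extensional (carrier M)"
    "\<And>x y. \<lbrakk>x \<in> carrier M; y \<in> carrier M\<rbrakk> \<Longrightarrow> f (x \<oplus>\<^bsub>M\<^esub> y) = f x \<oplus>\<^bsub>N\<^esub> f y"
    "\<And>x r. \<lbrakk>x \<in> carrier M; r \<in> carrier R\<rbrakk> \<Longrightarrow> f (x \<triangleleft>\<^bsub>M\<^esub> r) = f x \<triangleleft>\<^bsub>N\<^esub> r"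
  shows "f \<in> rlin R M N"
  using assms by (auto simp: rlin_def PiE_def)

lemma rlin_hom:
  assumes "f \<in> rlin R M N" "abelian_group M" "abelian_group N"
  shows "abelian_group_hom M N f"
  using assms by (intro abelian_group_hom_intro) (auto simp: rlin_def)

lemma rlin_compose:
  assumes "f \<in> rlin R M N" "g \<in> rlin R N P"
    and "\<And>x y. \<lbrakk>x \<in> carrier M; y \<in> carrier M\<rbrakk> \<Longrightarrow> x \<oplus>\<^bsub>M\<^esub> y \<in> carrier M"
    and "\<And>x r. \<lbrakk>x \<in> carrier M; r \<in> carrier R\<rbrakk> \<Longrightarrow> x \<triangleleft>\<^bsub>M\<^esub> r \<in> carrier M"
  shows "compose (carrier M) g f \<in> rlin R M P"
  using assms by (auto intro!: rlinI simp: compose_def rlin_closed rlin_add rlin_ract)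

lemma regular_rmod_simps [simp]:
  "carrier (regular_rmod R) = carrier R" "x \<oplus>\<^bsub>regular_rmod R\<^esub> y = x \<oplus>\<^bsub>R\<^esub> y"
  "\<zero>\<^bsub>regular_rmod R\<^esub> = \<zero>\<^bsub>R\<^esub>" "x \<triangleleft>\<^bsub>regular_rmod R\<^esub> r = x \<otimes>\<^bsub>R\<^esub> r"
  by (simp_all add: regular_rmod_def ring.defs rmod.defs)

lemma abelian_group_cong:
  assumes "abelian_group G" "carrier H = carrier G" "\<zero>\<^bsub>H\<^esub> = \<zero>\<^bsub>G\<^esub>"
    "\<And>x y. \<lbrakk>x \<in> carrier G; y \<in> carrier G\<rbrakk> \<Longrightarrow> x \<oplus>\<^bsub>H\<^esub> y = x \<oplus>\<^bsub>G\<^esub> y"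
  shows "abelian_group H"
proof -
  interpret G: abelian_group G by fact
  show ?thesis
    by (rule abelian_groupI) (use G.a_assoc G.a_comm G.l_neg in \<open>auto simp: assms intro!: bexI[OF _ G.a_inv_closed]\<close>)
qed

context right_module begin

lemma ract_hom: "r \<in> carrier R \<Longrightarrow> abelian_group_hom M M (\<lambda>m. m \<triangleleft>\<^bsub>M\<^esub> r)"
  by (intro abelian_group_hom_intro M.abelian_group_axioms) (auto simp: ract_closed ract_add_left)

end

lemma regular_right_module: "ring R \<Longrightarrow> right_module R (regular_rmod R)"
proof -
  assume "ring R"
  then interpret ring R .
  have "abelian_group (regular_rmod R)" by (rule abelian_group_cong[OF abelian_group_axioms]) simp_all
  then show ?thesis
    by (intro right_module.intro right_module_axioms.intro \<open>ring R\<close>) (simp_all add: l_distr r_distr m_assoc)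
qed

locale rmod_tensor = A: cring A + X: right_module A X + Y: right_module A Y
  for A :: "('a, 'c) ring_scheme" and X :: "('a, 'x, 'd) rmod_scheme" and Y :: "('a, 'y, 'e) rmod_scheme"
begin

lemma rtensor_simps:
  "carrier (rtensor A X Y) = carrier (tensor (rbalance A X Y) X Y)"
  "add (rtensor A X Y) = add (tensor (rbalance A X Y) X Y)"
  "ring.zero (rtensor A X Y) = ring.zero (tensor (rbalance A X Y) X Y)"
  "monoid.mult (rtensor A X Y) = monoid.mult (tensor (rbalance A X Y) X Y)"
  "one (rtensor A X Y) = one (tensor (rbalance A X Y) X Y)"
  "t \<triangleleft>\<^bsub>rtensor A X Y\<^esub> a = tlift (tensor (rbalance A X Y) X Y) (\<lambda>(x, y). rpure A X Y x (y \<triangleleft>\<^bsub>Y\<^esub> a)) t"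
  by (simp_all add: rtensor_def Let_def ring.defs rmod.defs)

sublocale tensor_product "rbalance A X Y" X Y "rtensor A X Y"
  by unfold_locales (auto simp: rbalance_def rtensor_simps X.ract_closed Y.ract_closed)

lemma balanced_rI:
  assumes "\<And>x y. \<lbrakk>x \<in> carrier X; y \<in> carrier Y\<rbrakk> \<Longrightarrow> f (x, y) \<in> carrier G"
    and "\<And>x x' y. \<lbrakk>x \<in> carrier X; x' \<in> carrier X; y \<in> carrier Y\<rbrakk> \<Longrightarrow>
      f (x \<oplus>\<^bsub>X\<^esub> x', y) = f (x, y) \<oplus>\<^bsub>G\<^esub> f (x', y)"
    and "\<And>x y y'. \<lbrakk>x \<in> carrier X; y \<in> carrier Y; y' \<in> carrier Y\<rbrakk> \<Longrightarrow>
      f (x, y \<oplus>\<^bsub>Y\<^esub> y') = f (x, y) \<oplus>\<^bsub>G\<^esub> f (x, y')"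
    and "\<And>a x y. \<lbrakk>a \<in> carrier A; x \<in> carrier X; y \<in> carrier Y\<rbrakk> \<Longrightarrow> f (x \<triangleleft>\<^bsub>X\<^esub> a, y) = f (x, y \<triangleleft>\<^bsub>Y\<^esub> a)"
  shows "balanced (rbalance A X Y) X Y G f"
  by (rule balancedI) (use assms in \<open>auto simp: rbalance_def\<close>)

lemma balanced_rD:
  assumes "balanced (rbalance A X Y) X Y G f" "a \<in> carrier A" "x \<in> carrier X" "y \<in> carrier Y"
  shows "f (x \<triangleleft>\<^bsub>X\<^esub> a, y) = f (x, y \<triangleleft>\<^bsub>Y\<^esub> a)"
proof -
  have "(\<lambda>x. x \<triangleleft>\<^bsub>X\<^esub> a, \<lambda>y. y \<triangleleft>\<^bsub>Y\<^esub> a) \<in> rbalance A X Y" using assms(2) by (auto simp: rbalance_def)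
  then show ?thesis using assms unfolding balanced_def by blast
qed

lemma pure_ract_balance:
  assumes "a \<in> carrier A" "x \<in> carrier X" "y \<in> carrier Y"
  shows "pure (x \<triangleleft>\<^bsub>X\<^esub> a) y = pure x (y \<triangleleft>\<^bsub>Y\<^esub> a)"
  using pure_balance[of "\<lambda>x. x \<triangleleft>\<^bsub>X\<^esub> a" "\<lambda>y. y \<triangleleft>\<^bsub>Y\<^esub> a" x y] assms by (auto simp: rbalance_def)

lemma rpure_eq: "rpure A X Y = pure"
  by (simp add: rpure_def fun_eq_iff)

lemma tensor_abelian: "abelian_group (tensor (rbalance A X Y) X Y)"
  by (rule abelian_group_cong[OF T_abelian]) (simp_all add: rtensor_simps)

text \<open>Letting a act on the second factor is compatible with moving b across the tensor sign
  because a and b commute in A.\<close>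

lemma balanced_ract:
  assumes "a \<in> carrier A"
  shows "balanced (rbalance A X Y) X Y (tensor (rbalance A X Y) X Y) (\<lambda>(x, y). pure x (y \<triangleleft>\<^bsub>Y\<^esub> a))"
proof (rule balanced_rI)
  show "(case (x \<triangleleft>\<^bsub>X\<^esub> b, y) of (x, y) \<Rightarrow> pure x (y \<triangleleft>\<^bsub>Y\<^esub> a)) = (case (x, y \<triangleleft>\<^bsub>Y\<^esub> b) of (x, y) \<Rightarrow> pure x (y \<triangleleft>\<^bsub>Y\<^esub> a))"
    if "b \<in> carrier A" "x \<in> carrier X" "y \<in> carrier Y" for b x y
    using that assms Y.ract_mult[of y a b] Y.ract_mult[of y b a]
    by (simp add: pure_ract_balance Y.ract_closed A.m_comm)
qed (use assms pure_closed pure_add_left pure_add_right in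
    \<open>auto simp: rtensor_simps X.ract_closed Y.ract_closed Y.ract_add_left\<close>)

lemma ract_pure:
  "\<lbrakk>a \<in> carrier A; x \<in> carrier X; y \<in> carrier Y\<rbrakk> \<Longrightarrow> pure x y \<triangleleft>\<^bsub>rtensor A X Y\<^esub> a = pure x (y \<triangleleft>\<^bsub>Y\<^esub> a)"
  using tlift_pure[OF tensor_abelian balanced_ract] by (simp add: rtensor_simps rpure_eq)

lemma ract_tensor_hom:
  assumes "a \<in> carrier A"
  shows "abelian_group_hom (rtensor A X Y) (rtensor A X Y) (\<lambda>t. t \<triangleleft>\<^bsub>rtensor A X Y\<^esub> a)"
  using tlift_closed[OF tensor_abelian balanced_ract[OF assms]] tlift_add[OF tensor_abelian balanced_ract[OF assms]]
  by (intro abelian_group_hom_intro T_abelian) (simp_all add: rtensor_simps rpure_eq)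

lemma rtensor_right_module: "right_module A (rtensor A X Y)"
proof (intro right_module.intro right_module_axioms.intro A.ring_axioms T_abelian)
  fix m a assume m: "m \<in> carrier (rtensor A X Y)" and a: "a \<in> carrier A"
  interpret a: abelian_group_hom "rtensor A X Y" "rtensor A X Y" "\<lambda>t. t \<triangleleft>\<^bsub>rtensor A X Y\<^esub> a"
    by (rule ract_tensor_hom[OF a])
  show "m \<triangleleft>\<^bsub>rtensor A X Y\<^esub> a \<in> carrier (rtensor A X Y)" using m by (rule a.hom_closed)
  show "(m \<oplus>\<^bsub>rtensor A X Y\<^esub> n) \<triangleleft>\<^bsub>rtensor A X Y\<^esub> a =
      m \<triangleleft>\<^bsub>rtensor A X Y\<^esub> a \<oplus>\<^bsub>rtensor A X Y\<^esub> n \<triangleleft>\<^bsub>rtensor A X Y\<^esub> a"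
    if "n \<in> carrier (rtensor A X Y)" for n using a.hom_add m that by blast
  fix b assume b: "b \<in> carrier A"
  interpret b: abelian_group_hom "rtensor A X Y" "rtensor A X Y" "\<lambda>t. t \<triangleleft>\<^bsub>rtensor A X Y\<^esub> b"
    by (rule ract_tensor_hom[OF b])
  have ab: "a \<oplus>\<^bsub>A\<^esub> b \<in> carrier A" "a \<otimes>\<^bsub>A\<^esub> b \<in> carrier A" using a b by simp_all
  have "abelian_group_hom (rtensor A X Y) (rtensor A X Y)
      (\<lambda>t. t \<triangleleft>\<^bsub>rtensor A X Y\<^esub> a \<oplus>\<^bsub>rtensor A X Y\<^esub> t \<triangleleft>\<^bsub>rtensor A X Y\<^esub> b)"
    by (intro abelian_group_hom_intro T_abelian) (simp_all add: T.a_ac)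
  then show "m \<triangleleft>\<^bsub>rtensor A X Y\<^esub> (a \<oplus>\<^bsub>A\<^esub> b) =
      m \<triangleleft>\<^bsub>rtensor A X Y\<^esub> a \<oplus>\<^bsub>rtensor A X Y\<^esub> m \<triangleleft>\<^bsub>rtensor A X Y\<^esub> b"
    by (rule tensor_hom_eqI[OF ract_tensor_hom[OF ab(1)] _ _ m])
      (simp add: ract_pure a b Y.ract_closed Y.ract_add_right pure_add_right)
  have "abelian_group_hom (rtensor A X Y) (rtensor A X Y)
      (\<lambda>t. t \<triangleleft>\<^bsub>rtensor A X Y\<^esub> a \<triangleleft>\<^bsub>rtensor A X Y\<^esub> b)"
    by (intro abelian_group_hom_intro T_abelian) simp_all
  then show "m \<triangleleft>\<^bsub>rtensor A X Y\<^esub> (a \<otimes>\<^bsub>A\<^esub> b) = m \<triangleleft>\<^bsub>rtensor A X Y\<^esub> a \<triangleleft>\<^bsub>rtensor A X Y\<^esub> b"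
    by (rule tensor_hom_eqI[OF ract_tensor_hom[OF ab(2)] _ _ m])
      (simp add: ract_pure a b Y.ract_closed Y.ract_mult)
next
  fix m assume m: "m \<in> carrier (rtensor A X Y)"
  have "abelian_group_hom (rtensor A X Y) (rtensor A X Y) (\<lambda>t. t)"
    by (intro abelian_group_hom_intro T_abelian) simp_all
  then show "m \<triangleleft>\<^bsub>rtensor A X Y\<^esub> \<one>\<^bsub>A\<^esub> = m"
    by (rule tensor_hom_eqI[where h' = "\<lambda>t. t", OF ract_tensor_hom[OF A.one_closed] _ _ m]) (simp_all add: ract_pure Y.ract_one)
qed

end

lemma dual_group_simps [simp]:
  "carrier (dual_group A M) = rlin A M (regular_rmod A)"
  "\<zero>\<^bsub>dual_group A M\<^esub> = (\<lambda>m\<in>carrier M. \<zero>\<^bsub>A\<^esub>)"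
  "f \<oplus>\<^bsub>dual_group A M\<^esub> g = (\<lambda>m\<in>carrier M. f m \<oplus>\<^bsub>A\<^esub> g m)"
  by (simp_all add: dual_group_def)

lemma dual_abelian_group:
  assumes "cring A" "right_module A M"
  shows "abelian_group (dual_group A M)"
proof -
  interpret A: cring A by fact
  interpret M: right_module A M by fact
  note D = rlin_closed[where N = "regular_rmod A", simplified] rlin_add[where N = "regular_rmod A", simplified]
    rlin_ract[where N = "regular_rmod A", simplified] 
  show ?thesis
  proof (rule abelian_groupI; unfold dual_group_simps)
    fix f g assume f: "f \<in> rlin A M (regular_rmod A)" and g: "g \<in> rlin A M (regular_rmod A)"
    note DD = D[OF f] D[OF g]
    show "(\<lambda>m\<in>carrier M. f m \<oplus>\<^bsub>A\<^esub> g m) \<in> rlin A M (regular_rmod A)"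
      by (rule rlinI) (simp_all add: DD M.ract_closed A.a_ac A.l_distr)
    show "(\<lambda>m\<in>carrier M. f m \<oplus>\<^bsub>A\<^esub> g m) = (\<lambda>m\<in>carrier M. g m \<oplus>\<^bsub>A\<^esub> f m)"
      by (rule restrict_ext) (simp add: DD A.a_comm)
    show "(\<lambda>m\<in>carrier M. (\<lambda>m\<in>carrier M. f m \<oplus>\<^bsub>A\<^esub> g m) m \<oplus>\<^bsub>A\<^esub> h m) =
        (\<lambda>m\<in>carrier M. f m \<oplus>\<^bsub>A\<^esub> (\<lambda>m\<in>carrier M. g m \<oplus>\<^bsub>A\<^esub> h m) m)"
      if h: "h \<in> rlin A M (regular_rmod A)" for h
      by (rule restrict_ext) (simp add: DD D[OF h] A.a_assoc)
    show "(\<lambda>m\<in>carrier M. (\<lambda>m\<in>carrier M. \<zero>\<^bsub>A\<^esub>) m \<oplus>\<^bsub>A\<^esub> f m) = f"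
      by (rule extensionalityI[OF _ rlin_extensional[OF f]]) (simp_all add: DD)
    have "(\<lambda>m\<in>carrier M. \<ominus>\<^bsub>A\<^esub> f m) \<in> rlin A M (regular_rmod A)"
      by (rule rlinI) (simp_all add: DD M.ract_closed A.minus_add A.l_minus)
    moreover have "(\<lambda>m\<in>carrier M. (\<lambda>m\<in>carrier M. \<ominus>\<^bsub>A\<^esub> f m) m \<oplus>\<^bsub>A\<^esub> f m) = (\<lambda>m\<in>carrier M. \<zero>\<^bsub>A\<^esub>)"
      by (rule restrict_ext) (simp add: DD A.l_neg)
    ultimately show "\<exists>g\<in>rlin A M (regular_rmod A). (\<lambda>m\<in>carrier M. g m \<oplus>\<^bsub>A\<^esub> f m) = (\<lambda>m\<in>carrier M. \<zero>\<^bsub>A\<^esub>)"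
      by blast
  next
    show "(\<lambda>m\<in>carrier M. \<zero>\<^bsub>A\<^esub>) \<in> rlin A M (regular_rmod A)"
      by (rule rlinI) (simp_all add: M.ract_closed)
  qed
qed

section \<open>The convolution algebra\<close>

lemma UA_simps [simp]:
  "carrier (UA H) = carrier (total H)" "x \<oplus>\<^bsub>UA H\<^esub> y = x \<oplus>\<^bsub>total H\<^esub> y" "\<zero>\<^bsub>UA H\<^esub> = \<zero>\<^bsub>total H\<^esub>"
  "x \<otimes>\<^bsub>UA H\<^esub> y = x \<otimes>\<^bsub>total H\<^esub> y" "\<one>\<^bsub>UA H\<^esub> = \<one>\<^bsub>total H\<^esub>" "x \<triangleleft>\<^bsub>UA H\<^esub> a = x \<otimes>\<^bsub>total H\<^esub> src H a"
  by (simp_all add: UA_def ring.defs rmod.defs)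

section \<open>Calculus with the comultiplication: sums over the two legs become lifts of balanced
  functions\<close>

context cocomm_hopf_algebroid begin

abbreviation "A \<equiv> base H"
abbreviation "U \<equiv> total H"

sublocale A: cring A
  using base_algebra by (simp add: algebra_def)

sublocale U: ring U
  using total_algebra by (simp add: k_algebra_def)

lemma src_closed [simp]: "a \<in> carrier A \<Longrightarrow> src H a \<in> carrier U"
  and src_mult: "\<lbrakk>a \<in> carrier A; b \<in> carrier A\<rbrakk> \<Longrightarrow> src H (a \<otimes>\<^bsub>A\<^esub> b) = src H a \<otimes>\<^bsub>U\<^esub> src H b"
  and src_add: "\<lbrakk>a \<in> carrier A; b \<in> carrier A\<rbrakk> \<Longrightarrow> src H (a \<oplus>\<^bsub>A\<^esub> b) = src H a \<oplus>\<^bsub>U\<^esub> src H b"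
  and src_one [simp]: "src H \<one>\<^bsub>A\<^esub> = \<one>\<^bsub>U\<^esub>"
  using src_hom by (auto simp: ring_hom_def)

lemma UA_right_module: "right_module A (UA H)"
proof -
  have "abelian_group (UA H)" by (rule abelian_group_cong[OF U.abelian_group_axioms]) simp_all
  then show ?thesis
    by (intro right_module.intro right_module_axioms.intro A.ring_axioms)
      (simp_all add: U.l_distr U.r_distr U.m_assoc src_mult src_add)
qed

sublocale UU: rmod_tensor A "UA H" "UA H"
  by (intro rmod_tensor.intro UA_right_module A.cring_axioms)

lemma uu_eq: "uu H = UU.pure"
  by (rule UU.rpure_eq)

lemma comult_takeuchi: "u \<in> carrier U \<Longrightarrow> comult H u \<in> takeuchi H"
  using comult_hom by (auto simp: ring_hom_def)

lemma takeuchi_closed: "t \<in> takeuchi H \<Longrightarrow> t \<in> carrier (UU H)"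
  by (simp add: takeuchi_def)

lemma comult_closed: "u \<in> carrier U \<Longrightarrow> comult H u \<in> carrier (UU H)"
  using comult_takeuchi takeuchi_closed by blast

lemma comult_add: "\<lbrakk>u \<in> carrier U; v \<in> carrier U\<rbrakk> \<Longrightarrow>
    comult H (u \<oplus>\<^bsub>U\<^esub> v) = comult H u \<oplus>\<^bsub>UU H\<^esub> comult H v"
  and comult_mult: "\<lbrakk>u \<in> carrier U; v \<in> carrier U\<rbrakk> \<Longrightarrow>
    comult H (u \<otimes>\<^bsub>U\<^esub> v) = comult H u \<otimes>\<^bsub>UU H\<^esub> comult H v"
  and comult_one: "comult H \<one>\<^bsub>U\<^esub> = UU.pure \<one>\<^bsub>U\<^esub> \<one>\<^bsub>U\<^esub>"
  using comult_hom by (auto simp: ring_hom_def UU.rtensor_simps tensor_def Let_def)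

abbreviation "balUU \<equiv> balanced (rbalance A (UA H) (UA H)) (UA H) (UA H)"

lemma balUU_I:
  assumes "\<And>x y. \<lbrakk>x \<in> carrier U; y \<in> carrier U\<rbrakk> \<Longrightarrow> f (x, y) \<in> carrier G"
    and "\<And>x x' y. \<lbrakk>x \<in> carrier U; x' \<in> carrier U; y \<in> carrier U\<rbrakk> \<Longrightarrow>
      f (x \<oplus>\<^bsub>U\<^esub> x', y) = f (x, y) \<oplus>\<^bsub>G\<^esub> f (x', y)"
    and "\<And>x y y'. \<lbrakk>x \<in> carrier U; y \<in> carrier U; y' \<in> carrier U\<rbrakk> \<Longrightarrow>
      f (x, y \<oplus>\<^bsub>U\<^esub> y') = f (x, y) \<oplus>\<^bsub>G\<^esub> f (x, y')"
    and "\<And>a x y. \<lbrakk>a \<in> carrier A; x \<in> carrier U; y \<in> carrier U\<rbrakk> \<Longrightarrow>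
      f (x \<otimes>\<^bsub>U\<^esub> src H a, y) = f (x, y \<otimes>\<^bsub>U\<^esub> src H a)"
  shows "balUU G f"
  by (rule UU.balanced_rI) (use assms in auto)

lemma balUU_closed: "\<lbrakk>balUU G f; x \<in> carrier U; y \<in> carrier U\<rbrakk> \<Longrightarrow> f (x, y) \<in> carrier G"
  and balUU_add_left: "\<lbrakk>balUU G f; x \<in> carrier U; x' \<in> carrier U; y \<in> carrier U\<rbrakk> \<Longrightarrow>
    f (x \<oplus>\<^bsub>U\<^esub> x', y) = f (x, y) \<oplus>\<^bsub>G\<^esub> f (x', y)"
  and balUU_add_right: "\<lbrakk>balUU G f; x \<in> carrier U; y \<in> carrier U; y' \<in> carrier U\<rbrakk> \<Longrightarrow>
    f (x, y \<oplus>\<^bsub>U\<^esub> y') = f (x, y) \<oplus>\<^bsub>G\<^esub> f (x, y')"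
  by (simp_all add: balanced_def)

lemma balUU_mid: "\<lbrakk>balUU G f; a \<in> carrier A; x \<in> carrier U; y \<in> carrier U\<rbrakk> \<Longrightarrow>
    f (x \<otimes>\<^bsub>U\<^esub> src H a, y) = f (x, y \<otimes>\<^bsub>U\<^esub> src H a)"
  using UU.balanced_rD by fastforce

lemma pureUU: "balUU (UU H) (\<lambda>(x, y). UU.pure x y)"
  by (rule UU.balanced_rI) (auto simp: UU.pure_closed UU.pure_add_left[simplified] UU.pure_add_right[simplified]
      UU.pure_ract_balance[simplified])

lemma balUU_mult_left:
  assumes f: "balUU G f" and u: "u \<in> carrier U"
  shows "balUU G (\<lambda>(x, y). f (u \<otimes>\<^bsub>U\<^esub> x, y))"
proof (rule balUU_I)
  fix a x y assume a: "a \<in> carrier A" and xy: "x \<in> carrier U" "y \<in> carrier U"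
  then show "(case (x \<otimes>\<^bsub>U\<^esub> src H a, y) of (x, y) \<Rightarrow> f (u \<otimes>\<^bsub>U\<^esub> x, y)) =
      (case (x, y \<otimes>\<^bsub>U\<^esub> src H a) of (x, y) \<Rightarrow> f (u \<otimes>\<^bsub>U\<^esub> x, y))"
    using balUU_mid[OF f a, of "u \<otimes>\<^bsub>U\<^esub> x" y] u by (simp add: U.m_assoc)
qed (use u in \<open>auto simp: balUU_closed[OF f] U.r_distr balUU_add_left[OF f] balUU_add_right[OF f]\<close>)

lemma balUU_mult_right:
  assumes f: "balUU G f" and u: "u \<in> carrier U"
  shows "balUU G (\<lambda>(x, y). f (x, u \<otimes>\<^bsub>U\<^esub> y))"
proof (rule balUU_I)
  fix a x y assume a: "a \<in> carrier A" and xy: "x \<in> carrier U" "y \<in> carrier U"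
  then show "(case (x \<otimes>\<^bsub>U\<^esub> src H a, y) of (x, y) \<Rightarrow> f (x, u \<otimes>\<^bsub>U\<^esub> y)) =
      (case (x, y \<otimes>\<^bsub>U\<^esub> src H a) of (x, y) \<Rightarrow> f (x, u \<otimes>\<^bsub>U\<^esub> y))"
    using balUU_mid[OF f a, of x "u \<otimes>\<^bsub>U\<^esub> y"] u by (simp add: U.m_assoc)
qed (use u in \<open>auto simp: balUU_closed[OF f] U.r_distr balUU_add_left[OF f] balUU_add_right[OF f]\<close>)

text \<open>The Takeuchi condition is an equation between two tensors; applying the lift of f to
  both sides lets an element of A, multiplied from the left, pass from the first leg to the second
  under any balanced f.\<close>

lemma takeuchi_slide:
  assumes t: "t \<in> takeuchi H" and a: "a \<in> carrier A" and G: "abelian_group G" and f: "balUU G f"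
  shows "tlift G (\<lambda>(x, y). f (src H a \<otimes>\<^bsub>U\<^esub> x, y)) t = tlift G (\<lambda>(x, y). f (x, src H a \<otimes>\<^bsub>U\<^esub> y)) t"
proof -
  have tc: "t \<in> carrier (UU H)" by (rule takeuchi_closed[OF t])
  note h = UU.tlift_hom[OF G f]
  have l: "balUU (UU H) (\<lambda>(x, y). UU.pure (src H a \<otimes>\<^bsub>U\<^esub> x) y)"
    and r: "balUU (UU H) (\<lambda>(x, y). UU.pure x (src H a \<otimes>\<^bsub>U\<^esub> y))"
    using balUU_mult_left[OF pureUU src_closed[OF a]] balUU_mult_right[OF pureUU src_closed[OF a]] by simp_all
  have "tlift G (\<lambda>(x, y). f (src H a \<otimes>\<^bsub>U\<^esub> x, y)) t = tlift G (\<lambda>p. tlift G f (case p of (x, y) \<Rightarrow> UU.pure (src H a \<otimes>\<^bsub>U\<^esub> x) y)) t"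
    by (rule UU.tlift_cong[OF G UU.balanced_comp[OF h l] _ tc]) (simp add: UU.tlift_pure[OF G f] a)
  also have "\<dots> = tlift G f (tlift (UU H) (\<lambda>(x, y). UU.pure (src H a \<otimes>\<^bsub>U\<^esub> x) y) t)"
    by (rule UU.tlift_comp[OF h l tc, symmetric])
  also have "\<dots> = tlift G f (tlift (UU H) (\<lambda>(x, y). UU.pure x (src H a \<otimes>\<^bsub>U\<^esub> y)) t)"
    using t a by (simp add: takeuchi_def uu_eq)
  also have "\<dots> = tlift G (\<lambda>p. tlift G f (case p of (x, y) \<Rightarrow> UU.pure x (src H a \<otimes>\<^bsub>U\<^esub> y))) t"
    by (rule UU.tlift_comp[OF h r tc])
  also have "\<dots> = tlift G (\<lambda>(x, y). f (x, src H a \<otimes>\<^bsub>U\<^esub> y)) t"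
    by (rule UU.tlift_cong[OF G UU.balanced_comp[OF h r] _ tc, symmetric]) (simp add: UU.tlift_pure[OF G f] a)
  finally show ?thesis .
qed

end

lemma restrict_scalars_simps [simp]:
  "carrier (restrict_scalars H M) = carrier M" "x \<oplus>\<^bsub>restrict_scalars H M\<^esub> y = x \<oplus>\<^bsub>M\<^esub> y"
  "\<zero>\<^bsub>restrict_scalars H M\<^esub> = \<zero>\<^bsub>M\<^esub>" "x \<triangleleft>\<^bsub>restrict_scalars H M\<^esub> a = x \<triangleleft>\<^bsub>M\<^esub> src H a"
  by (simp_all add: restrict_scalars_def ring.defs rmod.defs)

lemma restrict_scalars_regular: "restrict_scalars H (regular_rmod (total H)) = UA H"
  by (simp add: restrict_scalars_def regular_rmod_def UA_def ring.defs rmod.defs)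

lemma (in cocomm_hopf_algebroid) restrict_right_module:
  assumes "right_module U M"
  shows "right_module A (restrict_scalars H M)"
proof -
  interpret M: right_module U M by fact
  have "abelian_group (restrict_scalars H M)" by (rule abelian_group_cong[OF M.abelian_group_axioms]) simp_all
  then show ?thesis
    by (intro right_module.intro right_module_axioms.intro A.ring_axioms)
      (simp_all add: M.ract_closed M.ract_add_left M.ract_add_right M.ract_mult M.ract_one src_add src_mult)
qed

locale module_pair = cocomm_hopf_algebroid k H + M: right_module U M + N: right_module U N
  for k :: "('k, 'c) ring_scheme" and H :: "('k, 'a, 'u) hopf_data"
    and M :: "('u, 'm, 'd) rmod_scheme" and N :: "('u, 'n, 'e) rmod_scheme"
begin

sublocale MN: rmod_tensor A "restrict_scalars H M" "restrict_scalars H N"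
  by (intro rmod_tensor.intro restrict_right_module A.cring_axioms M.right_module_axioms N.right_module_axioms)

abbreviation "T \<equiv> rtensor A (restrict_scalars H M) (restrict_scalars H N)"
abbreviation "balMN \<equiv> balanced (rbalance A (restrict_scalars H M) (restrict_scalars H N)) (restrict_scalars H M) (restrict_scalars H N)"

lemma balMN_closed: "\<lbrakk>balMN G f; x \<in> carrier M; y \<in> carrier N\<rbrakk> \<Longrightarrow> f (x, y) \<in> carrier G"
  and balMN_add_left: "\<lbrakk>balMN G f; x \<in> carrier M; x' \<in> carrier M; y \<in> carrier N\<rbrakk> \<Longrightarrow>
    f (x \<oplus>\<^bsub>M\<^esub> x', y) = f (x, y) \<oplus>\<^bsub>G\<^esub> f (x', y)"
  and balMN_add_right: "\<lbrakk>balMN G f; x \<in> carrier M; y \<in> carrier N; y' \<in> carrier N\<rbrakk> \<Longrightarrow>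
    f (x, y \<oplus>\<^bsub>N\<^esub> y') = f (x, y) \<oplus>\<^bsub>G\<^esub> f (x, y')"
  by (simp_all add: balanced_def)

lemma balMN_mid: "\<lbrakk>balMN G f; a \<in> carrier A; x \<in> carrier M; y \<in> carrier N\<rbrakk> \<Longrightarrow>
    f (x \<triangleleft>\<^bsub>M\<^esub> src H a, y) = f (x, y \<triangleleft>\<^bsub>N\<^esub> src H a)"
  using MN.balanced_rD by fastforce

lemma pureMN: "balMN T (\<lambda>(x, y). MN.pure x y)"
  by (rule MN.balanced_rI) (auto simp: MN.pure_closed MN.pure_add_left[simplified] MN.pure_add_right[simplified]
      MN.pure_ract_balance[simplified])

lemma inner_balanced:
  assumes f: "balMN G f" and m: "m \<in> carrier M" and n: "n \<in> carrier N"
  shows "balUU G (\<lambda>(x, y). f (m \<triangleleft>\<^bsub>M\<^esub> x, n \<triangleleft>\<^bsub>N\<^esub> y))"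
proof (rule balUU_I)
  fix a x y assume a: "a \<in> carrier A" and xy: "x \<in> carrier U" "y \<in> carrier U"
  then show "(case (x \<otimes>\<^bsub>U\<^esub> src H a, y) of (x, y) \<Rightarrow> f (m \<triangleleft>\<^bsub>M\<^esub> x, n \<triangleleft>\<^bsub>N\<^esub> y)) =
      (case (x, y \<otimes>\<^bsub>U\<^esub> src H a) of (x, y) \<Rightarrow> f (m \<triangleleft>\<^bsub>M\<^esub> x, n \<triangleleft>\<^bsub>N\<^esub> y))"
    using balMN_mid[OF f a, of "m \<triangleleft>\<^bsub>M\<^esub> x" "n \<triangleleft>\<^bsub>N\<^esub> y"] m n
    by (simp add: M.ract_mult N.ract_mult M.ract_closed N.ract_closed)
qed (use m n in \<open>auto simp: balMN_closed[OF f] M.ract_closed N.ract_closed M.ract_add_right N.ract_add_right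
      balMN_add_left[OF f] balMN_add_right[OF f]\<close>)

text \<open>The diagonal action of t on m and n respects the balance over A exactly through the
  Takeuchi condition: an element of A acting on m before the first leg is absorbed into that leg,
  slides to the second leg, and is released onto n.\<close>

lemma outer_balanced:
  assumes G: "abelian_group G" and f: "balMN G f" and t: "t \<in> takeuchi H"
  shows "balMN G (\<lambda>(m, n). tlift G (\<lambda>(x, y). f (m \<triangleleft>\<^bsub>M\<^esub> x, n \<triangleleft>\<^bsub>N\<^esub> y)) t)"
proof -
  have tc: "t \<in> carrier (UU H)" by (rule takeuchi_closed[OF t])
  note ib = inner_balanced[OF f]
  note lc = M.ract_closed N.ract_closed balMN_closed[OF f]
  show ?thesis
  proof (rule MN.balanced_rI; simp only: restrict_scalars_simps prod.case)
    show "tlift G (\<lambda>(x, y). f (m \<triangleleft>\<^bsub>M\<^esub> x, n \<triangleleft>\<^bsub>N\<^esub> y)) t \<in> carrier G"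
      if "m \<in> carrier M" "n \<in> carrier N" for m n by (rule UU.tlift_closed[OF G ib[OF that] tc])
    show "tlift G (\<lambda>(x, y). f ((m \<oplus>\<^bsub>M\<^esub> m') \<triangleleft>\<^bsub>M\<^esub> x, n \<triangleleft>\<^bsub>N\<^esub> y)) t =
        tlift G (\<lambda>(x, y). f (m \<triangleleft>\<^bsub>M\<^esub> x, n \<triangleleft>\<^bsub>N\<^esub> y)) t \<oplus>\<^bsub>G\<^esub> tlift G (\<lambda>(x, y). f (m' \<triangleleft>\<^bsub>M\<^esub> x, n \<triangleleft>\<^bsub>N\<^esub> y)) t"
      if m: "m \<in> carrier M" "m' \<in> carrier M" "n \<in> carrier N" for m m' n
      by (rule UU.tensor_hom_eqI[OF UU.tlift_hom[OF G ib] abelian_group_hom_add[OF UU.tlift_hom[OF G ib] UU.tlift_hom[OF G ib]] _ tc])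
        (use m in \<open>simp_all add: UU.tlift_pure[OF G ib] M.ract_add_left lc balMN_add_left[OF f]\<close>)
    show "tlift G (\<lambda>(x, y). f (m \<triangleleft>\<^bsub>M\<^esub> x, (n \<oplus>\<^bsub>N\<^esub> n') \<triangleleft>\<^bsub>N\<^esub> y)) t =
        tlift G (\<lambda>(x, y). f (m \<triangleleft>\<^bsub>M\<^esub> x, n \<triangleleft>\<^bsub>N\<^esub> y)) t \<oplus>\<^bsub>G\<^esub> tlift G (\<lambda>(x, y). f (m \<triangleleft>\<^bsub>M\<^esub> x, n' \<triangleleft>\<^bsub>N\<^esub> y)) t"
      if m: "m \<in> carrier M" "n \<in> carrier N" "n' \<in> carrier N" for m n n'
      by (rule UU.tensor_hom_eqI[OF UU.tlift_hom[OF G ib] abelian_group_hom_add[OF UU.tlift_hom[OF G ib] UU.tlift_hom[OF G ib]] _ tc])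
        (use m in \<open>simp_all add: UU.tlift_pure[OF G ib] N.ract_add_left lc balMN_add_right[OF f]\<close>)
    show "tlift G (\<lambda>(x, y). f (m \<triangleleft>\<^bsub>M\<^esub> src H a \<triangleleft>\<^bsub>M\<^esub> x, n \<triangleleft>\<^bsub>N\<^esub> y)) t =
        tlift G (\<lambda>(x, y). f (m \<triangleleft>\<^bsub>M\<^esub> x, n \<triangleleft>\<^bsub>N\<^esub> src H a \<triangleleft>\<^bsub>N\<^esub> y)) t"
      if m: "a \<in> carrier A" "m \<in> carrier M" "n \<in> carrier N" for a m n
    proof -
      have "tlift G (\<lambda>(x, y). f (m \<triangleleft>\<^bsub>M\<^esub> src H a \<triangleleft>\<^bsub>M\<^esub> x, n \<triangleleft>\<^bsub>N\<^esub> y)) t =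
          tlift G (\<lambda>(x, y). f (m \<triangleleft>\<^bsub>M\<^esub> (src H a \<otimes>\<^bsub>U\<^esub> x), n \<triangleleft>\<^bsub>N\<^esub> y)) t"
        by (rule UU.tlift_cong[OF G balUU_mult_left[OF ib[OF m(2,3)] src_closed[OF m(1)], simplified] _ tc])
          (use m in \<open>simp add: M.ract_mult\<close>)
      also have "\<dots> = tlift G (\<lambda>(x, y). f (m \<triangleleft>\<^bsub>M\<^esub> x, n \<triangleleft>\<^bsub>N\<^esub> (src H a \<otimes>\<^bsub>U\<^esub> y))) t"
        using takeuchi_slide[OF t m(1) G ib[OF m(2,3)]] by simp
      also have "\<dots> = tlift G (\<lambda>(x, y). f (m \<triangleleft>\<^bsub>M\<^esub> x, n \<triangleleft>\<^bsub>N\<^esub> src H a \<triangleleft>\<^bsub>N\<^esub> y)) t"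
        by (rule UU.tlift_cong[OF G balUU_mult_right[OF ib[OF m(2,3)] src_closed[OF m(1)], simplified] _ tc, symmetric])
          (use m in \<open>simp add: N.ract_mult\<close>)
      finally show ?thesis .
    qed
  qed
qed

end

context cocomm_hopf_algebroid begin

text \<open>With U as a right module over itself, componentwise multiplication by an element of the
  Takeuchi product becomes a case of the diagonal action.\<close>

lemma regular_pair: "module_pair k H (regular_rmod U) (regular_rmod U)"
  by (intro module_pair.intro regular_right_module U.ring_axioms cocomm_hopf_algebroid_axioms)

lemma balUU_mult:
  assumes "balUU G f" "u \<in> carrier U" "v \<in> carrier U"
  shows "balUU G (\<lambda>(x, y). f (u \<otimes>\<^bsub>U\<^esub> x, v \<otimes>\<^bsub>U\<^esub> y))"
  using balUU_mult_right[OF balUU_mult_left[OF assms(1,2)] assms(3)] by simp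

lemma balUU_outer:
  assumes "abelian_group G" "balUU G f" "t \<in> takeuchi H"
  shows "balUU G (\<lambda>(u, v). tlift G (\<lambda>(x, y). f (u \<otimes>\<^bsub>U\<^esub> x, v \<otimes>\<^bsub>U\<^esub> y)) t)"
  using module_pair.outer_balanced[OF regular_pair] assms by (simp add: restrict_scalars_regular)

lemma UU_mult:
  assumes s: "s \<in> carrier (UU H)" and t: "t \<in> takeuchi H"
  shows "s \<otimes>\<^bsub>UU H\<^esub> t = tlift (UU H) (\<lambda>(u, v). tlift (UU H) (\<lambda>(x, y). UU.pure (u \<otimes>\<^bsub>U\<^esub> x) (v \<otimes>\<^bsub>U\<^esub> y)) t) s"
  using UU.tensor_mult[OF UU.rtensor_simps(4) _ _ _ _ s takeuchi_closed[OF t]]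
    balUU_mult[OF pureUU] balUU_outer[OF UU.T_abelian pureUU t] by simp

text \<open>Multiplicativity of the comultiplication in Sweedler form. The legs of u are outermost
  because the right factor of the product is the one that has to satisfy the Takeuchi
  condition.\<close>

lemma tlift_comult_mult:
  assumes G: "abelian_group G" and f: "balUU G f" and u: "u \<in> carrier U" and v: "v \<in> carrier U"
  shows "tlift G f (comult H (u \<otimes>\<^bsub>U\<^esub> v)) =
    tlift G (\<lambda>(p, q). tlift G (\<lambda>(x, y). f (p \<otimes>\<^bsub>U\<^esub> x, q \<otimes>\<^bsub>U\<^esub> y)) (comult H v)) (comult H u)"
proof -
  note h = UU.tlift_hom[OF G f]
  note o1 = balUU_outer[OF UU.T_abelian pureUU comult_takeuchi[OF v], simplified]
  note o2 = balUU_outer[OF G f comult_takeuchi[OF v]]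
  have "tlift G f (comult H (u \<otimes>\<^bsub>U\<^esub> v)) =
      tlift G (\<lambda>p. tlift G f (case p of (u, w) \<Rightarrow>
        tlift (UU H) (\<lambda>(x, y). UU.pure (u \<otimes>\<^bsub>U\<^esub> x) (w \<otimes>\<^bsub>U\<^esub> y)) (comult H v))) (comult H u)"
    using UU.tlift_comp[OF h o1 comult_closed[OF u]]
    by (simp add: comult_mult u v UU_mult comult_closed comult_takeuchi)
  also have "\<dots> = tlift G (\<lambda>(p, q). tlift G (\<lambda>(x, y). f (p \<otimes>\<^bsub>U\<^esub> x, q \<otimes>\<^bsub>U\<^esub> y)) (comult H v)) (comult H u)"
  proof (rule UU.tlift_cong[OF G o2 _ comult_closed[OF u]], unfold prod.case)
    fix p q assume "p \<in> carrier (UA H)" "q \<in> carrier (UA H)"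
    then have pq: "p \<in> carrier U" "q \<in> carrier U" by simp_all
    note b = balUU_mult[OF pureUU pq, simplified]
    have "tlift G f (tlift (UU H) (\<lambda>(x, y). UU.pure (p \<otimes>\<^bsub>U\<^esub> x) (q \<otimes>\<^bsub>U\<^esub> y)) (comult H v)) =
        tlift G (\<lambda>r. tlift G f (case r of (x, y) \<Rightarrow> UU.pure (p \<otimes>\<^bsub>U\<^esub> x) (q \<otimes>\<^bsub>U\<^esub> y))) (comult H v)"
      by (rule UU.tlift_comp[OF h b comult_closed[OF v]])
    also have "\<dots> = tlift G (\<lambda>(x, y). f (p \<otimes>\<^bsub>U\<^esub> x, q \<otimes>\<^bsub>U\<^esub> y)) (comult H v)"
      by (rule UU.tlift_cong[OF G balUU_mult[OF f pq] _ comult_closed[OF v]])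
        (simp add: UU.tlift_pure[OF G f] pq)
    finally show "tlift G f (tlift (UU H) (\<lambda>(x, y). UU.pure (p \<otimes>\<^bsub>U\<^esub> x) (q \<otimes>\<^bsub>U\<^esub> y)) (comult H v)) =
        tlift G (\<lambda>(x, y). f (p \<otimes>\<^bsub>U\<^esub> x, q \<otimes>\<^bsub>U\<^esub> y)) (comult H v)" .
  qed
  finally show ?thesis .
qed

text \<open>The comultiplication of an element a of A is a \<otimes> 1, so only the first leg is
  affected. Right linearity of convolution products comes down to this.\<close>

lemma tlift_comult_right_src:
  assumes G: "abelian_group G" and f: "balUU G f" and u: "u \<in> carrier U" and a: "a \<in> carrier A"
  shows "tlift G f (comult H (u \<otimes>\<^bsub>U\<^esub> src H a)) = tlift G (\<lambda>(x, y). f (x \<otimes>\<^bsub>U\<^esub> src H a, y)) (comult H u)"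
proof -
  note o2 = balUU_outer[OF G f comult_takeuchi[OF src_closed[OF a]]]
  have eq: "tlift G (\<lambda>(x, y). f (p \<otimes>\<^bsub>U\<^esub> x, q \<otimes>\<^bsub>U\<^esub> y)) (comult H (src H a)) = f (p \<otimes>\<^bsub>U\<^esub> src H a, q)"
    if "p \<in> carrier U" "q \<in> carrier U" for p q
    using UU.tlift_pure[OF G balUU_mult[OF f that], of "src H a" "\<one>\<^bsub>U\<^esub>"] a that
    by (simp add: comult_src uu_eq)
  have "tlift G f (comult H (u \<otimes>\<^bsub>U\<^esub> src H a)) = tlift G (\<lambda>(p, q). tlift G (\<lambda>(x, y). f (p \<otimes>\<^bsub>U\<^esub> x, q \<otimes>\<^bsub>U\<^esub> y)) (comult H (src H a))) (comult H u)"
    by (rule tlift_comult_mult[OF G f u src_closed[OF a]])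
  also have "\<dots> = tlift G (\<lambda>(x, y). f (x \<otimes>\<^bsub>U\<^esub> src H a, y)) (comult H u)"
    by (rule UU.tlift_cong[OF G o2 _ comult_closed[OF u], symmetric]) (simp add: eq)
  finally show ?thesis .
qed

end

section \<open>The convolution product\<close>

lemma conv_simps [simp]:
  "carrier (conv_algebra H) = rlin (base H) (UA H) (regular_rmod (base H))"
  "\<zero>\<^bsub>conv_algebra H\<^esub> = (\<lambda>u\<in>carrier (total H). \<zero>\<^bsub>base H\<^esub>)"
  "f \<oplus>\<^bsub>conv_algebra H\<^esub> g = (\<lambda>u\<in>carrier (total H). f u \<oplus>\<^bsub>base H\<^esub> g u)"
  "f \<otimes>\<^bsub>conv_algebra H\<^esub> g = (\<lambda>u\<in>carrier (total H).
    tlift (base H) (\<lambda>(x, y). f x \<otimes>\<^bsub>base H\<^esub> g y) (comult H u))"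
  by (simp_all add: conv_algebra_def dual_group_def)

context cocomm_hopf_algebroid begin

abbreviation "Us \<equiv> conv_algebra H"

lemma conv_abelian: "abelian_group Us"
  by (rule abelian_group_cong[OF dual_abelian_group[OF A.cring_axioms UA_right_module]]) simp_all

sublocale Us: abelian_group Us by (rule conv_abelian)

lemma conv_closed: "\<lbrakk>f \<in> carrier Us; u \<in> carrier U\<rbrakk> \<Longrightarrow> f u \<in> carrier A"
  and conv_add_arg: "\<lbrakk>f \<in> carrier Us; u \<in> carrier U; v \<in> carrier U\<rbrakk> \<Longrightarrow> f (u \<oplus>\<^bsub>U\<^esub> v) = f u \<oplus>\<^bsub>A\<^esub> f v"
  and conv_src: "\<lbrakk>f \<in> carrier Us; u \<in> carrier U; a \<in> carrier A\<rbrakk> \<Longrightarrow> f (u \<otimes>\<^bsub>U\<^esub> src H a) = f u \<otimes>\<^bsub>A\<^esub> a"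
  by (auto simp: rlin_def)

lemma conv_eqI: "\<lbrakk>f \<in> carrier Us; g \<in> carrier Us; \<And>u. u \<in> carrier U \<Longrightarrow> f u = g u\<rbrakk> \<Longrightarrow> f = g"
  by (rule rlin_eqI[of f A "UA H" "regular_rmod A" g]) simp_all

lemma convI:
  assumes "f \<in> extensional (carrier U)" "\<And>u. u \<in> carrier U \<Longrightarrow> f u \<in> carrier A"
    "\<And>u v. \<lbrakk>u \<in> carrier U; v \<in> carrier U\<rbrakk> \<Longrightarrow> f (u \<oplus>\<^bsub>U\<^esub> v) = f u \<oplus>\<^bsub>A\<^esub> f v"
    "\<And>u a. \<lbrakk>u \<in> carrier U; a \<in> carrier A\<rbrakk> \<Longrightarrow> f (u \<otimes>\<^bsub>U\<^esub> src H a) = f u \<otimes>\<^bsub>A\<^esub> a"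
  shows "f \<in> carrier Us"
  unfolding conv_simps by (rule rlinI) (use assms in simp_all)

lemma conv_eval_hom: "u \<in> carrier U \<Longrightarrow> abelian_group_hom Us A (\<lambda>f. f u)"
  by (rule abelian_group_hom_intro[OF conv_abelian A.abelian_group_axioms conv_closed]) simp_all

lemma conv_minus_apply:
  "\<lbrakk>f \<in> carrier Us; g \<in> carrier Us; u \<in> carrier U\<rbrakk> \<Longrightarrow> (f \<ominus>\<^bsub>Us\<^esub> g) u = f u \<ominus>\<^bsub>A\<^esub> g u"
  using abelian_group_hom.hom_minus[OF conv_eval_hom] by blast

lemma conv_balanced:
  assumes f: "f \<in> carrier Us" and g: "g \<in> carrier Us"
  shows "balUU A (\<lambda>(x, y). f x \<otimes>\<^bsub>A\<^esub> g y)"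
  by (rule balUU_I)
    (simp_all add: conv_closed[OF f] conv_closed[OF g] conv_add_arg[OF f] conv_add_arg[OF g] conv_src[OF f]
      conv_src[OF g] A.l_distr A.r_distr A.m_ac del: conv_simps)

lemma conv_mult_apply: "u \<in> carrier U \<Longrightarrow>
    (f \<otimes>\<^bsub>Us\<^esub> g) u = tlift A (\<lambda>(x, y). f x \<otimes>\<^bsub>A\<^esub> g y) (comult H u)"
  by simp

lemma conv_mult_closed:
  assumes f: "f \<in> carrier Us" and g: "g \<in> carrier Us"
  shows "f \<otimes>\<^bsub>Us\<^esub> g \<in> carrier Us"
proof (rule convI)
  note b = conv_balanced[OF f g]
  note A = A.abelian_group_axioms
  show "f \<otimes>\<^bsub>Us\<^esub> g \<in> extensional (carrier U)" by simp
  fix u assume u: "u \<in> carrier U"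
  show "(f \<otimes>\<^bsub>Us\<^esub> g) u \<in> carrier A"
    unfolding conv_mult_apply[OF u] by (rule UU.tlift_closed[OF A b comult_closed[OF u]])
  show "(f \<otimes>\<^bsub>Us\<^esub> g) (u \<oplus>\<^bsub>U\<^esub> v) = (f \<otimes>\<^bsub>Us\<^esub> g) u \<oplus>\<^bsub>A\<^esub> (f \<otimes>\<^bsub>Us\<^esub> g) v" if v: "v \<in> carrier U" for v
    using UU.tlift_add[OF A b comult_closed[OF u] comult_closed[OF v]] u v
    by (simp add: comult_add)
  show "(f \<otimes>\<^bsub>Us\<^esub> g) (u \<otimes>\<^bsub>U\<^esub> src H a) = (f \<otimes>\<^bsub>Us\<^esub> g) u \<otimes>\<^bsub>A\<^esub> a" if a: "a \<in> carrier A" for a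
  proof -
    have h: "abelian_group_hom A A (\<lambda>x. x \<otimes>\<^bsub>A\<^esub> a)"
      by (rule abelian_group_hom_intro[OF A A]) (simp_all add: a A.l_distr)
    have "(f \<otimes>\<^bsub>Us\<^esub> g) (u \<otimes>\<^bsub>U\<^esub> src H a) = tlift A (\<lambda>(x, y). f (x \<otimes>\<^bsub>U\<^esub> src H a) \<otimes>\<^bsub>A\<^esub> g y) (comult H u)"
      using tlift_comult_right_src[OF A b u a] u a by simp
    also have "\<dots> = tlift A (\<lambda>p. (case p of (x, y) \<Rightarrow> f x \<otimes>\<^bsub>A\<^esub> g y) \<otimes>\<^bsub>A\<^esub> a) (comult H u)"
    proof (rule UU.tlift_cong[OF A UU.balanced_comp[OF h b] _ comult_closed[OF u]])
      fix x y assume "x \<in> carrier (UA H)" "y \<in> carrier (UA H)"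
      then show "(case (x, y) of (x, y) \<Rightarrow> f (x \<otimes>\<^bsub>U\<^esub> src H a) \<otimes>\<^bsub>A\<^esub> g y) =
          (case (x, y) of (x, y) \<Rightarrow> f x \<otimes>\<^bsub>A\<^esub> g y) \<otimes>\<^bsub>A\<^esub> a"
        using conv_src[OF f, of x a] conv_closed[OF f, of x] conv_closed[OF g, of y] a
        by (simp add: A.m_ac)
    qed
    also have "\<dots> = (f \<otimes>\<^bsub>Us\<^esub> g) u \<otimes>\<^bsub>A\<^esub> a"
      using UU.tlift_comp[OF h b comult_closed[OF u]] u by simp
    finally show ?thesis .
  qed
qed

lemma conv_l_distr:
  assumes f: "f \<in> carrier Us" "f' \<in> carrier Us" and g: "g \<in> carrier Us"
  shows "(f \<oplus>\<^bsub>Us\<^esub> f') \<otimes>\<^bsub>Us\<^esub> g = f \<otimes>\<^bsub>Us\<^esub> g \<oplus>\<^bsub>Us\<^esub> f' \<otimes>\<^bsub>Us\<^esub> g"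
proof (rule conv_eqI)
  have ff: "f \<oplus>\<^bsub>Us\<^esub> f' \<in> carrier Us" by (rule Us.a_closed[OF f])
  note cl = conv_mult_closed[OF ff g] conv_mult_closed[OF f(1) g] conv_mult_closed[OF f(2) g]
  show "(f \<oplus>\<^bsub>Us\<^esub> f') \<otimes>\<^bsub>Us\<^esub> g \<in> carrier Us" "f \<otimes>\<^bsub>Us\<^esub> g \<oplus>\<^bsub>Us\<^esub> f' \<otimes>\<^bsub>Us\<^esub> g \<in> carrier Us"
    using cl Us.a_closed by blast+
  note A = A.abelian_group_axioms
  note b = conv_balanced[OF ff g] conv_balanced[OF f(1) g] conv_balanced[OF f(2) g]
  fix u assume u: "u \<in> carrier U"
  have "tlift A (\<lambda>(x, y). (f \<oplus>\<^bsub>Us\<^esub> f') x \<otimes>\<^bsub>A\<^esub> g y) (comult H u) =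
      tlift A (\<lambda>(x, y). f x \<otimes>\<^bsub>A\<^esub> g y) (comult H u) \<oplus>\<^bsub>A\<^esub> tlift A (\<lambda>(x, y). f' x \<otimes>\<^bsub>A\<^esub> g y) (comult H u)"
  proof (rule UU.tensor_hom_eqI[OF UU.tlift_hom[OF A b(1)] _ _ comult_closed[OF u]])
    show "abelian_group_hom (UU H) A (\<lambda>t. tlift A (\<lambda>(x, y). f x \<otimes>\<^bsub>A\<^esub> g y) t \<oplus>\<^bsub>A\<^esub> tlift A (\<lambda>(x, y). f' x \<otimes>\<^bsub>A\<^esub> g y) t)"
      by (rule abelian_group_hom_add[OF UU.tlift_hom[OF A b(2)] UU.tlift_hom[OF A b(3)]])
    fix x y assume "x \<in> carrier (UA H)" "y \<in> carrier (UA H)"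
    then have xy: "x \<in> carrier U" "y \<in> carrier U" by simp_all
    then show "tlift A (\<lambda>(x, y). (f \<oplus>\<^bsub>Us\<^esub> f') x \<otimes>\<^bsub>A\<^esub> g y) (UU.pure x y) =
        tlift A (\<lambda>(x, y). f x \<otimes>\<^bsub>A\<^esub> g y) (UU.pure x y) \<oplus>\<^bsub>A\<^esub> tlift A (\<lambda>(x, y). f' x \<otimes>\<^bsub>A\<^esub> g y) (UU.pure x y)"
      using UU.tlift_pure[OF A b(1), of x y] UU.tlift_pure[OF A b(2), of x y] UU.tlift_pure[OF A b(3), of x y]
        conv_closed[OF f(1)] conv_closed[OF f(2)] conv_closed[OF g] by (simp add: A.l_distr)
  qed
  then show "((f \<oplus>\<^bsub>Us\<^esub> f') \<otimes>\<^bsub>Us\<^esub> g) u = (f \<otimes>\<^bsub>Us\<^esub> g \<oplus>\<^bsub>Us\<^esub> f' \<otimes>\<^bsub>Us\<^esub> g) u"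
    using u by simp
qed

text \<open>Co-commutativity lets the legs be exchanged under the lift; commutativity of A then
  restores the order of the two values.\<close>

lemma conv_comm:
  assumes f: "f \<in> carrier Us" and g: "g \<in> carrier Us"
  shows "f \<otimes>\<^bsub>Us\<^esub> g = g \<otimes>\<^bsub>Us\<^esub> f"
proof (rule conv_eqI[OF conv_mult_closed[OF f g] conv_mult_closed[OF g f]])
  fix u assume u: "u \<in> carrier U"
  note A = A.abelian_group_axioms
  note b = conv_balanced[OF f g] and b' = conv_balanced[OF g f]
  have sw: "balUU (UU H) (\<lambda>(x, y). UU.pure y x)"
  proof (rule balUU_I)
    show "(case (x \<otimes>\<^bsub>U\<^esub> src H a, y) of (x, y) \<Rightarrow> UU.pure y x) = (case (x, y \<otimes>\<^bsub>U\<^esub> src H a) of (x, y) \<Rightarrow> UU.pure y x)"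
      if "a \<in> carrier A" "x \<in> carrier U" "y \<in> carrier U" for a x y
      using UU.pure_ract_balance[of a y x] that by simp
  qed (use UU.pure_closed UU.pure_add_left UU.pure_add_right in auto)
  have "tlift A (\<lambda>(x, y). f x \<otimes>\<^bsub>A\<^esub> g y) (comult H u) =
      tlift A (\<lambda>(x, y). f x \<otimes>\<^bsub>A\<^esub> g y) (tlift (UU H) (\<lambda>(x, y). UU.pure y x) (comult H u))"
    using cocomm[OF u] by (simp add: uu_eq)
  also have "\<dots> = tlift A (\<lambda>p. tlift A (\<lambda>(x, y). f x \<otimes>\<^bsub>A\<^esub> g y) (case p of (x, y) \<Rightarrow> UU.pure y x)) (comult H u)"
    by (rule UU.tlift_comp[OF UU.tlift_hom[OF A b] sw comult_closed[OF u]])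
  also have "\<dots> = tlift A (\<lambda>(x, y). g x \<otimes>\<^bsub>A\<^esub> f y) (comult H u)"
  proof (rule UU.tlift_cong[OF A b' _ comult_closed[OF u]])
    fix x y assume "x \<in> carrier (UA H)" "y \<in> carrier (UA H)"
    then show "tlift A (\<lambda>(x, y). f x \<otimes>\<^bsub>A\<^esub> g y) (case (x, y) of (x, y) \<Rightarrow> UU.pure y x) = (case (x, y) of (x, y) \<Rightarrow> g x \<otimes>\<^bsub>A\<^esub> f y)"
      using UU.tlift_pure[OF A b, of y x] conv_closed[OF f, of y] conv_closed[OF g, of x] by (simp add: A.m_comm)
  qed
  finally show "(f \<otimes>\<^bsub>Us\<^esub> g) u = (g \<otimes>\<^bsub>Us\<^esub> f) u" using u by simp
qed

lemma conv_r_distr: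
  assumes f: "f \<in> carrier Us" "f' \<in> carrier Us" and g: "g \<in> carrier Us"
  shows "g \<otimes>\<^bsub>Us\<^esub> (f \<oplus>\<^bsub>Us\<^esub> f') = g \<otimes>\<^bsub>Us\<^esub> f \<oplus>\<^bsub>Us\<^esub> g \<otimes>\<^bsub>Us\<^esub> f'"
  using conv_l_distr[OF f g] conv_comm[OF Us.a_closed[OF f] g] conv_comm[OF f(1) g] conv_comm[OF f(2) g]
  by (simp del: conv_simps)

end

section \<open>Completeness and multiplicativity of the filtration on the convolution
  algebra\<close>

locale filtered_hopf_algebroid = cocomm_hopf_algebroid k H + admissible_filtration H F
  for k :: "('k, 'c) ring_scheme" and H :: "('k, 'a, 'u) hopf_data" and F :: "nat \<Rightarrow> 'u set"
begin

abbreviation "G \<equiv> conv_filtration H F"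

lemma F_mono: "n \<le> m \<Longrightarrow> F n \<subseteq> F m"
  by (rule lift_Suc_mono_le[of F]) (rule increasing)

lemma F_carr: "u \<in> F n \<Longrightarrow> u \<in> carrier U"
  using exhaustive by blast

lemma F_cases:
  assumes "u \<in> carrier U"
  obtains n where "u \<in> F n"
  using assms exhaustive by blast

lemma G_Suc_iff: "f \<in> G (Suc n) \<longleftrightarrow> f \<in> carrier Us \<and> (\<forall>u\<in>F n. f u = \<zero>\<^bsub>A\<^esub>)"
  by simp

lemma G_0_iff: "f \<in> G 0 \<longleftrightarrow> f \<in> carrier Us"
  by simp

declare conv_filtration.simps [simp del]

lemma filtered_group_conv: "filtered_group Us G"
proof (intro filtered_group.intro filtered_group_axioms.intro conv_abelian)
  show "additive_subgroup (G n) Us" for n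
  proof (rule Us.additive_subgroup_intro)
    show "G n \<subseteq> carrier Us" by (cases n) (auto simp: conv_filtration.simps simp del: conv_simps)
    show "\<zero>\<^bsub>Us\<^esub> \<in> G n"
      using Us.zero_closed by (cases n) (auto simp: G_Suc_iff G_0_iff F_carr simp del: conv_simps(1))
    show "f \<oplus>\<^bsub>Us\<^esub> g \<in> G n" if "f \<in> G n" "g \<in> G n" for f g
      using that Us.a_closed[of f g] by (cases n) (auto simp: G_Suc_iff G_0_iff F_carr simp del: conv_simps(1))
    show "\<ominus>\<^bsub>Us\<^esub> f \<in> G n" if "f \<in> G n" for f
      using that Us.a_inv_closed[of f] abelian_group_hom.hom_a_inv[OF conv_eval_hom, of _ f]
      by (cases n) (auto simp: G_Suc_iff G_0_iff F_carr simp del: conv_simps)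
  qed
  show "G (Suc n) \<subseteq> G n" for n
    using increasing[THEN subsetD] by (cases n) (auto simp: G_Suc_iff G_0_iff simp del: conv_simps)
  show "G 0 = carrier Us" by (simp add: conv_filtration.simps)
qed

sublocale Us: filtered_group Us G by (rule filtered_group_conv)

text \<open>Elements of \<open>G (Suc n)\<close> vanish on \<open>F n\<close>, so a Cauchy sequence
  is constant on \<open>F n\<close> from index \<open>Suc n\<close> on. The \<open>F n\<close>
  exhaust U, and the stable values fit together to a limit.\<close>

lemma conv_complete:
  assumes a: "Us.cauchy a"
  shows "\<exists>y\<in>carrier Us. \<forall>n. a n \<ominus>\<^bsub>Us\<^esub> y \<in> G n"
proof -
  have ac: "a n \<in> carrier Us" for n by (rule Us.cauchy_carr[OF a])
  have stab: "a m u = a (Suc n) u" if "Suc n \<le> m" "u \<in> F n" for m n u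
  proof -
    have "a m \<ominus>\<^bsub>Us\<^esub> a (Suc n) \<in> G (Suc n)" by (rule Us.cauchyD[OF a that(1)])
    then have "a m u \<ominus>\<^bsub>A\<^esub> a (Suc n) u = \<zero>\<^bsub>A\<^esub>"
      using that(2) conv_minus_apply[OF ac ac F_carr[OF that(2)], of m "Suc n"] by (simp add: G_Suc_iff del: conv_simps)
    then show ?thesis
      using A.diff_eq_zero_iff[OF conv_closed[OF ac] conv_closed[OF ac]] F_carr[OF that(2)] by blast
  qed
  \<comment> \<open>The value at u is taken at the first index from which the sequence is known to
    be constant there: one more than the level of u, as \<open>G (Suc n)\<close> and not
    \<open>G n\<close> annihilates \<open>F n\<close>.\<close>
  define y where "y = (\<lambda>u\<in>carrier U. a (Suc (LEAST n. u \<in> F n)) u)"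
  have y: "y u = a (Suc n) u" if "u \<in> F n" for u n
  proof -
    have l: "u \<in> F (LEAST n. u \<in> F n)" "(LEAST n. u \<in> F n) \<le> n"
      using that by (auto intro: LeastI Least_le)
    show ?thesis using stab[OF _ l(1), of "Suc n"] l(2) F_carr[OF that] by (simp add: y_def)
  qed
  have yc: "y \<in> carrier Us"
  proof (rule convI)
    show "y \<in> extensional (carrier U)" by (simp add: y_def)
    fix u assume u: "u \<in> carrier U"
    obtain n where n: "u \<in> F n" using F_cases[OF u] by blast
    show "y u \<in> carrier A" using y[OF n] conv_closed[OF ac u] by (simp del: conv_simps)
    show "y (u \<oplus>\<^bsub>U\<^esub> v) = y u \<oplus>\<^bsub>A\<^esub> y v" if v: "v \<in> carrier U" for v
    proof -
      obtain m where m: "v \<in> F m" using F_cases[OF v] by blast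
      \<comment> \<open>Additivity is inherited from a single term of the sequence, so both
        arguments are placed in one common level.\<close>
      have uv: "u \<in> F (max n m)" "v \<in> F (max n m)" using n m F_mono[of n "max n m"] F_mono[of m "max n m"] by auto
      then have "u \<oplus>\<^bsub>U\<^esub> v \<in> F (max n m)" using additive_subgroup.a_closed[OF subgroup] by blast
      then show ?thesis using y uv conv_add_arg[OF ac u v] by (simp del: conv_simps)
    qed
    show "y (u \<otimes>\<^bsub>U\<^esub> src H b) = y u \<otimes>\<^bsub>A\<^esub> b" if b: "b \<in> carrier A" for b
      using y[OF right_closed[OF b n]] y[OF n] conv_src[OF ac u b] by (simp del: conv_simps)
  qed
  have "a n \<ominus>\<^bsub>Us\<^esub> y \<in> G n" for n
  proof (cases n)
    case 0 then show ?thesis using ac yc by (simp add: G_0_iff del: conv_simps)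
  next
    case (Suc m)
    have "(a n \<ominus>\<^bsub>Us\<^esub> y) u = \<zero>\<^bsub>A\<^esub>" if "u \<in> F m" for u
      using conv_minus_apply[OF ac yc F_carr[OF that], of n] y[OF that] conv_closed[OF ac F_carr[OF that], of n] Suc
      by (simp add: A.diff_self del: conv_simps)
    then show ?thesis using Suc Us.minus_closed[OF ac yc] by (simp add: G_Suc_iff del: conv_simps)
  qed
  then show ?thesis using yc by blast
qed

sublocale Us: complete_filtered_group Us G
proof
  show "\<exists>y\<in>carrier Us. \<forall>n. a n \<ominus>\<^bsub>Us\<^esub> y \<in> G n" if "Us.cauchy a" for a
    using conv_complete that by blast
  show "f = \<zero>\<^bsub>Us\<^esub>" if f: "f \<in> carrier Us" and n: "\<And>n. f \<in> G n" for f
  proof (rule conv_eqI[OF f Us.zero_closed])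
    fix u assume u: "u \<in> carrier U"
    obtain m where "u \<in> F m" using F_cases[OF u] by blast
    then show "f u = \<zero>\<^bsub>Us\<^esub> u" using n[of "Suc m"] u by (simp add: G_Suc_iff)
  qed
qed

text \<open>The comultiplication sends \<open>F n\<close> into the subgroup generated by x \<otimes>
  y with x in \<open>F i\<close>, y in \<open>F j\<close> and i + j = n. It is enough that the lift
  of the product kills these generators, its kernel being a subgroup.\<close>

lemma G_mult:
  assumes f: "f \<in> G p" and g: "g \<in> G q"
  shows "f \<otimes>\<^bsub>Us\<^esub> g \<in> G (p + q)"
proof (cases "p + q")
  case 0 then show ?thesis using conv_mult_closed[OF Us.F_carr[OF f] Us.F_carr[OF g]] by (simp only: G_0_iff)
next
  case (Suc n)
  note fc = Us.F_carr[OF f] and gc = Us.F_carr[OF g]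
  note b = conv_balanced[OF fc gc]
  note A = A.abelian_group_axioms
  interpret h: abelian_group_hom "UU H" A "tlift A (\<lambda>(x, y). f x \<otimes>\<^bsub>A\<^esub> g y)" by (rule UU.tlift_hom[OF A b])
  have "(f \<otimes>\<^bsub>Us\<^esub> g) u = \<zero>\<^bsub>A\<^esub>" if u: "u \<in> F n" for u
  proof -
    have "{uu H x y | x y i j. i + j = n \<and> x \<in> F i \<and> y \<in> F j} \<subseteq>
        kernel (add_monoid (UU H)) (add_monoid A) (tlift A (\<lambda>(x, y). f x \<otimes>\<^bsub>A\<^esub> g y))"
    proof
      fix z assume "z \<in> {uu H x y | x y i j. i + j = n \<and> x \<in> F i \<and> y \<in> F j}"
      then obtain x y i j where z: "z = UU.pure x y" "i + j = n" "x \<in> F i" "y \<in> F j" by (auto simp: uu_eq)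
      note xc = F_carr[OF z(3)] and yc = F_carr[OF z(4)]
      have "f x \<otimes>\<^bsub>A\<^esub> g y = \<zero>\<^bsub>A\<^esub>"
      proof (cases "i < p")
        case True
        then obtain p' where p': "p = Suc p'" "i \<le> p'" by (cases p) auto
        then have "x \<in> F p'" using z(3) F_mono by blast
        then have "f x = \<zero>\<^bsub>A\<^esub>" using f p'(1) by (simp add: G_Suc_iff del: conv_simps)
        then show ?thesis using conv_closed[OF gc yc] by simp
      next
        case False
        \<comment> \<open>Here p + q = n + 1 while i + j = n, so i \<ge> p forces j below q. The
          missing unit is that of the shifted indexing of G.\<close>
        then have "j < q" using z(2) Suc by simp
        then obtain q' where q': "q = Suc q'" "j \<le> q'" by (cases q) auto
        then have "y \<in> F q'" using z(4) F_mono by blast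
        then have "g y = \<zero>\<^bsub>A\<^esub>" using g q'(1) by (simp add: G_Suc_iff del: conv_simps)
        then show ?thesis using conv_closed[OF fc xc] by simp
      qed
      then show "z \<in> kernel (add_monoid (UU H)) (add_monoid A) (tlift A (\<lambda>(x, y). f x \<otimes>\<^bsub>A\<^esub> g y))"
        using UU.tlift_pure[OF A b, of x y] UU.pure_closed[of x y] xc yc z(1) by (simp add: kernel_def)
    qed
    then have "comult H u \<in> kernel (add_monoid (UU H)) (add_monoid A) (tlift A (\<lambda>(x, y). f x \<otimes>\<^bsub>A\<^esub> g y))"
      using comult_filtered[OF u] group.generate_subgroup_incl[OF UU.T.a_group _ group_hom.subgroup_kernel[OF h.a_group_hom]]
      by blast
    then show ?thesis using F_carr[OF u] by (simp add: kernel_def)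
  qed
  then show ?thesis using Suc conv_mult_closed[OF fc gc] by (simp add: G_Suc_iff del: conv_simps)
qed

end

section \<open>Finitely generated projective modules\<close>

text \<open>The index type is arbitrary, so that pairs of indices can index the dual basis of a
  tensor product without renumbering.\<close>

definition dual_basis :: "('s, 'c) ring_scheme \<Rightarrow> ('s, 'm, 'd) rmod_scheme \<Rightarrow> 'i set \<Rightarrow> ('i \<Rightarrow> 'm)
    \<Rightarrow> ('i \<Rightarrow> 'm \<Rightarrow> 's) \<Rightarrow> bool"
  where "dual_basis R M I e \<phi> \<longleftrightarrow> finite I \<and> (\<forall>i\<in>I. e i \<in> carrier M) \<and>
    (\<forall>i\<in>I. \<phi> i \<in> rlin R M (regular_rmod R)) \<and>
    (\<forall>m\<in>carrier M. m = (\<Oplus>\<^bsub>M\<^esub>i\<in>I. e i \<triangleleft>\<^bsub>M\<^esub> \<phi> i m))"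

lemma free_rmod_simps [simp]:
  "carrier (free_rmod R n) = {..<n} \<rightarrow>\<^sub>E carrier R"
  "x \<oplus>\<^bsub>free_rmod R n\<^esub> y = (\<lambda>i\<in>{..<n}. x i \<oplus>\<^bsub>R\<^esub> y i)"
  "x \<triangleleft>\<^bsub>free_rmod R n\<^esub> r = (\<lambda>i\<in>{..<n}. x i \<otimes>\<^bsub>R\<^esub> r)"
  by (simp_all add: free_rmod_def)

context right_module begin

text \<open>For a split surjection p with section s, the elements are the images under p of the
  standard basis vectors, and the functionals are the coordinates of s.\<close>

lemma dual_basis_of_fg_projective:
  assumes "fg_projective R M"
  shows "\<exists>I e \<phi>. dual_basis R M (I :: nat set) e \<phi>"
proof -
  obtain n p s where p: "p \<in> rlin R (free_rmod R n) M" and s: "s \<in> rlin R M (free_rmod R n)"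
    and ps: "\<And>m. m \<in> carrier M \<Longrightarrow> p (s m) = m"
    using assms unfolding fg_projective_def by blast
  define \<delta> where "\<delta> i = (\<lambda>j\<in>{..<n}. if j = i then \<one> else \<zero>)" for i
  define e where "e i = p (\<delta> i)" for i
  define \<phi> where "\<phi> i = (\<lambda>m\<in>carrier M. s m i)" for i
  have \<delta>: "\<delta> i \<in> {..<n} \<rightarrow>\<^sub>E carrier R" for i by (auto simp: \<delta>_def)
  have e: "e i \<in> carrier M" for i using rlin_closed[OF p] \<delta> by (simp add: e_def)
  have sc: "s m i \<in> carrier R" if "m \<in> carrier M" "i < n" for m i
    using rlin_closed[OF s that(1)] that(2) by auto
  have \<phi>: "\<phi> i \<in> rlin R M (regular_rmod R)" if i: "i < n" for i
    by (rule rlinI) (use i rlin_add[OF s] rlin_ract[OF s] in \<open>simp_all add: \<phi>_def sc ract_closed\<close>)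
  \<comment> \<open>Induction on the number k of retained coordinates: the truncated vectors stay
    inside the fixed free module, and one step adds a multiple of one basis vector.\<close>
  have key: "p (\<lambda>j\<in>{..<n}. if j < k then x j else \<zero>) = (\<Oplus>\<^bsub>M\<^esub>i\<in>{..<k}. e i \<triangleleft>\<^bsub>M\<^esub> x i)"
    if x: "x \<in> {..<n} \<rightarrow>\<^sub>E carrier R" and k: "k \<le> n" for x k
    using k
  proof (induction k)
    case 0
    let ?z = "\<lambda>j\<in>{..<n}. \<zero>"
    have z: "?z \<in> carrier (free_rmod R n)" by simp
    have "?z \<oplus>\<^bsub>free_rmod R n\<^esub> ?z = ?z" by (simp add: restrict_def fun_eq_iff)
    then have "p ?z \<oplus>\<^bsub>M\<^esub> p ?z = p ?z" using rlin_add[OF p z z] by simp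
    then have "p ?z = \<zero>\<^bsub>M\<^esub>" using rlin_closed[OF p z] by (metis M.add.l_cancel_one')
    then show ?case by (simp add: restrict_def)
  next
    case (Suc k)
    let ?x = "\<lambda>j\<in>{..<n}. if j < k then x j else \<zero>"
    have xj: "x j \<in> carrier R" if "j < n" for j by (rule PiE_mem[OF x]) (simp add: that)
    have xk: "x k \<in> carrier R" using xj Suc.prems by simp
    have xc: "?x \<in> carrier (free_rmod R n)" by (simp add: xj)
    have \<delta>c: "\<delta> k \<in> carrier (free_rmod R n)" using \<delta> by simp
    have d: "\<delta> k \<triangleleft>\<^bsub>free_rmod R n\<^esub> x k \<in> carrier (free_rmod R n)" using xk by (simp add: \<delta>_def)
    have "(\<lambda>j\<in>{..<n}. if j < Suc k then x j else \<zero>) = ?x \<oplus>\<^bsub>free_rmod R n\<^esub> (\<delta> k \<triangleleft>\<^bsub>free_rmod R n\<^esub> x k)"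
    proof
      fix j
      show "(\<lambda>j\<in>{..<n}. if j < Suc k then x j else \<zero>) j = (?x \<oplus>\<^bsub>free_rmod R n\<^esub> (\<delta> k \<triangleleft>\<^bsub>free_rmod R n\<^esub> x k)) j"
        using xk xj[of j] by (cases "j < k"; cases "j = k") (simp_all add: \<delta>_def)
    qed
    then have "p (\<lambda>j\<in>{..<n}. if j < Suc k then x j else \<zero>) = p ?x \<oplus>\<^bsub>M\<^esub> e k \<triangleleft>\<^bsub>M\<^esub> x k"
      using rlin_add[OF p xc d] rlin_ract[OF p \<delta>c xk] by (simp add: e_def)
    also have "\<dots> = e k \<triangleleft>\<^bsub>M\<^esub> x k \<oplus>\<^bsub>M\<^esub> (\<Oplus>\<^bsub>M\<^esub>i\<in>{..<k}. e i \<triangleleft>\<^bsub>M\<^esub> x i)"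
      unfolding Suc.IH[OF Suc_leD[OF Suc.prems]]
    proof (rule M.a_comm)
      show "(\<Oplus>\<^bsub>M\<^esub>i\<in>{..<k}. e i \<triangleleft>\<^bsub>M\<^esub> x i) \<in> carrier M"
        using Suc.prems by (intro M.finsum_closed Pi_I ract_closed e xj) simp
    qed (rule ract_closed[OF e xk])
    also have "\<dots> = (\<Oplus>\<^bsub>M\<^esub>i\<in>{..<Suc k}. e i \<triangleleft>\<^bsub>M\<^esub> x i)"
      unfolding lessThan_Suc using Suc.prems xk xj e
      by (subst M.finsum_insert) (auto simp: ract_closed)
    finally show ?case .
  qed
  have "m = (\<Oplus>\<^bsub>M\<^esub>i\<in>{..<n}. e i \<triangleleft>\<^bsub>M\<^esub> \<phi> i m)" if m: "m \<in> carrier M" for m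
  proof -
    have sm: "s m \<in> {..<n} \<rightarrow>\<^sub>E carrier R" using rlin_closed[OF s m] by simp
    then have "(\<lambda>j\<in>{..<n}. if j < n then s m j else \<zero>) = s m"
      by (auto simp: fun_eq_iff PiE_def extensional_def)
    then have "m = (\<Oplus>\<^bsub>M\<^esub>i\<in>{..<n}. e i \<triangleleft>\<^bsub>M\<^esub> s m i)" using key[OF sm order_refl] ps[OF m] by simp
    then show ?thesis using m by (simp add: \<phi>_def)
  qed
  then have "dual_basis R M {..<n} e \<phi>" using e \<phi> unfolding dual_basis_def by blast
  then show ?thesis by blast
qed

lemma fg_projective_of_dual_basis:
  assumes "dual_basis R M I e \<phi>"
  shows "fg_projective R M"
proof -
  have I: "finite I" and e: "\<And>i. i \<in> I \<Longrightarrow> e i \<in> carrier M"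
    and \<phi>: "\<And>i. i \<in> I \<Longrightarrow> \<phi> i \<in> rlin R M (regular_rmod R)"
    and sum: "\<And>m. m \<in> carrier M \<Longrightarrow> m = (\<Oplus>\<^bsub>M\<^esub>i\<in>I. e i \<triangleleft>\<^bsub>M\<^esub> \<phi> i m)"
    using assms unfolding dual_basis_def by blast+
  obtain h where h: "bij_betw h {..<card I} I"
    using ex_bij_betw_nat_finite[OF I] by (auto simp: atLeast0LessThan)
  let ?n = "card I"
  have hI: "h i \<in> I" if "i < ?n" for i using bij_betwE[OF h] that by blast
  define p where "p = (\<lambda>x\<in>carrier (free_rmod R ?n). \<Oplus>\<^bsub>M\<^esub>i\<in>{..<?n}. e (h i) \<triangleleft>\<^bsub>M\<^esub> x i)"
  define s where "s = (\<lambda>m\<in>carrier M. \<lambda>i\<in>{..<?n}. \<phi> (h i) m)"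
  note \<phi>D = rlin_closed[OF \<phi>[OF hI], simplified] rlin_add[OF \<phi>[OF hI], simplified] rlin_ract[OF \<phi>[OF hI], simplified]
  have s: "s \<in> rlin R M (free_rmod R ?n)"
    by (rule rlinI) (auto simp: s_def \<phi>D ract_closed fun_eq_iff)
  have c: "(\<lambda>i. e (h i) \<triangleleft>\<^bsub>M\<^esub> x i) \<in> {..<?n} \<rightarrow> carrier M" if "x \<in> carrier (free_rmod R ?n)" for x
    using that e hI by (auto intro!: ract_closed)
  have p: "p \<in> rlin R (free_rmod R ?n) M"
  proof (rule rlinI)
    show "p x \<in> carrier M" if "x \<in> carrier (free_rmod R ?n)" for x
      using M.finsum_closed[OF c[OF that]] that by (simp add: p_def)
    show "p \<in> extensional (carrier (free_rmod R ?n))" by (simp add: p_def)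
    show "p (x \<oplus>\<^bsub>free_rmod R ?n\<^esub> y) = p x \<oplus>\<^bsub>M\<^esub> p y"
      if x: "x \<in> carrier (free_rmod R ?n)" and y: "y \<in> carrier (free_rmod R ?n)" for x y
    proof -
      have xy: "x i \<in> carrier R" "y i \<in> carrier R" if "i < ?n" for i using x y that by auto
      have cl: "x \<oplus>\<^bsub>free_rmod R ?n\<^esub> y \<in> carrier (free_rmod R ?n)" using xy by auto
      have "p (x \<oplus>\<^bsub>free_rmod R ?n\<^esub> y) = (\<Oplus>\<^bsub>M\<^esub>i\<in>{..<?n}. e (h i) \<triangleleft>\<^bsub>M\<^esub> x i \<oplus>\<^bsub>M\<^esub> e (h i) \<triangleleft>\<^bsub>M\<^esub> y i)"
        unfolding p_def restrict_apply'[OF cl]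
        by (rule M.finsum_cong') (use c[OF x] c[OF y] xy e hI in \<open>auto simp: ract_add_right\<close>)
      also have "\<dots> = p x \<oplus>\<^bsub>M\<^esub> p y"
        unfolding p_def restrict_apply'[OF x] restrict_apply'[OF y] by (rule M.finsum_addf[OF c[OF x] c[OF y]])
      finally show ?thesis .
    qed
    show "p (x \<triangleleft>\<^bsub>free_rmod R ?n\<^esub> r) = p x \<triangleleft>\<^bsub>M\<^esub> r"
      if x: "x \<in> carrier (free_rmod R ?n)" and r: "r \<in> carrier R" for x r
    proof -
      have xi: "x i \<in> carrier R" if "i < ?n" for i using x that by auto
      have cl: "x \<triangleleft>\<^bsub>free_rmod R ?n\<^esub> r \<in> carrier (free_rmod R ?n)" using xi r by auto
      have "p x \<triangleleft>\<^bsub>M\<^esub> r = (\<Oplus>\<^bsub>M\<^esub>i\<in>{..<?n}. e (h i) \<triangleleft>\<^bsub>M\<^esub> x i \<triangleleft>\<^bsub>M\<^esub> r)"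
        unfolding p_def restrict_apply'[OF x]
        by (rule abelian_group_hom.hom_finsum[OF ract_hom[OF r] _ c[OF x]]) simp
      also have "\<dots> = p (x \<triangleleft>\<^bsub>free_rmod R ?n\<^esub> r)"
        unfolding p_def restrict_apply'[OF cl]
        by (rule M.finsum_cong') (use xi e hI r in \<open>auto simp: ract_mult ract_closed\<close>)
      finally show ?thesis by simp
    qed
  qed
  have "p (s m) = m" if m: "m \<in> carrier M" for m
  proof -
    have "p (s m) = (\<Oplus>\<^bsub>M\<^esub>i\<in>{..<?n}. e (h i) \<triangleleft>\<^bsub>M\<^esub> \<phi> (h i) m)"
      unfolding p_def restrict_apply'[OF rlin_closed[OF s m]]
      by (rule M.finsum_cong') (use m e hI \<phi>D in \<open>auto simp: s_def ract_closed\<close>)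
    also have "\<dots> = (\<Oplus>\<^bsub>M\<^esub>i\<in>h ` {..<?n}. e i \<triangleleft>\<^bsub>M\<^esub> \<phi> i m)"
      by (rule M.finsum_reindex[symmetric])
        (use h hI e m rlin_closed[OF \<phi>] in \<open>auto simp: bij_betw_def ract_closed\<close>)
    also have "\<dots> = m" using sum[OF m] h by (simp add: bij_betw_def)
    finally show ?thesis .
  qed
  then show ?thesis unfolding fg_projective_def using right_module_axioms p s by blast
qed

end

lemma fg_projective_iff_dual_basis:
  "fg_projective R M \<longleftrightarrow> right_module R M \<and> (\<exists>I e \<phi>. dual_basis R M (I :: nat set) e \<phi>)"
  using right_module.dual_basis_of_fg_projective right_module.fg_projective_of_dual_basis
  unfolding fg_projective_def by metis

text \<open>Pushes a module structure forward along an injection. Applied to a section into a free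
  module, it yields a copy whose elements are functions on the natural numbers.\<close>

definition transport_rmod :: "('s, 'm, 'd) rmod_scheme \<Rightarrow> ('m \<Rightarrow> 'n) \<Rightarrow> ('s, 'n) rmod"
  where "transport_rmod M s = \<lparr>carrier = s ` carrier M, monoid.mult = undefined, one = undefined,
    ring.zero = s \<zero>\<^bsub>M\<^esub>,
    add = (\<lambda>x y. s (inv_into (carrier M) s x \<oplus>\<^bsub>M\<^esub> inv_into (carrier M) s y)),
    ract = (\<lambda>x r. s (inv_into (carrier M) s x \<triangleleft>\<^bsub>M\<^esub> r))\<rparr>"

context right_module begin

context
  fixes s assumes inj: "inj_on s (carrier M)"
begin

lemma transport_simps:
  "carrier (transport_rmod M s) = s ` carrier M"
  "\<zero>\<^bsub>transport_rmod M s\<^esub> = s \<zero>\<^bsub>M\<^esub>"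
  "\<lbrakk>x \<in> carrier M; y \<in> carrier M\<rbrakk> \<Longrightarrow> s x \<oplus>\<^bsub>transport_rmod M s\<^esub> s y = s (x \<oplus>\<^bsub>M\<^esub> y)"
  "x \<in> carrier M \<Longrightarrow> s x \<triangleleft>\<^bsub>transport_rmod M s\<^esub> r = s (x \<triangleleft>\<^bsub>M\<^esub> r)"
  by (simp_all add: transport_rmod_def inv_into_f_f[OF inj])

lemma transport_right_module: "right_module R (transport_rmod M s)"
proof -
  have "abelian_group (transport_rmod M s)"
  proof (rule abelian_groupI)
    show "\<exists>y\<in>carrier (transport_rmod M s). y \<oplus>\<^bsub>transport_rmod M s\<^esub> x = \<zero>\<^bsub>transport_rmod M s\<^esub>"
      if x: "x \<in> carrier (transport_rmod M s)" for x
    proof -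
      obtain m where "m \<in> carrier M" "x = s m" using x unfolding transport_simps(1) by blast
      then show ?thesis
        by (intro bexI[of _ "s (\<ominus>\<^bsub>M\<^esub> m)"]) (simp_all add: transport_simps M.l_neg)
    qed
  qed (auto simp: transport_simps M.a_ac)
  then show ?thesis
    by (intro right_module.intro right_module_axioms.intro R.ring_axioms)
      (auto simp: transport_simps ract_closed ract_add_left ract_add_right ract_mult ract_one)
qed

lemma transport_iso: "restrict s (carrier M) \<in> rmod_iso R M (transport_rmod M s)"
proof -
  have "restrict s (carrier M) \<in> rlin R M (transport_rmod M s)"
    by (rule rlinI) (simp_all add: transport_simps ract_closed)
  then show ?thesis
    using inj by (simp add: rmod_iso_def bij_betw_def inj_on_restrict_eq transport_simps)
qed

end

end

lemma fg_projective_transport: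
  assumes M: "fg_projective R M" and N: "right_module R N"
    and f: "f \<in> rlin R M N" "bij_betw f (carrier M) (carrier N)"
  shows "fg_projective R N"
proof -
  interpret M: right_module R M using M by (simp add: fg_projective_def)
  interpret N: right_module R N by fact
  obtain I e \<phi> where db: "dual_basis R M (I :: nat set) e \<phi>"
    using M.dual_basis_of_fg_projective[OF M] by blast
  have I: "finite I" and e: "\<And>i. i \<in> I \<Longrightarrow> e i \<in> carrier M"
    and \<phi>: "\<And>i. i \<in> I \<Longrightarrow> \<phi> i \<in> rlin R M (regular_rmod R)"
    and sum: "\<And>m. m \<in> carrier M \<Longrightarrow> m = (\<Oplus>\<^bsub>M\<^esub>i\<in>I. e i \<triangleleft>\<^bsub>M\<^esub> \<phi> i m)"
    using db unfolding dual_basis_def by blast+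
  define g where "g = inv_into (carrier M) f"
  have g: "g y \<in> carrier M" "f (g y) = y" if "y \<in> carrier N" for y
    using that f(2) inv_into_into[of y f "carrier M"] f_inv_into_f[of y f "carrier M"]
    by (auto simp: g_def bij_betw_def)
  have gf: "g (f x) = x" if "x \<in> carrier M" for x
    using that f(2) by (simp add: g_def bij_betw_def)
  have g_add: "g (x \<oplus>\<^bsub>N\<^esub> y) = g x \<oplus>\<^bsub>M\<^esub> g y" if "x \<in> carrier N" "y \<in> carrier N" for x y
    using rlin_add[OF f(1) g(1)[OF that(1)] g(1)[OF that(2)]] g that gf[of "g x \<oplus>\<^bsub>M\<^esub> g y"] by simp
  have g_ract: "g (x \<triangleleft>\<^bsub>N\<^esub> r) = g x \<triangleleft>\<^bsub>M\<^esub> r" if "x \<in> carrier N" "r \<in> carrier R" for x r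
    using rlin_ract[OF f(1) g(1)[OF that(1)] that(2)] g that gf[of "g x \<triangleleft>\<^bsub>M\<^esub> r"] by (simp add: M.ract_closed)
  note \<phi>D = rlin_closed[OF \<phi>, simplified] rlin_add[OF \<phi>, simplified] rlin_ract[OF \<phi>, simplified]
  have "dual_basis R N I (\<lambda>i. f (e i)) (\<lambda>i. \<lambda>y\<in>carrier N. \<phi> i (g y))"
    unfolding dual_basis_def
  proof (intro conjI ballI I)
    show "f (e i) \<in> carrier N" if "i \<in> I" for i using rlin_closed[OF f(1) e[OF that]] .
    show "(\<lambda>y\<in>carrier N. \<phi> i (g y)) \<in> rlin R N (regular_rmod R)" if "i \<in> I" for i
      by (rule rlinI) (simp_all add: \<phi>D[OF that] g g_add g_ract N.ract_closed)
    fix y assume y: "y \<in> carrier N"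
    have c: "(\<lambda>i. e i \<triangleleft>\<^bsub>M\<^esub> \<phi> i (g y)) \<in> I \<rightarrow> carrier M"
      using e \<phi>D(1) g(1)[OF y] by (auto simp: M.ract_closed)
    have "y = f (\<Oplus>\<^bsub>M\<^esub>i\<in>I. e i \<triangleleft>\<^bsub>M\<^esub> \<phi> i (g y))" using sum[OF g(1)[OF y]] g(2)[OF y] by simp
    also have "\<dots> = (\<Oplus>\<^bsub>N\<^esub>i\<in>I. f (e i \<triangleleft>\<^bsub>M\<^esub> \<phi> i (g y)))"
      by (rule abelian_group_hom.hom_finsum[OF rlin_hom[OF f(1) M.abelian_group_axioms N.abelian_group_axioms] I c])
    also have "\<dots> = (\<Oplus>\<^bsub>N\<^esub>i\<in>I. f (e i) \<triangleleft>\<^bsub>N\<^esub> (\<lambda>y\<in>carrier N. \<phi> i (g y)) y)"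
      by (rule N.finsum_cong')
        (use e y g \<phi>D(1) rlin_ract[OF f(1)] rlin_closed[OF f(1)] in \<open>auto simp: N.ract_closed\<close>)
    finally show "y = (\<Oplus>\<^bsub>N\<^esub>i\<in>I. f (e i) \<triangleleft>\<^bsub>N\<^esub> (\<lambda>y\<in>carrier N. \<phi> i (g y)) y)" .
  qed
  then show ?thesis by (rule N.fg_projective_of_dual_basis)
qed

section \<open>Tensor products of modules over the Hopf algebroid\<close>

lemma mod_tensor_simps:
  "carrier (mod_tensor H M N) = carrier (rtensor (base H) (restrict_scalars H M) (restrict_scalars H N))"
  "add (mod_tensor H M N) = add (rtensor (base H) (restrict_scalars H M) (restrict_scalars H N))"
  "ring.zero (mod_tensor H M N) = ring.zero (rtensor (base H) (restrict_scalars H M) (restrict_scalars H N))"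
  "t \<triangleleft>\<^bsub>mod_tensor H M N\<^esub> u = tlift (rtensor (base H) (restrict_scalars H M) (restrict_scalars H N))
    (\<lambda>(m, n). tlift (rtensor (base H) (restrict_scalars H M) (restrict_scalars H N))
      (\<lambda>(u1, u2). mod_pure H M N (m \<triangleleft>\<^bsub>M\<^esub> u1) (n \<triangleleft>\<^bsub>N\<^esub> u2)) (comult H u)) t"
  by (simp_all add: mod_tensor_def Let_def ring.defs rmod.defs)

definition Umod :: "('k, 'a, 'u) hopf_data \<Rightarrow> ('u, 'm, 'd) rmod_scheme \<Rightarrow> bool"
  where "Umod H M \<longleftrightarrow> right_module (total H) M \<and> fg_projective (base H) (restrict_scalars H M)"

lemma fmods_iff: "M \<in> fmods H \<longleftrightarrow> Umod H M"
  by (simp add: fmods_def Umod_def)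

text \<open>Restricts the record types of \<open>module_pair\<close> to the plain ones on which
  \<open>mod_tensor\<close>, \<open>mod_pure\<close> and \<open>star\<close> are defined.\<close>

locale umodule_pair = module_pair k H M N
  for k :: "('k, 'c) ring_scheme" and H :: "('k, 'a, 'u) hopf_data"
    and M :: "('u, 'm) rmod" and N :: "('u, 'n) rmod"
begin

lemma mod_pure_eq: "mod_pure H M N = MN.pure"
  by (simp add: mod_pure_def MN.rpure_eq fun_eq_iff)

abbreviation "P \<equiv> mod_tensor H M N"

abbreviation "act u \<equiv> tlift T (\<lambda>(m, n). tlift T (\<lambda>(x, y). MN.pure (m \<triangleleft>\<^bsub>M\<^esub> x) (n \<triangleleft>\<^bsub>N\<^esub> y)) (comult H u))"

lemma P_simps:
  "carrier P = carrier T" "add P = add T" "\<zero>\<^bsub>P\<^esub> = \<zero>\<^bsub>T\<^esub>" "t \<triangleleft>\<^bsub>P\<^esub> u = act u t"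
  by (simp_all add: mod_tensor_simps mod_pure_eq)

lemma inner_pure: "\<lbrakk>m \<in> carrier M; n \<in> carrier N\<rbrakk> \<Longrightarrow>
    balUU T (\<lambda>(x, y). MN.pure (m \<triangleleft>\<^bsub>M\<^esub> x) (n \<triangleleft>\<^bsub>N\<^esub> y))"
  using inner_balanced[OF pureMN] by simp

lemma outer_pure: "u \<in> carrier U \<Longrightarrow>
    balMN T (\<lambda>(m, n). tlift T (\<lambda>(x, y). MN.pure (m \<triangleleft>\<^bsub>M\<^esub> x) (n \<triangleleft>\<^bsub>N\<^esub> y)) (comult H u))"
  using outer_balanced[OF MN.T_abelian pureMN comult_takeuchi] by simp

lemma act_hom: "u \<in> carrier U \<Longrightarrow> abelian_group_hom T T (act u)"
  by (rule MN.tlift_hom[OF MN.T_abelian outer_pure])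

lemma act_pure: "\<lbrakk>u \<in> carrier U; m \<in> carrier M; n \<in> carrier N\<rbrakk> \<Longrightarrow>
    act u (MN.pure m n) = tlift T (\<lambda>(x, y). MN.pure (m \<triangleleft>\<^bsub>M\<^esub> x) (n \<triangleleft>\<^bsub>N\<^esub> y)) (comult H u)"
  using MN.tlift_pure[OF MN.T_abelian outer_pure] by simp

text \<open>Associativity of the diagonal action is multiplicativity of the comultiplication,
  combined with associativity of the actions on M and N leg by leg.\<close>

lemma act_mult:
  assumes u: "u \<in> carrier U" and v: "v \<in> carrier U" and t: "t \<in> carrier T"
  shows "act (u \<otimes>\<^bsub>U\<^esub> v) t = act v (act u t)"
proof -
  interpret hu: abelian_group_hom T T "act u" by (rule act_hom[OF u])
  interpret hv: abelian_group_hom T T "act v" by (rule act_hom[OF v])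
  have "abelian_group_hom T T (\<lambda>t. act v (act u t))"
    by (intro abelian_group_hom_intro MN.T_abelian) simp_all
  then show ?thesis
  proof (rule MN.tensor_hom_eqI[OF act_hom[OF U.m_closed[OF u v]] _ _ t])
    fix m n assume "m \<in> carrier (restrict_scalars H M)" "n \<in> carrier (restrict_scalars H N)"
    then have mn: "m \<in> carrier M" "n \<in> carrier N" by simp_all
    note ip = inner_pure[OF mn]
    have "act (u \<otimes>\<^bsub>U\<^esub> v) (MN.pure m n) = tlift T (\<lambda>(p, q). tlift T (\<lambda>(x, y).
        MN.pure (m \<triangleleft>\<^bsub>M\<^esub> (p \<otimes>\<^bsub>U\<^esub> x)) (n \<triangleleft>\<^bsub>N\<^esub> (q \<otimes>\<^bsub>U\<^esub> y))) (comult H v)) (comult H u)"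
      using tlift_comult_mult[OF MN.T_abelian ip u v] by (simp add: act_pure u v mn)
    also have "\<dots> = tlift T (\<lambda>p. act v (case p of (x, y) \<Rightarrow> MN.pure (m \<triangleleft>\<^bsub>M\<^esub> x) (n \<triangleleft>\<^bsub>N\<^esub> y))) (comult H u)"
    proof (rule UU.tlift_cong[OF MN.T_abelian UU.balanced_comp[OF act_hom[OF v] ip] _ comult_closed[OF u]], unfold prod.case)
      fix p q assume "p \<in> carrier (UA H)" "q \<in> carrier (UA H)"
      then have pq: "p \<in> carrier U" "q \<in> carrier U" by simp_all
      have mp: "m \<triangleleft>\<^bsub>M\<^esub> p \<in> carrier M" "n \<triangleleft>\<^bsub>N\<^esub> q \<in> carrier N" using mn pq M.ract_closed N.ract_closed by blast+
      show "tlift T (\<lambda>(x, y). MN.pure (m \<triangleleft>\<^bsub>M\<^esub> (p \<otimes>\<^bsub>U\<^esub> x)) (n \<triangleleft>\<^bsub>N\<^esub> (q \<otimes>\<^bsub>U\<^esub> y))) (comult H v) =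
          act v (MN.pure (m \<triangleleft>\<^bsub>M\<^esub> p) (n \<triangleleft>\<^bsub>N\<^esub> q))"
        unfolding act_pure[OF v mp]
        by (rule UU.tlift_cong[OF MN.T_abelian inner_pure[OF mp] _ comult_closed[OF v]])
          (use mn pq in \<open>simp add: M.ract_mult N.ract_mult\<close>)
    qed
    also have "\<dots> = act v (act u (MN.pure m n))"
      using UU.tlift_comp[OF act_hom[OF v] ip comult_closed[OF u]] by (simp add: act_pure u mn)
    finally show "act (u \<otimes>\<^bsub>U\<^esub> v) (MN.pure m n) = act v (act u (MN.pure m n))" .
  qed
qed

lemma act_add:
  assumes u: "u \<in> carrier U" and v: "v \<in> carrier U" and t: "t \<in> carrier T"
  shows "act (u \<oplus>\<^bsub>U\<^esub> v) t = act u t \<oplus>\<^bsub>T\<^esub> act v t"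
proof (rule MN.tensor_hom_eqI[OF act_hom[OF U.a_closed[OF u v]] abelian_group_hom_add[OF act_hom[OF u] act_hom[OF v]] _ t])
  fix m n assume "m \<in> carrier (restrict_scalars H M)" "n \<in> carrier (restrict_scalars H N)"
  then have mn: "m \<in> carrier M" "n \<in> carrier N" by simp_all
  show "act (u \<oplus>\<^bsub>U\<^esub> v) (MN.pure m n) = act u (MN.pure m n) \<oplus>\<^bsub>T\<^esub> act v (MN.pure m n)"
    using UU.tlift_add[OF MN.T_abelian inner_pure[OF mn] comult_closed[OF u] comult_closed[OF v]]
    unfolding act_pure[OF U.a_closed[OF u v] mn] act_pure[OF u mn] act_pure[OF v mn]
    by (simp add: comult_add u v)
qed

text \<open>Restricting the diagonal action to A gives back the A-module structure of the tensor
  product, since a has comultiplication a \<otimes> 1. Projectivity can hence be checked on the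
  tensor product over A; the case a = 1 is the unit law of the action.\<close>

lemma act_src:
  assumes a: "a \<in> carrier A" and t: "t \<in> carrier T"
  shows "act (src H a) t = t \<triangleleft>\<^bsub>T\<^esub> a"
proof (rule MN.tensor_hom_eqI[OF act_hom[OF src_closed[OF a]] MN.ract_tensor_hom[OF a] _ t])
  fix m n assume "m \<in> carrier (restrict_scalars H M)" "n \<in> carrier (restrict_scalars H N)"
  then have mn: "m \<in> carrier M" "n \<in> carrier N" by simp_all
  have "act (src H a) (MN.pure m n) = MN.pure (m \<triangleleft>\<^bsub>M\<^esub> src H a) n"
    using UU.tlift_pure[OF MN.T_abelian inner_pure[OF mn], of "src H a" "\<one>\<^bsub>U\<^esub>"]
    unfolding act_pure[OF src_closed[OF a] mn] by (simp add: a mn comult_src uu_eq N.ract_one)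
  then show "act (src H a) (MN.pure m n) = MN.pure m n \<triangleleft>\<^bsub>T\<^esub> a"
    using MN.pure_ract_balance[OF a, of m n] MN.ract_pure[OF a, of m n] mn by simp
qed

lemma mod_tensor_right_module: "right_module U P"
proof (intro right_module.intro right_module_axioms.intro U.ring_axioms)
  show "abelian_group P" by (rule abelian_group_cong[OF MN.T_abelian]) (simp_all add: P_simps)
  show "t \<triangleleft>\<^bsub>P\<^esub> u \<in> carrier P" if "t \<in> carrier P" "u \<in> carrier U" for t u
    using abelian_group_hom.hom_closed[OF act_hom] that by (simp add: P_simps)
  show "(s \<oplus>\<^bsub>P\<^esub> t) \<triangleleft>\<^bsub>P\<^esub> u = s \<triangleleft>\<^bsub>P\<^esub> u \<oplus>\<^bsub>P\<^esub> t \<triangleleft>\<^bsub>P\<^esub> u"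
    if "s \<in> carrier P" "t \<in> carrier P" "u \<in> carrier U" for s t u
    using abelian_group_hom.hom_add[OF act_hom] that by (simp add: P_simps)
  show "t \<triangleleft>\<^bsub>P\<^esub> (u \<oplus>\<^bsub>U\<^esub> v) = t \<triangleleft>\<^bsub>P\<^esub> u \<oplus>\<^bsub>P\<^esub> t \<triangleleft>\<^bsub>P\<^esub> v"
    if "t \<in> carrier P" "u \<in> carrier U" "v \<in> carrier U" for t u v
    using act_add that by (simp add: P_simps)
  show "t \<triangleleft>\<^bsub>P\<^esub> (u \<otimes>\<^bsub>U\<^esub> v) = t \<triangleleft>\<^bsub>P\<^esub> u \<triangleleft>\<^bsub>P\<^esub> v"
    if "t \<in> carrier P" "u \<in> carrier U" "v \<in> carrier U" for t u v
    using act_mult that by (simp add: P_simps)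
  show "t \<triangleleft>\<^bsub>P\<^esub> \<one>\<^bsub>U\<^esub> = t" if "t \<in> carrier P" for t
    using act_src[OF A.one_closed] that right_module.ract_one[OF MN.rtensor_right_module] by (simp add: P_simps)
qed

text \<open>Dual bases multiply: the tensors \<open>MN.pure (e i) (e' j)\<close>, together with the
  functionals induced by products \<phi> i m times \<psi> j n, form a dual basis of the tensor
  product.\<close>

lemma mod_tensor_Umod:
  assumes M: "Umod H M" and N: "Umod H N"
  shows "Umod H P"
  unfolding Umod_def
proof
  interpret TM: right_module A T by (rule MN.rtensor_right_module)
  obtain I :: "nat set" and e \<phi> where db: "dual_basis A (restrict_scalars H M) I e \<phi>"
    using M unfolding Umod_def fg_projective_iff_dual_basis by blast
  obtain J :: "nat set" and e' \<psi> where db': "dual_basis A (restrict_scalars H N) J e' \<psi>"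
    using N unfolding Umod_def fg_projective_iff_dual_basis by blast
  have I: "finite I" and e: "\<And>i. i \<in> I \<Longrightarrow> e i \<in> carrier M"
    and \<phi>: "\<And>i. i \<in> I \<Longrightarrow> \<phi> i \<in> rlin A (restrict_scalars H M) (regular_rmod A)"
    and sumI: "\<And>m. m \<in> carrier M \<Longrightarrow> m = (\<Oplus>\<^bsub>restrict_scalars H M\<^esub>i\<in>I. e i \<triangleleft>\<^bsub>M\<^esub> src H (\<phi> i m))"
    using db unfolding dual_basis_def by simp_all
  have J: "finite J" and e': "\<And>i. i \<in> J \<Longrightarrow> e' i \<in> carrier N"
    and \<psi>: "\<And>i. i \<in> J \<Longrightarrow> \<psi> i \<in> rlin A (restrict_scalars H N) (regular_rmod A)"
    and sumJ: "\<And>n. n \<in> carrier N \<Longrightarrow> n = (\<Oplus>\<^bsub>restrict_scalars H N\<^esub>i\<in>J. e' i \<triangleleft>\<^bsub>N\<^esub> src H (\<psi> i n))"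
    using db' unfolding dual_basis_def by simp_all
  note \<phi>D = rlin_closed[OF \<phi>, simplified] rlin_add[OF \<phi>, simplified] rlin_ract[OF \<phi>, simplified]
  note \<psi>D = rlin_closed[OF \<psi>, simplified] rlin_add[OF \<psi>, simplified] rlin_ract[OF \<psi>, simplified]
  have bal: "balMN A (\<lambda>(m, n). \<phi> i m \<otimes>\<^bsub>A\<^esub> \<psi> j n)" if "i \<in> I" "j \<in> J" for i j
    by (rule MN.balanced_rI)
      (simp_all add: \<phi>D[OF that(1)] \<psi>D[OF that(2)] A.l_distr A.r_distr A.m_ac)
  define \<chi> where "\<chi> = (\<lambda>(i, j). \<lambda>t\<in>carrier T. tlift A (\<lambda>(m, n). \<phi> i m \<otimes>\<^bsub>A\<^esub> \<psi> j n) t)"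
  define g where "g = (\<lambda>(i, j). MN.pure (e i) (e' j))"
  note A = A.abelian_group_axioms
  have \<chi>: "\<chi> p \<in> rlin A T (regular_rmod A)" if p: "p \<in> I \<times> J" for p
  proof -
    obtain i j where ij: "p = (i, j)" "i \<in> I" "j \<in> J" using p by blast
    note b = bal[OF ij(2,3)]
    show ?thesis
    proof (rule rlinI)
      show "\<chi> p t \<in> carrier (regular_rmod A)" if "t \<in> carrier T" for t
        using MN.tlift_closed[OF A b that] that by (simp add: \<chi>_def ij(1))
      show "\<chi> p \<in> extensional (carrier T)" by (simp add: \<chi>_def ij(1))
      show "\<chi> p (s \<oplus>\<^bsub>T\<^esub> t) = \<chi> p s \<oplus>\<^bsub>regular_rmod A\<^esub> \<chi> p t" if "s \<in> carrier T" "t \<in> carrier T" for s t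
        using MN.tlift_add[OF A b that] that by (simp add: \<chi>_def ij(1))
      show "\<chi> p (t \<triangleleft>\<^bsub>T\<^esub> a) = \<chi> p t \<triangleleft>\<^bsub>regular_rmod A\<^esub> a" if t: "t \<in> carrier T" and a: "a \<in> carrier A" for t a
      proof -
        have h1: "abelian_group_hom T A (\<lambda>t. tlift A (\<lambda>(m, n). \<phi> i m \<otimes>\<^bsub>A\<^esub> \<psi> j n) (t \<triangleleft>\<^bsub>T\<^esub> a))"
          using MN.tlift_closed[OF A b] MN.tlift_add[OF A b] a
          by (intro abelian_group_hom_intro MN.T_abelian A) (simp_all add: TM.ract_closed TM.ract_add_left)
        have h2: "abelian_group_hom T A (\<lambda>t. tlift A (\<lambda>(m, n). \<phi> i m \<otimes>\<^bsub>A\<^esub> \<psi> j n) t \<otimes>\<^bsub>A\<^esub> a)"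
          using MN.tlift_closed[OF A b] MN.tlift_add[OF A b] a
          by (intro abelian_group_hom_intro MN.T_abelian A) (simp_all add: A.l_distr)
        have "tlift A (\<lambda>(m, n). \<phi> i m \<otimes>\<^bsub>A\<^esub> \<psi> j n) (t \<triangleleft>\<^bsub>T\<^esub> a) = tlift A (\<lambda>(m, n). \<phi> i m \<otimes>\<^bsub>A\<^esub> \<psi> j n) t \<otimes>\<^bsub>A\<^esub> a"
        proof (rule MN.tensor_hom_eqI[OF h1 h2 _ t])
          fix m n assume "m \<in> carrier (restrict_scalars H M)" "n \<in> carrier (restrict_scalars H N)"
          then have mn: "m \<in> carrier M" "n \<in> carrier N" by simp_all
          then show "tlift A (\<lambda>(m, n). \<phi> i m \<otimes>\<^bsub>A\<^esub> \<psi> j n) (MN.pure m n \<triangleleft>\<^bsub>T\<^esub> a) =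
              tlift A (\<lambda>(m, n). \<phi> i m \<otimes>\<^bsub>A\<^esub> \<psi> j n) (MN.pure m n) \<otimes>\<^bsub>A\<^esub> a"
            using MN.tlift_pure[OF A b, of m n] MN.tlift_pure[OF A b, of m "n \<triangleleft>\<^bsub>N\<^esub> src H a"] MN.ract_pure[OF a, of m n] a
            by (simp add: N.ract_closed \<phi>D[OF ij(2)] \<psi>D[OF ij(3)] A.m_assoc)
        qed
        then show ?thesis using t a by (simp add: \<chi>_def ij(1) TM.ract_closed)
      qed
    qed
  qed
  have g: "g p \<in> carrier T" if "p \<in> I \<times> J" for p
    using that e e' MN.pure_closed by (auto simp: g_def)
  have expand: "t = (\<Oplus>\<^bsub>T\<^esub>p\<in>I \<times> J. g p \<triangleleft>\<^bsub>T\<^esub> \<chi> p t)" if t: "t \<in> carrier T" for t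
  proof -
    have c: "(\<lambda>p. g p \<triangleleft>\<^bsub>T\<^esub> \<chi> p t) \<in> I \<times> J \<rightarrow> carrier T" if "t \<in> carrier T" for t
      using g rlin_closed[OF \<chi> that] by (auto intro!: TM.ract_closed)
    have h1: "abelian_group_hom T T (\<lambda>t. t)"
      by (intro abelian_group_hom_intro MN.T_abelian) simp_all
    have h2: "abelian_group_hom T T (\<lambda>t. \<Oplus>\<^bsub>T\<^esub>p\<in>I \<times> J. g p \<triangleleft>\<^bsub>T\<^esub> \<chi> p t)"
    proof (intro abelian_group_hom_intro MN.T_abelian)
      show "(\<Oplus>\<^bsub>T\<^esub>p\<in>I \<times> J. g p \<triangleleft>\<^bsub>T\<^esub> \<chi> p t) \<in> carrier T" if "t \<in> carrier T" for t
        by (rule MN.T.finsum_closed[OF c[OF that]])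
      show "(\<Oplus>\<^bsub>T\<^esub>p\<in>I \<times> J. g p \<triangleleft>\<^bsub>T\<^esub> \<chi> p (s \<oplus>\<^bsub>T\<^esub> t)) =
          (\<Oplus>\<^bsub>T\<^esub>p\<in>I \<times> J. g p \<triangleleft>\<^bsub>T\<^esub> \<chi> p s) \<oplus>\<^bsub>T\<^esub> (\<Oplus>\<^bsub>T\<^esub>p\<in>I \<times> J. g p \<triangleleft>\<^bsub>T\<^esub> \<chi> p t)"
        if s: "s \<in> carrier T" and t: "t \<in> carrier T" for s t
      proof -
        have "(\<Oplus>\<^bsub>T\<^esub>p\<in>I \<times> J. g p \<triangleleft>\<^bsub>T\<^esub> \<chi> p (s \<oplus>\<^bsub>T\<^esub> t)) = (\<Oplus>\<^bsub>T\<^esub>p\<in>I \<times> J. g p \<triangleleft>\<^bsub>T\<^esub> \<chi> p s \<oplus>\<^bsub>T\<^esub> g p \<triangleleft>\<^bsub>T\<^esub> \<chi> p t)"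
        proof (rule MN.T.finsum_cong')
          show "g p \<triangleleft>\<^bsub>T\<^esub> \<chi> p (s \<oplus>\<^bsub>T\<^esub> t) = g p \<triangleleft>\<^bsub>T\<^esub> \<chi> p s \<oplus>\<^bsub>T\<^esub> g p \<triangleleft>\<^bsub>T\<^esub> \<chi> p t" if "p \<in> I \<times> J" for p
            using rlin_add[OF \<chi>[OF that] s t] rlin_closed[OF \<chi>[OF that]] s t g[OF that] by (simp add: TM.ract_add_right)
        qed (use c[OF s] c[OF t] in \<open>auto simp: Pi_iff\<close>)
        also have "\<dots> = (\<Oplus>\<^bsub>T\<^esub>p\<in>I \<times> J. g p \<triangleleft>\<^bsub>T\<^esub> \<chi> p s) \<oplus>\<^bsub>T\<^esub> (\<Oplus>\<^bsub>T\<^esub>p\<in>I \<times> J. g p \<triangleleft>\<^bsub>T\<^esub> \<chi> p t)"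
          by (rule MN.T.finsum_addf[OF c[OF s] c[OF t]])
        finally show ?thesis .
      qed
    qed
    show ?thesis
    proof (rule MN.tensor_hom_eqI[OF h1 h2 _ t])
      fix m n assume mn': "m \<in> carrier (restrict_scalars H M)" "n \<in> carrier (restrict_scalars H N)"
      then have mn: "m \<in> carrier M" "n \<in> carrier N" by simp_all
      have hl: "abelian_group_hom (restrict_scalars H M) T (\<lambda>x. MN.pure x n)"
        by (intro abelian_group_hom_intro MN.X.abelian_group_axioms MN.T_abelian)
          (use mn' MN.pure_closed MN.pure_add_left in auto)
      have hr: "abelian_group_hom (restrict_scalars H N) T (\<lambda>y. MN.pure x y)" if "x \<in> carrier M" for x
        by (intro abelian_group_hom_intro MN.Y.abelian_group_axioms MN.T_abelian)
          (use that MN.pure_closed MN.pure_add_right in auto)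
      have ca: "e i \<triangleleft>\<^bsub>M\<^esub> src H (\<phi> i m) \<in> carrier M" if "i \<in> I" for i
        using that e \<phi>D(1) mn by (simp add: M.ract_closed)
      have cb: "e' j \<triangleleft>\<^bsub>N\<^esub> src H (\<psi> j n) \<in> carrier N" if "j \<in> J" for j
        using that e' \<psi>D(1) mn by (simp add: N.ract_closed)
      \<comment> \<open>Both coefficients are collected on the last factor, where the action on the
        tensor product is defined; commutativity of A orders them as in \<chi>.\<close>
      have term_eq: "MN.pure (e i \<triangleleft>\<^bsub>M\<^esub> src H (\<phi> i m)) (e' j \<triangleleft>\<^bsub>N\<^esub> src H (\<psi> j n)) = g (i, j) \<triangleleft>\<^bsub>T\<^esub> \<chi> (i, j) (MN.pure m n)"
        if ij: "i \<in> I" "j \<in> J" for i j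
      proof -
        have fa: "\<phi> i m \<in> carrier A" "\<psi> j n \<in> carrier A" using \<phi>D(1) \<psi>D(1) ij mn by blast+
        have "MN.pure (e i \<triangleleft>\<^bsub>M\<^esub> src H (\<phi> i m)) (e' j \<triangleleft>\<^bsub>N\<^esub> src H (\<psi> j n)) =
            MN.pure (e i) (e' j \<triangleleft>\<^bsub>N\<^esub> src H (\<psi> j n) \<triangleleft>\<^bsub>N\<^esub> src H (\<phi> i m))"
          using MN.pure_ract_balance[OF fa(1), of "e i" "e' j \<triangleleft>\<^bsub>N\<^esub> src H (\<psi> j n)"] e[OF ij(1)] cb[OF ij(2)] by simp
        also have "e' j \<triangleleft>\<^bsub>N\<^esub> src H (\<psi> j n) \<triangleleft>\<^bsub>N\<^esub> src H (\<phi> i m) = e' j \<triangleleft>\<^bsub>N\<^esub> src H (\<phi> i m \<otimes>\<^bsub>A\<^esub> \<psi> j n)"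
          using N.ract_mult[OF e'[OF ij(2)], of "src H (\<psi> j n)" "src H (\<phi> i m)"] fa
          by (simp add: src_mult[symmetric] A.m_comm)
        also have "MN.pure (e i) \<dots> = MN.pure (e i) (e' j) \<triangleleft>\<^bsub>T\<^esub> (\<phi> i m \<otimes>\<^bsub>A\<^esub> \<psi> j n)"
          using MN.ract_pure[of "\<phi> i m \<otimes>\<^bsub>A\<^esub> \<psi> j n" "e i" "e' j"] fa e[OF ij(1)] e'[OF ij(2)] by simp
        finally show ?thesis
          using MN.tlift_pure[OF A bal[OF ij] mn'] MN.pure_closed[OF mn'] by (simp add: g_def \<chi>_def)
      qed
      have "MN.pure m n = MN.pure (\<Oplus>\<^bsub>restrict_scalars H M\<^esub>i\<in>I. e i \<triangleleft>\<^bsub>M\<^esub> src H (\<phi> i m)) n"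
        using sumI[OF mn(1)] by simp
      also have "\<dots> = (\<Oplus>\<^bsub>T\<^esub>i\<in>I. MN.pure (e i \<triangleleft>\<^bsub>M\<^esub> src H (\<phi> i m)) n)"
        by (rule abelian_group_hom.hom_finsum[OF hl I]) (use ca in auto)
      also have "\<dots> = (\<Oplus>\<^bsub>T\<^esub>i\<in>I. \<Oplus>\<^bsub>T\<^esub>j\<in>J. g (i, j) \<triangleleft>\<^bsub>T\<^esub> \<chi> (i, j) (MN.pure m n))"
      proof (rule MN.T.finsum_cong')
        show "(\<lambda>i. \<Oplus>\<^bsub>T\<^esub>j\<in>J. g (i, j) \<triangleleft>\<^bsub>T\<^esub> \<chi> (i, j) (MN.pure m n)) \<in> I \<rightarrow> carrier T"
          using c[OF MN.pure_closed[OF mn']] by (auto intro!: MN.T.finsum_closed)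
        fix i assume i: "i \<in> I"
        have "MN.pure (e i \<triangleleft>\<^bsub>M\<^esub> src H (\<phi> i m)) n = MN.pure (e i \<triangleleft>\<^bsub>M\<^esub> src H (\<phi> i m)) (\<Oplus>\<^bsub>restrict_scalars H N\<^esub>j\<in>J. e' j \<triangleleft>\<^bsub>N\<^esub> src H (\<psi> j n))"
          using sumJ[OF mn(2)] by simp
        also have "\<dots> = (\<Oplus>\<^bsub>T\<^esub>j\<in>J. MN.pure (e i \<triangleleft>\<^bsub>M\<^esub> src H (\<phi> i m)) (e' j \<triangleleft>\<^bsub>N\<^esub> src H (\<psi> j n)))"
          by (rule abelian_group_hom.hom_finsum[OF hr[OF ca[OF i]] J]) (use cb in auto)
        also have "\<dots> = (\<Oplus>\<^bsub>T\<^esub>j\<in>J. g (i, j) \<triangleleft>\<^bsub>T\<^esub> \<chi> (i, j) (MN.pure m n))"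
          by (rule MN.T.finsum_cong') (use c[OF MN.pure_closed[OF mn']] i term_eq in auto)
        finally show "MN.pure (e i \<triangleleft>\<^bsub>M\<^esub> src H (\<phi> i m)) n = (\<Oplus>\<^bsub>T\<^esub>j\<in>J. g (i, j) \<triangleleft>\<^bsub>T\<^esub> \<chi> (i, j) (MN.pure m n))" .
      qed simp
      also have "\<dots> = (\<Oplus>\<^bsub>T\<^esub>p\<in>I \<times> J. g p \<triangleleft>\<^bsub>T\<^esub> \<chi> p (MN.pure m n))"
        by (rule MN.T.finsum_Times[OF I J c[OF MN.pure_closed[OF mn']]])
      finally show "MN.pure m n = (\<Oplus>\<^bsub>T\<^esub>p\<in>I \<times> J. g p \<triangleleft>\<^bsub>T\<^esub> \<chi> p (MN.pure m n))" .
    qed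
  qed
  have "dual_basis A T (I \<times> J) g \<chi>"
    unfolding dual_basis_def using I J g \<chi> expand by blast
  then have fgT: "fg_projective A T" by (rule TM.fg_projective_of_dual_basis)
  \<comment> \<open>T and the restriction of P are different records with the same elements. The
    identity is the isomorphism along which projectivity is transported.\<close>
  have "(\<lambda>t\<in>carrier T. t) \<in> rlin A T (restrict_scalars H P)"
    by (rule rlinI) (simp_all add: P_simps act_src TM.ract_closed)
  moreover have "bij_betw (\<lambda>t\<in>carrier T. t) (carrier T) (carrier (restrict_scalars H P))"
    by (simp add: P_simps bij_betw_def inj_on_def)
  ultimately show "fg_projective A (restrict_scalars H P)"
    using fg_projective_transport[OF fgT restrict_right_module[OF mod_tensor_right_module]] by blast
qed (rule mod_tensor_right_module)

end

lemma unit_mod_simps [simp]: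
  "carrier (unit_mod H) = carrier (base H)" "x \<oplus>\<^bsub>unit_mod H\<^esub> y = x \<oplus>\<^bsub>base H\<^esub> y"
  "\<zero>\<^bsub>unit_mod H\<^esub> = \<zero>\<^bsub>base H\<^esub>" "a \<triangleleft>\<^bsub>unit_mod H\<^esub> u = counit H (src H a \<otimes>\<^bsub>total H\<^esub> u)"
  by (simp_all add: unit_mod_def ring.defs rmod.defs)

lemma mod_dual_simps [simp]:
  "carrier (mod_dual H M) = rlin (base H) (restrict_scalars H M) (regular_rmod (base H))"
  "\<phi> \<oplus>\<^bsub>mod_dual H M\<^esub> \<psi> = (\<lambda>m\<in>carrier M. \<phi> m \<oplus>\<^bsub>base H\<^esub> \<psi> m)"
  by simp_all

section \<open>Models of modules, matrix coefficients and the unit module\<close>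

context cocomm_hopf_algebroid begin

lemma rlin_restrict: "f \<in> rlin U M N \<Longrightarrow> f \<in> rlin A (restrict_scalars H M) (restrict_scalars H N)"
  by (auto simp: rlin_def)

lemma Umod_right_module: "Umod H M \<Longrightarrow> right_module U M"
  by (simp add: Umod_def)

text \<open>The section of a split surjection embeds M into a free module over A, whose elements are
  functions on the natural numbers. Transport along it gives a copy on the type demanded by
  \<open>fmods\<close>.\<close>

lemma model_exists:
  fixes M :: "('u, 'm) rmod"
  assumes M: "Umod H M"
  shows "\<exists>P. P \<in> fmods H \<and> rmod_iso U M P \<noteq> {}"
proof -
  interpret M: right_module U M by (rule Umod_right_module[OF M])
  obtain n p s where s: "s \<in> rlin A (restrict_scalars H M) (free_rmod A n)"
    and ps: "\<And>m. m \<in> carrier M \<Longrightarrow> p (s m) = m"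
    using M unfolding Umod_def fg_projective_def by auto
  have inj: "inj_on s (carrier M)" by (rule inj_on_inverseI[of _ p]) (rule ps)
  note iso = M.transport_iso[OF inj]
  have "fg_projective A (restrict_scalars H (transport_rmod M s))"
  proof (rule fg_projective_transport)
    show "fg_projective A (restrict_scalars H M)" using M by (simp add: Umod_def)
    show "right_module A (restrict_scalars H (transport_rmod M s))"
      by (rule restrict_right_module[OF M.transport_right_module[OF inj]])
    show "restrict s (carrier M) \<in> rlin A (restrict_scalars H M) (restrict_scalars H (transport_rmod M s))"
      by (rule rlin_restrict) (use iso in \<open>simp add: rmod_iso_def\<close>)
    show "bij_betw (restrict s (carrier M)) (carrier (restrict_scalars H M)) (carrier (restrict_scalars H (transport_rmod M s)))"
      using iso by (simp add: rmod_iso_def)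
  qed
  then have "transport_rmod M s \<in> fmods H"
    using M.transport_right_module[OF inj] by (simp add: fmods_def)
  then show ?thesis using iso by blast
qed

lemma model_Umod:
  fixes M :: "('u, 'm) rmod"
  assumes "Umod H M"
  shows "model H M \<in> fmods H" "to_model H M \<in> rmod_iso U M (model H M)"
proof -
  have m: "model H M \<in> fmods H \<and> rmod_iso U M (model H M) \<noteq> {}"
    unfolding model_def by (rule someI_ex[OF model_exists[OF assms]])
  then show "model H M \<in> fmods H" by blast
  from m have "\<exists>f. f \<in> rmod_iso U M (model H M)" by blast
  then show "to_model H M \<in> rmod_iso U M (model H M)"
    unfolding to_model_def by (rule someI_ex)
qed

text \<open>The value of \<zeta> on the class of \<phi> \<otimes> m, made available for modules on
  any type and so also for tensor products and the unit module before a model is chosen.\<close>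

definition matrix_coeff :: "('u, 'm, 'd) rmod_scheme \<Rightarrow> ('m \<Rightarrow> 'a) \<Rightarrow> 'm \<Rightarrow> 'u \<Rightarrow> 'a"
  where "matrix_coeff M \<phi> m = (\<lambda>u\<in>carrier U. \<phi> (m \<triangleleft>\<^bsub>M\<^esub> u))"

lemma dualD:
  assumes "\<phi> \<in> carrier (mod_dual H M)"
  shows "m \<in> carrier M \<Longrightarrow> \<phi> m \<in> carrier A"
    and "\<lbrakk>m \<in> carrier M; n \<in> carrier M\<rbrakk> \<Longrightarrow> \<phi> (m \<oplus>\<^bsub>M\<^esub> n) = \<phi> m \<oplus>\<^bsub>A\<^esub> \<phi> n"
    and "\<lbrakk>m \<in> carrier M; a \<in> carrier A\<rbrakk> \<Longrightarrow> \<phi> (m \<triangleleft>\<^bsub>M\<^esub> src H a) = \<phi> m \<otimes>\<^bsub>A\<^esub> a"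
    and "\<phi> \<in> extensional (carrier M)"
  using assms by (auto simp: rlin_def PiE_def)

lemma dualI:
  assumes "\<And>m. m \<in> carrier M \<Longrightarrow> \<phi> m \<in> carrier A" "\<phi> \<in> extensional (carrier M)"
    "\<And>m n. \<lbrakk>m \<in> carrier M; n \<in> carrier M\<rbrakk> \<Longrightarrow> \<phi> (m \<oplus>\<^bsub>M\<^esub> n) = \<phi> m \<oplus>\<^bsub>A\<^esub> \<phi> n"
    "\<And>m a. \<lbrakk>m \<in> carrier M; a \<in> carrier A\<rbrakk> \<Longrightarrow> \<phi> (m \<triangleleft>\<^bsub>M\<^esub> src H a) = \<phi> m \<otimes>\<^bsub>A\<^esub> a"
  shows "\<phi> \<in> carrier (mod_dual H M)"
  unfolding mod_dual_simps by (rule rlinI) (use assms in simp_all)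

lemma dual_eqI:
  "\<lbrakk>\<phi> \<in> carrier (mod_dual H M); \<psi> \<in> carrier (mod_dual H M); \<And>m. m \<in> carrier M \<Longrightarrow> \<phi> m = \<psi> m\<rbrakk> \<Longrightarrow> \<phi> = \<psi>"
  by (rule rlin_eqI[of \<phi> A "restrict_scalars H M" "regular_rmod A" \<psi>]) simp_all

lemma mod_dual_abelian: "right_module U M \<Longrightarrow> abelian_group (mod_dual H M)"
  by (rule dual_abelian_group[OF A.cring_axioms restrict_right_module])

lemma matrix_coeff_closed:
  assumes M: "right_module U M" and \<phi>: "\<phi> \<in> carrier (mod_dual H M)" and m: "m \<in> carrier M"
  shows "matrix_coeff M \<phi> m \<in> carrier Us"
proof -
  interpret M: right_module U M by fact
  show ?thesis
    by (rule convI) (use m in \<open>simp_all add: matrix_coeff_def dualD[OF \<phi>] M.ract_closed M.ract_add_right M.ract_mult del: mod_dual_simps\<close>)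
qed

lemma dual_compose:
  assumes M: "right_module U M" and \<phi>: "\<phi> \<in> carrier (mod_dual H N)" and f: "f \<in> rlin U M N"
  shows "compose (carrier M) \<phi> f \<in> carrier (mod_dual H M)"
proof -
  interpret M: right_module U M by fact
  show ?thesis
    by (rule dualI) (simp_all add: compose_def dualD[OF \<phi>] rlin_closed[OF f] rlin_add[OF f] rlin_ract[OF f]
        M.ract_closed del: mod_dual_simps)
qed

lemma matrix_coeff_balanced:
  assumes M: "right_module U M"
  shows "balanced (end_balance H M) (mod_dual H M) M Us (\<lambda>(\<phi>, m). matrix_coeff M \<phi> m)"
proof -
  interpret M: right_module U M by fact
  interpret D: abelian_group "mod_dual H M" by (rule mod_dual_abelian[OF M])
  note c = matrix_coeff_closed[OF M]
  show ?thesis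
  proof (rule balancedI; unfold prod.case)
    fix \<phi> m assume \<phi>: "\<phi> \<in> carrier (mod_dual H M)" and m: "m \<in> carrier M"
    show "matrix_coeff M \<phi> m \<in> carrier Us" by (rule c[OF \<phi> m])
    show "matrix_coeff M (\<phi> \<oplus>\<^bsub>mod_dual H M\<^esub> \<psi>) m = matrix_coeff M \<phi> m \<oplus>\<^bsub>Us\<^esub> matrix_coeff M \<psi> m" if \<psi>: "\<psi> \<in> carrier (mod_dual H M)" for \<psi>
      using m by (simp add: matrix_coeff_def M.ract_closed cong: restrict_cong)
    show "matrix_coeff M \<phi> (m \<oplus>\<^bsub>M\<^esub> n) = matrix_coeff M \<phi> m \<oplus>\<^bsub>Us\<^esub> matrix_coeff M \<phi> n" if n: "n \<in> carrier M" for n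
      using m n by (simp add: matrix_coeff_def M.ract_closed M.ract_add_left dualD(2)[OF \<phi>] cong: restrict_cong)
    show "matrix_coeff M (r \<phi>) m = matrix_coeff M \<phi> (l m)" if rl: "(r, l) \<in> end_balance H M" for r l
    proof -
      obtain f where f: "r = (\<lambda>\<phi>. compose (carrier M) \<phi> f)" "l = f" "f \<in> rlin U M M"
        using rl by (auto simp: end_balance_def)
      show ?thesis using m f by (simp add: matrix_coeff_def compose_def M.ract_closed rlin_ract[OF f(3)] cong: restrict_cong)
    qed
  qed
qed

end

context filtered_hopf_algebroid begin

text \<open>Counitality at 1, with comultiplication 1 \<otimes> 1, says that the counit of 1 becomes
  1 inside U; the embedding of A into U, part of the admissible filtration, brings this back to
  A.\<close>

lemma counit_one: "counit H \<one>\<^bsub>U\<^esub> = \<one>\<^bsub>A\<^esub>"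
proof -
  have b: "balUU U (\<lambda>(x, y). x \<otimes>\<^bsub>U\<^esub> src H (counit H y))"
    by (rule balUU_I)
      (simp_all add: counit_closed counit_add counit_right_linear src_add U.l_distr U.r_distr src_mult[symmetric]
        A.m_comm U.m_assoc)
  have "src H (counit H \<one>\<^bsub>U\<^esub>) = src H \<one>\<^bsub>A\<^esub>"
    using counital_right[OF U.one_closed] UU.tlift_pure[OF U.abelian_group_axioms b, of "\<one>\<^bsub>U\<^esub>" "\<one>\<^bsub>U\<^esub>"]
    by (simp add: comult_one counit_closed)
  then show ?thesis by (rule inj_onD[OF src_inj _ counit_closed[OF U.one_closed] A.one_closed])
qed

lemma counit_src: "a \<in> carrier A \<Longrightarrow> counit H (src H a) = a"
  using counit_right_linear[of "\<one>\<^bsub>U\<^esub>" a] by (simp add: counit_one)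

text \<open>Associativity of the action is the axiom \<open>counit_mult\<close>, and the unit law is
  that the counit is a left inverse of the map from A to U.\<close>

lemma unit_mod_right_module: "right_module U (unit_mod H)"
proof (intro right_module.intro right_module_axioms.intro U.ring_axioms)
  show "abelian_group (unit_mod H)" by (rule abelian_group_cong[OF A.abelian_group_axioms]) simp_all
  show "m \<triangleleft>\<^bsub>unit_mod H\<^esub> (r \<otimes>\<^bsub>U\<^esub> s) = m \<triangleleft>\<^bsub>unit_mod H\<^esub> r \<triangleleft>\<^bsub>unit_mod H\<^esub> s"
    if "m \<in> carrier (unit_mod H)" "r \<in> carrier U" "s \<in> carrier U" for m r s
    using that counit_mult[of "src H m \<otimes>\<^bsub>U\<^esub> r" s] by (simp add: U.m_assoc)
qed (simp_all add: counit_closed counit_add src_add U.l_distr U.r_distr counit_src)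

text \<open>Over A the unit module is A acting by multiplication, hence free with the single basis
  element 1 and the identity as functional.\<close>

lemma unit_mod_Umod: "Umod H (unit_mod H)"
proof -
  interpret R: right_module A "restrict_scalars H (unit_mod H)"
    by (rule restrict_right_module[OF unit_mod_right_module])
  have act: "counit H (src H x \<otimes>\<^bsub>U\<^esub> src H y) = x \<otimes>\<^bsub>A\<^esub> y" if "x \<in> carrier A" "y \<in> carrier A" for x y
    using that by (simp add: src_mult[symmetric] counit_src)
  have "dual_basis A (restrict_scalars H (unit_mod H)) {()} (\<lambda>_. \<one>\<^bsub>A\<^esub>) (\<lambda>_. \<lambda>a\<in>carrier A. a)"
    unfolding dual_basis_def
  proof (intro conjI ballI)
    show "(\<lambda>a\<in>carrier A. a) \<in> rlin A (restrict_scalars H (unit_mod H)) (regular_rmod A)"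
      by (rule rlinI) (simp_all add: act)
    fix m assume m: "m \<in> carrier (restrict_scalars H (unit_mod H))"
    have "(\<Oplus>\<^bsub>restrict_scalars H (unit_mod H)\<^esub>i\<in>{()}. \<one>\<^bsub>A\<^esub> \<triangleleft>\<^bsub>restrict_scalars H (unit_mod H)\<^esub> (\<lambda>a\<in>carrier A. a) m) =
        \<one>\<^bsub>A\<^esub> \<triangleleft>\<^bsub>restrict_scalars H (unit_mod H)\<^esub> (\<lambda>a\<in>carrier A. a) m"
      using m by (subst R.M.finsum_insert) (simp_all add: act counit_src R.M.r_zero[simplified])
    then show "m = (\<Oplus>\<^bsub>restrict_scalars H (unit_mod H)\<^esub>i\<in>{()}. \<one>\<^bsub>A\<^esub> \<triangleleft>\<^bsub>restrict_scalars H (unit_mod H)\<^esub> (\<lambda>a\<in>carrier A. a) m)"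
      using m by (simp add: counit_src)
  qed simp_all
  then show ?thesis
    using R.fg_projective_of_dual_basis unit_mod_right_module by (auto simp: Umod_def)
qed

end

section \<open>The direct sum over all modules\<close>

context cocomm_hopf_algebroid begin

lemma summand_tensor_product:
  fixes M :: "('u, 'm) rmod"
  assumes "right_module U M"
  shows "tensor_product (end_balance H M) (mod_dual H M) M (summand H M)"
proof -
  interpret M: right_module U M by fact
  interpret D: abelian_group "mod_dual H M" by (rule mod_dual_abelian[OF assms])
  show ?thesis
  proof
    show "r \<phi> \<in> carrier (mod_dual H M) \<and> l m \<in> carrier M"
      if rl: "(r, l) \<in> end_balance H M" and \<phi>: "\<phi> \<in> carrier (mod_dual H M)" and m: "m \<in> carrier M" for r l \<phi> m
    proof -
      obtain f where f: "r = (\<lambda>\<phi>. compose (carrier M) \<phi> f)" "l = f" "f \<in> rlin U M M"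
        using rl by (auto simp: end_balance_def)
      then show ?thesis using dual_compose[OF assms \<phi> f(3)] rlin_closed[OF f(3) m] by blast
    qed
  qed (simp_all add: summand_def)
qed

abbreviation "DG \<equiv> dsum_group H"

abbreviation "sp M \<equiv> pure_tensor (end_balance H M) (mod_dual H M) M"

lemma fmods_right_module: "M \<in> fmods H \<Longrightarrow> right_module U M"
  by (simp add: fmods_def)

lemmas summand_tp = summand_tensor_product[OF fmods_right_module]

lemma summand_abelian: "M \<in> fmods H \<Longrightarrow> abelian_group (summand H M)"
  by (rule tensor_product.T_abelian[OF summand_tp])

lemma summand_group: "M \<in> fmods H \<Longrightarrow> group (add_monoid (summand H M))"
  by (rule abelian_group.a_group[OF summand_abelian])

lemma DG_simps:
  "carrier DG = {d \<in> \<Pi>\<^sub>E M\<in>fmods H. carrier (summand H M). finite {M \<in> fmods H. d M \<noteq> \<zero>\<^bsub>summand H M\<^esub>}}"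
  "d \<oplus>\<^bsub>DG\<^esub> e = (\<lambda>M\<in>fmods H. d M \<oplus>\<^bsub>summand H M\<^esub> e M)"
  "\<zero>\<^bsub>DG\<^esub> = (\<lambda>M\<in>fmods H. \<zero>\<^bsub>summand H M\<^esub>)"
  using carrier_sum_group[of "fmods H" "\<lambda>M. add_monoid (summand H M)"] summand_group
  by (simp_all add: dsum_group_def Let_def)

lemma DG_mem: "\<lbrakk>d \<in> carrier DG; M \<in> fmods H\<rbrakk> \<Longrightarrow> d M \<in> carrier (summand H M)"
  by (auto simp: DG_simps)

lemma DG_finite: "d \<in> carrier DG \<Longrightarrow> finite {M \<in> fmods H. d M \<noteq> \<zero>\<^bsub>summand H M\<^esub>}"
  by (simp add: DG_simps)

lemma DG_eqI:
  assumes "d \<in> carrier DG" "e \<in> carrier DG" "\<And>M. M \<in> fmods H \<Longrightarrow> d M = e M"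
  shows "d = e"
  using assms by (auto simp: DG_simps intro: PiE_ext)

lemma DG_abelian: "abelian_group DG"
proof -
  interpret S: group "sum_group (fmods H) (\<lambda>M. add_monoid (summand H M))"
    by (rule sum_group) (rule summand_group)
  have S: "carrier (sum_group (fmods H) (\<lambda>M. add_monoid (summand H M))) = carrier DG"
    "(\<otimes>\<^bsub>sum_group (fmods H) (\<lambda>M. add_monoid (summand H M))\<^esub>) = (\<oplus>\<^bsub>DG\<^esub>)"
    "\<one>\<^bsub>sum_group (fmods H) (\<lambda>M. add_monoid (summand H M))\<^esub> = \<zero>\<^bsub>DG\<^esub>"
    by (simp_all add: dsum_group_def Let_def)
  show ?thesis
  proof (rule abelian_groupI)
    show "d \<oplus>\<^bsub>DG\<^esub> e = e \<oplus>\<^bsub>DG\<^esub> d" if "d \<in> carrier DG" "e \<in> carrier DG" for d e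
      unfolding DG_simps(2)
      by (rule restrict_ext) (rule abelian_groupE(4)[OF summand_abelian DG_mem[OF that(1)] DG_mem[OF that(2)]])
  qed (use S.m_closed S.one_closed S.m_assoc S.l_one S.l_inv_ex in \<open>unfold S, auto\<close>)
qed

sublocale DG: abelian_group DG by (rule DG_abelian)

definition single :: "('a, 'u) fobj \<Rightarrow> ((nat \<Rightarrow> 'a) \<Rightarrow> 'a, nat \<Rightarrow> 'a) tens \<Rightarrow> ('a, 'u) fsum"
  where "single M t = (\<lambda>N\<in>fmods H. if N = M then t else \<zero>\<^bsub>summand H N\<^esub>)"

lemma dsum_elt_single: "dsum_elt H M \<phi> m = single M (sp M \<phi> m)"
  by (simp add: dsum_elt_def single_def)

lemma summand_zero_closed: "M \<in> fmods H \<Longrightarrow> \<zero>\<^bsub>summand H M\<^esub> \<in> carrier (summand H M)"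
  by (rule abelian_groupE(2)[OF summand_abelian])

lemma single_closed:
  assumes "M \<in> fmods H" "t \<in> carrier (summand H M)"
  shows "single M t \<in> carrier DG"
proof -
  have "finite {N \<in> fmods H. single M t N \<noteq> \<zero>\<^bsub>summand H N\<^esub>}"
    by (rule finite_subset[of _ "{M}"]) (auto simp: single_def)
  then show ?thesis using assms summand_zero_closed by (auto simp: DG_simps single_def)
qed

lemma single_hom:
  assumes M: "M \<in> fmods H"
  shows "abelian_group_hom (summand H M) DG (single M)"
proof (rule abelian_group_hom_intro[OF summand_abelian[OF M] DG_abelian single_closed[OF M]])
  fix s t assume "s \<in> carrier (summand H M)" "t \<in> carrier (summand H M)"
  show "single M (s \<oplus>\<^bsub>summand H M\<^esub> t) = single M s \<oplus>\<^bsub>DG\<^esub> single M t"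
    unfolding DG_simps(2) single_def
  proof (rule restrict_ext)
    fix N assume N: "N \<in> fmods H"
    have "\<zero>\<^bsub>summand H N\<^esub> \<oplus>\<^bsub>summand H N\<^esub> \<zero>\<^bsub>summand H N\<^esub> = \<zero>\<^bsub>summand H N\<^esub>"
      by (rule abelian_groupE(5)[OF summand_abelian[OF N] summand_zero_closed[OF N]])
    then show "(if N = M then s \<oplus>\<^bsub>summand H M\<^esub> t else \<zero>\<^bsub>summand H N\<^esub>) =
        (\<lambda>N\<in>fmods H. if N = M then s else \<zero>\<^bsub>summand H N\<^esub>) N \<oplus>\<^bsub>summand H N\<^esub>
        (\<lambda>N\<in>fmods H. if N = M then t else \<zero>\<^bsub>summand H N\<^esub>) N"
      using N by simp
  qed
qed

lemma dsum_elt_closed: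
  assumes "M \<in> fmods H" "\<phi> \<in> carrier (mod_dual H M)" "m \<in> carrier M"
  shows "dsum_elt H M \<phi> m \<in> carrier DG"
  unfolding dsum_elt_single
  by (rule single_closed[OF assms(1) tensor_product.pure_closed[OF summand_tp[OF assms(1)] assms(2,3)]])

lemma dsum_elt_balanced:
  assumes M: "M \<in> fmods H"
  shows "balanced (end_balance H M) (mod_dual H M) M DG (\<lambda>(\<phi>, m). dsum_elt H M \<phi> m)"
proof -
  interpret tp: tensor_product "end_balance H M" "mod_dual H M" M "summand H M" by (rule summand_tp[OF M])
  interpret s: abelian_group_hom "summand H M" DG "single M" by (rule single_hom[OF M])
  show ?thesis
    by (rule balancedI; unfold prod.case dsum_elt_single)
      (simp_all only: tp.pure_closed tp.pure_add_left tp.pure_add_right tp.pure_balance s.hom_closed s.hom_add)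
qed

text \<open>Induction on a finite set containing the support. Elements of a single summand are
  reached by \<open>tensor_induct\<close>, so only the generators, zero and differences need to be
  treated.\<close>

lemma dsum_induct [consumes 1, case_names zero elt diff]:
  assumes d: "d \<in> carrier DG"
    and zero: "P \<zero>\<^bsub>DG\<^esub>"
    and elt: "\<And>M \<phi> m. \<lbrakk>M \<in> fmods H; \<phi> \<in> carrier (mod_dual H M); m \<in> carrier M\<rbrakk> \<Longrightarrow> P (dsum_elt H M \<phi> m)"
    and diff: "\<And>d e. \<lbrakk>d \<in> carrier DG; e \<in> carrier DG; P d; P e\<rbrakk> \<Longrightarrow> P (d \<ominus>\<^bsub>DG\<^esub> e)"
  shows "P d"
proof -
  have single: "P (single M t)" if M: "M \<in> fmods H" and t: "t \<in> carrier (summand H M)" for M t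
    using t
  proof (induction rule: tensor_product.tensor_induct[OF summand_tp[OF M], consumes 1, case_names pure diff])
    case (pure \<phi> m) then show ?case using elt[OF M] by (simp only: dsum_elt_single)
  next
    case (diff s t)
    then show ?case
      using assms(4)[OF single_closed[OF M] single_closed[OF M]] abelian_group_hom.hom_minus[OF single_hom[OF M]] by simp
  qed
  have "\<forall>d\<in>carrier DG. {M \<in> fmods H. d M \<noteq> \<zero>\<^bsub>summand H M\<^esub>} \<subseteq> S \<longrightarrow> P d" if "finite S" for S
    using that
  proof (induction S rule: finite_induct)
    case empty
    have "d = \<zero>\<^bsub>DG\<^esub>" if "d \<in> carrier DG" "{M \<in> fmods H. d M \<noteq> \<zero>\<^bsub>summand H M\<^esub>} \<subseteq> {}" for d
      by (rule DG_eqI[OF that(1) DG.zero_closed]) (use that(2) in \<open>auto simp: DG_simps(3)\<close>)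
    then show ?case using zero by blast
  next
    case (insert N S)
    show ?case
    proof (intro ballI impI)
      fix d assume d: "d \<in> carrier DG" and sup: "{M \<in> fmods H. d M \<noteq> \<zero>\<^bsub>summand H M\<^esub>} \<subseteq> insert N S"
      show "P d"
      proof (cases "N \<in> fmods H")
        case False
        then have "{M \<in> fmods H. d M \<noteq> \<zero>\<^bsub>summand H M\<^esub>} \<subseteq> S" using sup by blast
        then show ?thesis using insert.IH d by blast
      next
        case True
        interpret SN: abelian_group "summand H N" by (rule summand_abelian[OF True])
        \<comment> \<open>Adding s cancels the component at N and shrinks the support; the original
          element is recovered as a difference, the operation under which P is closed.\<close>
        define s where "s = single N (\<ominus>\<^bsub>summand H N\<^esub> d N)"
        have nc: "\<ominus>\<^bsub>summand H N\<^esub> d N \<in> carrier (summand H N)" using DG_mem[OF d True] by simp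
        have sc: "s \<in> carrier DG" unfolding s_def by (rule single_closed[OF True nc])
        have dc: "d \<oplus>\<^bsub>DG\<^esub> s \<in> carrier DG" by (rule DG.a_closed[OF d sc])
        have "{M \<in> fmods H. (d \<oplus>\<^bsub>DG\<^esub> s) M \<noteq> \<zero>\<^bsub>summand H M\<^esub>} \<subseteq> S"
        proof
          fix M assume M: "M \<in> {M \<in> fmods H. (d \<oplus>\<^bsub>DG\<^esub> s) M \<noteq> \<zero>\<^bsub>summand H M\<^esub>}"
          then have Mf: "M \<in> fmods H" by blast
          from M have ne: "d M \<oplus>\<^bsub>summand H M\<^esub> s M \<noteq> \<zero>\<^bsub>summand H M\<^esub>"
            unfolding DG_simps(2) mem_Collect_eq restrict_apply'[OF Mf] by (rule conjunct2)
          interpret SM: abelian_group "summand H M" by (rule summand_abelian[OF Mf])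
          have "M \<noteq> N"
          proof
            assume "M = N"
            moreover have "s N = \<ominus>\<^bsub>summand H N\<^esub> d N" using True by (simp add: s_def single_def)
            ultimately have "d M \<oplus>\<^bsub>summand H M\<^esub> s M = \<zero>\<^bsub>summand H M\<^esub>"
              using SN.r_neg[OF DG_mem[OF d True]] by simp
            then show False using ne by (rule notE[rotated])
          qed
          then have "s M = \<zero>\<^bsub>summand H M\<^esub>" using Mf by (simp add: s_def single_def)
          then have "d M \<noteq> \<zero>\<^bsub>summand H M\<^esub>" using ne SM.l_zero[OF SM.zero_closed] by auto
          then show "M \<in> S" using sup Mf \<open>M \<noteq> N\<close> by blast
        qed
        then have "P (d \<oplus>\<^bsub>DG\<^esub> s)" using insert.IH dc by blast
        moreover have "P s" unfolding s_def by (rule single[OF True nc])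
        ultimately have "P ((d \<oplus>\<^bsub>DG\<^esub> s) \<ominus>\<^bsub>DG\<^esub> s)" using diff dc sc by blast
        then show ?thesis using DG.add_diff_cancel[OF d sc] by simp
      qed
    qed
  qed
  then show ?thesis using d DG_finite[OF d] by blast
qed

definition balanced_family :: "('g, 'e) ring_scheme \<Rightarrow> (('a, 'u) fobj \<Rightarrow> ((nat \<Rightarrow> 'a) \<Rightarrow> 'a) \<Rightarrow> (nat \<Rightarrow> 'a) \<Rightarrow> 'g) \<Rightarrow> bool"
  where "balanced_family G h \<longleftrightarrow> (\<forall>M\<in>fmods H. balanced (end_balance H M) (mod_dual H M) M G (\<lambda>(\<phi>, m). h M \<phi> m))"

text \<open>As for formal combinations, summands with zero component contribute nothing; a common
  finite set of modules then yields additivity although supports vary.\<close>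

lemma dsum_lift_superset:
  assumes G: "abelian_group G" and h: "balanced_family G h" and d: "d \<in> carrier DG"
    and S: "finite S" "S \<subseteq> fmods H" "{M \<in> fmods H. d M \<noteq> \<zero>\<^bsub>summand H M\<^esub>} \<subseteq> S"
  shows "dsum_lift H G h d = (\<Oplus>\<^bsub>G\<^esub>M\<in>S. tlift G (\<lambda>(\<phi>, m). h M \<phi> m) (d M))"
proof -
  interpret G: abelian_group G by fact
  have hom: "abelian_group_hom (summand H M) G (tlift G (\<lambda>(\<phi>, m). h M \<phi> m))" if "M \<in> fmods H" for M
    by (rule tensor_product.tlift_hom[OF summand_tp[OF that] G]) (use h that in \<open>simp add: balanced_family_def\<close>)
  show ?thesis
    unfolding dsum_lift_def
  proof (rule G.add.finprod_mono_neutral_cong_left[OF S(1,3)])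
    show "tlift G (\<lambda>(\<phi>, m). h M \<phi> m) (d M) = \<zero>\<^bsub>G\<^esub>" if "M \<in> S - {M \<in> fmods H. d M \<noteq> \<zero>\<^bsub>summand H M\<^esub>}" for M
      using that S(2) abelian_group_hom.hom_zero[OF hom, of M] by auto
    show "(\<lambda>M. tlift G (\<lambda>(\<phi>, m). h M \<phi> m) (d M)) \<in> S \<rightarrow> carrier G"
      using S(2) abelian_group_hom.hom_closed[OF hom DG_mem[OF d]] by auto
  qed simp
qed

lemma dsum_lift_hom:
  assumes G: "abelian_group G" and h: "balanced_family G h"
  shows "abelian_group_hom DG G (dsum_lift H G h)"
proof -
  interpret G: abelian_group G by fact
  have hom: "abelian_group_hom (summand H M) G (tlift G (\<lambda>(\<phi>, m). h M \<phi> m))" if "M \<in> fmods H" for M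
    by (rule tensor_product.tlift_hom[OF summand_tp[OF that] G]) (use h that in \<open>simp add: balanced_family_def\<close>)
  have c: "(\<lambda>M. tlift G (\<lambda>(\<phi>, m). h M \<phi> m) (d M)) \<in> S \<rightarrow> carrier G" if "d \<in> carrier DG" "S \<subseteq> fmods H" for d S
    using that(2) abelian_group_hom.hom_closed[OF hom DG_mem[OF that(1)]] by auto
  show ?thesis
  proof (rule abelian_group_hom_intro[OF DG_abelian G])
    fix d assume d: "d \<in> carrier DG"
    show "dsum_lift H G h d \<in> carrier G"
      unfolding dsum_lift_def by (rule G.finsum_closed[OF c[OF d]]) blast
    fix e assume e: "e \<in> carrier DG"
    let ?S = "{M \<in> fmods H. d M \<noteq> \<zero>\<^bsub>summand H M\<^esub>} \<union> {M \<in> fmods H. e M \<noteq> \<zero>\<^bsub>summand H M\<^esub>}"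
    have S: "finite ?S" "?S \<subseteq> fmods H" using DG_finite[OF d] DG_finite[OF e] by auto
    have de: "d \<oplus>\<^bsub>DG\<^esub> e \<in> carrier DG" by (rule DG.a_closed[OF d e])
    have sup: "{M \<in> fmods H. (d \<oplus>\<^bsub>DG\<^esub> e) M \<noteq> \<zero>\<^bsub>summand H M\<^esub>} \<subseteq> ?S"
      using abelian_groupE(5)[OF summand_abelian summand_zero_closed] by (auto simp: DG_simps(2))
    have "dsum_lift H G h (d \<oplus>\<^bsub>DG\<^esub> e) = (\<Oplus>\<^bsub>G\<^esub>M\<in>?S. tlift G (\<lambda>(\<phi>, m). h M \<phi> m) ((d \<oplus>\<^bsub>DG\<^esub> e) M))"
      by (rule dsum_lift_superset[OF G h de S sup])
    also have "\<dots> = (\<Oplus>\<^bsub>G\<^esub>M\<in>?S. tlift G (\<lambda>(\<phi>, m). h M \<phi> m) (d M) \<oplus>\<^bsub>G\<^esub> tlift G (\<lambda>(\<phi>, m). h M \<phi> m) (e M))"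
    proof (rule G.finsum_cong')
      show "tlift G (\<lambda>(\<phi>, m). h M \<phi> m) ((d \<oplus>\<^bsub>DG\<^esub> e) M) =
          tlift G (\<lambda>(\<phi>, m). h M \<phi> m) (d M) \<oplus>\<^bsub>G\<^esub> tlift G (\<lambda>(\<phi>, m). h M \<phi> m) (e M)" if "M \<in> ?S" for M
      proof -
        have M: "M \<in> fmods H" using that by blast
        show ?thesis
          using abelian_group_hom.hom_add[OF hom[OF M] DG_mem[OF d M] DG_mem[OF e M]] M by (simp add: DG_simps(2))
      qed
    qed (use c[OF d S(2)] c[OF e S(2)] in \<open>auto simp: Pi_iff\<close>)
    also have "\<dots> = (\<Oplus>\<^bsub>G\<^esub>M\<in>?S. tlift G (\<lambda>(\<phi>, m). h M \<phi> m) (d M)) \<oplus>\<^bsub>G\<^esub> (\<Oplus>\<^bsub>G\<^esub>M\<in>?S. tlift G (\<lambda>(\<phi>, m). h M \<phi> m) (e M))"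
      by (rule G.finsum_addf[OF c[OF d S(2)] c[OF e S(2)]])
    also have "\<dots> = dsum_lift H G h d \<oplus>\<^bsub>G\<^esub> dsum_lift H G h e"
      using dsum_lift_superset[OF G h d S] dsum_lift_superset[OF G h e S] by simp
    finally show "dsum_lift H G h (d \<oplus>\<^bsub>DG\<^esub> e) = dsum_lift H G h d \<oplus>\<^bsub>G\<^esub> dsum_lift H G h e" .
  qed
qed

lemma dsum_lift_elt:
  assumes G: "abelian_group G" and h: "balanced_family G h"
    and M: "M \<in> fmods H" and \<phi>: "\<phi> \<in> carrier (mod_dual H M)" and m: "m \<in> carrier M"
  shows "dsum_lift H G h (dsum_elt H M \<phi> m) = h M \<phi> m"
proof -
  interpret G: abelian_group G by fact
  have b: "balanced (end_balance H M) (mod_dual H M) M G (\<lambda>(\<phi>, m). h M \<phi> m)"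
    using h M by (simp add: balanced_family_def)
  have p: "tlift G (\<lambda>(\<phi>, m). h M \<phi> m) (sp M \<phi> m) = h M \<phi> m"
    using tensor_product.tlift_pure[OF summand_tp[OF M] G b \<phi> m] by simp
  have hc: "h M \<phi> m \<in> carrier G" using b \<phi> m unfolding balanced_def by fastforce
  have e: "dsum_elt H M \<phi> m M = sp M \<phi> m" using M by (simp add: dsum_elt_def)
  have "dsum_lift H G h (dsum_elt H M \<phi> m) = (\<Oplus>\<^bsub>G\<^esub>N\<in>{M}. tlift G (\<lambda>(\<phi>, m). h N \<phi> m) (dsum_elt H M \<phi> m N))"
    by (rule dsum_lift_superset[OF G h dsum_elt_closed[OF M \<phi> m]]) (use M in \<open>auto simp: dsum_elt_def\<close>)
  also have "\<dots> = h M \<phi> m" using hc by (subst G.finsum_insert) (simp_all add: e p)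
  finally show ?thesis .
qed

lemma dsum_hom_eqI:
  assumes h: "abelian_group_hom DG G h" and h': "abelian_group_hom DG G h'"
    and eq: "\<And>M \<phi> m. \<lbrakk>M \<in> fmods H; \<phi> \<in> carrier (mod_dual H M); m \<in> carrier M\<rbrakk> \<Longrightarrow>
      h (dsum_elt H M \<phi> m) = h' (dsum_elt H M \<phi> m)"
    and d: "d \<in> carrier DG"
  shows "h d = h' d"
  using d
proof (induction rule: dsum_induct)
  case zero then show ?case using abelian_group_hom.hom_zero[OF h] abelian_group_hom.hom_zero[OF h'] by simp
next
  case (diff d e)
  then show ?case using abelian_group_hom.hom_minus[OF h] abelian_group_hom.hom_minus[OF h'] by simp
qed (rule eq)

end

section \<open>Transport of elements to the chosen models\<close>

context cocomm_hopf_algebroid begin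

lemma rlin_inverse:
  assumes M: "right_module U M" and f: "f \<in> rmod_iso U M N"
  shows "(\<lambda>x\<in>carrier N. inv_into (carrier M) f x) \<in> rlin U N M"
proof -
  interpret M: right_module U M by fact
  have fl: "f \<in> rlin U M N" and b: "bij_betw f (carrier M) (carrier N)" using f by (auto simp: rmod_iso_def)
  define g where "g = inv_into (carrier M) f"
  have g: "g y \<in> carrier M" "f (g y) = y" if "y \<in> carrier N" for y
    using that b inv_into_into[of y f "carrier M"] f_inv_into_f[of y f "carrier M"]
    by (auto simp: g_def bij_betw_def)
  have gf: "g (f x) = x" if "x \<in> carrier M" for x
    using that b by (simp add: g_def bij_betw_def)
  have add: "x \<oplus>\<^bsub>N\<^esub> y \<in> carrier N" "g (x \<oplus>\<^bsub>N\<^esub> y) = g x \<oplus>\<^bsub>M\<^esub> g y" if "x \<in> carrier N" "y \<in> carrier N" for x y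
    using rlin_add[OF fl g(1)[OF that(1)] g(1)[OF that(2)]] g that gf[of "g x \<oplus>\<^bsub>M\<^esub> g y"]
      rlin_closed[OF fl, of "g x \<oplus>\<^bsub>M\<^esub> g y"] by simp_all
  have ract: "x \<triangleleft>\<^bsub>N\<^esub> r \<in> carrier N" "g (x \<triangleleft>\<^bsub>N\<^esub> r) = g x \<triangleleft>\<^bsub>M\<^esub> r" if "x \<in> carrier N" "r \<in> carrier U" for x r
    using rlin_ract[OF fl g(1)[OF that(1)] that(2)] g that gf[of "g x \<triangleleft>\<^bsub>M\<^esub> r"]
      rlin_closed[OF fl, of "g x \<triangleleft>\<^bsub>M\<^esub> r"] by (simp_all add: M.ract_closed)
  show ?thesis
    unfolding g_def[symmetric] by (rule rlinI) (simp_all add: g add ract)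
qed

context
  fixes Q :: "('u, 'm) rmod"
  assumes Q: "Umod H Q"
begin

interpretation Q: right_module U Q by (rule Umod_right_module[OF Q])

private abbreviation "mdl \<equiv> model H Q"
private abbreviation "tmd \<equiv> to_model H Q"
private abbreviation "imd \<equiv> \<lambda>x\<in>carrier mdl. inv_into (carrier Q) tmd x"

lemma to_model_rlin: "tmd \<in> rlin U Q mdl"
  and to_model_inv: "m \<in> carrier Q \<Longrightarrow> inv_into (carrier Q) tmd (tmd m) = m"
  and to_model_closed: "m \<in> carrier Q \<Longrightarrow> tmd m \<in> carrier mdl"
  using model_Umod(2)[OF Q] by (auto simp: rmod_iso_def bij_betw_def)

lemma transport_elt_eq: "transport_elt H Q \<phi> m = dsum_elt H mdl (compose (carrier mdl) \<phi> imd) (tmd m)"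
proof -
  have "(\<lambda>x\<in>carrier mdl. \<phi> (inv_into (carrier Q) tmd x)) = compose (carrier mdl) \<phi> imd"
    by (simp add: compose_def cong: restrict_cong)
  then show ?thesis by (simp add: transport_elt_def)
qed

lemma transport_dual_closed: "\<phi> \<in> carrier (mod_dual H Q) \<Longrightarrow> compose (carrier mdl) \<phi> imd \<in> carrier (mod_dual H mdl)"
  by (rule dual_compose[OF fmods_right_module[OF model_Umod(1)[OF Q]] _ rlin_inverse[OF Q.right_module_axioms model_Umod(2)[OF Q]]])

lemma transport_elt_closed:
  "\<lbrakk>\<phi> \<in> carrier (mod_dual H Q); m \<in> carrier Q\<rbrakk> \<Longrightarrow> transport_elt H Q \<phi> m \<in> carrier DG"
  unfolding transport_elt_eq
  by (rule dsum_elt_closed[OF model_Umod(1)[OF Q] transport_dual_closed to_model_closed])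

text \<open>An endomorphism of Q corresponds to its conjugate on the model, so the relations over
  the endomorphism ring of Q follow from those that hold in the summand of the model.\<close>

lemma transport_elt_balanced:
  "balanced (end_balance H Q) (mod_dual H Q) Q DG (\<lambda>(\<phi>, m). transport_elt H Q \<phi> m)"
proof -
  note Pf = model_Umod(1)[OF Q]
  note b = dsum_elt_balanced[OF Pf]
  note imd = rlin_inverse[OF Q.right_module_axioms model_Umod(2)[OF Q]]
  interpret mdl: right_module U mdl by (rule fmods_right_module[OF Pf])
  interpret DQ: abelian_group "mod_dual H Q" by (rule mod_dual_abelian[OF Q.right_module_axioms])
  show ?thesis
  proof (rule balancedI; unfold prod.case)
    fix \<phi> m assume \<phi>: "\<phi> \<in> carrier (mod_dual H Q)" and m: "m \<in> carrier Q"
    show "transport_elt H Q \<phi> m \<in> carrier DG" by (rule transport_elt_closed[OF \<phi> m])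
    show "transport_elt H Q (\<phi> \<oplus>\<^bsub>mod_dual H Q\<^esub> \<psi>) m = transport_elt H Q \<phi> m \<oplus>\<^bsub>DG\<^esub> transport_elt H Q \<psi> m"
      if \<psi>: "\<psi> \<in> carrier (mod_dual H Q)" for \<psi>
    proof -
      have "compose (carrier mdl) (\<phi> \<oplus>\<^bsub>mod_dual H Q\<^esub> \<psi>) imd = compose (carrier mdl) \<phi> imd \<oplus>\<^bsub>mod_dual H mdl\<^esub> compose (carrier mdl) \<psi> imd"
        unfolding compose_def mod_dual_simps(2)
      proof (rule restrict_ext)
        fix x assume x: "x \<in> carrier mdl"
        have "imd x \<in> carrier Q" by (rule rlin_closed[OF imd x])
        then show "(\<lambda>m\<in>carrier Q. \<phi> m \<oplus>\<^bsub>A\<^esub> \<psi> m) (imd x) = (\<lambda>x\<in>carrier mdl. \<phi> (imd x)) x \<oplus>\<^bsub>A\<^esub> (\<lambda>x\<in>carrier mdl. \<psi> (imd x)) x"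
          using x by simp
      qed
      then show ?thesis
        using b transport_dual_closed[OF \<phi>] transport_dual_closed[OF \<psi>] to_model_closed[OF m]
        unfolding transport_elt_eq balanced_def by simp
    qed
    show "transport_elt H Q \<phi> (m \<oplus>\<^bsub>Q\<^esub> n) = transport_elt H Q \<phi> m \<oplus>\<^bsub>DG\<^esub> transport_elt H Q \<phi> n"
      if n: "n \<in> carrier Q" for n
      using b transport_dual_closed[OF \<phi>] to_model_closed[OF m] to_model_closed[OF n] rlin_add[OF to_model_rlin m n]
      unfolding transport_elt_eq balanced_def by simp
    show "transport_elt H Q (r \<phi>) m = transport_elt H Q \<phi> (l m)" if rl: "(r, l) \<in> end_balance H Q" for r l
    proof -
      obtain f where f: "r = (\<lambda>\<phi>. compose (carrier Q) \<phi> f)" "l = f" "f \<in> rlin U Q Q"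
        using rl by (auto simp: end_balance_def)
      \<comment> \<open>The endomorphism f conjugated by the isomorphism with the model.\<close>
      define f' where "f' = compose (carrier mdl) (compose (carrier Q) tmd f) imd"
      have f': "f' \<in> rlin U mdl mdl"
        unfolding f'_def
        by (intro rlin_compose[OF imd rlin_compose[OF f(3) to_model_rlin]])
          (simp_all add: Q.ract_closed mdl.ract_closed)
      have f'x: "f' x = tmd (f (imd x))" if "x \<in> carrier mdl" for x
        using that rlin_closed[OF imd that] by (simp add: f'_def compose_def)
      have "compose (carrier mdl) (r \<phi>) imd = compose (carrier mdl) (compose (carrier mdl) \<phi> imd) f'"
        unfolding f(1) compose_def[of "carrier mdl"]
      proof (rule restrict_ext)
        fix x assume x: "x \<in> carrier mdl"
        have gx: "imd x \<in> carrier Q" by (rule rlin_closed[OF imd x])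
        have fgx: "f (imd x) \<in> carrier Q" by (rule rlin_closed[OF f(3) gx])
        have "imd (f' x) = f (imd x)" using f'x[OF x] to_model_inv[OF fgx] to_model_closed[OF fgx] by simp
        moreover have "f' x \<in> carrier mdl" by (rule rlin_closed[OF f' x])
        ultimately show "compose (carrier Q) \<phi> f (imd x) = (\<lambda>x\<in>carrier mdl. \<phi> (imd x)) (f' x)"
          using gx by (simp add: compose_def)
      qed
      moreover have "f' (tmd m) = tmd (f m)"
        using f'x[OF to_model_closed[OF m]] to_model_inv[OF m] to_model_closed[OF m] by simp
      moreover have "dsum_elt H mdl (compose (carrier mdl) (compose (carrier mdl) \<phi> imd) f') (tmd m) =
          dsum_elt H mdl (compose (carrier mdl) \<phi> imd) (f' (tmd m))"
      proof -
        have "(\<lambda>\<phi>. compose (carrier mdl) \<phi> f', f') \<in> end_balance H mdl" using f' by (auto simp: end_balance_def)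
        then show ?thesis
          using b transport_dual_closed[OF \<phi>] to_model_closed[OF m] unfolding balanced_def by fast
      qed
      ultimately show ?thesis unfolding transport_elt_eq f(2) by simp
    qed
  qed
qed

text \<open>Isomorphic modules have the same matrix coefficients, so values of \<zeta> do not see
  which model and which isomorphism were chosen.\<close>

lemma matrix_coeff_transport:
  assumes \<phi>: "\<phi> \<in> carrier (mod_dual H Q)" and m: "m \<in> carrier Q"
  shows "matrix_coeff mdl (compose (carrier mdl) \<phi> imd) (tmd m) = matrix_coeff Q \<phi> m"
  unfolding matrix_coeff_def
proof (rule restrict_ext)
  fix u assume u: "u \<in> carrier U"
  have mu: "m \<triangleleft>\<^bsub>Q\<^esub> u \<in> carrier Q" by (rule Q.ract_closed[OF m u])
  show "compose (carrier mdl) \<phi> imd (tmd m \<triangleleft>\<^bsub>mdl\<^esub> u) = \<phi> (m \<triangleleft>\<^bsub>Q\<^esub> u)"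
    using rlin_ract[OF to_model_rlin m u] to_model_inv[OF mu] to_model_closed[OF mu] by (simp add: compose_def)
qed

end

end

section \<open>Functionals and endomorphisms of a tensor product, and products of matrix
  coefficients\<close>

context umodule_pair begin

lemma star_balanced:
  assumes \<psi>: "\<psi> \<in> carrier (mod_dual H N)" and \<phi>: "\<phi> \<in> carrier (mod_dual H M)"
  shows "balMN A (\<lambda>(m, n). \<phi> m \<otimes>\<^bsub>A\<^esub> \<psi> n)"
  by (rule MN.balanced_rI)
    (simp_all add: dualD[OF \<phi>] dualD[OF \<psi>] A.l_distr A.r_distr A.m_ac del: mod_dual_simps)

lemma star_apply: "t \<in> carrier T \<Longrightarrow> star H M N \<psi> \<phi> t = tlift A (\<lambda>(m, n). \<phi> m \<otimes>\<^bsub>A\<^esub> \<psi> n) t"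
  by (simp add: star_def P_simps)

lemma star_pure:
  assumes "\<psi> \<in> carrier (mod_dual H N)" "\<phi> \<in> carrier (mod_dual H M)" "m \<in> carrier M" "n \<in> carrier N"
  shows "star H M N \<psi> \<phi> (MN.pure m n) = \<phi> m \<otimes>\<^bsub>A\<^esub> \<psi> n"
  using MN.tlift_pure[OF A.abelian_group_axioms star_balanced[OF assms(1,2)], of m n] MN.pure_closed[of m n] assms(3,4)
  by (simp add: star_apply)

lemma star_closed:
  assumes \<psi>: "\<psi> \<in> carrier (mod_dual H N)" and \<phi>: "\<phi> \<in> carrier (mod_dual H M)"
  shows "star H M N \<psi> \<phi> \<in> carrier (mod_dual H P)"
proof (rule dualI)
  note A = A.abelian_group_axioms
  note b = star_balanced[OF assms]
  interpret TM: right_module A T by (rule MN.rtensor_right_module)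
  show "star H M N \<psi> \<phi> \<in> extensional (carrier P)" by (simp add: star_def)
  show "star H M N \<psi> \<phi> t \<in> carrier A" if "t \<in> carrier P" for t
    using that MN.tlift_closed[OF A b] by (simp add: P_simps star_apply)
  show "star H M N \<psi> \<phi> (s \<oplus>\<^bsub>P\<^esub> t) = star H M N \<psi> \<phi> s \<oplus>\<^bsub>A\<^esub> star H M N \<psi> \<phi> t" if "s \<in> carrier P" "t \<in> carrier P" for s t
    using that MN.tlift_add[OF A b] by (simp add: P_simps star_apply)
  fix t a assume t: "t \<in> carrier P" and a: "a \<in> carrier A"
  have h1: "abelian_group_hom T A (\<lambda>t. tlift A (\<lambda>(m, n). \<phi> m \<otimes>\<^bsub>A\<^esub> \<psi> n) (t \<triangleleft>\<^bsub>T\<^esub> a))"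
    using MN.tlift_closed[OF A b] MN.tlift_add[OF A b] a
    by (intro abelian_group_hom_intro MN.T_abelian A) (simp_all add: TM.ract_closed TM.ract_add_left)
  have h2: "abelian_group_hom T A (\<lambda>t. tlift A (\<lambda>(m, n). \<phi> m \<otimes>\<^bsub>A\<^esub> \<psi> n) t \<otimes>\<^bsub>A\<^esub> a)"
    using MN.tlift_closed[OF A b] MN.tlift_add[OF A b] a
    by (intro abelian_group_hom_intro MN.T_abelian A) (simp_all add: A.l_distr)
  have tc: "t \<in> carrier T" using t by (simp add: P_simps)
  have "tlift A (\<lambda>(m, n). \<phi> m \<otimes>\<^bsub>A\<^esub> \<psi> n) (t \<triangleleft>\<^bsub>T\<^esub> a) = tlift A (\<lambda>(m, n). \<phi> m \<otimes>\<^bsub>A\<^esub> \<psi> n) t \<otimes>\<^bsub>A\<^esub> a"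
  proof (rule MN.tensor_hom_eqI[OF h1 h2 _ tc])
    fix m n assume "m \<in> carrier (restrict_scalars H M)" "n \<in> carrier (restrict_scalars H N)"
    then have mn: "m \<in> carrier M" "n \<in> carrier N" by simp_all
    then show "tlift A (\<lambda>(m, n). \<phi> m \<otimes>\<^bsub>A\<^esub> \<psi> n) (MN.pure m n \<triangleleft>\<^bsub>T\<^esub> a) =
        tlift A (\<lambda>(m, n). \<phi> m \<otimes>\<^bsub>A\<^esub> \<psi> n) (MN.pure m n) \<otimes>\<^bsub>A\<^esub> a"
      using MN.tlift_pure[OF A b, of m n] MN.tlift_pure[OF A b, of m "n \<triangleleft>\<^bsub>N\<^esub> src H a"] MN.ract_pure[OF a, of m n] a
      by (simp add: N.ract_closed dualD[OF \<phi>] dualD[OF \<psi>] A.m_assoc del: mod_dual_simps)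
  qed
  then show "star H M N \<psi> \<phi> (t \<triangleleft>\<^bsub>P\<^esub> src H a) = star H M N \<psi> \<phi> t \<otimes>\<^bsub>A\<^esub> a"
    using act_src[OF a tc] TM.ract_closed[OF tc a] tc by (simp add: P_simps star_apply)
qed

lemma dual_tensor_eqI:
  assumes \<alpha>: "\<alpha> \<in> carrier (mod_dual H P)" and \<beta>: "\<beta> \<in> carrier (mod_dual H P)"
    and eq: "\<And>m n. \<lbrakk>m \<in> carrier M; n \<in> carrier N\<rbrakk> \<Longrightarrow> \<alpha> (MN.pure m n) = \<beta> (MN.pure m n)"
  shows "\<alpha> = \<beta>"
proof (rule dual_eqI[OF \<alpha> \<beta>])
  have h: "abelian_group_hom T A \<gamma>" if \<gamma>: "\<gamma> \<in> carrier (mod_dual H P)" for \<gamma>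
    by (intro abelian_group_hom_intro MN.T_abelian A.abelian_group_axioms)
      (use dualD[OF \<gamma>] in \<open>simp_all add: P_simps del: mod_dual_simps\<close>)
  fix t assume "t \<in> carrier P"
  then have t: "t \<in> carrier T" by (simp add: P_simps)
  show "\<alpha> t = \<beta> t" by (rule MN.tensor_hom_eqI[OF h[OF \<alpha>] h[OF \<beta>] _ t]) (simp add: eq)
qed

interpretation DP: abelian_group "mod_dual H P" by (rule mod_dual_abelian[OF mod_tensor_right_module])
interpretation DM: abelian_group "mod_dual H M" by (rule mod_dual_abelian[OF M.right_module_axioms])
interpretation DN: abelian_group "mod_dual H N" by (rule mod_dual_abelian[OF N.right_module_axioms])

lemma star_add_left:
  assumes \<psi>: "\<psi> \<in> carrier (mod_dual H N)" "\<psi>' \<in> carrier (mod_dual H N)" and \<phi>: "\<phi> \<in> carrier (mod_dual H M)"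
  shows "star H M N (\<psi> \<oplus>\<^bsub>mod_dual H N\<^esub> \<psi>') \<phi> = star H M N \<psi> \<phi> \<oplus>\<^bsub>mod_dual H P\<^esub> star H M N \<psi>' \<phi>"
proof (rule dual_tensor_eqI)
  note s = DN.a_closed[OF \<psi>]
  show "star H M N (\<psi> \<oplus>\<^bsub>mod_dual H N\<^esub> \<psi>') \<phi> \<in> carrier (mod_dual H P)" by (rule star_closed[OF s \<phi>])
  show "star H M N \<psi> \<phi> \<oplus>\<^bsub>mod_dual H P\<^esub> star H M N \<psi>' \<phi> \<in> carrier (mod_dual H P)"
    by (rule DP.a_closed[OF star_closed[OF \<psi>(1) \<phi>] star_closed[OF \<psi>(2) \<phi>]])
  fix m n assume mn: "m \<in> carrier M" "n \<in> carrier N"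
  have c: "\<phi> m \<in> carrier A" "\<psi> n \<in> carrier A" "\<psi>' n \<in> carrier A" "MN.pure m n \<in> carrier P"
    using dualD(1)[OF \<phi> mn(1)] dualD(1)[OF \<psi>(1) mn(2)] dualD(1)[OF \<psi>(2) mn(2)] MN.pure_closed[of m n] mn
    by (simp_all add: P_simps)
  show "star H M N (\<psi> \<oplus>\<^bsub>mod_dual H N\<^esub> \<psi>') \<phi> (MN.pure m n) = (star H M N \<psi> \<phi> \<oplus>\<^bsub>mod_dual H P\<^esub> star H M N \<psi>' \<phi>) (MN.pure m n)"
    using star_pure[OF s \<phi> mn] star_pure[OF \<psi>(1) \<phi> mn] star_pure[OF \<psi>(2) \<phi> mn] c mn
    by (simp add: A.r_distr)
qed

lemma star_add_right:
  assumes \<psi>: "\<psi> \<in> carrier (mod_dual H N)" and \<phi>: "\<phi> \<in> carrier (mod_dual H M)" "\<phi>' \<in> carrier (mod_dual H M)"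
  shows "star H M N \<psi> (\<phi> \<oplus>\<^bsub>mod_dual H M\<^esub> \<phi>') = star H M N \<psi> \<phi> \<oplus>\<^bsub>mod_dual H P\<^esub> star H M N \<psi> \<phi>'"
proof (rule dual_tensor_eqI)
  note s = DM.a_closed[OF \<phi>]
  show "star H M N \<psi> (\<phi> \<oplus>\<^bsub>mod_dual H M\<^esub> \<phi>') \<in> carrier (mod_dual H P)" by (rule star_closed[OF \<psi> s])
  show "star H M N \<psi> \<phi> \<oplus>\<^bsub>mod_dual H P\<^esub> star H M N \<psi> \<phi>' \<in> carrier (mod_dual H P)"
    by (rule DP.a_closed[OF star_closed[OF \<psi> \<phi>(1)] star_closed[OF \<psi> \<phi>(2)]])
  fix m n assume mn: "m \<in> carrier M" "n \<in> carrier N"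
  have c: "\<phi> m \<in> carrier A" "\<phi>' m \<in> carrier A" "\<psi> n \<in> carrier A" "MN.pure m n \<in> carrier P"
    using dualD(1)[OF \<phi>(1) mn(1)] dualD(1)[OF \<phi>(2) mn(1)] dualD(1)[OF \<psi> mn(2)] MN.pure_closed[of m n] mn
    by (simp_all add: P_simps)
  show "star H M N \<psi> (\<phi> \<oplus>\<^bsub>mod_dual H M\<^esub> \<phi>') (MN.pure m n) = (star H M N \<psi> \<phi> \<oplus>\<^bsub>mod_dual H P\<^esub> star H M N \<psi> \<phi>') (MN.pure m n)"
    using star_pure[OF \<psi> s mn] star_pure[OF \<psi> \<phi>(1) mn] star_pure[OF \<psi> \<phi>(2) mn] c mn
    by (simp add: A.l_distr)
qed

text \<open>The tensor product of two endomorphisms. It turns relations over the endomorphism rings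
  of the factors into a relation over that of P, as \<open>star_compose\<close> makes
  precise.\<close>

definition tens_map :: "('m \<Rightarrow> 'm) \<Rightarrow> ('n \<Rightarrow> 'n) \<Rightarrow> ('m, 'n) tens \<Rightarrow> ('m, 'n) tens"
  where "tens_map f g = (\<lambda>t\<in>carrier P. tlift T (\<lambda>(m, n). MN.pure (f m) (g n)) t)"

context
  fixes f g assumes f: "f \<in> rlin U M M" and g: "g \<in> rlin U N N"
begin

lemma tens_map_balanced: "balMN T (\<lambda>(m, n). MN.pure (f m) (g n))"
  by (rule MN.balanced_rI)
    (use rlin_closed[OF f] rlin_closed[OF g] MN.pure_closed MN.pure_add_left MN.pure_add_right MN.pure_ract_balance in
      \<open>simp_all add: rlin_add[OF f] rlin_add[OF g] rlin_ract[OF f] rlin_ract[OF g]\<close>)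

lemma tens_map_pure: "\<lbrakk>m \<in> carrier M; n \<in> carrier N\<rbrakk> \<Longrightarrow> tens_map f g (MN.pure m n) = MN.pure (f m) (g n)"
  using MN.tlift_pure[OF MN.T_abelian tens_map_balanced, of m n] MN.pure_closed[of m n] by (simp add: tens_map_def P_simps)

lemma tens_map_hom: "abelian_group_hom T T (tens_map f g)"
proof -
  interpret h: abelian_group_hom T T "tlift T (\<lambda>(m, n). MN.pure (f m) (g n))"
    by (rule MN.tlift_hom[OF MN.T_abelian tens_map_balanced])
  show ?thesis by (intro abelian_group_hom_intro MN.T_abelian) (simp_all add: tens_map_def P_simps)
qed

text \<open>On a pure tensor, u acts by its two legs separately, and f and g commute with these one
  leg at a time.\<close>

lemma tens_map_rlin: "tens_map f g \<in> rlin U P P"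
proof (rule rlinI)
  interpret h: abelian_group_hom T T "tens_map f g" by (rule tens_map_hom)
  show "tens_map f g \<in> extensional (carrier P)" by (simp add: tens_map_def)
  show "tens_map f g t \<in> carrier P" if "t \<in> carrier P" for t using that by (simp add: P_simps)
  show "tens_map f g (s \<oplus>\<^bsub>P\<^esub> t) = tens_map f g s \<oplus>\<^bsub>P\<^esub> tens_map f g t" if "s \<in> carrier P" "t \<in> carrier P" for s t
    using that by (simp add: P_simps)
  fix t u assume "t \<in> carrier P" and u: "u \<in> carrier U"
  then have t: "t \<in> carrier T" by (simp add: P_simps)
  interpret a: abelian_group_hom T T "act u" by (rule act_hom[OF u])
  have h1: "abelian_group_hom T T (\<lambda>t. tens_map f g (act u t))" and h2: "abelian_group_hom T T (\<lambda>t. act u (tens_map f g t))"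
    by (intro abelian_group_hom_intro MN.T_abelian; simp)+
  have "tens_map f g (act u t) = act u (tens_map f g t)"
  proof (rule MN.tensor_hom_eqI[OF h1 h2 _ t])
    fix m n assume "m \<in> carrier (restrict_scalars H M)" "n \<in> carrier (restrict_scalars H N)"
    then have mn: "m \<in> carrier M" "n \<in> carrier N" by simp_all
    have fg: "f m \<in> carrier M" "g n \<in> carrier N" using rlin_closed[OF f] rlin_closed[OF g] mn by blast+
    have "tens_map f g (act u (MN.pure m n)) =
        tlift T (\<lambda>p. tens_map f g (case p of (x, y) \<Rightarrow> MN.pure (m \<triangleleft>\<^bsub>M\<^esub> x) (n \<triangleleft>\<^bsub>N\<^esub> y))) (comult H u)"
      unfolding act_pure[OF u mn] by (rule UU.tlift_comp[OF tens_map_hom inner_pure[OF mn] comult_closed[OF u]])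
    also have "\<dots> = tlift T (\<lambda>(x, y). MN.pure (f m \<triangleleft>\<^bsub>M\<^esub> x) (g n \<triangleleft>\<^bsub>N\<^esub> y)) (comult H u)"
      by (rule UU.tlift_cong[OF MN.T_abelian inner_pure[OF fg] _ comult_closed[OF u]])
        (use mn in \<open>simp add: tens_map_pure M.ract_closed N.ract_closed rlin_ract[OF f] rlin_ract[OF g]\<close>)
    also have "\<dots> = act u (tens_map f g (MN.pure m n))"
      unfolding tens_map_pure[OF mn] act_pure[OF u fg] ..
    finally show "tens_map f g (act u (MN.pure m n)) = act u (tens_map f g (MN.pure m n))" .
  qed
  then show "tens_map f g (t \<triangleleft>\<^bsub>P\<^esub> u) = tens_map f g t \<triangleleft>\<^bsub>P\<^esub> u" by (simp add: P_simps)
qed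

lemma star_compose:
  assumes \<psi>: "\<psi> \<in> carrier (mod_dual H N)" and \<phi>: "\<phi> \<in> carrier (mod_dual H M)"
  shows "star H M N (compose (carrier N) \<psi> g) (compose (carrier M) \<phi> f) = compose (carrier P) (star H M N \<psi> \<phi>) (tens_map f g)"
proof (rule dual_tensor_eqI)
  note c = dual_compose[OF N.right_module_axioms \<psi> g] dual_compose[OF M.right_module_axioms \<phi> f]
  show "star H M N (compose (carrier N) \<psi> g) (compose (carrier M) \<phi> f) \<in> carrier (mod_dual H P)" by (rule star_closed[OF c])
  show "compose (carrier P) (star H M N \<psi> \<phi>) (tens_map f g) \<in> carrier (mod_dual H P)"
    by (rule dual_compose[OF mod_tensor_right_module star_closed[OF \<psi> \<phi>] tens_map_rlin])
  fix m n assume mn: "m \<in> carrier M" "n \<in> carrier N"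
  have fg: "f m \<in> carrier M" "g n \<in> carrier N" using rlin_closed[OF f] rlin_closed[OF g] mn by blast+
  have p: "MN.pure m n \<in> carrier P" using MN.pure_closed[of m n] mn by (simp add: P_simps)
  show "star H M N (compose (carrier N) \<psi> g) (compose (carrier M) \<phi> f) (MN.pure m n) =
      compose (carrier P) (star H M N \<psi> \<phi>) (tens_map f g) (MN.pure m n)"
    unfolding star_pure[OF c mn] compose_eq[OF p] compose_eq[OF mn(1)] compose_eq[OF mn(2)] tens_map_pure[OF mn]
      star_pure[OF \<psi> \<phi> fg] ..
qed

end

text \<open>The diagonal action sends m \<otimes> n to the sum of m u1 \<otimes> n u2, and
  evaluating the functional produces \<phi>(m u1) \<psi>(n u2), the convolution of the two
  coefficients. Multiplicativity of \<zeta> originates here.\<close>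

lemma matrix_coeff_star:
  assumes \<psi>: "\<psi> \<in> carrier (mod_dual H N)" and \<phi>: "\<phi> \<in> carrier (mod_dual H M)"
    and mn: "m \<in> carrier M" "n \<in> carrier N"
  shows "matrix_coeff P (star H M N \<psi> \<phi>) (MN.pure m n) = matrix_coeff M \<phi> m \<otimes>\<^bsub>Us\<^esub> matrix_coeff N \<psi> n"
proof (rule conv_eqI)
  note c = matrix_coeff_closed[OF M.right_module_axioms \<phi> mn(1)] matrix_coeff_closed[OF N.right_module_axioms \<psi> mn(2)]
  have p: "MN.pure m n \<in> carrier T" using MN.pure_closed[of m n] mn by simp
  show "matrix_coeff P (star H M N \<psi> \<phi>) (MN.pure m n) \<in> carrier Us"
    by (rule matrix_coeff_closed[OF mod_tensor_right_module star_closed[OF \<psi> \<phi>]]) (simp add: P_simps p)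
  show "matrix_coeff M \<phi> m \<otimes>\<^bsub>Us\<^esub> matrix_coeff N \<psi> n \<in> carrier Us" by (rule conv_mult_closed[OF c])
  note A = A.abelian_group_axioms
  note b = star_balanced[OF \<psi> \<phi>]
  fix u assume u: "u \<in> carrier U"
  have "matrix_coeff P (star H M N \<psi> \<phi>) (MN.pure m n) u = tlift A (\<lambda>(m, n). \<phi> m \<otimes>\<^bsub>A\<^esub> \<psi> n) (act u (MN.pure m n))"
    using u p abelian_group_hom.hom_closed[OF act_hom[OF u] p] by (simp add: matrix_coeff_def star_apply P_simps)
  also have "\<dots> = tlift A (\<lambda>p. tlift A (\<lambda>(m, n). \<phi> m \<otimes>\<^bsub>A\<^esub> \<psi> n) (case p of (x, y) \<Rightarrow> MN.pure (m \<triangleleft>\<^bsub>M\<^esub> x) (n \<triangleleft>\<^bsub>N\<^esub> y))) (comult H u)"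
    unfolding act_pure[OF u mn]
    by (rule UU.tlift_comp[OF MN.tlift_hom[OF A b] inner_pure[OF mn] comult_closed[OF u]])
  also have "\<dots> = tlift A (\<lambda>(x, y). matrix_coeff M \<phi> m x \<otimes>\<^bsub>A\<^esub> matrix_coeff N \<psi> n y) (comult H u)"
  proof (rule UU.tlift_cong[OF A conv_balanced[OF c] _ comult_closed[OF u]])
    fix x y assume "x \<in> carrier (UA H)" "y \<in> carrier (UA H)"
    then have xy: "x \<in> carrier U" "y \<in> carrier U" by simp_all
    then show "tlift A (\<lambda>(m, n). \<phi> m \<otimes>\<^bsub>A\<^esub> \<psi> n) (case (x, y) of (x, y) \<Rightarrow> MN.pure (m \<triangleleft>\<^bsub>M\<^esub> x) (n \<triangleleft>\<^bsub>N\<^esub> y)) =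
        (case (x, y) of (x, y) \<Rightarrow> matrix_coeff M \<phi> m x \<otimes>\<^bsub>A\<^esub> matrix_coeff N \<psi> n y)"
      using MN.tlift_pure[OF A b, of "m \<triangleleft>\<^bsub>M\<^esub> x" "n \<triangleleft>\<^bsub>N\<^esub> y"] mn
      by (simp add: matrix_coeff_def M.ract_closed N.ract_closed)
  qed
  also have "\<dots> = (matrix_coeff M \<phi> m \<otimes>\<^bsub>Us\<^esub> matrix_coeff N \<psi> n) u" using u by simp
  finally show "matrix_coeff P (star H M N \<psi> \<phi>) (MN.pure m n) u = (matrix_coeff M \<phi> m \<otimes>\<^bsub>Us\<^esub> matrix_coeff N \<psi> n) u" .
qed

end

section \<open>The finite dual\<close>

text \<open>The direct sum is not known to be a ring, so the additive part of \<open>Quot\<close> is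
  obtained from the quotient by an additive subgroup.\<close>

lemma (in abelian_group) quot_abelian_group:
  assumes I: "additive_subgroup I G"
  shows "carrier (G Quot I) = (\<lambda>x. I +> x) ` carrier G"
    and "\<lbrakk>x \<in> carrier G; y \<in> carrier G\<rbrakk> \<Longrightarrow> (I +> x) \<oplus>\<^bsub>G Quot I\<^esub> (I +> y) = I +> (x \<oplus> y)"
    and "abelian_group (G Quot I)"
proof -
  interpret I: abelian_subgroup I G by (rule abelian_subgroupI3[OF I abelian_group_axioms])
  show "carrier (G Quot I) = (\<lambda>x. I +> x) ` carrier G"
    by (auto simp: FactRing_def A_RCOSETS_def')
  show "\<lbrakk>x \<in> carrier G; y \<in> carrier G\<rbrakk> \<Longrightarrow> (I +> x) \<oplus>\<^bsub>G Quot I\<^esub> (I +> y) = I +> (x \<oplus> y)"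
    by (simp add: FactRing_def I.a_rcos_sum)
  interpret Q: comm_group "G A_Mod I" by (rule I.a_factorgroup_is_comm_group)
  have Q: "carrier (G A_Mod I) = carrier (G Quot I)" "x \<otimes>\<^bsub>G A_Mod I\<^esub> y = x \<oplus>\<^bsub>G Quot I\<^esub> y"
    "\<one>\<^bsub>G A_Mod I\<^esub> = \<zero>\<^bsub>G Quot I\<^esub>" for x y
    by (simp_all add: FactRing_def A_FactGroup_def')
  show "abelian_group (G Quot I)"
    by (rule abelian_groupI)
      (use Q.m_closed Q.one_closed Q.m_assoc Q.m_comm Q.l_one Q.l_inv_ex in \<open>unfold Q, auto\<close>)
qed

text \<open>A negative of a product is moved into its left factor, which left distributivity
  permits. The assumptions are laws that hold for both the finite dual and A \<otimes> A.\<close>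

lemma ideal_power_subgroup:
  fixes R (structure)
  assumes R: "abelian_group R"
    and m_closed: "\<And>x y. \<lbrakk>x \<in> carrier R; y \<in> carrier R\<rbrakk> \<Longrightarrow> x \<otimes> y \<in> carrier R"
    and l_distr: "\<And>x y z. \<lbrakk>x \<in> carrier R; y \<in> carrier R; z \<in> carrier R\<rbrakk> \<Longrightarrow> (x \<oplus> y) \<otimes> z = x \<otimes> z \<oplus> y \<otimes> z"
    and I: "additive_subgroup I R"
  shows "additive_subgroup (ideal_power R I n) R"
proof (induction n)
  interpret R: abelian_group R by fact
  case 0
  show ?case unfolding ideal_power.simps by (rule R.additive_subgroup_intro) simp_all
next
  interpret R: abelian_group R by fact
  interpret I: additive_subgroup I R by fact
  case (Suc n)
  then interpret J: additive_subgroup "ideal_power R I n" R .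
  have hom: "abelian_group_hom R R (\<lambda>x. x \<otimes> z)" if "z \<in> carrier R" for z
    by (rule abelian_group_hom_intro[OF R R]) (simp_all add: m_closed l_distr that)
  have sub: "x \<in> carrier R" if "x \<in> ideal_power R I (Suc n)" for x
    using that unfolding ideal_power.simps
    by (induction rule: ideal_prod.induct) (simp_all add: m_closed)
  show ?case
  proof (rule R.additive_subgroup_intro)
    show "\<zero> \<in> ideal_power R I (Suc n)"
      using ideal_prod.prod[OF I.zero_closed J.zero_closed, of R] abelian_group_hom.hom_zero[OF hom[OF R.zero_closed]] by simp
    fix x assume x: "x \<in> ideal_power R I (Suc n)"
    show "x \<oplus> y \<in> ideal_power R I (Suc n)" if "y \<in> ideal_power R I (Suc n)" for y
      using x that by (simp add: ideal_prod.sum)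
    show "\<ominus> x \<in> ideal_power R I (Suc n)"
      using x unfolding ideal_power.simps
    proof (induction rule: ideal_prod.induct)
      case (prod i j)
      have "\<ominus> (i \<otimes> j) = (\<ominus> i) \<otimes> j"
        using abelian_group_hom.hom_a_inv[OF hom, of j i] prod by simp
      then show ?case using prod ideal_prod.prod[OF I.a_inv_closed[OF prod(1)] prod(2)] by simp
    next
      case (sum s t)
      have "s \<in> carrier R" "t \<in> carrier R" using sub sum by simp_all
      then show ?case using ideal_prod.sum[OF sum(3,4)] by (simp add: R.minus_add)
    qed
  qed (use sub in blast)
qed

lemma ideal_prod_mono:
  assumes "J \<subseteq> J'"
  shows "ideal_prod R I J \<subseteq> ideal_prod R I J'"
proof
  fix x assume "x \<in> ideal_prod R I J"
  then show "x \<in> ideal_prod R I J'"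
    by (induction rule: ideal_prod.induct) (use assms in \<open>auto intro: ideal_prod.intros\<close>)
qed

lemma ideal_power_filtered_group:
  fixes R (structure)
  assumes R: "abelian_group R"
    and m_closed: "\<And>x y. \<lbrakk>x \<in> carrier R; y \<in> carrier R\<rbrakk> \<Longrightarrow> x \<otimes> y \<in> carrier R"
    and l_distr: "\<And>x y z. \<lbrakk>x \<in> carrier R; y \<in> carrier R; z \<in> carrier R\<rbrakk> \<Longrightarrow> (x \<oplus> y) \<otimes> z = x \<otimes> z \<oplus> y \<otimes> z"
    and I: "additive_subgroup I R"
  shows "filtered_group R (ideal_power R I)"
proof (intro filtered_group.intro filtered_group_axioms.intro R)
  note sub = ideal_power_subgroup[OF R m_closed l_distr I]
  show "additive_subgroup (ideal_power R I n) R" for n by (rule sub)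
  show "ideal_power R I (Suc n) \<subseteq> ideal_power R I n" for n
  proof (induction n)
    case 0 then show ?case using additive_subgroup.a_subset[OF sub, of "Suc 0"] by simp
  next
    case (Suc n) then show ?case using ideal_prod_mono[OF Suc] by simp
  qed
qed simp

text \<open>Two multiplicative maps into the same target are compared: if generators of the powers
  on one side have values attained on the other, products and sums of such values are attained by
  the corresponding products and sums. To be used with g = \<theta> and f = \<zeta>.\<close>

lemma ideal_power_image:
  assumes f_mult: "\<And>x y. \<lbrakk>x \<in> carrier R; y \<in> carrier R\<rbrakk> \<Longrightarrow> f (x \<otimes>\<^bsub>R\<^esub> y) = f x \<otimes>\<^bsub>S\<^esub> f y"
    and f_add: "\<And>x y. \<lbrakk>x \<in> carrier R; y \<in> carrier R\<rbrakk> \<Longrightarrow> f (x \<oplus>\<^bsub>R\<^esub> y) = f x \<oplus>\<^bsub>S\<^esub> f y"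
    and g_mult: "\<And>x y. \<lbrakk>x \<in> carrier R'; y \<in> carrier R'\<rbrakk> \<Longrightarrow> g (x \<otimes>\<^bsub>R'\<^esub> y) = g x \<otimes>\<^bsub>S\<^esub> g y"
    and g_add: "\<And>x y. \<lbrakk>x \<in> carrier R'; y \<in> carrier R'\<rbrakk> \<Longrightarrow> g (x \<oplus>\<^bsub>R'\<^esub> y) = g x \<oplus>\<^bsub>S\<^esub> g y"
    and IR: "I \<subseteq> carrier R" and IR': "I' \<subseteq> carrier R'"
    and pow: "\<And>n. ideal_power R I n \<subseteq> carrier R" and pow': "\<And>n. ideal_power R' I' n \<subseteq> carrier R'"
    and base: "g ` carrier R' \<subseteq> f ` carrier R" and ideal: "g ` I' \<subseteq> f ` I"
  shows "g ` ideal_power R' I' n \<subseteq> f ` ideal_power R I n"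
proof (induction n)
  case 0 then show ?case using base by simp
next
  case (Suc n)
  have "g x \<in> f ` ideal_power R I (Suc n)" if "x \<in> ideal_prod R' I' (ideal_power R' I' n)" for x
    using that
  proof (induction rule: ideal_prod.induct)
    case (prod i j)
    obtain i' j' where ij: "i' \<in> I" "g i = f i'" "j' \<in> ideal_power R I n" "g j = f j'"
      using Suc ideal prod by blast
    have "i \<in> carrier R'" "j \<in> carrier R'" "i' \<in> carrier R" "j' \<in> carrier R"
      using prod ij IR IR' pow pow' by blast+
    then have "g (i \<otimes>\<^bsub>R'\<^esub> j) = f (i' \<otimes>\<^bsub>R\<^esub> j')" by (simp add: g_mult f_mult ij)
    then show ?case using ideal_prod.prod[OF ij(1,3), of R] by simp
  next
    case (sum s t)
    obtain s' t' where st: "s' \<in> ideal_power R I (Suc n)" "g s = f s'" "t' \<in> ideal_power R I (Suc n)" "g t = f t'"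
      using sum(3,4) by blast
    have "s \<in> carrier R'" "t \<in> carrier R'" using sum(1,2) pow'[of "Suc n"] by auto
    moreover have "s' \<in> carrier R" "t' \<in> carrier R" using st(1,3) pow by blast+
    ultimately have "g (s \<oplus>\<^bsub>R'\<^esub> t) = f (s' \<oplus>\<^bsub>R\<^esub> t')" by (simp add: g_add f_add st)
    moreover have "s' \<oplus>\<^bsub>R\<^esub> t' \<in> ideal_power R I (Suc n)" using st by (simp add: ideal_prod.sum)
    ultimately show ?case by blast
  qed
  then show ?case by auto
qed

section \<open>The multiplication on the direct sum and its map to the convolution algebra\<close>

context cocomm_hopf_algebroid begin

lemma transport_add_left: "\<lbrakk>Umod H Q; \<phi> \<in> carrier (mod_dual H Q); \<psi> \<in> carrier (mod_dual H Q); m \<in> carrier Q\<rbrakk> \<Longrightarrow>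
    transport_elt H Q (\<phi> \<oplus>\<^bsub>mod_dual H Q\<^esub> \<psi>) m = transport_elt H Q \<phi> m \<oplus>\<^bsub>DG\<^esub> transport_elt H Q \<psi> m"
  and transport_add_right: "\<lbrakk>Umod H Q; \<phi> \<in> carrier (mod_dual H Q); m \<in> carrier Q; n \<in> carrier Q\<rbrakk> \<Longrightarrow>
    transport_elt H Q \<phi> (m \<oplus>\<^bsub>Q\<^esub> n) = transport_elt H Q \<phi> m \<oplus>\<^bsub>DG\<^esub> transport_elt H Q \<phi> n"
  using transport_elt_balanced[of Q] unfolding balanced_def prod.case by blast+

lemma transport_compose:
  assumes "Umod H Q" "\<phi> \<in> carrier (mod_dual H Q)" "m \<in> carrier Q" "f \<in> rlin U Q Q"
  shows "transport_elt H Q (compose (carrier Q) \<phi> f) m = transport_elt H Q \<phi> (f m)"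
proof -
  have "(\<lambda>\<phi>. compose (carrier Q) \<phi> f, f) \<in> end_balance H Q" using assms(4) by (auto simp: end_balance_def)
  then show ?thesis using transport_elt_balanced[OF assms(1)] assms(2,3) unfolding balanced_def prod.case by blast
qed

lemma fmods_pair: "\<lbrakk>M \<in> fmods H; N \<in> fmods H\<rbrakk> \<Longrightarrow> umodule_pair k H M N"
  by (intro umodule_pair.intro module_pair.intro cocomm_hopf_algebroid_axioms fmods_right_module)

text \<open>The product of \<psi> \<otimes> n and \<phi> \<otimes> m, with arguments in the order of
  the factors; the module underlying the result is M \<otimes> N, in the opposite order.\<close>

abbreviation "mu N \<psi> n M \<phi> m \<equiv> transport_elt H (mod_tensor H M N) (star H M N \<psi> \<phi>) (mod_pure H M N m n)"

lemma id_rlin: "right_module U M \<Longrightarrow> (\<lambda>m\<in>carrier M. m) \<in> rlin U M M"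
proof -
  assume "right_module U M"
  then interpret M: right_module U M .
  show ?thesis by (rule rlinI) (simp_all add: M.ract_closed)
qed

lemma compose_id: "\<phi> \<in> carrier (mod_dual H M) \<Longrightarrow> compose (carrier M) \<phi> (\<lambda>m\<in>carrier M. m) = \<phi>"
  by (rule extensionalityI[OF compose_extensional dualD(4)]) (auto simp: compose_def)

text \<open>What two successive lifts require: additivity in each of the four variables, and
  compatibility with endomorphisms on both sides at once. One-sided compatibility is this last fact
  with the identity on the other side.\<close>

lemma mu_facts:
  assumes M: "M \<in> fmods H" and N: "N \<in> fmods H"
    and \<phi>: "\<phi> \<in> carrier (mod_dual H M)" and m: "m \<in> carrier M"
    and \<psi>: "\<psi> \<in> carrier (mod_dual H N)" and n: "n \<in> carrier N"
  shows "mu N \<psi> n M \<phi> m \<in> carrier DG"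
    and "\<phi>' \<in> carrier (mod_dual H M) \<Longrightarrow> mu N \<psi> n M (\<phi> \<oplus>\<^bsub>mod_dual H M\<^esub> \<phi>') m = mu N \<psi> n M \<phi> m \<oplus>\<^bsub>DG\<^esub> mu N \<psi> n M \<phi>' m"
    and "m' \<in> carrier M \<Longrightarrow> mu N \<psi> n M \<phi> (m \<oplus>\<^bsub>M\<^esub> m') = mu N \<psi> n M \<phi> m \<oplus>\<^bsub>DG\<^esub> mu N \<psi> n M \<phi> m'"
    and "\<psi>' \<in> carrier (mod_dual H N) \<Longrightarrow> mu N (\<psi> \<oplus>\<^bsub>mod_dual H N\<^esub> \<psi>') n M \<phi> m = mu N \<psi> n M \<phi> m \<oplus>\<^bsub>DG\<^esub> mu N \<psi>' n M \<phi> m"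
    and "n' \<in> carrier N \<Longrightarrow> mu N \<psi> (n \<oplus>\<^bsub>N\<^esub> n') M \<phi> m = mu N \<psi> n M \<phi> m \<oplus>\<^bsub>DG\<^esub> mu N \<psi> n' M \<phi> m"
    and "\<lbrakk>f \<in> rlin U M M; g \<in> rlin U N N\<rbrakk> \<Longrightarrow>
      mu N (compose (carrier N) \<psi> g) n M (compose (carrier M) \<phi> f) m = mu N \<psi> (g n) M \<phi> (f m)"
proof -
  interpret pr: umodule_pair k H M N by (rule fmods_pair[OF M N])
  have Q: "Umod H (mod_tensor H M N)" using pr.mod_tensor_Umod M N by (simp add: fmods_iff)
  have p: "pr.MN.pure x y \<in> carrier (mod_tensor H M N)" if "x \<in> carrier M" "y \<in> carrier N" for x y
    using pr.MN.pure_closed[of x y] that by (simp add: pr.P_simps)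
  note st = pr.star_closed
  note eq = pr.mod_pure_eq
  show "mu N \<psi> n M \<phi> m \<in> carrier DG"
    unfolding eq by (rule transport_elt_closed[OF Q st[OF \<psi> \<phi>] p[OF m n]])
  show "mu N \<psi> n M (\<phi> \<oplus>\<^bsub>mod_dual H M\<^esub> \<phi>') m = mu N \<psi> n M \<phi> m \<oplus>\<^bsub>DG\<^esub> mu N \<psi> n M \<phi>' m" if "\<phi>' \<in> carrier (mod_dual H M)"
    unfolding eq pr.star_add_right[OF \<psi> \<phi> that] by (rule transport_add_left[OF Q st[OF \<psi> \<phi>] st[OF \<psi> that] p[OF m n]])
  show "mu N (\<psi> \<oplus>\<^bsub>mod_dual H N\<^esub> \<psi>') n M \<phi> m = mu N \<psi> n M \<phi> m \<oplus>\<^bsub>DG\<^esub> mu N \<psi>' n M \<phi> m" if "\<psi>' \<in> carrier (mod_dual H N)"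
    unfolding eq pr.star_add_left[OF \<psi> that \<phi>] by (rule transport_add_left[OF Q st[OF \<psi> \<phi>] st[OF that \<phi>] p[OF m n]])
  show "mu N \<psi> n M \<phi> (m \<oplus>\<^bsub>M\<^esub> m') = mu N \<psi> n M \<phi> m \<oplus>\<^bsub>DG\<^esub> mu N \<psi> n M \<phi> m'" if m': "m' \<in> carrier M"
  proof -
    have "pr.MN.pure (m \<oplus>\<^bsub>M\<^esub> m') n = pr.MN.pure m n \<oplus>\<^bsub>mod_tensor H M N\<^esub> pr.MN.pure m' n"
      using pr.MN.pure_add_left[of m m' n] m m' n by (simp add: pr.P_simps)
    then show ?thesis unfolding eq using transport_add_right[OF Q st[OF \<psi> \<phi>] p[OF m n] p[OF m' n]] by simp
  qed
  show "mu N \<psi> (n \<oplus>\<^bsub>N\<^esub> n') M \<phi> m = mu N \<psi> n M \<phi> m \<oplus>\<^bsub>DG\<^esub> mu N \<psi> n' M \<phi> m" if n': "n' \<in> carrier N"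
  proof -
    have "pr.MN.pure m (n \<oplus>\<^bsub>N\<^esub> n') = pr.MN.pure m n \<oplus>\<^bsub>mod_tensor H M N\<^esub> pr.MN.pure m n'"
      using pr.MN.pure_add_right[of m n n'] m n n' by (simp add: pr.P_simps)
    then show ?thesis unfolding eq using transport_add_right[OF Q st[OF \<psi> \<phi>] p[OF m n] p[OF m n']] by simp
  qed
  show "mu N (compose (carrier N) \<psi> g) n M (compose (carrier M) \<phi> f) m = mu N \<psi> (g n) M \<phi> (f m)"
    if f: "f \<in> rlin U M M" and g: "g \<in> rlin U N N"
    unfolding eq pr.star_compose[OF f g \<psi> \<phi>]
    using transport_compose[OF Q st[OF \<psi> \<phi>] p[OF m n] pr.tens_map_rlin[OF f g]] pr.tens_map_pure[OF f g m n] by simp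
qed

lemma mu_balanced_right:
  assumes N: "N \<in> fmods H" and \<psi>: "\<psi> \<in> carrier (mod_dual H N)" and n: "n \<in> carrier N"
  shows "balanced_family DG (mu N \<psi> n)"
  unfolding balanced_family_def
proof (intro ballI balancedI; unfold prod.case)
  fix M \<phi> m assume M: "M \<in> fmods H" and \<phi>: "\<phi> \<in> carrier (mod_dual H M)" and m: "m \<in> carrier M"
  note mu = mu_facts[OF M N \<phi> m \<psi> n]
  show "mu N \<psi> n M \<phi> m \<in> carrier DG" by (rule mu(1))
  show "mu N \<psi> n M (\<phi> \<oplus>\<^bsub>mod_dual H M\<^esub> \<phi>') m = mu N \<psi> n M \<phi> m \<oplus>\<^bsub>DG\<^esub> mu N \<psi> n M \<phi>' m" if "\<phi>' \<in> carrier (mod_dual H M)" for \<phi>'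
    by (rule mu(2)[OF that])
  show "mu N \<psi> n M \<phi> (m \<oplus>\<^bsub>M\<^esub> m') = mu N \<psi> n M \<phi> m \<oplus>\<^bsub>DG\<^esub> mu N \<psi> n M \<phi> m'" if "m' \<in> carrier M" for m'
    by (rule mu(3)[OF that])
  show "mu N \<psi> n M (r \<phi>) m = mu N \<psi> n M \<phi> (l m)" if rl: "(r, l) \<in> end_balance H M" for r l
  proof -
    obtain f where f: "r = (\<lambda>\<phi>. compose (carrier M) \<phi> f)" "l = f" "f \<in> rlin U M M"
      using rl by (auto simp: end_balance_def)
    show ?thesis
      using mu(6)[OF f(3) id_rlin[OF fmods_right_module[OF N]]] n unfolding compose_id[OF \<psi>] f(1,2) by simp
  qed
qed

abbreviation "mul_right e \<equiv> (\<lambda>N \<psi> n. dsum_lift H DG (mu N \<psi> n) e)"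

lemma mul_right_hom: "\<lbrakk>N \<in> fmods H; \<psi> \<in> carrier (mod_dual H N); n \<in> carrier N\<rbrakk> \<Longrightarrow>
    abelian_group_hom DG DG (dsum_lift H DG (mu N \<psi> n))"
  by (rule dsum_lift_hom[OF DG_abelian mu_balanced_right])

lemma mul_right_elt: "\<lbrakk>N \<in> fmods H; \<psi> \<in> carrier (mod_dual H N); n \<in> carrier N;
    M \<in> fmods H; \<phi> \<in> carrier (mod_dual H M); m \<in> carrier M\<rbrakk> \<Longrightarrow>
    dsum_lift H DG (mu N \<psi> n) (dsum_elt H M \<phi> m) = mu N \<psi> n M \<phi> m"
  by (rule dsum_lift_elt[OF DG_abelian mu_balanced_right])

text \<open>The right factor e is an arbitrary element of the direct sum; each balance condition in
  the left variables is an equality of additive maps in e and is thus checked on generators.\<close>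

lemma mul_right_balanced:
  assumes e: "e \<in> carrier DG"
  shows "balanced_family DG (mul_right e)"
  unfolding balanced_family_def
proof (intro ballI balancedI; unfold prod.case)
  fix N \<psi> n assume N: "N \<in> fmods H" and \<psi>: "\<psi> \<in> carrier (mod_dual H N)" and n: "n \<in> carrier N"
  interpret N: right_module U N by (rule fmods_right_module[OF N])
  interpret DN: abelian_group "mod_dual H N" by (rule mod_dual_abelian[OF N.right_module_axioms])
  note h = mul_right_hom[OF N]
  show "mul_right e N \<psi> n \<in> carrier DG" by (rule abelian_group_hom.hom_closed[OF h[OF \<psi> n] e])
  show "mul_right e N (\<psi> \<oplus>\<^bsub>mod_dual H N\<^esub> \<psi>') n = mul_right e N \<psi> n \<oplus>\<^bsub>DG\<^esub> mul_right e N \<psi>' n"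
    if \<psi>': "\<psi>' \<in> carrier (mod_dual H N)" for \<psi>'
  proof (rule dsum_hom_eqI[OF h[OF DN.a_closed[OF \<psi> \<psi>'] n] abelian_group_hom_add[OF h[OF \<psi> n] h[OF \<psi>' n]] _ e])
    fix M \<phi> m assume M: "M \<in> fmods H" "\<phi> \<in> carrier (mod_dual H M)" "m \<in> carrier M"
    show "mul_right (dsum_elt H M \<phi> m) N (\<psi> \<oplus>\<^bsub>mod_dual H N\<^esub> \<psi>') n =
        mul_right (dsum_elt H M \<phi> m) N \<psi> n \<oplus>\<^bsub>DG\<^esub> mul_right (dsum_elt H M \<phi> m) N \<psi>' n"
      unfolding mul_right_elt[OF N DN.a_closed[OF \<psi> \<psi>'] n M] mul_right_elt[OF N \<psi> n M] mul_right_elt[OF N \<psi>' n M]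
      by (rule mu_facts(4)[OF M(1) N M(2,3) \<psi> n \<psi>'])
  qed
  show "mul_right e N \<psi> (n \<oplus>\<^bsub>N\<^esub> n') = mul_right e N \<psi> n \<oplus>\<^bsub>DG\<^esub> mul_right e N \<psi> n'"
    if n': "n' \<in> carrier N" for n'
  proof (rule dsum_hom_eqI[OF h[OF \<psi> N.M.a_closed[OF n n']] abelian_group_hom_add[OF h[OF \<psi> n] h[OF \<psi> n']] _ e])
    fix M \<phi> m assume M: "M \<in> fmods H" "\<phi> \<in> carrier (mod_dual H M)" "m \<in> carrier M"
    show "mul_right (dsum_elt H M \<phi> m) N \<psi> (n \<oplus>\<^bsub>N\<^esub> n') =
        mul_right (dsum_elt H M \<phi> m) N \<psi> n \<oplus>\<^bsub>DG\<^esub> mul_right (dsum_elt H M \<phi> m) N \<psi> n'"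
      unfolding mul_right_elt[OF N \<psi> N.M.a_closed[OF n n'] M] mul_right_elt[OF N \<psi> n M] mul_right_elt[OF N \<psi> n' M]
      by (rule mu_facts(5)[OF M(1) N M(2,3) \<psi> n n'])
  qed
  show "mul_right e N (r \<psi>) n = mul_right e N \<psi> (l n)" if rl: "(r, l) \<in> end_balance H N" for r l
  proof -
    obtain g where g: "r = (\<lambda>\<phi>. compose (carrier N) \<phi> g)" "l = g" "g \<in> rlin U N N"
      using rl by (auto simp: end_balance_def)
    have c: "r \<psi> \<in> carrier (mod_dual H N)" unfolding g(1) by (rule dual_compose[OF N.right_module_axioms \<psi> g(3)])
    have gn: "l n \<in> carrier N" unfolding g(2) by (rule rlin_closed[OF g(3) n])
    show ?thesis
    proof (rule dsum_hom_eqI[OF h[OF c n] h[OF \<psi> gn] _ e])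
      fix M \<phi> m assume M: "M \<in> fmods H" "\<phi> \<in> carrier (mod_dual H M)" "m \<in> carrier M"
      show "mul_right (dsum_elt H M \<phi> m) N (r \<psi>) n = mul_right (dsum_elt H M \<phi> m) N \<psi> (l n)"
        unfolding mul_right_elt[OF N c n M] mul_right_elt[OF N \<psi> gn M]
        using mu_facts(6)[OF M(1) N M(2,3) \<psi> n id_rlin[OF fmods_right_module[OF M(1)]] g(3)] M(3)
        unfolding compose_id[OF M(2)] g(1,2) by simp
    qed
  qed
qed

abbreviation "D \<equiv> dsum_algebra H"

lemma D_simps:
  "carrier D = carrier DG" "add D = add DG" "\<zero>\<^bsub>D\<^esub> = \<zero>\<^bsub>DG\<^esub>"
  "d \<otimes>\<^bsub>D\<^esub> e = dsum_lift H DG (mul_right e) d"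
  by (simp_all add: dsum_algebra_def)

lemma D_abelian: "abelian_group D"
  by (rule abelian_group_cong[OF DG_abelian]) (simp_all add: D_simps)

sublocale D: abelian_group D by (rule D_abelian)

lemma D_mult_closed: "\<lbrakk>d \<in> carrier D; e \<in> carrier D\<rbrakk> \<Longrightarrow> d \<otimes>\<^bsub>D\<^esub> e \<in> carrier D"
  using abelian_group_hom.hom_closed[OF dsum_lift_hom[OF DG_abelian mul_right_balanced]] by (simp add: D_simps)

text \<open>The map \<zeta> before passing to the quotient by the relations.\<close>

abbreviation "Z \<equiv> dsum_lift H Us (\<lambda>M \<phi> m. \<lambda>u\<in>carrier U. \<phi> (m \<triangleleft>\<^bsub>M\<^esub> u))"

lemma Z_family: "balanced_family Us (\<lambda>M \<phi> m. \<lambda>u\<in>carrier U. \<phi> (m \<triangleleft>\<^bsub>M\<^esub> u))"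
  unfolding balanced_family_def using matrix_coeff_balanced[OF fmods_right_module] unfolding matrix_coeff_def by blast

lemma Z_hom_DG: "abelian_group_hom DG Us Z"
  by (rule dsum_lift_hom[OF conv_abelian Z_family])

lemma Z_elt: "\<lbrakk>M \<in> fmods H; \<phi> \<in> carrier (mod_dual H M); m \<in> carrier M\<rbrakk> \<Longrightarrow> Z (dsum_elt H M \<phi> m) = matrix_coeff M \<phi> m"
  using dsum_lift_elt[OF conv_abelian Z_family] unfolding matrix_coeff_def by blast

lemma Z_transport:
  assumes Q: "Umod H Q" and \<phi>: "\<phi> \<in> carrier (mod_dual H Q)" and m: "m \<in> carrier Q"
  shows "Z (transport_elt H Q \<phi> m) = matrix_coeff Q \<phi> m"
  unfolding transport_elt_eq[OF Q] Z_elt[OF model_Umod(1)[OF Q] transport_dual_closed[OF Q \<phi>] to_model_closed[OF Q m]]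
  by (rule matrix_coeff_transport[OF Q \<phi> m])

lemma Z_hom: "abelian_group_hom D Us Z"
  using abelian_group_hom.hom_closed[OF Z_hom_DG] abelian_group_hom.hom_add[OF Z_hom_DG]
  by (intro abelian_group_hom_intro D_abelian conv_abelian) (simp_all add: D_simps del: conv_simps)

lemma conv_mult_hom_left: "g \<in> carrier Us \<Longrightarrow> abelian_group_hom Us Us (\<lambda>f. f \<otimes>\<^bsub>Us\<^esub> g)"
  by (intro abelian_group_hom_intro conv_abelian conv_mult_closed conv_l_distr)

lemma conv_mult_hom_right: "g \<in> carrier Us \<Longrightarrow> abelian_group_hom Us Us (\<lambda>f. g \<otimes>\<^bsub>Us\<^esub> f)"
  by (intro abelian_group_hom_intro conv_abelian conv_mult_closed conv_r_distr)

text \<open>Checked on generators twice, first in the left factor and then in the right one, where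
  it becomes the product formula for matrix coefficients.\<close>

lemma Z_mult:
  assumes d: "d \<in> carrier D" and e: "e \<in> carrier D"
  shows "Z (d \<otimes>\<^bsub>D\<^esub> e) = Z d \<otimes>\<^bsub>Us\<^esub> Z e"
proof -
  note d' = d[unfolded D_simps(1)] and e' = e[unfolded D_simps(1)]
  have Zc: "Z x \<in> carrier Us" if "x \<in> carrier DG" for x by (rule abelian_group_hom.hom_closed[OF Z_hom_DG that])
  show ?thesis
    unfolding D_simps(4)
  proof (rule dsum_hom_eqI[OF abelian_group_hom_comp[OF dsum_lift_hom[OF DG_abelian mul_right_balanced[OF e']] Z_hom_DG]
        abelian_group_hom_comp[OF Z_hom_DG conv_mult_hom_left[OF Zc[OF e']]] _ d'])
    fix N \<psi> n assume N: "N \<in> fmods H" and \<psi>: "\<psi> \<in> carrier (mod_dual H N)" and n: "n \<in> carrier N"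
    have "Z (mul_right e N \<psi> n) = matrix_coeff N \<psi> n \<otimes>\<^bsub>Us\<^esub> Z e"
    proof (rule dsum_hom_eqI[OF abelian_group_hom_comp[OF mul_right_hom[OF N \<psi> n] Z_hom_DG]
          abelian_group_hom_comp[OF Z_hom_DG conv_mult_hom_right[OF matrix_coeff_closed[OF fmods_right_module[OF N] \<psi> n]]] _ e'])
      fix M \<phi> m assume M: "M \<in> fmods H" and \<phi>: "\<phi> \<in> carrier (mod_dual H M)" and m: "m \<in> carrier M"
      interpret pr: umodule_pair k H M N by (rule fmods_pair[OF M N])
      have Q: "Umod H (mod_tensor H M N)" using pr.mod_tensor_Umod M N by (simp add: fmods_iff)
      have p: "pr.MN.pure m n \<in> carrier (mod_tensor H M N)"
        using pr.MN.pure_closed[of m n] m n by (simp add: pr.P_simps)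
      have "Z (mul_right (dsum_elt H M \<phi> m) N \<psi> n) = matrix_coeff (mod_tensor H M N) (star H M N \<psi> \<phi>) (pr.MN.pure m n)"
        unfolding mul_right_elt[OF N \<psi> n M \<phi> m] pr.mod_pure_eq by (rule Z_transport[OF Q pr.star_closed[OF \<psi> \<phi>] p])
      also have "\<dots> = matrix_coeff M \<phi> m \<otimes>\<^bsub>Us\<^esub> matrix_coeff N \<psi> n" by (rule pr.matrix_coeff_star[OF \<psi> \<phi> m n])
      \<comment> \<open>The product lives on M \<otimes> N, with factors in reversed order;
        commutativity of convolution, which stems from co-commutativity, puts them right.\<close>
      also have "\<dots> = matrix_coeff N \<psi> n \<otimes>\<^bsub>Us\<^esub> matrix_coeff M \<phi> m"
        by (rule conv_comm[OF matrix_coeff_closed[OF fmods_right_module[OF M] \<phi> m] matrix_coeff_closed[OF fmods_right_module[OF N] \<psi> n]])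
      finally show "Z (mul_right (dsum_elt H M \<phi> m) N \<psi> n) = matrix_coeff N \<psi> n \<otimes>\<^bsub>Us\<^esub> Z (dsum_elt H M \<phi> m)"
        unfolding Z_elt[OF M \<phi> m] .
    qed
    then show "Z (dsum_lift H DG (mul_right e) (dsum_elt H N \<psi> n)) = Z (dsum_elt H N \<psi> n) \<otimes>\<^bsub>Us\<^esub> Z e"
      unfolding Z_elt[OF N \<psi> n] dsum_lift_elt[OF DG_abelian mul_right_balanced[OF e'] N \<psi> n] .
  qed
qed

end

lemma image_constantI: "\<lbrakk>d \<in> S; \<And>e. e \<in> S \<Longrightarrow> h e = c\<rbrakk> \<Longrightarrow> h ` S = {c}"
  by auto

section \<open>Passage to the quotient: the maps \<zeta> and the counit on classes\<close>

context cocomm_hopf_algebroid begin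

abbreviation "Uo \<equiv> finite_dual H"
abbreviation "rel_ideal \<equiv> ideal_generated D (dual_rels H)"
abbreviation "cl d \<equiv> rel_ideal +>\<^bsub>D\<^esub> d"

lemma Z_closed: "d \<in> carrier D \<Longrightarrow> Z d \<in> carrier Us"
  by (rule abelian_group_hom.hom_closed[OF Z_hom])

lemma Z_minus: "\<lbrakk>d \<in> carrier D; e \<in> carrier D\<rbrakk> \<Longrightarrow> Z (d \<ominus>\<^bsub>D\<^esub> e) = Z d \<ominus>\<^bsub>Us\<^esub> Z e"
  by (rule abelian_group_hom.hom_minus[OF Z_hom])

text \<open>The kernel of \<open>Z\<close> is one of the sets intersected in
  \<open>ideal_generated\<close>, and therefore contains the ideal of relations. This makes \<zeta>
  constant on classes.\<close>

lemma kernel_Z_member: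
  "{d \<in> carrier D. Z d = \<zero>\<^bsub>Us\<^esub>} \<in> {I. additive_subgroup I D \<and> dual_rels H \<subseteq> I \<and>
    (\<forall>x\<in>I. \<forall>r\<in>carrier D. r \<otimes>\<^bsub>D\<^esub> x \<in> I \<and> x \<otimes>\<^bsub>D\<^esub> r \<in> I)}"
proof (rule CollectI, intro conjI ballI)
  show "additive_subgroup {d \<in> carrier D. Z d = \<zero>\<^bsub>Us\<^esub>} D"
    by (rule abelian_group_hom.additive_subgroup_a_kernel[OF Z_hom, unfolded a_kernel_def'])
  show "dual_rels H \<subseteq> {d \<in> carrier D. Z d = \<zero>\<^bsub>Us\<^esub>}"
  proof
    fix x assume "x \<in> dual_rels H"
    then obtain M N \<phi> m f where x: "x = dsum_elt H N \<phi> (f m) \<ominus>\<^bsub>D\<^esub> dsum_elt H M (compose (carrier M) \<phi> f) m"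
      and M: "M \<in> fmods H" and N: "N \<in> fmods H" and \<phi>: "\<phi> \<in> carrier (mod_dual H N)"
      and m: "m \<in> carrier M" and f: "f \<in> rlin U M N"
      unfolding dual_rels_def by blast
    interpret M: right_module U M by (rule fmods_right_module[OF M])
    have fm: "f m \<in> carrier N" by (rule rlin_closed[OF f m])
    have \<phi>f: "compose (carrier M) \<phi> f \<in> carrier (mod_dual H M)"
      by (rule dual_compose[OF M.right_module_axioms \<phi> f])
    have c: "dsum_elt H N \<phi> (f m) \<in> carrier D" "dsum_elt H M (compose (carrier M) \<phi> f) m \<in> carrier D"
      using dsum_elt_closed[OF N \<phi> fm] dsum_elt_closed[OF M \<phi>f m] by (simp_all only: D_simps(1))
    \<comment> \<open>A defining relation compares \<phi> applied to f(m) u with \<phi> f applied to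
      m u; these agree because f is U-linear.\<close>
    have "matrix_coeff N \<phi> (f m) = matrix_coeff M (compose (carrier M) \<phi> f) m"
      unfolding matrix_coeff_def by (rule restrict_ext) (simp add: compose_def M.ract_closed m rlin_ract[OF f])
    then have "Z x = \<zero>\<^bsub>Us\<^esub>"
      unfolding x Z_minus[OF c] Z_elt[OF N \<phi> fm] Z_elt[OF M \<phi>f m]
      using Us.diff_self[OF matrix_coeff_closed[OF M.right_module_axioms \<phi>f m]] by (simp only:)
    then show "x \<in> {d \<in> carrier D. Z d = \<zero>\<^bsub>Us\<^esub>}" using D.minus_closed[OF c] x by blast
  qed
  fix x r assume x: "x \<in> {d \<in> carrier D. Z d = \<zero>\<^bsub>Us\<^esub>}" and r: "r \<in> carrier D"
  then have xc: "x \<in> carrier D" and x0: "Z x = \<zero>\<^bsub>Us\<^esub>" by blast+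
  have "Z (r \<otimes>\<^bsub>D\<^esub> x) = \<zero>\<^bsub>Us\<^esub>"
    unfolding Z_mult[OF r xc] x0 by (rule abelian_group_hom.hom_zero[OF conv_mult_hom_right[OF Z_closed[OF r]]])
  then show "r \<otimes>\<^bsub>D\<^esub> x \<in> {d \<in> carrier D. Z d = \<zero>\<^bsub>Us\<^esub>}" using D_mult_closed[OF r xc] by blast
  have "Z (x \<otimes>\<^bsub>D\<^esub> r) = \<zero>\<^bsub>Us\<^esub>"
    unfolding Z_mult[OF xc r] x0 by (rule abelian_group_hom.hom_zero[OF conv_mult_hom_left[OF Z_closed[OF r]]])
  then show "x \<otimes>\<^bsub>D\<^esub> r \<in> {d \<in> carrier D. Z d = \<zero>\<^bsub>Us\<^esub>}" using D_mult_closed[OF xc r] by blast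
qed

lemma rel_ideal_subset: "rel_ideal \<subseteq> {d \<in> carrier D. Z d = \<zero>\<^bsub>Us\<^esub>}"
  unfolding ideal_generated_def by (rule Inter_lower[OF kernel_Z_member])

text \<open>An intersection of additive subgroups; it lies in the carrier because the family
  contains the kernel of \<open>Z\<close>, an empty intersection being everything.\<close>

lemma rel_ideal_subgroup: "additive_subgroup rel_ideal D"
proof (rule D.additive_subgroup_intro)
  show "rel_ideal \<subseteq> carrier D" using rel_ideal_subset by blast
  show "\<zero>\<^bsub>D\<^esub> \<in> rel_ideal" unfolding ideal_generated_def by (auto dest: additive_subgroup.zero_closed)
  show "x \<oplus>\<^bsub>D\<^esub> y \<in> rel_ideal" if "x \<in> rel_ideal" "y \<in> rel_ideal" for x y
    using that unfolding ideal_generated_def by (auto intro: additive_subgroup.a_closed)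
  show "\<ominus>\<^bsub>D\<^esub> x \<in> rel_ideal" if "x \<in> rel_ideal" for x
    using that unfolding ideal_generated_def by (auto intro: additive_subgroup.a_inv_closed)
qed

lemma Uo_simps:
  "carrier Uo = cl ` carrier D"
  "\<lbrakk>d \<in> carrier D; e \<in> carrier D\<rbrakk> \<Longrightarrow> cl d \<oplus>\<^bsub>Uo\<^esub> cl e = cl (d \<oplus>\<^bsub>D\<^esub> e)"
  unfolding finite_dual_def
  by (rule D.quot_abelian_group[OF rel_ideal_subgroup])+

lemma Uo_abelian: "abelian_group Uo"
  unfolding finite_dual_def by (rule D.quot_abelian_group(3)[OF rel_ideal_subgroup])

sublocale Uo: abelian_group Uo by (rule Uo_abelian)

lemma cl_closed: "d \<in> carrier D \<Longrightarrow> cl d \<in> carrier Uo"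
  unfolding Uo_simps(1) by (rule imageI)

lemma Uo_cases:
  assumes "x \<in> carrier Uo"
  obtains d where "d \<in> carrier D" "x = cl d"
  using assms unfolding Uo_simps(1) by blast

lemma cl_self: "d \<in> carrier D \<Longrightarrow> d \<in> cl d"
  unfolding D.coset_eq_diff[OF rel_ideal_subgroup]
  using D.diff_self additive_subgroup.zero_closed[OF rel_ideal_subgroup] by simp

lemma Z_cl:
  assumes d: "d \<in> carrier D" and e: "e \<in> cl d"
  shows "e \<in> carrier D" "Z e = Z d"
proof -
  have e': "e \<in> carrier D" "e \<ominus>\<^bsub>D\<^esub> d \<in> rel_ideal"
    using e unfolding D.coset_eq_diff[OF rel_ideal_subgroup d] by blast+
  have "Z (e \<ominus>\<^bsub>D\<^esub> d) = \<zero>\<^bsub>Us\<^esub>" using subsetD[OF rel_ideal_subset e'(2)] by (simp only: mem_Collect_eq)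
  then have "Z e \<ominus>\<^bsub>Us\<^esub> Z d = \<zero>\<^bsub>Us\<^esub>" by (simp only: Z_minus[OF e'(1) d])
  then show "Z e = Z d" by (rule Us.diff_eq_zero_iff[OF Z_closed[OF e'(1)] Z_closed[OF d], THEN iffD1])
  show "e \<in> carrier D" by (rule e'(1))
qed

lemma zeta_cl:
  assumes d: "d \<in> carrier D"
  shows "zeta H (cl d) = Z d"
proof -
  have "Z ` cl d = {Z d}" by (rule image_constantI[OF cl_self[OF d] Z_cl(2)[OF d]])
  then show ?thesis unfolding zeta_def finite_dual_lift_def by simp
qed

lemma zeta_hom: "abelian_group_hom Uo Us (zeta H)"
proof (rule abelian_group_hom_intro[OF Uo_abelian conv_abelian])
  fix x assume "x \<in> carrier Uo"
  then obtain d where d: "d \<in> carrier D" "x = cl d" by (rule Uo_cases)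
  show "zeta H x \<in> carrier Us" unfolding d(2) zeta_cl[OF d(1)] by (rule Z_closed[OF d(1)])
  fix y assume "y \<in> carrier Uo"
  then obtain e where e: "e \<in> carrier D" "y = cl e" by (rule Uo_cases)
  show "zeta H (x \<oplus>\<^bsub>Uo\<^esub> y) = zeta H x \<oplus>\<^bsub>Us\<^esub> zeta H y"
    unfolding d(2) e(2) Uo_simps(2)[OF d(1) e(1)] zeta_cl[OF d(1)] zeta_cl[OF e(1)] zeta_cl[OF D.a_closed[OF d(1) e(1)]]
    by (rule abelian_group_hom.hom_add[OF Z_hom d(1) e(1)])
qed

text \<open>Evaluation at 1 is additive on U* and sends the matrix coefficient of \<phi> and m to
  \<phi> m, so balancedness is inherited from that of matrix coefficients.\<close>

lemma counit_family: "balanced_family A (\<lambda>M \<phi> m. \<phi> m)"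
  unfolding balanced_family_def
proof
  fix M assume M: "M \<in> fmods H"
  interpret M: right_module U M by (rule fmods_right_module[OF M])
  have e: "matrix_coeff M \<phi> m \<one>\<^bsub>U\<^esub> = \<phi> m" if "m \<in> carrier M" for \<phi> m
    using M.ract_one[OF that] by (simp add: matrix_coeff_def)
  have b: "balanced (end_balance H M) (mod_dual H M) M A (\<lambda>p. (case p of (\<phi>, m) \<Rightarrow> matrix_coeff M \<phi> m) \<one>\<^bsub>U\<^esub>)"
    by (rule tensor_product.balanced_comp[OF summand_tp[OF M] conv_eval_hom[OF U.one_closed] matrix_coeff_balanced[OF M.right_module_axioms]])
  interpret tp: tensor_product "end_balance H M" "mod_dual H M" M "summand H M" by (rule summand_tp[OF M])
  show "balanced (end_balance H M) (mod_dual H M) M A (\<lambda>(\<phi>, m). \<phi> m)"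
    using b tp.balance_closed unfolding balanced_def prod.case
    by (auto simp: e tp.X.a_closed simp del: mod_dual_simps)
qed

text \<open>Since m acted on by 1 is m, the counit is evaluation of \<zeta> at 1. This describes the
  augmentation ideal inside U*, where it can be compared with \<open>F 0\<close> and with
  \<theta>.\<close>

lemma counit_circ_eq:
  assumes x: "x \<in> carrier Uo"
  shows "counit_circ H x = zeta H x \<one>\<^bsub>U\<^esub>"
proof -
  obtain d where d: "d \<in> carrier D" "x = cl d" using x by (rule Uo_cases)
  have E: "dsum_lift H A (\<lambda>M \<phi> m. \<phi> m) e = Z e \<one>\<^bsub>U\<^esub>" if e: "e \<in> carrier DG" for e
  proof (rule dsum_hom_eqI[OF dsum_lift_hom[OF A.abelian_group_axioms counit_family]
        abelian_group_hom_comp[OF Z_hom_DG conv_eval_hom[OF U.one_closed]] _ e])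
    fix M \<phi> m assume M: "M \<in> fmods H" and \<phi>: "\<phi> \<in> carrier (mod_dual H M)" and m: "m \<in> carrier M"
    interpret M: right_module U M by (rule fmods_right_module[OF M])
    show "dsum_lift H A (\<lambda>M \<phi> m. \<phi> m) (dsum_elt H M \<phi> m) = Z (dsum_elt H M \<phi> m) \<one>\<^bsub>U\<^esub>"
      unfolding Z_elt[OF M \<phi> m] dsum_lift_elt[OF A.abelian_group_axioms counit_family M \<phi> m]
      using M.ract_one[OF m] by (simp add: matrix_coeff_def)
  qed
  have "dsum_lift H A (\<lambda>M \<phi> m. \<phi> m) e = Z d \<one>\<^bsub>U\<^esub>" if "e \<in> cl d" for e
    unfolding E[OF Z_cl(1)[OF d(1) that, unfolded D_simps(1)]] Z_cl(2)[OF d(1) that] ..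
  then have "dsum_lift H A (\<lambda>M \<phi> m. \<phi> m) ` cl d = {Z d \<one>\<^bsub>U\<^esub>}" by (rule image_constantI[OF cl_self[OF d(1)]])
  then show ?thesis unfolding d(2) zeta_cl[OF d(1)] counit_circ_def finite_dual_lift_def by simp
qed

end

section \<open>The finite dual as a filtered group when \<zeta> is injective\<close>

locale injective_zeta = filtered_hopf_algebroid +
  assumes zeta_inj: "inj_on (zeta H) (carrier (finite_dual H))"
begin

interpretation zeta: abelian_group_hom Uo Us "zeta H" by (rule zeta_hom)

text \<open>Injectivity of \<open>\<zeta>\<close> makes the product of the finite dual independent of representatives.\<close>

lemma Uo_mult:
  assumes d: "d \<in> carrier D" and e: "e \<in> carrier D"
  shows "cl d \<otimes>\<^bsub>Uo\<^esub> cl e = cl (d \<otimes>\<^bsub>D\<^esub> e)"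
proof -
  have "cl (a \<otimes>\<^bsub>D\<^esub> b) = cl (d \<otimes>\<^bsub>D\<^esub> e)" if a: "a \<in> cl d" and b: "b \<in> cl e" for a b
  proof -
    note a' = Z_cl[OF d a] and b' = Z_cl[OF e b]
    have "zeta H (cl (a \<otimes>\<^bsub>D\<^esub> b)) = zeta H (cl (d \<otimes>\<^bsub>D\<^esub> e))"
      unfolding zeta_cl[OF D_mult_closed[OF a'(1) b'(1)]] zeta_cl[OF D_mult_closed[OF d e]]
        Z_mult[OF a'(1) b'(1)] Z_mult[OF d e] a'(2) b'(2) ..
    then show ?thesis
      by (rule inj_onD[OF zeta_inj _ cl_closed[OF D_mult_closed[OF a'(1) b'(1)]] cl_closed[OF D_mult_closed[OF d e]]])
  qed
  then have "(\<Union>a\<in>cl d. \<Union>b\<in>cl e. cl (a \<otimes>\<^bsub>D\<^esub> b)) = (\<Union>a\<in>cl d. \<Union>b\<in>cl e. cl (d \<otimes>\<^bsub>D\<^esub> e))"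
    by (intro SUP_cong refl) blast
  also have "\<dots> = cl (d \<otimes>\<^bsub>D\<^esub> e)" using cl_self[OF d] cl_self[OF e] by blast
  finally have "(\<Union>a\<in>cl d. \<Union>b\<in>cl e. cl (a \<otimes>\<^bsub>D\<^esub> b)) = cl (d \<otimes>\<^bsub>D\<^esub> e)" .
  then show ?thesis by (simp add: finite_dual_def FactRing_def rcoset_mult_def)
qed

lemma Uo_mult_closed: "\<lbrakk>x \<in> carrier Uo; y \<in> carrier Uo\<rbrakk> \<Longrightarrow> x \<otimes>\<^bsub>Uo\<^esub> y \<in> carrier Uo"
  and zeta_mult: "\<lbrakk>x \<in> carrier Uo; y \<in> carrier Uo\<rbrakk> \<Longrightarrow> zeta H (x \<otimes>\<^bsub>Uo\<^esub> y) = zeta H x \<otimes>\<^bsub>Us\<^esub> zeta H y"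
proof -
  assume x: "x \<in> carrier Uo" and y: "y \<in> carrier Uo"
  obtain d where d: "d \<in> carrier D" "x = cl d" using x by (rule Uo_cases)
  obtain e where e: "e \<in> carrier D" "y = cl e" using y by (rule Uo_cases)
  note de = D_mult_closed[OF d(1) e(1)]
  show "x \<otimes>\<^bsub>Uo\<^esub> y \<in> carrier Uo" unfolding d(2) e(2) Uo_mult[OF d(1) e(1)] by (rule cl_closed[OF de])
  show "zeta H (x \<otimes>\<^bsub>Uo\<^esub> y) = zeta H x \<otimes>\<^bsub>Us\<^esub> zeta H y"
    unfolding d(2) e(2) Uo_mult[OF d(1) e(1)] zeta_cl[OF d(1)] zeta_cl[OF e(1)] zeta_cl[OF de]
    by (rule Z_mult[OF d(1) e(1)])
qed

text \<open>Pulled back from the convolution algebra: both sides have the same image under the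
  injective \<zeta>.\<close>

lemma Uo_l_distr:
  assumes "x \<in> carrier Uo" "y \<in> carrier Uo" "z \<in> carrier Uo"
  shows "(x \<oplus>\<^bsub>Uo\<^esub> y) \<otimes>\<^bsub>Uo\<^esub> z = x \<otimes>\<^bsub>Uo\<^esub> z \<oplus>\<^bsub>Uo\<^esub> y \<otimes>\<^bsub>Uo\<^esub> z"
proof (rule inj_onD[OF zeta_inj])
  show "zeta H ((x \<oplus>\<^bsub>Uo\<^esub> y) \<otimes>\<^bsub>Uo\<^esub> z) = zeta H (x \<otimes>\<^bsub>Uo\<^esub> z \<oplus>\<^bsub>Uo\<^esub> y \<otimes>\<^bsub>Uo\<^esub> z)"
    using assms conv_l_distr[OF zeta.hom_closed zeta.hom_closed zeta.hom_closed]
    by (simp add: zeta_mult Uo_mult_closed del: conv_simps)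
qed (use assms Uo_mult_closed in simp_all)

abbreviation "augmentation \<equiv> {x \<in> carrier Uo. counit_circ H x = \<zero>\<^bsub>A\<^esub>}"
abbreviation "K \<equiv> finite_dual_filtration H"

lemma K_eq: "K = ideal_power Uo augmentation"
  by (rule ext) (simp add: finite_dual_filtration_def)

lemma augmentation_subgroup: "additive_subgroup augmentation Uo"
proof -
  note h = abelian_group_hom_comp[OF zeta_hom conv_eval_hom[OF U.one_closed]]
  have "augmentation = a_kernel Uo A (\<lambda>x. zeta H x \<one>\<^bsub>U\<^esub>)"
    unfolding a_kernel_def' by (intro Collect_cong conj_cong refl) (simp only: counit_circ_eq)
  then show ?thesis using abelian_group_hom.additive_subgroup_a_kernel[OF h] by (simp only:)
qed

lemma K_filtered_group: "filtered_group Uo K"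
  unfolding K_eq by (rule ideal_power_filtered_group[OF Uo_abelian Uo_mult_closed Uo_l_distr augmentation_subgroup])

interpretation K: filtered_group Uo K by (rule K_filtered_group)

text \<open>\<open>F 0\<close> is the image of A in U, so a right linear map that vanishes at 1
  vanishes on all of \<open>F 0\<close>.\<close>

lemma zeta_augmentation:
  assumes "x \<in> augmentation"
  shows "zeta H x \<in> G (Suc 0)"
proof -
  have x: "x \<in> carrier Uo" and x0: "zeta H x \<one>\<^bsub>U\<^esub> = \<zero>\<^bsub>A\<^esub>" using assms counit_circ_eq by auto
  have "zeta H x u = \<zero>\<^bsub>A\<^esub>" if u: "u \<in> F 0" for u
  proof -
    obtain a where a: "a \<in> carrier A" "u = src H a" using u unfolding F_zero by blast
    show ?thesis
      using conv_src[OF zeta.hom_closed[OF x] U.one_closed a(1)] x0 a by simp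
  qed
  then show ?thesis using zeta.hom_closed[OF x] by (simp only: G_Suc_iff) blast
qed

text \<open>Each further factor from the augmentation ideal has image in \<open>G 1\<close> and
  raises the level by one, by \<open>G_mult\<close>.\<close>

lemma zeta_filtered: "x \<in> K n \<Longrightarrow> zeta H x \<in> G n"
proof (induction n arbitrary: x)
  case 0 then show ?case using zeta.hom_closed[of x] by (simp only: G_0_iff K.F_0)
next
  case (Suc n)
  have "x \<in> ideal_prod Uo augmentation (K n)" using Suc.prems by (simp add: K_eq)
  then show ?case
  proof (induction rule: ideal_prod.induct)
    case (prod i j)
    have ij: "i \<in> carrier Uo" "j \<in> carrier Uo" using prod K.F_carr by blast+
    show ?case
      unfolding zeta_mult[OF ij] using G_mult[OF zeta_augmentation[OF prod(1)] Suc.IH[OF prod(2)]] by (simp only: add_Suc add_0)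
  next
    case (sum s t)
    have "s \<in> K (Suc n)" "t \<in> K (Suc n)" using sum(1,2) by (simp_all add: K_eq)
    then have st: "s \<in> carrier Uo" "t \<in> carrier Uo" using K.F_carr by blast+
    show ?case unfolding zeta.hom_add[OF st] by (rule Us.F_add[OF sum(3,4)])
  qed
qed

lemma completed_zeta: "completed_hom Uo K Us G (zeta H)"
  by (intro completed_hom.intro filtered_hom.intro filtered_hom_axioms.intro K_filtered_group filtered_group_conv
      zeta_hom zeta_filtered Us.complete_filtered_group_axioms)

end

section \<open>The map from the tensor square of the base\<close>

context cocomm_hopf_algebroid begin

abbreviation "kbal \<equiv> {(\<lambda>a. c \<odot>\<^bsub>A\<^esub> a, \<lambda>b. c \<odot>\<^bsub>A\<^esub> b) | c. c \<in> carrier k}"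
abbreviation "AA \<equiv> base_tensor k H"

lemma smult_closed: "\<lbrakk>c \<in> carrier k; a \<in> carrier A\<rbrakk> \<Longrightarrow> c \<odot>\<^bsub>A\<^esub> a \<in> carrier A"
  using base_algebra by (simp add: algebra_def Module.module_def module_axioms_def)

lemma smult_assoc: "\<lbrakk>c \<in> carrier k; a \<in> carrier A; b \<in> carrier A\<rbrakk> \<Longrightarrow> (c \<odot>\<^bsub>A\<^esub> a) \<otimes>\<^bsub>A\<^esub> b = c \<odot>\<^bsub>A\<^esub> (a \<otimes>\<^bsub>A\<^esub> b)"
  using base_algebra by (simp add: algebra_def algebra_axioms_def)

lemma mult_smult: "\<lbrakk>c \<in> carrier k; a \<in> carrier A; b \<in> carrier A\<rbrakk> \<Longrightarrow> a \<otimes>\<^bsub>A\<^esub> (c \<odot>\<^bsub>A\<^esub> b) = c \<odot>\<^bsub>A\<^esub> (a \<otimes>\<^bsub>A\<^esub> b)"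
  using smult_assoc[of c b a] smult_closed by (simp add: A.m_comm)

sublocale AA: tensor_product kbal A A AA
  by unfold_locales (auto simp: base_tensor_def smult_closed)

lemma AA_balancedI:
  assumes "\<And>x y. \<lbrakk>x \<in> carrier A; y \<in> carrier A\<rbrakk> \<Longrightarrow> f (x, y) \<in> carrier G"
    and "\<And>x x' y. \<lbrakk>x \<in> carrier A; x' \<in> carrier A; y \<in> carrier A\<rbrakk> \<Longrightarrow> f (x \<oplus>\<^bsub>A\<^esub> x', y) = f (x, y) \<oplus>\<^bsub>G\<^esub> f (x', y)"
    and "\<And>x y y'. \<lbrakk>x \<in> carrier A; y \<in> carrier A; y' \<in> carrier A\<rbrakk> \<Longrightarrow> f (x, y \<oplus>\<^bsub>A\<^esub> y') = f (x, y) \<oplus>\<^bsub>G\<^esub> f (x, y')"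
    and "\<And>c x y. \<lbrakk>c \<in> carrier k; x \<in> carrier A; y \<in> carrier A\<rbrakk> \<Longrightarrow> f (c \<odot>\<^bsub>A\<^esub> x, y) = f (x, c \<odot>\<^bsub>A\<^esub> y)"
  shows "balanced kbal A A G f"
  by (rule balancedI) (use assms in auto)

lemma AA_pure_smult: "\<lbrakk>c \<in> carrier k; x \<in> carrier A; y \<in> carrier A\<rbrakk> \<Longrightarrow> AA.pure (c \<odot>\<^bsub>A\<^esub> x) y = AA.pure x (c \<odot>\<^bsub>A\<^esub> y)"
  using AA.pure_balance[of "\<lambda>a. c \<odot>\<^bsub>A\<^esub> a" "\<lambda>b. c \<odot>\<^bsub>A\<^esub> b" x y] by blast

lemma AA_inner: "\<lbrakk>x \<in> carrier A; y \<in> carrier A\<rbrakk> \<Longrightarrow>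
    balanced kbal A A AA (\<lambda>(x', y'). AA.pure (x \<otimes>\<^bsub>A\<^esub> x') (y \<otimes>\<^bsub>A\<^esub> y'))"
  by (rule AA_balancedI)
    (simp_all add: AA.pure_closed AA.pure_add_left AA.pure_add_right A.r_distr mult_smult AA_pure_smult)

text \<open>Each clause is an equality of additive maps in t, checked on pure tensors; together with
  \<open>AA_inner\<close> it makes the componentwise product on A \<otimes> A well defined.\<close>

lemma AA_outer:
  assumes t: "t \<in> carrier AA"
  shows "balanced kbal A A AA (\<lambda>(x, y). tlift AA (\<lambda>(x', y'). AA.pure (x \<otimes>\<^bsub>A\<^esub> x') (y \<otimes>\<^bsub>A\<^esub> y')) t)"
proof (rule AA_balancedI; unfold prod.case)
  note h = AA.tlift_hom[OF AA.T_abelian AA_inner]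
  note p = AA.tlift_pure[OF AA.T_abelian AA_inner]
  fix x y assume x: "x \<in> carrier A" and y: "y \<in> carrier A"
  show "tlift AA (\<lambda>(x', y'). AA.pure (x \<otimes>\<^bsub>A\<^esub> x') (y \<otimes>\<^bsub>A\<^esub> y')) t \<in> carrier AA"
    by (rule AA.tlift_closed[OF AA.T_abelian AA_inner[OF x y] t])
  show "tlift AA (\<lambda>(p, q). AA.pure ((x \<oplus>\<^bsub>A\<^esub> x') \<otimes>\<^bsub>A\<^esub> p) (y \<otimes>\<^bsub>A\<^esub> q)) t =
      tlift AA (\<lambda>(p, q). AA.pure (x \<otimes>\<^bsub>A\<^esub> p) (y \<otimes>\<^bsub>A\<^esub> q)) t \<oplus>\<^bsub>AA\<^esub> tlift AA (\<lambda>(p, q). AA.pure (x' \<otimes>\<^bsub>A\<^esub> p) (y \<otimes>\<^bsub>A\<^esub> q)) t"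
    if x': "x' \<in> carrier A" for x'
    by (rule AA.tensor_hom_eqI[OF h[OF A.a_closed[OF x x'] y] abelian_group_hom_add[OF h[OF x y] h[OF x' y]] _ t])
      (simp add: p x x' y A.l_distr AA.pure_add_left)
  show "tlift AA (\<lambda>(p, q). AA.pure (x \<otimes>\<^bsub>A\<^esub> p) ((y \<oplus>\<^bsub>A\<^esub> y') \<otimes>\<^bsub>A\<^esub> q)) t =
      tlift AA (\<lambda>(p, q). AA.pure (x \<otimes>\<^bsub>A\<^esub> p) (y \<otimes>\<^bsub>A\<^esub> q)) t \<oplus>\<^bsub>AA\<^esub> tlift AA (\<lambda>(p, q). AA.pure (x \<otimes>\<^bsub>A\<^esub> p) (y' \<otimes>\<^bsub>A\<^esub> q)) t"
    if y': "y' \<in> carrier A" for y'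
    by (rule AA.tensor_hom_eqI[OF h[OF x A.a_closed[OF y y']] abelian_group_hom_add[OF h[OF x y] h[OF x y']] _ t])
      (simp add: p x y y' A.l_distr AA.pure_add_right)
  show "tlift AA (\<lambda>(p, q). AA.pure (c \<odot>\<^bsub>A\<^esub> x \<otimes>\<^bsub>A\<^esub> p) (y \<otimes>\<^bsub>A\<^esub> q)) t =
      tlift AA (\<lambda>(p, q). AA.pure (x \<otimes>\<^bsub>A\<^esub> p) (c \<odot>\<^bsub>A\<^esub> y \<otimes>\<^bsub>A\<^esub> q)) t" if c: "c \<in> carrier k" for c
    by (rule AA.tensor_hom_eqI[OF h[OF smult_closed[OF c x] y] h[OF x smult_closed[OF c y]] _ t])
      (simp add: p x y c smult_closed smult_assoc AA_pure_smult)
qed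

lemma AA_mult:
  assumes s: "s \<in> carrier AA" and t: "t \<in> carrier AA"
  shows "s \<otimes>\<^bsub>AA\<^esub> t = tlift AA (\<lambda>(x, y). tlift AA (\<lambda>(x', y'). AA.pure (x \<otimes>\<^bsub>A\<^esub> x') (y \<otimes>\<^bsub>A\<^esub> y')) t) s"
  by (rule AA.tensor_mult[OF _ A.m_closed A.m_closed AA_inner AA_outer[OF t] s t]) (simp add: base_tensor_def)

lemma AA_mult_hom: "t \<in> carrier AA \<Longrightarrow> abelian_group_hom AA AA (\<lambda>s. s \<otimes>\<^bsub>AA\<^esub> t)"
  using AA.tlift_closed[OF AA.T_abelian AA_outer] AA.tlift_add[OF AA.T_abelian AA_outer]
  by (intro abelian_group_hom_intro AA.T_abelian) (simp_all add: AA_mult)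

lemma AA_mult_closed: "\<lbrakk>s \<in> carrier AA; t \<in> carrier AA\<rbrakk> \<Longrightarrow> s \<otimes>\<^bsub>AA\<^esub> t \<in> carrier AA"
  by (rule abelian_group_hom.hom_closed[OF AA_mult_hom])

lemma AA_l_distr: "\<lbrakk>s \<in> carrier AA; s' \<in> carrier AA; t \<in> carrier AA\<rbrakk> \<Longrightarrow>
    (s \<oplus>\<^bsub>AA\<^esub> s') \<otimes>\<^bsub>AA\<^esub> t = s \<otimes>\<^bsub>AA\<^esub> t \<oplus>\<^bsub>AA\<^esub> s' \<otimes>\<^bsub>AA\<^esub> t"
  by (rule abelian_group_hom.hom_add[OF AA_mult_hom])

abbreviation "theta0 a' a \<equiv> \<lambda>u\<in>carrier U. counit H (src H a \<otimes>\<^bsub>U\<^esub> u) \<otimes>\<^bsub>A\<^esub> a'"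

lemma theta0_closed: "\<lbrakk>a' \<in> carrier A; a \<in> carrier A\<rbrakk> \<Longrightarrow> theta0 a' a \<in> carrier Us"
proof (rule convI)
  assume a: "a' \<in> carrier A" "a \<in> carrier A"
  show "theta0 a' a (u \<otimes>\<^bsub>U\<^esub> src H b) = theta0 a' a u \<otimes>\<^bsub>A\<^esub> b" if "u \<in> carrier U" "b \<in> carrier A" for u b
    using a that counit_right_linear[of "src H a \<otimes>\<^bsub>U\<^esub> u" b]
    by (simp add: U.m_assoc[symmetric] counit_closed A.m_ac)
qed (simp_all add: counit_closed U.r_distr counit_add A.l_distr)

text \<open>The scalar is moved to the far right of the product in U, where it appears as the
  element c 1 of A, and right A-linearity of the counit takes it out.\<close>

lemma counit_smult:
  assumes c: "c \<in> carrier k" and u: "u \<in> carrier U" and a: "a \<in> carrier A"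
  shows "counit H (src H (c \<odot>\<^bsub>A\<^esub> a) \<otimes>\<^bsub>U\<^esub> u) = c \<odot>\<^bsub>A\<^esub> counit H (src H a \<otimes>\<^bsub>U\<^esub> u)"
proof -
  have kU: "\<And>x y. \<lbrakk>x \<in> carrier U; y \<in> carrier U\<rbrakk> \<Longrightarrow> (c \<odot>\<^bsub>U\<^esub> x) \<otimes>\<^bsub>U\<^esub> y = c \<odot>\<^bsub>U\<^esub> (x \<otimes>\<^bsub>U\<^esub> y)"
    "\<And>x y. \<lbrakk>x \<in> carrier U; y \<in> carrier U\<rbrakk> \<Longrightarrow> x \<otimes>\<^bsub>U\<^esub> (c \<odot>\<^bsub>U\<^esub> y) = c \<odot>\<^bsub>U\<^esub> (x \<otimes>\<^bsub>U\<^esub> y)"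
    using total_algebra c unfolding k_algebra_def by blast+
  let ?v = "src H a \<otimes>\<^bsub>U\<^esub> u"
  have v: "?v \<in> carrier U" using a u by simp
  have "src H (c \<odot>\<^bsub>A\<^esub> a) \<otimes>\<^bsub>U\<^esub> u = c \<odot>\<^bsub>U\<^esub> (?v \<otimes>\<^bsub>U\<^esub> \<one>\<^bsub>U\<^esub>)" using a u by (simp add: src_smult[OF c a] kU(1))
  also have "\<dots> = ?v \<otimes>\<^bsub>U\<^esub> (c \<odot>\<^bsub>U\<^esub> \<one>\<^bsub>U\<^esub>)" using kU(2)[OF v U.one_closed] by simp
  also have "\<dots> = ?v \<otimes>\<^bsub>U\<^esub> src H (c \<odot>\<^bsub>A\<^esub> \<one>\<^bsub>A\<^esub>)" by (simp add: src_smult[OF c A.one_closed])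
  finally show ?thesis
    using counit_right_linear[OF v smult_closed[OF c A.one_closed]] mult_smult[OF c counit_closed[OF v] A.one_closed] counit_closed[OF v]
    by simp
qed

lemma theta0_balanced: "balanced kbal A A Us (\<lambda>(a', a). theta0 a' a)"
proof (rule AA_balancedI; unfold prod.case)
  fix a' a assume a': "a' \<in> carrier A" and a: "a \<in> carrier A"
  show "theta0 a' a \<in> carrier Us" by (rule theta0_closed[OF a' a])
  show "theta0 (a' \<oplus>\<^bsub>A\<^esub> b) a = theta0 a' a \<oplus>\<^bsub>Us\<^esub> theta0 b a" if "b \<in> carrier A" for b
    unfolding conv_simps by (rule restrict_ext) (simp add: a a' that counit_closed A.r_distr)
  show "theta0 a' (a \<oplus>\<^bsub>A\<^esub> b) = theta0 a' a \<oplus>\<^bsub>Us\<^esub> theta0 a' b" if "b \<in> carrier A" for b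
    unfolding conv_simps
    by (rule restrict_ext) (simp add: a a' that counit_closed src_add U.l_distr counit_add A.l_distr)
  show "theta0 (c \<odot>\<^bsub>A\<^esub> a') a = theta0 a' (c \<odot>\<^bsub>A\<^esub> a)" if c: "c \<in> carrier k" for c
  proof (rule restrict_ext)
    fix u assume u: "u \<in> carrier U"
    have "counit H (src H a \<otimes>\<^bsub>U\<^esub> u) \<in> carrier A" using a u by (simp add: counit_closed)
    then show "counit H (src H a \<otimes>\<^bsub>U\<^esub> u) \<otimes>\<^bsub>A\<^esub> (c \<odot>\<^bsub>A\<^esub> a') = counit H (src H (c \<odot>\<^bsub>A\<^esub> a) \<otimes>\<^bsub>U\<^esub> u) \<otimes>\<^bsub>A\<^esub> a'"
      unfolding counit_smult[OF c u a] using c a' by (simp add: mult_smult smult_assoc)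
  qed
qed

lemma theta_hom: "abelian_group_hom AA Us (theta H)"
  unfolding theta_def by (rule AA.tlift_hom[OF conv_abelian theta0_balanced])

lemma theta_pure: "\<lbrakk>a' \<in> carrier A; a \<in> carrier A\<rbrakk> \<Longrightarrow> theta H (AA.pure a' a) = theta0 a' a"
  unfolding theta_def using AA.tlift_pure[OF conv_abelian theta0_balanced] by simp

text \<open>The element y' is slid from the second leg to the first, where it joins y; what remains
  on the second leg is the counit, and counitality collapses the sum over the legs to u.\<close>

lemma theta0_mult:
  assumes x: "x \<in> carrier A" "x' \<in> carrier A" and y: "y \<in> carrier A" "y' \<in> carrier A"
  shows "theta0 (x \<otimes>\<^bsub>A\<^esub> x') (y \<otimes>\<^bsub>A\<^esub> y') = theta0 x y \<otimes>\<^bsub>Us\<^esub> theta0 x' y'"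
proof (rule conv_eqI)
  show "theta0 (x \<otimes>\<^bsub>A\<^esub> x') (y \<otimes>\<^bsub>A\<^esub> y') \<in> carrier Us" by (rule theta0_closed) (simp_all add: x y)
  show "theta0 x y \<otimes>\<^bsub>Us\<^esub> theta0 x' y' \<in> carrier Us" by (intro conv_mult_closed theta0_closed x y)
  note A = A.abelian_group_axioms
  fix u assume u: "u \<in> carrier U"
  let ?e = "theta0 x' \<one>\<^bsub>A\<^esub>"
  note b0 = conv_balanced[OF theta0_closed[OF x(1) y(1)] theta0_closed[OF x(2) A.one_closed]]
  note b1 = conv_balanced[OF theta0_closed[OF x(1) y(1)] theta0_closed[OF x(2) y(2)]]
  let ?h = "\<lambda>v. counit H (src H (y \<otimes>\<^bsub>A\<^esub> y') \<otimes>\<^bsub>U\<^esub> v) \<otimes>\<^bsub>A\<^esub> (x \<otimes>\<^bsub>A\<^esub> x')"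
  have h: "abelian_group_hom U A ?h"
    by (rule abelian_group_hom_intro[OF U.abelian_group_axioms A])
      (simp_all add: x y counit_closed U.r_distr counit_add A.l_distr)
  have bc: "balUU U (\<lambda>(p, q). p \<otimes>\<^bsub>U\<^esub> src H (counit H q))"
    by (rule balUU_I)
      (simp_all add: counit_closed counit_add counit_right_linear src_add U.l_distr U.r_distr src_mult[symmetric]
        A.m_comm U.m_assoc)
  have "(theta0 x y \<otimes>\<^bsub>Us\<^esub> theta0 x' y') u = tlift A (\<lambda>(p, q). theta0 x y p \<otimes>\<^bsub>A\<^esub> theta0 x' y' q) (comult H u)"
    by (rule conv_mult_apply[OF u])
  \<comment> \<open>The factor y' is split off as a left multiplication on the second leg, the form
    in which \<open>takeuchi_slide\<close> applies.\<close>
  also have "\<dots> = tlift A (\<lambda>(p, q). theta0 x y p \<otimes>\<^bsub>A\<^esub> ?e (src H y' \<otimes>\<^bsub>U\<^esub> q)) (comult H u)"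
    by (rule UU.tlift_cong[OF A b1 _ comult_closed[OF u], symmetric]) (simp add: y)
  also have "\<dots> = tlift A (\<lambda>(p, q). theta0 x y (src H y' \<otimes>\<^bsub>U\<^esub> p) \<otimes>\<^bsub>A\<^esub> ?e q) (comult H u)"
    using takeuchi_slide[OF comult_takeuchi[OF u] y(2) A b0] by simp
  \<comment> \<open>The integrand is rewritten as one additive map applied to p times the counit of
    q, so that the lift can be pulled inside and \<open>counital_right\<close> used.\<close>
  also have "\<dots> = tlift A (\<lambda>r. ?h (case r of (p, q) \<Rightarrow> p \<otimes>\<^bsub>U\<^esub> src H (counit H q))) (comult H u)"
  proof (rule UU.tlift_cong[OF A UU.balanced_comp[OF h bc] _ comult_closed[OF u]], unfold prod.case)
    fix p q assume "p \<in> carrier (UA H)" "q \<in> carrier (UA H)"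
    then have pq: "p \<in> carrier U" "q \<in> carrier U" by simp_all
    have v: "src H (y \<otimes>\<^bsub>A\<^esub> y') \<otimes>\<^bsub>U\<^esub> p \<in> carrier U" using pq y by simp
    have "counit H (src H (y \<otimes>\<^bsub>A\<^esub> y') \<otimes>\<^bsub>U\<^esub> (p \<otimes>\<^bsub>U\<^esub> src H (counit H q))) =
        counit H (src H (y \<otimes>\<^bsub>A\<^esub> y') \<otimes>\<^bsub>U\<^esub> p) \<otimes>\<^bsub>A\<^esub> counit H q"
      using counit_right_linear[OF v counit_closed[OF pq(2)]] pq y counit_closed[OF pq(2)] by (simp add: U.m_assoc)
    then show "theta0 x y (src H y' \<otimes>\<^bsub>U\<^esub> p) \<otimes>\<^bsub>A\<^esub> ?e q = ?h (p \<otimes>\<^bsub>U\<^esub> src H (counit H q))"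
      using pq x y counit_closed by (simp add: src_mult U.m_assoc A.m_ac)
  qed
  also have "\<dots> = ?h (tlift U (\<lambda>(p, q). p \<otimes>\<^bsub>U\<^esub> src H (counit H q)) (comult H u))"
    by (rule UU.tlift_comp[OF h bc comult_closed[OF u], symmetric])
  also have "\<dots> = theta0 (x \<otimes>\<^bsub>A\<^esub> x') (y \<otimes>\<^bsub>A\<^esub> y') u" using counital_right[OF u] u by simp
  finally show "theta0 (x \<otimes>\<^bsub>A\<^esub> x') (y \<otimes>\<^bsub>A\<^esub> y') u = (theta0 x y \<otimes>\<^bsub>Us\<^esub> theta0 x' y') u" by simp
qed

lemma theta_mult:
  assumes s: "s \<in> carrier AA" and t: "t \<in> carrier AA"
  shows "theta H (s \<otimes>\<^bsub>AA\<^esub> t) = theta H s \<otimes>\<^bsub>Us\<^esub> theta H t"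
proof -
  have tc: "theta H r \<in> carrier Us" if "r \<in> carrier AA" for r
    by (rule abelian_group_hom.hom_closed[OF theta_hom that])
  show ?thesis
  proof (rule AA.tensor_hom_eqI[OF abelian_group_hom_comp[OF AA_mult_hom[OF t] theta_hom] abelian_group_hom_comp[OF theta_hom conv_mult_hom_left[OF tc[OF t]]] _ s])
    fix x y assume x: "x \<in> carrier A" and y: "y \<in> carrier A"
    have "theta H (tlift AA (\<lambda>(x', y'). AA.pure (x \<otimes>\<^bsub>A\<^esub> x') (y \<otimes>\<^bsub>A\<^esub> y')) t) = theta0 x y \<otimes>\<^bsub>Us\<^esub> theta H t"
    proof (rule AA.tensor_hom_eqI[OF abelian_group_hom_comp[OF AA.tlift_hom[OF AA.T_abelian AA_inner[OF x y]] theta_hom]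
          abelian_group_hom_comp[OF theta_hom conv_mult_hom_right[OF theta0_closed[OF x y]]] _ t])
      fix x' y' assume x': "x' \<in> carrier A" and y': "y' \<in> carrier A"
      show "theta H (tlift AA (\<lambda>(x', y'). AA.pure (x \<otimes>\<^bsub>A\<^esub> x') (y \<otimes>\<^bsub>A\<^esub> y')) (AA.pure x' y')) = theta0 x y \<otimes>\<^bsub>Us\<^esub> theta H (AA.pure x' y')"
        unfolding AA.tlift_pure[OF AA.T_abelian AA_inner[OF x y] x' y'] prod.case theta_pure[OF x' y']
          theta_pure[OF A.m_closed[OF x x'] A.m_closed[OF y y']]
        by (rule theta0_mult[OF x x' y y'])
    qed
    then show "theta H (AA.pure x y \<otimes>\<^bsub>AA\<^esub> t) = theta H (AA.pure x y) \<otimes>\<^bsub>Us\<^esub> theta H t"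
      unfolding AA_mult[OF AA.pure_closed[OF x y] t] AA.tlift_pure[OF AA.T_abelian AA_outer[OF t] x y] prod.case theta_pure[OF x y] .
  qed
qed

abbreviation "AA_augmentation \<equiv> {t \<in> carrier AA. tlift A (\<lambda>(a, b). a \<otimes>\<^bsub>A\<^esub> b) t = \<zero>\<^bsub>A\<^esub>}"

lemma AA_multiplication_hom: "abelian_group_hom AA A (tlift A (\<lambda>(a, b). a \<otimes>\<^bsub>A\<^esub> b))"
  and AA_multiplication_pure: "\<lbrakk>x \<in> carrier A; y \<in> carrier A\<rbrakk> \<Longrightarrow> tlift A (\<lambda>(a, b). a \<otimes>\<^bsub>A\<^esub> b) (AA.pure x y) = x \<otimes>\<^bsub>A\<^esub> y"
proof -
  have b: "balanced kbal A A A (\<lambda>(a, b). a \<otimes>\<^bsub>A\<^esub> b)"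
    by (rule AA_balancedI) (simp_all add: A.l_distr A.r_distr mult_smult smult_assoc)
  show "abelian_group_hom AA A (tlift A (\<lambda>(a, b). a \<otimes>\<^bsub>A\<^esub> b))" by (rule AA.tlift_hom[OF A.abelian_group_axioms b])
  show "\<lbrakk>x \<in> carrier A; y \<in> carrier A\<rbrakk> \<Longrightarrow> tlift A (\<lambda>(a, b). a \<otimes>\<^bsub>A\<^esub> b) (AA.pure x y) = x \<otimes>\<^bsub>A\<^esub> y"
    using AA.tlift_pure[OF A.abelian_group_axioms b] by simp
qed

lemma AA_augmentation_subgroup: "additive_subgroup AA_augmentation AA"
  using abelian_group_hom.additive_subgroup_a_kernel[OF AA_multiplication_hom] by (simp add: a_kernel_def')

abbreviation "AA_filtration \<equiv> base_tensor_filtration k H"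

lemma AA_filtration_eq: "AA_filtration = ideal_power AA AA_augmentation"
  by (rule ext) (simp add: base_tensor_filtration_def)

lemma AA_filtered_group: "filtered_group AA AA_filtration"
  unfolding AA_filtration_eq
  by (rule ideal_power_filtered_group[OF AA.T_abelian AA_mult_closed AA_l_distr AA_augmentation_subgroup])

end

context filtered_hopf_algebroid begin

text \<open>At u = 1 the counit of a is a itself, leaving the product in A. With
  \<open>counit_circ_eq\<close> this matches the augmentation ideal of A \<otimes> A with that of
  the finite dual.\<close>

lemma theta_eval_one:
  assumes t: "t \<in> carrier AA"
  shows "theta H t \<one>\<^bsub>U\<^esub> = tlift A (\<lambda>(a, b). a \<otimes>\<^bsub>A\<^esub> b) t"
proof (rule AA.tensor_hom_eqI[OF abelian_group_hom_comp[OF theta_hom conv_eval_hom[OF U.one_closed]] AA_multiplication_hom _ t])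
  fix x y assume x: "x \<in> carrier A" and y: "y \<in> carrier A"
  show "theta H (AA.pure x y) \<one>\<^bsub>U\<^esub> = tlift A (\<lambda>(a, b). a \<otimes>\<^bsub>A\<^esub> b) (AA.pure x y)"
    unfolding theta_pure[OF x y] AA_multiplication_pure[OF x y] using x y by (simp add: counit_src A.m_comm)
qed

lemma theta0_in_zeta_image:
  assumes a': "a' \<in> carrier A" and a: "a \<in> carrier A"
  shows "theta0 a' a \<in> zeta H ` carrier Uo"
proof -
  \<comment> \<open>Multiplication by a' is a functional on the unit module; applied to a u, which
    is the counit of the product of a and u, it gives the value of \<theta>.\<close>
  let ?\<phi> = "\<lambda>b\<in>carrier A. b \<otimes>\<^bsub>A\<^esub> a'"
  interpret R: right_module U "unit_mod H" by (rule unit_mod_right_module)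
  have \<phi>: "?\<phi> \<in> carrier (mod_dual H (unit_mod H))"
    by (rule dualI) (simp_all add: a' A.l_distr A.r_distr src_mult[symmetric] counit_src A.m_ac)
  have ac: "a \<in> carrier (unit_mod H)" using a by simp
  have d: "transport_elt H (unit_mod H) ?\<phi> a \<in> carrier D"
    unfolding D_simps(1) by (rule transport_elt_closed[OF unit_mod_Umod \<phi> ac])
  have "zeta H (cl (transport_elt H (unit_mod H) ?\<phi> a)) = matrix_coeff (unit_mod H) ?\<phi> a"
    unfolding zeta_cl[OF d] by (rule Z_transport[OF unit_mod_Umod \<phi> ac])
  also have "\<dots> = theta0 a' a"
    unfolding matrix_coeff_def by (rule restrict_ext) (simp add: a counit_closed)
  finally have eq: "zeta H (cl (transport_elt H (unit_mod H) ?\<phi> a)) = theta0 a' a" .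
  show ?thesis unfolding eq[symmetric] by (rule imageI[OF cl_closed[OF d]])
qed

lemma theta_in_zeta_image:
  assumes t: "t \<in> carrier AA"
  shows "theta H t \<in> zeta H ` carrier Uo"
  using t
proof (induction rule: AA.tensor_induct)
  case (pure x y)
  show ?case unfolding theta_pure[OF pure] by (rule theta0_in_zeta_image[OF pure])
next
  case (diff s t)
  obtain x y where xy: "x \<in> carrier Uo" "theta H s = zeta H x" "y \<in> carrier Uo" "theta H t = zeta H y"
    using diff(3,4) by blast
  have "theta H (s \<ominus>\<^bsub>AA\<^esub> t) = zeta H (x \<ominus>\<^bsub>Uo\<^esub> y)"
    unfolding abelian_group_hom.hom_minus[OF theta_hom diff(1,2)] abelian_group_hom.hom_minus[OF zeta_hom xy(1,3)] xy(2,4) ..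
  then show ?case using Uo.minus_closed[OF xy(1,3)] by blast
qed

end

context injective_zeta begin

text \<open>Membership in either augmentation ideal is vanishing of the image at 1, so a preimage
  under \<zeta> of an element of the one lies in the other. Powers follow by multiplicativity of
  both maps.\<close>

lemma theta_filtration_in_zeta_image: "theta H ` AA_filtration n \<subseteq> zeta H ` K n"
proof -
  interpret K: filtered_group Uo K by (rule K_filtered_group)
  interpret J: filtered_group AA AA_filtration by (rule AA_filtered_group)
  show ?thesis
    unfolding AA_filtration_eq K_eq
  proof (rule ideal_power_image[where S = Us, OF zeta_mult abelian_group_hom.hom_add[OF zeta_hom] theta_mult abelian_group_hom.hom_add[OF theta_hom]])
    show "ideal_power Uo augmentation n \<subseteq> carrier Uo" for n using K.F_carr unfolding K_eq by blast
    show "ideal_power AA AA_augmentation n \<subseteq> carrier AA" for n using J.F_carr unfolding AA_filtration_eq by blast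
    show "theta H ` carrier AA \<subseteq> zeta H ` carrier Uo" using theta_in_zeta_image by blast
    show "theta H ` AA_augmentation \<subseteq> zeta H ` augmentation"
    proof
      fix f assume "f \<in> theta H ` AA_augmentation"
      then obtain t where t: "t \<in> carrier AA" "tlift A (\<lambda>(a, b). a \<otimes>\<^bsub>A\<^esub> b) t = \<zero>\<^bsub>A\<^esub>" "f = theta H t" by blast
      obtain x where x: "x \<in> carrier Uo" "theta H t = zeta H x" using theta_in_zeta_image[OF t(1)] by blast
      have "counit_circ H x = \<zero>\<^bsub>A\<^esub>" using counit_circ_eq[OF x(1)] theta_eval_one[OF t(1)] t(2) x(2) by simp
      then show "f \<in> zeta H ` augmentation" using x t(3) by blast
    qed
  qed blast+
qed

text \<open>That \<theta> respects levels is inherited from \<zeta>, since every power on its side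
  has its image inside the image of the same power on the other.\<close>

lemma completed_theta: "completed_hom AA AA_filtration Us G (theta H)"
proof -
  have "theta H t \<in> G n" if "t \<in> AA_filtration n" for t n
  proof -
    obtain x where "x \<in> K n" "theta H t = zeta H x" using theta_filtration_in_zeta_image[of n] \<open>t \<in> AA_filtration n\<close> by blast
    then show ?thesis using zeta_filtered by simp
  qed
  then show ?thesis
    by (intro completed_hom.intro filtered_hom.intro filtered_hom_axioms.intro AA_filtered_group filtered_group_conv
        theta_hom Us.complete_filtered_group_axioms)
qed

lemma zeta_approximation:
  assumes iso: "filtered_iso (completion AA AA_filtration) (completion_filtration AA AA_filtration) Us G (hat_map Us G (theta H))"
    and y: "y \<in> G n"
  shows "\<exists>x\<in>K n. zeta H x \<ominus>\<^bsub>Us\<^esub> y \<in> G m"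
proof -
  obtain t where t: "t \<in> AA_filtration n" "theta H t \<ominus>\<^bsub>Us\<^esub> y \<in> G m"
    using completed_hom.approximation_of_filtered_iso[OF completed_theta iso y] by blast
  obtain x where "x \<in> K n" "theta H t = zeta H x" using theta_filtration_in_zeta_image[of n] t(1) by blast
  then show ?thesis using t(2) by auto
qed

end

theorem proposition4p4:
  fixes k :: "('k, 'c) ring_scheme" and H :: "('k, 'a, 'u) hopf_data" and F :: "nat \<Rightarrow> 'u set"
  assumes "cocomm_hopf_algebroid k H"
    and "admissible_filtration H F"
    and "inj_on (zeta H) (carrier (finite_dual H))"
  shows "let
      Uo = finite_dual H;
      K = finite_dual_filtration H;
      Uo_hat = completion Uo K;
      K_hat = completion_filtration Uo K;
      Us = conv_algebra H;
      G = conv_filtration H F;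
      zeta_hat = hat_map Us G (zeta H);
      induced = (\<lambda>n. {x \<in> carrier Uo. zeta H x \<in> G n});
      top_Uo_hat = linear_topology Uo_hat K_hat;
      top_Us = linear_topology Us G;
      dense = (top_Us closure_of (zeta H ` carrier Uo) = topspace top_Us);
      AA = base_tensor k H;
      J = base_tensor_filtration k H;
      theta_hat = hat_map Us G (theta H);
      a = filtered_iso Uo_hat K_hat Us G zeta_hat;
      b = (gr_map Us G zeta_hat \<in> iso (gr Uo_hat K_hat) (gr Us G));
      c = (zeta_hat ` carrier Uo_hat = carrier Us \<and> (\<forall>n. K n = induced n));
      d = (gr_map Us G zeta_hat ` carrier (gr Uo_hat K_hat) = carrier (gr Us G) \<and>
           (\<forall>n. K n = induced n));
      e = (gr_map Us G (zeta H) ` carrier (gr Uo K) = carrier (gr Us G) \<and>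
           (\<forall>n. K n = induced n));
      f = homeomorphic_map top_Uo_hat top_Us zeta_hat;
      g = (open_map top_Uo_hat top_Us zeta_hat \<and> inj_on zeta_hat (carrier Uo_hat) \<and> dense);
      h = (linear_topology Uo K = linear_topology Uo induced \<and> dense)
    in
      all_equivalent [a, b, c, d, e] \<and>
      all_equivalent [f, g, h] \<and>
      (filtered_iso (completion AA J) (completion_filtration AA J) Us G theta_hat \<longrightarrow>
       all_equivalent [a, b, c, d, e, f, g, h])"
proof -
  interpret injective_zeta k H F
    using assms by (intro injective_zeta.intro filtered_hopf_algebroid.intro injective_zeta_axioms.intro)
  interpret hat: completed_hom "finite_dual H" "finite_dual_filtration H" "conv_algebra H" "conv_filtration H F" "zeta H"
    by (rule completed_zeta)
  \<comment> \<open>The condition on \<theta> identifies the common meanings of the two groups of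
    assertions, which joins them into one.\<close>
  have eq: "hat.topological_iso \<longleftrightarrow> hat.gr_surjective \<and> hat.gr_injective"
    if "filtered_iso (completion AA AA_filtration) (completion_filtration AA AA_filtration) Us G (hat_map Us G (theta H))"
    by (rule hat.strict_approximation[OF zeta_approximation[OF that]])
  show ?thesis
    unfolding Let_def hat.equivalent_conditions_iff using eq by (simp add: all_equivalent_def)
qed

end
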